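(* Let $(M,g_M)$ be a Riemannian manifold, let $\lambda$ be an eigenvalue of the Laplacian of $(M,g_M)$, and suppose that $(M,g_M)$ admits an eigenmap $X:(M,g_M)\to\mathbb{S}^{m-1}$ associated to this eigenvalue $\lambda$. Let $\Omega$ be a bounded domain of $M$ and let $0<\lambda_1\le\lambda_2\le\cdots\to+\infty$ be the eigenvalues of the clamped plate problem $$\Delta^2u=\mu u\ \text{ in }\Omega,\qquad u=\frac{\partial u}{\partial\nu}=0\ \text{ on }\partial\Omega .$$ Then for any $k\ge1$ such that $\lambda_{k+1}>\lambda_k$ and for any couple $(f,g)\in\Im_{\lambda_{k+1}}$, $$\sum_{i=1}^k f(\lambda_i)\le\left[\sum_{i=1}^k g(\lambda_i)\Big(\lambda+6\lambda_i^{1/2}\Big)\right]^{1/2}\left[\sum_{i=1}^k\frac{f(\lambda_i)^2}{g(\lambda_i)(\lambda_{k+1}-\lambda_i)}\Big(\lambda+4\lambda_i^{1/2}\Big)\right]^{1/2}.$$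
   Context: $\Delta$ denotes the Laplacian ($\Delta=\operatorname{div}\nabla$) of the Riemannian manifold $M$, $\Delta^2$ the biharmonic operator, and $\nu$ the outward unit normal to $\partial\Omega$. It is taken as well known that the eigenvalues of the clamped plate problem on the bounded domain $\Omega$, repeated according to multiplicity, form a countable family $0<\lambda_1\le\lambda_2\le\cdots\to+\infty$. A map $X=(X_1,\dots,X_m):(M,g_M)\to\mathbb{S}^{m-1}\subset\mathbb{R}^m$ (unit sphere) is called an eigenmap associated to $\lambda$ if its components are all eigenfunctions of the Laplacian of $(M,g_M)$ associated to the same eigenvalue $\lambda$, i.e. $\Delta X_p=-\lambda X_p$ for $p=1,\dots,m$. Equivalently, $X$ is a harmonic map into $\mathbb{S}^{m-1}$ with constant energy $\sum_{p=1}^m|\nabla X_p|^2=\lambda$. For $\Lambda>0$, $\Im_\Lambda$ is the set of couples $(f,g)$ of functions defined on the open interval $(0,\Lambda)$ such that: (1) $f$ and $g$ are positive; (2) for all $x,y\in(0,\Lambda)$ with $x\ne y$, $$\left(\frac{f(x)-f(y)}{x-y}\right)^2+\left(\frac{f(x)^2}{g(x)(\Lambda-x)}+\frac{f(y)^2}{g(y)(\Lambda-y)}\right)\left(\frac{g(x)-g(y)}{x-y}\right)\le0 .$$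
   Formalization: The eigenvalue λ is assumed nonzero: for λ = 0 (constant eigenmap) the inequality fails, e.g. on a sphere of dimension at least 5 minus a small ball with k = 1, f = g = 1. "Bounded domain" is read as relatively compact, and the clamped conditions as membership in H²₀(Ω). *)

theory Defs
  imports "HOL-Analysis.Analysis"
begin

section \<open>Smooth functions on open subsets of Euclidean space\<close>

definition pderiv_at :: "'n::finite \<Rightarrow> (real^'n \<Rightarrow> real) \<Rightarrow> real^'n \<Rightarrow> real" where
  "pderiv_at i v y = frechet_derivative v (at y) (axis i 1)"

fun Ck_on :: "nat \<Rightarrow> (real^'n::finite) set \<Rightarrow> (real^'n \<Rightarrow> real) \<Rightarrow> bool" where
  "Ck_on 0 S v \<longleftrightarrow> continuous_on S v"
| "Ck_on (Suc k) S v \<longleftrightarrow> v differentiable_on S \<and> (\<forall>i. Ck_on k S (pderiv_at i v))"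

text \<open>Only used for open \<open>S\<close>, where the values of \<open>v\<close> outside \<open>S\<close> do not matter.\<close>

definition smooth_on :: "(real^'n::finite) set \<Rightarrow> (real^'n \<Rightarrow> real) \<Rightarrow> bool" where
  "smooth_on S v \<longleftrightarrow> (\<forall>k. Ck_on k S v)"

section \<open>Smooth manifolds and Riemannian metrics\<close>

text \<open>The points of the manifold are all elements of a second countable Hausdorff type.
  A chart is a domain together with a coordinate map; \<open>chart_inv\<close> is meaningful on the
  image \<open>chart_range\<close> only.\<close>

type_synonym ('a, 'n) chart = "'a set \<times> ('a \<Rightarrow> real^'n)"

definition chart_range :: "('a, 'n::finite) chart \<Rightarrow> (real^'n) set" where
  "chart_range c = snd c ` fst c"

definition chart_inv :: "('a, 'n::finite) chart \<Rightarrow> real^'n \<Rightarrow> 'a" where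
  "chart_inv c = inv_into (fst c) (snd c)"

definition transition :: "('a, 'n::finite) chart \<Rightarrow> ('a, 'n) chart \<Rightarrow> real^'n \<Rightarrow> real^'n" where
  "transition c d y = snd d (chart_inv c y)"

definition smooth_atlas ::
    "('a::{t2_space, second_countable_topology}, 'n::finite) chart set \<Rightarrow> bool" where
  "smooth_atlas A \<longleftrightarrow>
     (\<Union>c\<in>A. fst c) = UNIV \<and>
     (\<forall>c\<in>A. open (fst c) \<and> open (chart_range c) \<and>
        homeomorphism (fst c) (chart_range c) (snd c) (chart_inv c)) \<and>
     (\<forall>c\<in>A. \<forall>d\<in>A. \<forall>i. smooth_on (snd c ` (fst c \<inter> fst d)) (\<lambda>y. transition c d y $ i))"

text \<open>A metric assigns to each chart the matrix of its components \<open>g\<^sub>i\<^sub>j\<close> as functions of the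
  coordinates; the last clause is the transformation law of a covariant 2-tensor.\<close>

type_synonym ('a, 'n) metric = "('a, 'n) chart \<Rightarrow> real^'n \<Rightarrow> real^'n^'n"

definition riemannian_manifold ::
    "('a::{t2_space, second_countable_topology}, 'n::finite) chart set \<Rightarrow> ('a, 'n) metric \<Rightarrow> bool"
  where
  "riemannian_manifold A g \<longleftrightarrow>
     smooth_atlas A \<and>
     (\<forall>c\<in>A. \<forall>i j. smooth_on (chart_range c) (\<lambda>y. g c y $ i $ j)) \<and>
     (\<forall>c\<in>A. \<forall>y\<in>chart_range c. transpose (g c y) = g c y \<and>
        (\<forall>v. v \<noteq> 0 \<longrightarrow> v \<bullet> (g c y *v v) > 0)) \<and>
     (\<forall>c\<in>A. \<forall>d\<in>A. \<forall>y\<in>snd c ` (fst c \<inter> fst d).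
        let J = matrix (frechet_derivative (transition c d) (at y))
        in g c y = transpose J ** g d (transition c d y) ** J)"

definition smooth_fun :: "('a, 'n::finite) chart set \<Rightarrow> ('a \<Rightarrow> real) \<Rightarrow> bool" where
  "smooth_fun A u \<longleftrightarrow> (\<forall>c\<in>A. smooth_on (chart_range c) (u \<circ> chart_inv c))"

text \<open>Smooth functions with compact support contained in \<open>\<Omega>\<close>.\<close>

definition test_funs ::
    "('a::topological_space, 'n::finite) chart set \<Rightarrow> 'a set \<Rightarrow> ('a \<Rightarrow> real) set" where
  "test_funs A \<Omega> = {\<phi>. smooth_fun A \<phi> \<and>
     compact (closure {x. \<phi> x \<noteq> 0}) \<and> closure {x. \<phi> x \<noteq> 0} \<subseteq> \<Omega>}"

section \<open>Gradient, divergence, Laplacian\<close>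

text \<open>Vector fields are given by their components in each chart. In coordinates,
  \<open>(grad u)\<^sup>i = g\<^sup>i\<^sup>j \<partial>\<^sub>j u\<close> and \<open>div V = (det g) powr (-1/2) * \<partial>\<^sub>i ((det g) powr (1/2) * V\<^sup>i)\<close>.
  The divergence of a smooth vector field does not depend on the chart, so that it can be
  computed in an arbitrarily chosen one.\<close>

definition grad :: "('a, 'n::finite) metric \<Rightarrow> ('a \<Rightarrow> real) \<Rightarrow> ('a, 'n) chart \<Rightarrow> real^'n \<Rightarrow> real^'n" where
  "grad g u c y = matrix_inv (g c y) *v (\<chi> j. pderiv_at j (u \<circ> chart_inv c) y)"

definition chart_at :: "('a, 'n::finite) chart set \<Rightarrow> 'a \<Rightarrow> ('a, 'n) chart" where
  "chart_at A x = (SOME c. c \<in> A \<and> x \<in> fst c)"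

definition divergence ::
    "('a, 'n::finite) chart set \<Rightarrow> ('a, 'n) metric \<Rightarrow> (('a, 'n) chart \<Rightarrow> real^'n \<Rightarrow> real^'n) \<Rightarrow> 'a \<Rightarrow> real"
  where
  "divergence A g V x =
     (let c = chart_at A x; y = snd c x
      in (\<Sum>i\<in>UNIV. pderiv_at i (\<lambda>z. sqrt (det (g c z)) * V c z $ i) y) / sqrt (det (g c y)))"

definition laplacian ::
    "('a, 'n::finite) chart set \<Rightarrow> ('a, 'n) metric \<Rightarrow> ('a \<Rightarrow> real) \<Rightarrow> 'a \<Rightarrow> real" where
  "laplacian A g u = divergence A g (grad g u)"

definition laplace_eigenvalue ::
    "('a, 'n::finite) chart set \<Rightarrow> ('a, 'n) metric \<Rightarrow> real \<Rightarrow> bool" where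
  "laplace_eigenvalue A g \<mu> \<longleftrightarrow>
     (\<exists>u. smooth_fun A u \<and> (\<exists>x. u x \<noteq> 0) \<and> (\<forall>x. laplacian A g u x = - \<mu> * u x))"

definition eigenmap ::
    "('a, 'n::finite) chart set \<Rightarrow> ('a, 'n) metric \<Rightarrow> real \<Rightarrow> ('a \<Rightarrow> real^'m::finite) \<Rightarrow> bool" where
  "eigenmap A g \<mu> X \<longleftrightarrow>
     (\<forall>x. X x \<in> sphere 0 1) \<and>
     (\<forall>p. smooth_fun A (\<lambda>x. X x $ p) \<and>
          (\<forall>x. laplacian A g (\<lambda>x. X x $ p) x = - \<mu> * (X x $ p)))"

section \<open>Riemannian volume and the clamped plate problem\<close>

text \<open>The unique Borel measure with density \<open>(det g) powr (1/2)\<close> in every chart.\<close>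

definition riem_volume ::
    "('a::{t2_space, second_countable_topology}, 'n::finite) chart set \<Rightarrow> ('a, 'n) metric \<Rightarrow> 'a measure"
  where
  "riem_volume A g = (THE M. sets M = sets borel \<and>
     (\<forall>c\<in>A. \<forall>B\<in>sets borel. B \<subseteq> fst c \<longrightarrow>
        emeasure M B = (\<integral>\<^sup>+y\<in>snd c ` B. ennreal (sqrt (det (g c y))) \<partial>lborel)))"

abbreviation vol_on ::
    "('a::{t2_space, second_countable_topology}, 'n::finite) chart set \<Rightarrow> ('a, 'n) metric \<Rightarrow> 'a set \<Rightarrow> 'a measure"
  where
  "vol_on A g \<Omega> \<equiv> restrict_space (riem_volume A g) \<Omega>"

text \<open>Bounded means relatively compact; on a complete manifold this agrees with boundedness
  for the Riemannian distance.\<close>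

definition bounded_domain :: "'a::topological_space set \<Rightarrow> bool" where
  "bounded_domain \<Omega> \<longleftrightarrow> open \<Omega> \<and> connected \<Omega> \<and> \<Omega> \<noteq> {} \<and> compact (closure \<Omega>)"

definition L2 :: "'a measure \<Rightarrow> ('a \<Rightarrow> real) set" where
  "L2 M = {u. u \<in> borel_measurable M \<and> integrable M (\<lambda>x. (u x)\<^sup>2)}"

text \<open>No regularity of the boundary of \<open>\<Omega>\<close> is assumed, so the clamped boundary conditions
  \<open>u = \<partial>u/\<partial>\<nu> = 0\<close> are imposed in the usual way, by membership in the closure \<open>H\<^sup>2\<^sub>0(\<Omega>)\<close> of the test
  functions. As \<open>\<Omega>\<close> is relatively compact, the \<open>H\<^sup>2\<close>-norm is equivalent on test functions to the
  norm \<open>u \<mapsto> \<parallel>u\<parallel> + \<parallel>\<Delta>u\<parallel>\<close> used here; in the definition \<open>w\<close> is the weak Laplacian of \<open>u\<close>.\<close>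

definition H20 ::
    "('a::{t2_space, second_countable_topology}, 'n::finite) chart set \<Rightarrow> ('a, 'n) metric \<Rightarrow> 'a set \<Rightarrow> ('a \<Rightarrow> real) set"
  where
  "H20 A g \<Omega> = {u \<in> L2 (vol_on A g \<Omega>). \<exists>w \<in> L2 (vol_on A g \<Omega>). \<exists>\<phi> :: nat \<Rightarrow> 'a \<Rightarrow> real.
     (\<forall>n. \<phi> n \<in> test_funs A \<Omega>) \<and>
     (\<lambda>n. \<integral>x. (\<phi> n x - u x)\<^sup>2 \<partial>vol_on A g \<Omega>) \<longlonglongrightarrow> 0 \<and>
     (\<lambda>n. \<integral>x. (laplacian A g (\<phi> n) x - w x)\<^sup>2 \<partial>vol_on A g \<Omega>) \<longlonglongrightarrow> 0}"

text \<open>The clamped \<open>u\<close> with \<open>\<Delta>\<^sup>2u = \<mu>u\<close> in \<open>\<Omega>\<close> in the sense of distributions.\<close>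

definition clamped_eigenspace ::
    "('a::{t2_space, second_countable_topology}, 'n::finite) chart set \<Rightarrow> ('a, 'n) metric \<Rightarrow> 'a set \<Rightarrow> real \<Rightarrow> ('a \<Rightarrow> real) set"
  where
  "clamped_eigenspace A g \<Omega> \<mu> = {u \<in> H20 A g \<Omega>. \<forall>\<phi>\<in>test_funs A \<Omega>.
     (\<integral>x. u x * laplacian A g (laplacian A g \<phi>) x \<partial>vol_on A g \<Omega>) =
     \<mu> * (\<integral>x. u x * \<phi> x \<partial>vol_on A g \<Omega>)}"

text \<open>The space \<open>V\<close> of functions, taken modulo equality almost everywhere, has dimension \<open>d\<close>.\<close>

definition has_dim_AE :: "'a measure \<Rightarrow> ('a \<Rightarrow> real) set \<Rightarrow> nat \<Rightarrow> bool" where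
  "has_dim_AE M V d \<longleftrightarrow> (\<exists>b :: nat \<Rightarrow> 'a \<Rightarrow> real.
     (\<forall>j<d. b j \<in> V) \<and>
     (\<forall>a :: nat \<Rightarrow> real. (AE x in M. (\<Sum>j<d. a j * b j x) = 0) \<longrightarrow> (\<forall>j<d. a j = 0)) \<and>
     (\<forall>u\<in>V. \<exists>a :: nat \<Rightarrow> real. AE x in M. u x = (\<Sum>j<d. a j * b j x)))"

text \<open>The sequence \<open>ev 1, ev 2, \<dots>\<close> (\<open>ev 0\<close> is irrelevant) lists the eigenvalues in nondecreasing
  order, each repeated according to its multiplicity: every real \<open>\<mu>\<close> occurs exactly as often as
  the dimension of its eigenspace, which is 0 if \<open>\<mu>\<close> is not an eigenvalue.\<close>

definition clamped_eigenvalues ::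
    "('a::{t2_space, second_countable_topology}, 'n::finite) chart set \<Rightarrow> ('a, 'n) metric \<Rightarrow> 'a set \<Rightarrow> (nat \<Rightarrow> real) \<Rightarrow> bool"
  where
  "clamped_eigenvalues A g \<Omega> ev \<longleftrightarrow>
     0 < ev 1 \<and> (\<forall>i\<ge>1. ev i \<le> ev (i + 1)) \<and> filterlim ev at_top sequentially \<and>
     (\<forall>\<mu>. has_dim_AE (vol_on A g \<Omega>) (clamped_eigenspace A g \<Omega> \<mu>) (card {i. i \<ge> 1 \<and> ev i = \<mu>}))"

section \<open>The class of couples of functions\<close>

definition Im_class :: "real \<Rightarrow> ((real \<Rightarrow> real) \<times> (real \<Rightarrow> real)) set" where
  "Im_class \<Lambda> = {(f, g).
     (\<forall>x\<in>{0<..<\<Lambda>}. 0 < f x \<and> 0 < g x) \<and>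
     (\<forall>x\<in>{0<..<\<Lambda>}. \<forall>y\<in>{0<..<\<Lambda>}. x \<noteq> y \<longrightarrow>
        ((f x - f y) / (x - y))\<^sup>2 +
        ((f x)\<^sup>2 / (g x * (\<Lambda> - x)) + (f y)\<^sup>2 / (g y * (\<Lambda> - y))) * ((g x - g y) / (x - y)) \<le> 0)}"

end

theory Submission
  imports Defs
begin

text \<open>On test functions put \<open>[\<Delta>, X\<^sub>p] u = \<Delta>(X\<^sub>p u) - X\<^sub>p \<Delta>u = 2 \<langle>\<nabla>X\<^sub>p, \<nabla>u\<rangle> - \<lambda> X\<^sub>p u\<close>. As \<open>\<Sum>X\<^sub>p\<^sup>2 = 1\<close> and
  \<open>\<Sum>|\<nabla>X\<^sub>p|\<^sup>2 = \<lambda>\<close>, one has \<open>\<Sum>X\<^sub>p [\<Delta>, X\<^sub>p] u = -\<lambda> u\<close> and \<open>\<Sum>\<parallel>[\<Delta>, X\<^sub>p] u\<parallel>\<^sup>2 \<le> \<lambda>\<^sup>2 \<parallel>u\<parallel>\<^sup>2 + 4 \<lambda> \<parallel>\<nabla>u\<parallel>\<^sup>2\<close>, and nothing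
  else about the manifold enters the algebra. For the eigenfunctions \<open>u\<^sub>1, \<dots>, u\<^sub>k\<close>, the component of
  \<open>X\<^sub>p u\<^sub>i\<close> orthogonal to all of them is a trial function for \<open>\<lambda>\<^sub>k\<^sub>+\<^sub>1\<close>; the condition defining the class of
  couples makes the terms in the coefficients \<open>\<langle>X\<^sub>p u\<^sub>i, u\<^sub>j\<rangle>\<close> have the right sign after summation over \<open>i\<close>.

  That \<open>\<lambda>\<^sub>k\<^sub>+\<^sub>1\<close> bounds the Rayleigh quotient on this orthogonal complement needs the existence of minimisers,
  hence the compactness of the embedding of \<open>H\<^sup>2\<^sub>0\<close> into \<open>L\<^sup>2\<close>, which is obtained from the Poincare inequality on
  small cubes in charts. Green's formula on the manifold comes from integration by parts in charts and a
  partition of unity.\<close>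

section \<open>Square integrable functions\<close>

text \<open>The eigenfunctions are only weak elements of \<open>H20\<close>, so neither the
  commutator nor a product with \<open>X p\<close> is ever differentiated on them. Each inequality
  is proved for test functions, in terms of inner products that are continuous in the graph norm of
  the Laplacian, and passed to the limit along test functions approximating \<open>u i\<close>. The
  coefficients of the commutator against \<open>u j\<close> survive the limit because the Laplacian
  is moved onto the weak Laplacian \<open>w j\<close>. In this form the coefficients of the products
  are symmetric in i and j and those of the commutator antisymmetric, which pairs the terms (i, j)
  and (j, i) into a quadratic form of two variables. A weight \<beta> > 0, the same for all i, stays
  free until every sum is taken; the resulting bound 2 F \<le> \<beta> W + H / \<beta> yields the
  product of the two square roots. Both sides carry a common factor \<open>lam\<close> until the
  end, so its positivity matters; it comes from the energy identity of the eigenmap.\<close>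

definition ip :: "'a measure \<Rightarrow> ('a \<Rightarrow> real) \<Rightarrow> ('a \<Rightarrow> real) \<Rightarrow> real" where
  "ip M u v = (\<integral>x. u x * v x \<partial>M)"

text \<open>The Bochner integral of a non-integrable function is 0, so this expresses convergence
  only when the differences lie in \<open>L2 M\<close>; hence the membership hypotheses in the
  lemmas about it.\<close>

definition L2lim :: "'a measure \<Rightarrow> (nat \<Rightarrow> 'a \<Rightarrow> real) \<Rightarrow> ('a \<Rightarrow> real) \<Rightarrow> bool" where
  "L2lim M \<phi> u \<longleftrightarrow> (\<lambda>n. \<integral>x. (\<phi> n x - u x)\<^sup>2 \<partial>M) \<longlonglongrightarrow> 0"

lemma L2_mult_integrable:
  assumes "u \<in> L2 M" "v \<in> L2 M"
  shows "integrable M (\<lambda>x. u x * v x)"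
proof (rule Bochner_Integration.integrable_bound[of _ "\<lambda>x. (u x)\<^sup>2 + (v x)\<^sup>2"])
  show "integrable M (\<lambda>x. (u x)\<^sup>2 + (v x)\<^sup>2)" using assms by (auto simp: L2_def)
  have [measurable]: "u \<in> borel_measurable M" "v \<in> borel_measurable M"
    using assms by (auto simp: L2_def)
  show "(\<lambda>x. u x * v x) \<in> borel_measurable M" by measurable
  have "\<bar>a * b\<bar> \<le> \<bar>a\<^sup>2 + b\<^sup>2\<bar>" for a b :: real
  proof -
    have "0 \<le> (\<bar>a\<bar> - \<bar>b\<bar>)\<^sup>2" by simp
    then have "2 * (\<bar>a\<bar> * \<bar>b\<bar>) \<le> a\<^sup>2 + b\<^sup>2" by (simp add: power2_diff)
    moreover have "0 \<le> \<bar>a\<bar> * \<bar>b\<bar>" by simp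
    ultimately show ?thesis unfolding abs_mult by linarith
  qed
  then show "AE x in M. norm (u x * v x) \<le> norm ((u x)\<^sup>2 + (v x)\<^sup>2)" by simp
qed

lemma L2_lin:
  assumes "u \<in> L2 M" "v \<in> L2 M"
  shows "(\<lambda>x. a * u x + b * v x) \<in> L2 M"
proof -
  have "(\<lambda>x. (a * u x + b * v x)\<^sup>2) = (\<lambda>x. a\<^sup>2 * (u x)\<^sup>2 + (2 * a * b) * (u x * v x) + b\<^sup>2 * (v x)\<^sup>2)"
    by (auto simp: power2_eq_square algebra_simps)
  moreover have "integrable M \<dots>"
    using assms L2_mult_integrable[OF assms] by (auto simp: L2_def)
  ultimately show ?thesis using assms by (auto simp: L2_def)
qed

lemma L2_zero [simp]: "(\<lambda>x. 0) \<in> L2 M" by (simp add: L2_def)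

lemma L2_add: "u \<in> L2 M \<Longrightarrow> v \<in> L2 M \<Longrightarrow> (\<lambda>x. u x + v x) \<in> L2 M"
  using L2_lin[of u M v 1 1] by simp

lemma L2_diff: "u \<in> L2 M \<Longrightarrow> v \<in> L2 M \<Longrightarrow> (\<lambda>x. u x - v x) \<in> L2 M"
  using L2_lin[of u M v 1 "-1"] by simp

lemma L2_cmult: "u \<in> L2 M \<Longrightarrow> (\<lambda>x. a * u x) \<in> L2 M"
  using L2_lin[of u M u a 0] by simp

lemma L2_sum: "(\<And>j. j \<in> J \<Longrightarrow> u j \<in> L2 M) \<Longrightarrow> (\<lambda>x. \<Sum>j\<in>J. u j x) \<in> L2 M"
  by (induction J rule: infinite_finite_induct) (auto intro: L2_add)

lemma L2_mult_bounded:
  assumes "u \<in> L2 M" "X \<in> borel_measurable M" "\<And>x. \<bar>X x\<bar> \<le> C"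
  shows "(\<lambda>x. X x * u x) \<in> L2 M"
proof -
  have [measurable]: "u \<in> borel_measurable M" "X \<in> borel_measurable M"
    using assms by (auto simp: L2_def)
  have "integrable M (\<lambda>x. C\<^sup>2 * (u x)\<^sup>2)" using assms by (auto simp: L2_def)
  moreover have "(X x * u x)\<^sup>2 \<le> C\<^sup>2 * (u x)\<^sup>2" for x
    unfolding power_mult_distrib using assms(3)[of x]
    by (intro mult_right_mono) (auto simp: abs_le_square_iff[symmetric])
  ultimately have "integrable M (\<lambda>x. (X x * u x)\<^sup>2)"
    by (elim Bochner_Integration.integrable_bound) (auto simp: abs_mult)
  then show ?thesis by (simp add: L2_def)
qed

lemma ip_commute: "ip M u v = ip M v u"
  by (simp add: ip_def mult.commute)

lemma ip_self_nonneg: "0 \<le> ip M u u"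
  by (simp add: ip_def)

lemma ip_lin_left:
  assumes "u \<in> L2 M" "v \<in> L2 M" "w \<in> L2 M"
  shows "ip M (\<lambda>x. a * u x + b * v x) w = a * ip M u w + b * ip M v w"
proof -
  have "(\<lambda>x. (a * u x + b * v x) * w x) = (\<lambda>x. a * (u x * w x) + b * (v x * w x))"
    by (auto simp: algebra_simps)
  then show ?thesis
    using L2_mult_integrable[OF assms(1,3)] L2_mult_integrable[OF assms(2,3)]
    by (simp add: ip_def)
qed

lemma ip_diff_left:
  "u \<in> L2 M \<Longrightarrow> v \<in> L2 M \<Longrightarrow> w \<in> L2 M \<Longrightarrow> ip M (\<lambda>x. u x - v x) w = ip M u w - ip M v w"
  using ip_lin_left[of u M v w 1 "-1"] by simp

lemma ip_diff_right:
  "u \<in> L2 M \<Longrightarrow> v \<in> L2 M \<Longrightarrow> w \<in> L2 M \<Longrightarrow> ip M w (\<lambda>x. u x - v x) = ip M w u - ip M w v"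
  using ip_diff_left[of u M v w] by (simp only: ip_commute[of M w])

lemma ip_add_left:
  "u \<in> L2 M \<Longrightarrow> v \<in> L2 M \<Longrightarrow> w \<in> L2 M \<Longrightarrow> ip M (\<lambda>x. u x + v x) w = ip M u w + ip M v w"
  using ip_lin_left[of u M v w 1 1] by simp

lemma ip_cmult_left: "ip M (\<lambda>x. a * u x) w = a * ip M u w"
  by (simp add: ip_def mult.assoc)

lemma ip_sum_left:
  assumes "\<And>j. j \<in> J \<Longrightarrow> u j \<in> L2 M" "w \<in> L2 M"
  shows "ip M (\<lambda>x. \<Sum>j\<in>J. u j x) w = (\<Sum>j\<in>J. ip M (u j) w)"
  using assms
proof (induction J rule: infinite_finite_induct)
  case (insert j J)
  have "ip M (\<lambda>x. \<Sum>i\<in>insert j J. u i x) w = ip M (\<lambda>x. u j x + (\<Sum>i\<in>J. u i x)) w"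
    using insert by simp
  also have "\<dots> = ip M (u j) w + ip M (\<lambda>x. \<Sum>i\<in>J. u i x) w"
    using insert by (intro ip_add_left L2_sum) auto
  finally show ?case using insert by simp
qed (auto simp: ip_def)

lemma ip_lin_lin:
  assumes "u \<in> L2 M" "v \<in> L2 M"
  shows "ip M (\<lambda>x. a * u x + b * v x) (\<lambda>x. a * u x + b * v x)
     = a\<^sup>2 * ip M u u + 2 * a * b * ip M u v + b\<^sup>2 * ip M v v"
proof -
  let ?z = "\<lambda>x. a * u x + b * v x"
  have z: "?z \<in> L2 M" using assms by (rule L2_lin)
  have "ip M u ?z = a * ip M u u + b * ip M u v" "ip M v ?z = a * ip M u v + b * ip M v v"
    using ip_lin_left[OF assms assms(1), of a b] ip_lin_left[OF assms assms(2), of a b]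
    by (simp_all only: ip_commute[of M u ?z] ip_commute[of M v ?z] ip_commute[of M v u])
  then show ?thesis
    unfolding ip_lin_left[OF assms z] by (simp add: algebra_simps power2_eq_square)
qed

text \<open>\<open>ip M\<close> is only semidefinite on functions, so \<open>ip M v v = 0\<close> is
  a separate case: the nonnegative quadratic is then affine in \<open>b\<close>, and a nonzero slope
  would let it reach -1.\<close>

lemma ip_Cauchy_Schwarz:
  assumes "u \<in> L2 M" "v \<in> L2 M"
  shows "(ip M u v)\<^sup>2 \<le> ip M u u * ip M v v"
proof -
  have q: "0 \<le> a\<^sup>2 * ip M u u + 2 * a * b * ip M u v + b\<^sup>2 * ip M v v" for a b
    using ip_self_nonneg[of M "\<lambda>x. a * u x + b * v x"] ip_lin_lin[OF assms] by metis
  show ?thesis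
  proof (cases "ip M v v = 0")
    case True
    have "ip M u v = 0"
    proof (rule ccontr)
      assume *: "ip M u v \<noteq> 0"
      have "0 \<le> ip M u u - (ip M u u + 1)"
        using q[of 1 "- (ip M u u + 1) / (2 * ip M u v)"] True * by (simp add: field_simps)
      then show False by simp
    qed
    then show ?thesis using True by simp
  next
    case False
    then have p: "ip M v v > 0" using ip_self_nonneg[of M v] by simp
    have "0 \<le> ip M v v * (ip M u u * ip M v v - (ip M u v)\<^sup>2)"
      using q[of "ip M v v" "- ip M u v"] by (simp add: algebra_simps power2_eq_square)
    then show ?thesis using p by (simp add: zero_le_mult_iff)
  qed
qed

lemma ip_abs_le:
  assumes "u \<in> L2 M" "v \<in> L2 M"
  shows "\<bar>ip M u v\<bar> \<le> sqrt (ip M u u) * sqrt (ip M v v)"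
  using real_sqrt_le_mono[OF ip_Cauchy_Schwarz[OF assms]] by (simp add: real_sqrt_mult)

lemma L2lim_iff: "L2lim M \<phi> u \<longleftrightarrow> (\<lambda>n. ip M (\<lambda>x. \<phi> n x - u x) (\<lambda>x. \<phi> n x - u x)) \<longlonglongrightarrow> 0"
  by (simp add: L2lim_def ip_def power2_eq_square)

lemma tendsto_zero_bounded:
  fixes a b :: "nat \<Rightarrow> real"
  assumes "b \<longlonglongrightarrow> c" "c = 0" "\<And>n. \<bar>a n\<bar> \<le> b n"
  shows "a \<longlonglongrightarrow> 0"
  by (rule Lim_null_comparison[of _ b]) (use assms in auto)

lemma L2lim_ip:
  assumes "L2lim M \<phi> u" "\<And>n. \<phi> n \<in> L2 M" "u \<in> L2 M" "v \<in> L2 M"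
  shows "(\<lambda>n. ip M (\<phi> n) v) \<longlonglongrightarrow> ip M u v"
proof -
  have "(\<lambda>n. sqrt (ip M (\<lambda>x. \<phi> n x - u x) (\<lambda>x. \<phi> n x - u x)) * sqrt (ip M v v)) \<longlonglongrightarrow> sqrt 0 * sqrt (ip M v v)"
    using assms(1) unfolding L2lim_iff by (intro tendsto_intros)
  then have "(\<lambda>n. ip M (\<lambda>x. \<phi> n x - u x) v) \<longlonglongrightarrow> 0"
    using ip_abs_le[OF L2_diff[OF assms(2,3)] assms(4)] by (auto intro: tendsto_zero_bounded)
  then have "(\<lambda>n. ip M (\<phi> n) v - ip M u v) \<longlonglongrightarrow> 0"
    using assms by (simp add: ip_diff_left)
  then show ?thesis by (simp add: LIM_zero_iff)
qed

text \<open>Expansion around the limits: \<open>ip M (d n) (e n)\<close> tends to 0 by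
  Cauchy-Schwarz, and the remaining terms have one argument fixed.\<close>

lemma L2lim_ip2:
  assumes "L2lim M \<phi> u" "\<And>n. \<phi> n \<in> L2 M" "u \<in> L2 M"
    and "L2lim M \<psi> v" "\<And>n. \<psi> n \<in> L2 M" "v \<in> L2 M"
  shows "(\<lambda>n. ip M (\<phi> n) (\<psi> n)) \<longlonglongrightarrow> ip M u v"
proof -
  define d e where "d = (\<lambda>n x. \<phi> n x - u x)" and "e = (\<lambda>n x. \<psi> n x - v x)"
  have de: "d n \<in> L2 M" "e n \<in> L2 M" for n using assms by (auto simp: d_def e_def intro: L2_diff)
  have "(\<lambda>n. sqrt (ip M (d n) (d n)) * sqrt (ip M (e n) (e n))) \<longlonglongrightarrow> sqrt 0 * sqrt 0"
    using assms(1,4) unfolding L2lim_iff d_def e_def by (intro tendsto_intros)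
  then have "(\<lambda>n. ip M (d n) (e n)) \<longlonglongrightarrow> 0"
    using ip_abs_le[OF de] by (auto intro: tendsto_zero_bounded)
  moreover have "(\<lambda>n. ip M (\<phi> n) v) \<longlonglongrightarrow> ip M u v" using assms by (intro L2lim_ip)
  moreover have "(\<lambda>n. ip M (\<psi> n) u) \<longlonglongrightarrow> ip M v u" using assms by (intro L2lim_ip)
  ultimately have "(\<lambda>n. ip M (d n) (e n) + ip M (\<phi> n) v + ip M (\<psi> n) u - ip M u v) \<longlonglongrightarrow> 0 + ip M u v + ip M v u - ip M u v"
    by (intro tendsto_intros)
  moreover have "ip M (d n) (e n) + ip M (\<phi> n) v + ip M (\<psi> n) u - ip M u v = ip M (\<phi> n) (\<psi> n)" for n
    using assms de unfolding d_def
    by (simp add: ip_diff_left ip_diff_right e_def ip_commute[of M _ u])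
  ultimately show ?thesis by (simp add: ip_commute)
qed

lemma L2lim_lin:
  assumes "L2lim M \<phi> u" "\<And>n. \<phi> n \<in> L2 M" "u \<in> L2 M"
    and "L2lim M \<psi> v" "\<And>n. \<psi> n \<in> L2 M" "v \<in> L2 M"
  shows "L2lim M (\<lambda>n x. a * \<phi> n x + b * \<psi> n x) (\<lambda>x. a * u x + b * v x)"
proof -
  define d e where "d = (\<lambda>n x. \<phi> n x - u x)" and "e = (\<lambda>n x. \<psi> n x - v x)"
  have de: "d n \<in> L2 M" "e n \<in> L2 M" for n using assms by (auto simp: d_def e_def intro: L2_diff)
  have eq: "(\<lambda>x. a * \<phi> n x + b * \<psi> n x - (a * u x + b * v x)) = (\<lambda>x. a * d n x + b * e n x)" for n
    by (auto simp: d_def e_def algebra_simps)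
  have "(\<lambda>n. sqrt (ip M (d n) (d n)) * sqrt (ip M (e n) (e n))) \<longlonglongrightarrow> sqrt 0 * sqrt 0"
    using assms(1,4) unfolding L2lim_iff d_def e_def by (intro tendsto_intros)
  then have "(\<lambda>n. ip M (d n) (e n)) \<longlonglongrightarrow> 0"
    using ip_abs_le[OF de] by (auto intro: tendsto_zero_bounded)
  moreover have "(\<lambda>n. ip M (d n) (d n)) \<longlonglongrightarrow> 0" "(\<lambda>n. ip M (e n) (e n)) \<longlonglongrightarrow> 0"
    using assms(1,4) unfolding L2lim_iff d_def e_def .
  ultimately have "(\<lambda>n. a\<^sup>2 * ip M (d n) (d n) + 2 * a * b * ip M (d n) (e n) + b\<^sup>2 * ip M (e n) (e n))
      \<longlonglongrightarrow> a\<^sup>2 * 0 + 2 * a * b * 0 + b\<^sup>2 * 0"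
    by (intro tendsto_intros)
  then show ?thesis unfolding L2lim_iff eq ip_lin_lin[OF de] by simp
qed

lemma L2lim_mult_bounded:
  assumes "L2lim M \<phi> u" "\<And>n. \<phi> n \<in> L2 M" "u \<in> L2 M" "X \<in> borel_measurable M" "\<And>x. \<bar>X x\<bar> \<le> C"
  shows "L2lim M (\<lambda>n x. X x * \<phi> n x) (\<lambda>x. X x * u x)"
  unfolding L2lim_def
proof (rule Lim_null_comparison)
  show "(\<lambda>n. C\<^sup>2 * (\<integral>x. (\<phi> n x - u x)\<^sup>2 \<partial>M)) \<longlonglongrightarrow> 0"
    using tendsto_mult_left[OF assms(1)[unfolded L2lim_def], of "C\<^sup>2"] by simp
  have "norm (\<integral>x. (X x * \<phi> n x - X x * u x)\<^sup>2 \<partial>M) \<le> C\<^sup>2 * (\<integral>x. (\<phi> n x - u x)\<^sup>2 \<partial>M)" for n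
  proof -
    have d: "(\<lambda>x. \<phi> n x - u x) \<in> L2 M" using assms by (intro L2_diff)
    have "(\<integral>x. (X x * (\<phi> n x - u x))\<^sup>2 \<partial>M) \<le> (\<integral>x. C\<^sup>2 * (\<phi> n x - u x)\<^sup>2 \<partial>M)"
    proof (rule integral_mono)
      show "integrable M (\<lambda>x. (X x * (\<phi> n x - u x))\<^sup>2)"
        using L2_mult_bounded[OF d assms(4,5)] by (simp add: L2_def)
      show "integrable M (\<lambda>x. C\<^sup>2 * (\<phi> n x - u x)\<^sup>2)" using d by (simp add: L2_def)
      show "(X x * (\<phi> n x - u x))\<^sup>2 \<le> C\<^sup>2 * (\<phi> n x - u x)\<^sup>2" for x
        unfolding power_mult_distrib using assms(5)[of x]
        by (intro mult_right_mono) (auto simp: abs_le_square_iff[symmetric])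
    qed
    then show ?thesis by (simp add: right_diff_distrib)
  qed
  then show "\<forall>\<^sub>F n in sequentially. norm (\<integral>x. (X x * \<phi> n x - X x * u x)\<^sup>2 \<partial>M) \<le> C\<^sup>2 * (\<integral>x. (\<phi> n x - u x)\<^sup>2 \<partial>M)"
    by simp
qed

text \<open>Along a subsequence with \<open>\<parallel>f\<^sub>k\<^sub>+\<^sub>1 - f\<^sub>k\<parallel>\<^sup>2 \<le> 8 ^ -k\<close> the series \<open>\<Sum>2 ^ k (f\<^sub>k\<^sub>+\<^sub>1 - f\<^sub>k)\<^sup>2\<close> has a finite
  integral, which forces almost everywhere convergence; the limit is identified by Fatou's lemma.\<close>

lemma L2_complete:
  fixes f :: "nat \<Rightarrow> 'a \<Rightarrow> real"
  assumes L2: "\<And>n. f n \<in> L2 M"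
    and Cauchy: "\<And>e. e > 0 \<Longrightarrow> \<exists>N. \<forall>m\<ge>N. \<forall>n\<ge>N. ip M (\<lambda>x. f m x - f n x) (\<lambda>x. f m x - f n x) \<le> e"
  obtains u where "u \<in> L2 M" "L2lim M f u"
proof -
  have [measurable]: "f n \<in> borel_measurable M" for n using L2[of n] by (simp add: L2_def)
  have nn: "(\<integral>\<^sup>+x. ennreal ((f m x - f n x)\<^sup>2) \<partial>M) = ennreal (ip M (\<lambda>x. f m x - f n x) (\<lambda>x. f m x - f n x))" for m n
    using L2_diff[OF L2 L2, of m n] unfolding ip_def L2_def
    by (subst nn_integral_eq_integral) (auto simp: power2_eq_square)
  obtain N where N: "\<And>k m n. m \<ge> N k \<Longrightarrow> n \<ge> N k \<Longrightarrow> ip M (\<lambda>x. f m x - f n x) (\<lambda>x. f m x - f n x) \<le> (1/8)^k"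
  proof -
    have "\<forall>k. \<exists>N. \<forall>m\<ge>N. \<forall>n\<ge>N. ip M (\<lambda>x. f m x - f n x) (\<lambda>x. f m x - f n x) \<le> (1/8)^k"
      using Cauchy by simp
    then show ?thesis using that by metis
  qed
  \<comment> \<open>\<open>N\<close> may fail to be monotone; summing it makes \<open>r k\<close> at
    least every \<open>N i\<close> with \<open>i \<le> k\<close>, and the summand \<open>k\<close>
    forces \<open>r\<close> to infinity.\<close>
  define r where "r k = (\<Sum>i\<le>k. N i) + k" for k
  have rN: "r k \<ge> N k" "r (Suc k) \<ge> N k" "r k \<ge> k" for k
    using member_le_sum[of k "{..k}" N] by (auto simp: r_def)
  define d where "d k x = f (r (Suc k)) x - f (r k) x" for k x
  have [measurable]: "d k \<in> borel_measurable M" for k unfolding d_def by measurable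
  have "(\<integral>\<^sup>+x. (\<Sum>k. ennreal (2^k * (d k x)\<^sup>2)) \<partial>M) = (\<Sum>k. \<integral>\<^sup>+x. ennreal (2^k * (d k x)\<^sup>2) \<partial>M)"
    by (rule nn_integral_suminf) simp
  also have "\<dots> \<le> (\<Sum>k. ennreal ((1/4)^k))"
  proof (rule suminf_le)
    fix k
    have "(\<integral>\<^sup>+x. ennreal (2^k * (d k x)\<^sup>2) \<partial>M) = ennreal (2^k) * (\<integral>\<^sup>+x. ennreal ((d k x)\<^sup>2) \<partial>M)"
      by (subst nn_integral_cmult[symmetric]) (auto simp: ennreal_mult)
    also have "\<dots> \<le> ennreal (2^k) * ennreal ((1/8)^k)"
      unfolding d_def nn using N[of k "r (Suc k)" "r k"] rN
      by (intro mult_left_mono ennreal_leI) auto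
    also have "\<dots> = ennreal ((1/4)^k)"
      by (simp add: ennreal_mult[symmetric] power_mult_distrib[symmetric])
    finally show "(\<integral>\<^sup>+x. ennreal (2^k * (d k x)\<^sup>2) \<partial>M) \<le> ennreal ((1/4)^k)" .
  qed auto
  also have "\<dots> = ennreal (\<Sum>k. (1/4)^k)"
    by (intro suminf_ennreal2) auto
  finally have fin: "(\<integral>\<^sup>+x. (\<Sum>k. ennreal (2^k * (d k x)\<^sup>2)) \<partial>M) \<noteq> \<infinity>"
    by (auto simp: top_unique)
  have "AE x in M. (\<Sum>k. ennreal (2^k * (d k x)\<^sup>2)) \<noteq> \<infinity>"
    using fin by (intro nn_integral_noteq_infinite) auto
  then have conv: "AE x in M. convergent (\<lambda>k. f (r k) x)"
  proof eventually_elim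
    case (elim x)
    have "summable (\<lambda>k. 2^k * (d k x)\<^sup>2)"
      using elim by (intro summable_suminf_not_top) auto
    then have "(\<lambda>k. 2^k * (d k x)\<^sup>2) \<longlonglongrightarrow> 0" by (rule summable_LIMSEQ_zero)
    then obtain B where B: "\<And>k. \<bar>2^k * (d k x)\<^sup>2\<bar> \<le> B"
      using convergent_imp_Bseq[of "\<lambda>k. 2^k * (d k x)\<^sup>2"] unfolding convergent_def Bseq_def by auto
    have B0: "B \<ge> 0" using B[of 0] by (smt (verit))
    \<comment> \<open>Bounded weighted squares give |d k x| \<le> sqrt B times sqrt (1/2) to the
      power k, so the telescoping series has a geometric majorant.\<close>
    have "summable (\<lambda>k. d k x)"
    proof (rule summable_comparison_test')
      show "summable (\<lambda>k. sqrt B * (sqrt (1/2))^k)"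
        by (intro summable_mult summable_geometric) (simp add: real_less_lsqrt)
      fix k :: nat
      have "(d k x)\<^sup>2 \<le> B * (1/2)^k" using B[of k] by (simp add: field_simps)
      then have "\<bar>d k x\<bar> \<le> sqrt (B * (1/2)^k)" using real_sqrt_le_mono by fastforce
      then show "norm (d k x) \<le> sqrt B * (sqrt (1/2))^k"
        by (simp add: real_sqrt_mult real_sqrt_power)
    qed
    then have "convergent (\<lambda>n. \<Sum>k<n. d k x)" by (simp add: summable_iff_convergent)
    moreover have "(\<Sum>k<n. d k x) = f (r n) x - f (r 0) x" for n
      unfolding d_def by (rule sum_lessThan_telescope)
    ultimately have "convergent (\<lambda>n. f (r n) x - f (r 0) x + f (r 0) x)"
      by (intro convergent_add convergent_const) simp
    then show ?case by simp
  qed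
  define u where "u x = lim (\<lambda>k. f (r k) x)" for x
  have [measurable]: "u \<in> borel_measurable M" unfolding u_def by (rule borel_measurable_lim_metric) simp
  have bound: "(\<integral>\<^sup>+x. ennreal ((f n x - u x)\<^sup>2) \<partial>M) \<le> ennreal ((1/8)^K)" if n: "n \<ge> N K" for n K
  proof -
    have "(\<integral>\<^sup>+x. ennreal ((f n x - u x)\<^sup>2) \<partial>M) \<le> (\<integral>\<^sup>+x. liminf (\<lambda>k. ennreal ((f n x - f (r k) x)\<^sup>2)) \<partial>M)"
    proof (rule nn_integral_mono_AE, use conv in eventually_elim)
      case (elim x)
      then have "(\<lambda>k. f (r k) x) \<longlonglongrightarrow> u x" by (simp add: u_def convergent_LIMSEQ_iff)
      then have "(\<lambda>k. ennreal ((f n x - f (r k) x)\<^sup>2)) \<longlonglongrightarrow> ennreal ((f n x - u x)\<^sup>2)"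
        by (intro tendsto_intros)
      from lim_imp_Liminf[OF trivial_limit_sequentially this] show ?case by (metis order_refl)
    qed
    also have "\<dots> \<le> liminf (\<lambda>k. \<integral>\<^sup>+x. ennreal ((f n x - f (r k) x)\<^sup>2) \<partial>M)"
      by (rule nn_integral_liminf) simp
    also have "\<dots> \<le> liminf (\<lambda>k::nat. ennreal ((1/8)^K))"
    proof (rule Liminf_mono, unfold eventually_sequentially, intro exI allI impI)
      fix k assume "k \<ge> N K"
      then have "r k \<ge> N K" using rN(3)[of k] by simp
      then show "(\<integral>\<^sup>+x. ennreal ((f n x - f (r k) x)\<^sup>2) \<partial>M) \<le> ennreal ((1/8)^K)"
        unfolding nn using N n by (intro ennreal_leI) auto
    qed
    also have "\<dots> = ennreal ((1/8)^K)" by (simp add: Liminf_const)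
    finally show ?thesis .
  qed
  \<comment> \<open>Square integrability of \<open>u\<close> is obtained backwards:
    \<open>f (N 0) - u\<close> has finite norm by Fatou, and \<open>u\<close> is then a difference
    of two square integrable functions.\<close>
  have dif: "(\<lambda>x. f n x - u x) \<in> L2 M" if "n \<ge> N 0" for n
    unfolding L2_def using bound[of 0 n] that
    by (auto intro!: integrableI_nonneg simp: top.not_eq_extremum intro: le_less_trans)
  have "(\<lambda>x. f (N 0) x - (f (N 0) x - u x)) \<in> L2 M"
    by (rule L2_diff[OF L2 dif]) simp
  then have uL: "u \<in> L2 M" by simp
  have "L2lim M f u"
    unfolding L2lim_def
  proof (rule LIMSEQ_I)
    fix e :: real assume e: "e > 0"
    obtain K where K: "(1/8)^K < e" using real_arch_pow_inv[of e "1/8"] e by auto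
    have "norm ((\<integral>x. (f n x - u x)\<^sup>2 \<partial>M) - 0) < e" if "n \<ge> N K" for n
    proof -
      have "ennreal (\<integral>x. (f n x - u x)\<^sup>2 \<partial>M) = (\<integral>\<^sup>+x. ennreal ((f n x - u x)\<^sup>2) \<partial>M)"
        using L2_diff[OF L2 uL, of n] by (subst nn_integral_eq_integral) (auto simp: L2_def)
      then have "ennreal (\<integral>x. (f n x - u x)\<^sup>2 \<partial>M) \<le> ennreal ((1/8)^K)" using bound[OF that] by simp
      then have "(\<integral>x. (f n x - u x)\<^sup>2 \<partial>M) \<le> (1/8)^K" by simp
      then show ?thesis using K by simp
    qed
    then show "\<exists>no. \<forall>n\<ge>no. norm ((\<integral>x. (f n x - u x)\<^sup>2 \<partial>M) - 0) < e" by blast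
  qed
  then show ?thesis using that uL by blast
qed

text \<open>Estimates for minimising sequences come with a separate error for each index, which
  makes the Cauchy property immediate.\<close>

lemma L2_complete_bound:
  fixes f :: "nat \<Rightarrow> 'a \<Rightarrow> real"
  assumes L2: "\<And>n. f n \<in> L2 M"
    and b: "b \<longlonglongrightarrow> 0" "\<And>m n. ip M (\<lambda>x. f m x - f n x) (\<lambda>x. f m x - f n x) \<le> b m + b n"
  obtains u where "u \<in> L2 M" "L2lim M f u"
proof (rule L2_complete[OF L2])
  fix e :: real assume e: "e > 0"
  then obtain N where N: "\<And>n. n \<ge> N \<Longrightarrow> \<bar>b n\<bar> < e / 2"
    using LIMSEQ_D[OF b(1), of "e / 2"] by auto
  show "\<exists>N. \<forall>m\<ge>N. \<forall>n\<ge>N. ip M (\<lambda>x. f m x - f n x) (\<lambda>x. f m x - f n x) \<le> e"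
  proof (intro exI allI impI)
    fix m n assume "m \<ge> N" "n \<ge> N"
    then show "ip M (\<lambda>x. f m x - f n x) (\<lambda>x. f m x - f n x) \<le> e"
      using b(2)[of m n] N[of m] N[of n] by linarith
  qed
qed (use that in blast)

text \<open>Stated for general families because it is also applied to the weak Laplacians
  \<open>w j\<close>, whose Gram matrix is diagonal with entries \<open>ev j\<close>.\<close>

lemma ip_proj:
  assumes "finite J" "p \<in> L2 M" "q \<in> L2 M" "\<And>j. j \<in> J \<Longrightarrow> e j \<in> L2 M" "\<And>j. j \<in> J \<Longrightarrow> h j \<in> L2 M"
  shows "ip M (\<lambda>x. p x - (\<Sum>j\<in>J. b j * e j x)) (\<lambda>x. q x - (\<Sum>j\<in>J. c j * h j x))
    = ip M p q - (\<Sum>j\<in>J. c j * ip M p (h j)) - (\<Sum>j\<in>J. b j * ip M (e j) q)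
      + (\<Sum>i\<in>J. \<Sum>j\<in>J. b i * c j * ip M (e i) (h j))"
proof -
  define P where "P = (\<lambda>x. \<Sum>j\<in>J. b j * e j x)"
  define R where "R = (\<lambda>x. \<Sum>j\<in>J. c j * h j x)"
  have L: "P \<in> L2 M" "R \<in> L2 M"
    unfolding P_def R_def using assms by (auto intro!: L2_sum L2_cmult)
  have P: "ip M P v = (\<Sum>j\<in>J. b j * ip M (e j) v)" if "v \<in> L2 M" for v
    unfolding P_def using assms that by (subst ip_sum_left) (auto intro!: L2_cmult simp: ip_cmult_left)
  have R: "ip M v R = (\<Sum>j\<in>J. c j * ip M v (h j))" if "v \<in> L2 M" for v
    unfolding R_def ip_commute[of M v] using assms that
    by (subst ip_sum_left) (auto intro!: L2_cmult simp: ip_cmult_left)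
  have "ip M (\<lambda>x. p x - P x) (\<lambda>x. q x - R x) = ip M p q - ip M p R - ip M P q + ip M P R"
    using assms L by (simp add: ip_diff_left ip_diff_right L2_diff)
  moreover have "ip M P R = (\<Sum>i\<in>J. \<Sum>j\<in>J. b i * c j * ip M (e i) (h j))"
    using P[OF L(2)] R assms(4) by (simp add: sum_distrib_left mult_ac)
  ultimately show ?thesis using P[of q] R[of p] assms unfolding P_def R_def by simp
qed

lemma ip_proj_orthonormal:
  assumes "finite J" "p \<in> L2 M" "q \<in> L2 M" "\<And>j. j \<in> J \<Longrightarrow> e j \<in> L2 M"
    and "\<And>i j. i \<in> J \<Longrightarrow> j \<in> J \<Longrightarrow> ip M (e i) (e j) = (if i = j then 1 else 0)"
  shows "ip M (\<lambda>x. p x - (\<Sum>j\<in>J. ip M p (e j) * e j x)) (\<lambda>x. q x - (\<Sum>j\<in>J. ip M q (e j) * e j x))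
    = ip M p q - (\<Sum>j\<in>J. ip M p (e j) * ip M q (e j))"
proof -
  have "(\<Sum>i\<in>J. \<Sum>j\<in>J. ip M p (e i) * ip M q (e j) * ip M (e i) (e j))
    = (\<Sum>i\<in>J. \<Sum>j\<in>J. if i = j then ip M p (e i) * ip M q (e j) else 0)"
    using assms(5) by (intro sum.cong refl) auto
  also have "\<dots> = (\<Sum>i\<in>J. ip M p (e i) * ip M q (e i))"
    using assms(1) by simp
  finally show ?thesis
    by (subst ip_proj) (use assms in \<open>auto simp: ip_commute[of M _ q] mult.commute\<close>)
qed

section \<open>Orthonormal bases modulo null sets\<close>

lemma ip_eq_zero_AE:
  assumes "u \<in> L2 M" "ip M u u = 0"
  shows "AE x in M. u x = 0"
proof -
  have "AE x in M. (u x)\<^sup>2 = 0"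
    using assms integral_nonneg_eq_0_iff_AE[of M "\<lambda>x. (u x)\<^sup>2"]
    by (auto simp: L2_def ip_def power2_eq_square)
  then show ?thesis by simp
qed

lemma ip_cong_AE:
  assumes "AE x in M. u x = v x" "u \<in> L2 M" "v \<in> L2 M" "w \<in> L2 M"
  shows "ip M u w = ip M v w"
  unfolding ip_def
  by (rule integral_cong_AE) (use assms in \<open>auto simp: L2_def\<close>)

text \<open>Gram-Schmidt for a space whose dimension is counted modulo null sets. Completeness is
  phrased as "orthogonal to all \<open>e j\<close> implies norm 0", the form in which the absence of
  further eigenfunctions below \<Lambda> is later used.\<close>

lemma orthonormal_basis:
  assumes V: "V \<subseteq> L2 M" "\<And>u v a b. u \<in> V \<Longrightarrow> v \<in> V \<Longrightarrow> (\<lambda>x. a * u x + b * v x) \<in> V"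
    and dim: "has_dim_AE M V d"
  obtains e where "\<And>j. j < d \<Longrightarrow> e j \<in> V"
    "\<And>i j. i < d \<Longrightarrow> j < d \<Longrightarrow> ip M (e i) (e j) = (if i = j then 1 else 0)"
    "\<And>y. y \<in> V \<Longrightarrow> (\<And>j. j < d \<Longrightarrow> ip M y (e j) = 0) \<Longrightarrow> ip M y y = 0"
proof -
  obtain b where b: "\<And>j. j < d \<Longrightarrow> b j \<in> V"
    and indep: "\<And>a :: nat \<Rightarrow> real. AE x in M. (\<Sum>j<d. a j * b j x) = 0 \<Longrightarrow> \<forall>j<d. a j = 0"
    and span: "\<And>u. u \<in> V \<Longrightarrow> \<exists>a :: nat \<Rightarrow> real. AE x in M. u x = (\<Sum>j<d. a j * b j x)"
    using dim unfolding has_dim_AE_def by blast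
  have bL: "b j \<in> L2 M" if "j < d" for j using b V that by auto
  \<comment> \<open>The induction carries the coefficients \<open>c\<close> of the
    \<open>e i\<close> over the original basis, because independence is known only for
    \<open>b\<close>. They vanish from position \<open>m\<close> on, so that \<open>b m\<close>
    enters the next residual with coefficient 1 and the residual is not null; the last clause
    transfers orthogonality from \<open>e\<close> back to \<open>b\<close>.\<close>
  define P where "P m e c \<longleftrightarrow> (\<forall>i<m. e i \<in> V) \<and>
      (\<forall>i<m. \<forall>j<m. ip M (e i) (e j) = (if i = j then 1 else 0)) \<and>
      (\<forall>i<m. \<forall>x. e i x = (\<Sum>j<d. c i j * b j x)) \<and> (\<forall>i<m. \<forall>j\<ge>m. c i j = (0::real)) \<and>
      (\<forall>y\<in>L2 M. (\<forall>i<m. ip M y (e i) = 0) \<longrightarrow> (\<forall>j<m. ip M y (b j) = 0))" for m e c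
  have "\<exists>e c. P m e c" if "m \<le> d" for m
    using that
  proof (induction m)
    case (Suc m)
    then obtain e c where P: "P m e c" using Suc_leD by blast
    have e: "\<And>i. i < m \<Longrightarrow> e i \<in> V"
      and on: "\<And>i j. i < m \<Longrightarrow> j < m \<Longrightarrow> ip M (e i) (e j) = (if i = j then 1 else 0)"
      and c: "\<And>i x. i < m \<Longrightarrow> e i x = (\<Sum>j<d. c i j * b j x)" "\<And>i j. i < m \<Longrightarrow> j \<ge> m \<Longrightarrow> c i j = (0::real)"
      and orth: "\<And>y. y \<in> L2 M \<Longrightarrow> (\<And>i. i < m \<Longrightarrow> ip M y (e i) = 0) \<Longrightarrow> \<forall>j<m. ip M y (b j) = 0"
      using P unfolding P_def by blast+
    have md: "m < d" using Suc by simp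
    have eL: "e i \<in> L2 M" if "i < m" for i using e V that by auto
    define r where "r = (\<lambda>x. b m x - (\<Sum>i<m. ip M (b m) (e i) * e i x))"
    define C where "C j = (if j = m then 1 else 0) - (\<Sum>i<m. ip M (b m) (e i) * c i j)" for j
    have rC: "r = (\<lambda>x. \<Sum>j<d. C j * b j x)"
    proof
      fix x
      have "(\<Sum>i<m. ip M (b m) (e i) * e i x) = (\<Sum>i<m. \<Sum>j<d. ip M (b m) (e i) * c i j * b j x)"
        by (intro sum.cong refl) (simp add: c sum_distrib_left mult_ac)
      also have "\<dots> = (\<Sum>j<d. (\<Sum>i<m. ip M (b m) (e i) * c i j) * b j x)"
        by (subst sum.swap) (simp add: sum_distrib_right)
      finally have "r x = b m x - (\<Sum>j<d. (\<Sum>i<m. ip M (b m) (e i) * c i j) * b j x)"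
        by (simp add: r_def)
      also have "b m x = (\<Sum>j<d. (if j = m then 1 else 0) * b j x)"
        using md by (simp add: if_distrib[of "\<lambda>z. z * _"] cong: if_cong)
      finally show "r x = (\<Sum>j<d. C j * b j x)"
        by (simp add: C_def sum_subtractf left_diff_distrib)
    qed
    have Cm: "C m = 1" using c(2) by (simp add: C_def)
    have Cj: "C j = 0" if "j \<ge> Suc m" for j using c(2) that by (simp add: C_def)
    have sumV: "(\<lambda>x. b m x - (\<Sum>i\<in>I. \<beta> i * e i x)) \<in> V" if "finite I" "I \<subseteq> {..<m}" for I \<beta>
      using that
    proof (induction I)
      case (insert i I)
      then have "(\<lambda>x. 1 * (b m x - (\<Sum>i\<in>I. \<beta> i * e i x)) + (- \<beta> i) * e i x) \<in> V"
        using e by (intro V(2)) auto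
      then show ?case using insert by (simp add: algebra_simps)
    qed (use b md in simp)
    have rV: "r \<in> V" unfolding r_def by (rule sumV) auto
    then have rL: "r \<in> L2 M" using V by auto
    have re: "ip M r (e i) = 0" if "i < m" for i
    proof -
      have "ip M (\<lambda>x. \<Sum>j<m. ip M (b m) (e j) * e j x) (e i) = (\<Sum>j<m. ip M (b m) (e j) * ip M (e j) (e i))"
        using eL that by (subst ip_sum_left) (auto intro: L2_cmult simp: ip_cmult_left)
      also have "\<dots> = (\<Sum>j<m. if j = i then ip M (b m) (e j) else 0)"
        using on that by (intro sum.cong) auto
      finally show ?thesis
        unfolding r_def using that bL[OF md] eL
        by (subst ip_diff_left) (auto intro!: L2_sum L2_cmult)
    qed
    have "ip M r r \<noteq> 0"
    proof
      assume "ip M r r = 0"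
      then have "AE x in M. r x = 0" by (rule ip_eq_zero_AE[OF rL])
      then have "AE x in M. (\<Sum>j<d. C j * b j x) = 0" by (simp add: rC)
      then have "C m = 0" using indep md by blast
      then show False using Cm by simp
    qed
    then have rp: "ip M r r > 0" using ip_self_nonneg[of M r] by simp
    define s where "s = 1 / sqrt (ip M r r)"
    have s: "s \<noteq> 0" "s * s * ip M r r = 1" using rp by (auto simp: s_def)
    define e' where "e' = e(m := (\<lambda>x. s * r x))"
    define c' where "c' = c(m := (\<lambda>j. s * C j))"
    have "\<forall>i<Suc m. e' i \<in> V"
      using e V(2)[OF rV rV, of s 0] by (auto simp: e'_def less_Suc_eq)
    moreover have "\<forall>i<Suc m. \<forall>j<Suc m. ip M (e' i) (e' j) = (if i = j then 1 else 0)"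
    proof -
      have "ip M r (\<lambda>x. s * r x) = s * ip M r r" "ip M (e i) (\<lambda>x. s * r x) = s * ip M r (e i)" for i
        by (metis ip_cmult_left ip_commute)+
      then show ?thesis using on re s by (auto simp: e'_def less_Suc_eq ip_cmult_left)
    qed
    moreover have "\<forall>i<Suc m. \<forall>x. e' i x = (\<Sum>j<d. c' i j * b j x)"
      using c(1) by (auto simp: e'_def c'_def less_Suc_eq rC sum_distrib_left mult.assoc)
    moreover have "\<forall>i<Suc m. \<forall>j\<ge>Suc m. c' i j = 0"
      using c(2) Cj by (auto simp: c'_def less_Suc_eq)
    moreover have "\<forall>y\<in>L2 M. (\<forall>i<Suc m. ip M y (e' i) = 0) \<longrightarrow> (\<forall>j<Suc m. ip M y (b j) = 0)"
    proof (intro ballI impI)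
      fix y assume y: "y \<in> L2 M" and ye: "\<forall>i<Suc m. ip M y (e' i) = 0"
      have ye': "ip M y (e i) = 0" if "i < m" for i using ye that by (auto simp: e'_def less_Suc_eq)
      have "ip M y (\<lambda>x. s * r x) = 0" using ye by (auto simp: e'_def)
      then have yr: "ip M r y = 0" using s by (simp add: ip_commute[of M y] ip_cmult_left)
      have "ip M (\<lambda>x. \<Sum>i<m. ip M (b m) (e i) * e i x) y = (\<Sum>i<m. ip M (b m) (e i) * ip M (e i) y)"
        using eL y by (subst ip_sum_left) (auto intro: L2_cmult simp: ip_cmult_left)
      then have "ip M r y = ip M (b m) y - (\<Sum>i<m. ip M (b m) (e i) * ip M y (e i))"
        unfolding r_def using bL[OF md] eL y
        by (subst ip_diff_left) (auto intro!: L2_sum L2_cmult simp: ip_commute[of M y])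
      then have "ip M y (b m) = 0" using yr ye' by (simp add: ip_commute[of M y])
      then show "\<forall>j<Suc m. ip M y (b j) = 0"
        using orth[OF y ye'] by (auto simp: less_Suc_eq)
    qed
    ultimately have "P (Suc m) e' c'" unfolding P_def by blast
    then show ?case by blast
  qed (intro exI, simp add: P_def)
  then obtain e c where "P d e c" by blast
  then have e: "\<And>i. i < d \<Longrightarrow> e i \<in> V"
      and on: "\<And>i j. i < d \<Longrightarrow> j < d \<Longrightarrow> ip M (e i) (e j) = (if i = j then 1 else 0)"
      and orth: "\<And>y. y \<in> L2 M \<Longrightarrow> (\<And>i. i < d \<Longrightarrow> ip M y (e i) = 0) \<Longrightarrow> \<forall>j<d. ip M y (b j) = 0"
    unfolding P_def by blast+
  show ?thesis
  proof (rule that[OF e on])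
    fix y assume y: "y \<in> V" and ye: "\<And>j. j < d \<Longrightarrow> ip M y (e j) = 0"
    have yL: "y \<in> L2 M" using y V by auto
    obtain a :: "nat \<Rightarrow> real" where a: "AE x in M. y x = (\<Sum>j<d. a j * b j x)" using span[OF y] by blast
    have "ip M y y = ip M (\<lambda>x. \<Sum>j<d. a j * b j x) y"
      using bL yL a by (intro ip_cong_AE) (auto intro!: L2_sum L2_cmult)
    also have "\<dots> = (\<Sum>j<d. a j * ip M (b j) y)"
      using bL yL by (subst ip_sum_left) (auto intro!: L2_cmult simp: ip_cmult_left)
    also have "\<dots> = 0" using orth[OF yL ye] by (simp add: ip_commute[of M _ y])
    finally show "ip M y y = 0" .
  qed auto
qed

section \<open>The spectrum below an eigenvalue\<close>

text \<open>The first variation at a minimum. For a \<noteq> 0 the value t = -a / (|b| + 1) would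
  make the right-hand side negative.\<close>

lemma linear_le_quadratic_imp_zero:
  fixes a b :: real
  assumes "\<And>t. 0 \<le> 2 * t * a + t\<^sup>2 * b"
  shows "a = 0"
proof (rule ccontr)
  assume a: "a \<noteq> 0"
  define c where "c = \<bar>b\<bar> + 1"
  have c: "c > 0" "b \<le> c" by (auto simp: c_def)
  have "0 \<le> 2 * (- a / c) * a + (- a / c)\<^sup>2 * b" by (rule assms)
  also have "\<dots> \<le> 2 * (- a / c) * a + (- a / c)\<^sup>2 * c"
    using c by (intro add_left_mono mult_left_mono) auto
  also have "\<dots> = - (a\<^sup>2 / c)" using c by (simp add: field_simps power2_eq_square)
  also have "\<dots> < 0" using a c by simp
  finally show False by simp
qed

text \<open>Bolzano-Weierstrass applied once per index, passing to further subsequences; used for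
  the finitely many functionals of the compactness inequality.\<close>

lemma bounded_family_convergent_subseq:
  fixes a :: "nat \<Rightarrow> nat \<Rightarrow> real"
  assumes "\<And>j. j < N \<Longrightarrow> bounded (range (\<lambda>n. a n j))"
  shows "\<exists>r. strict_mono r \<and> (\<forall>j<N. convergent (\<lambda>n. a (r n) j))"
  using assms
proof (induction N)
  case 0
  then show ?case by (auto intro: strict_mono_id)
next
  case (Suc N)
  then obtain r where r: "strict_mono r" "\<And>j. j < N \<Longrightarrow> convergent (\<lambda>n. a (r n) j)" by auto
  have "bounded (range (\<lambda>n. a (r n) N))"
    using Suc.prems[of N] by (rule bounded_subset) auto
  then obtain l s where s: "strict_mono s" "((\<lambda>n. a (r n) N) \<circ> s) \<longlonglongrightarrow> l"
    using bounded_imp_convergent_subsequence by blast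
  have "convergent (\<lambda>n. a ((r \<circ> s) n) j)" if "j < Suc N" for j
  proof (cases "j = N")
    case True
    then show ?thesis using s by (auto simp: o_def intro: convergentI)
  next
    case False
    then have "convergent (\<lambda>n. a (r n) j)" using r that by simp
    then show ?thesis
      using convergent_subseq_convergent[OF _ s(1), of "\<lambda>n. a (r n) j"] by (simp add: o_def)
  qed
  then show ?case using strict_mono_o[OF r(1) s(1)] by blast
qed

lemma ip_diff_sum_right:
  assumes "v \<in> L2 M" "p \<in> L2 M" "\<And>j. j \<in> J \<Longrightarrow> h j \<in> L2 M"
  shows "ip M v (\<lambda>x. p x - (\<Sum>j\<in>J. c j * h j x)) = ip M v p - (\<Sum>j\<in>J. c j * ip M v (h j))"
proof -
  have "ip M (\<lambda>x. \<Sum>j\<in>J. c j * h j x) v = (\<Sum>j\<in>J. c j * ip M (h j) v)"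
    using assms by (subst ip_sum_left) (auto intro: L2_cmult simp: ip_cmult_left)
  then have "ip M v (\<lambda>x. \<Sum>j\<in>J. c j * h j x) = (\<Sum>j\<in>J. c j * ip M v (h j))"
    by (simp only: ip_commute[of M v])
  moreover have "(\<lambda>x. \<Sum>j\<in>J. c j * h j x) \<in> L2 M" using assms by (auto intro!: L2_sum L2_cmult)
  ultimately show ?thesis using assms by (simp add: ip_diff_right)
qed

text \<open>Abstract form of the clamped problem: \<open>T\<close> stands for the test functions on
  the domain, \<open>L\<close> for the Laplacian, \<open>M\<close> for the volume.
  \<open>compactness\<close> is the compact embedding in quantitative form: up to finitely many
  linear functionals, the squared norm is a small multiple of the squared graph norm of
  \<open>L\<close>.\<close>

locale clamped =
  fixes M :: "'a measure" and T :: "('a \<Rightarrow> real) set" and L :: "('a \<Rightarrow> real) \<Rightarrow> 'a \<Rightarrow> real"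
  assumes T_L2: "\<phi> \<in> T \<Longrightarrow> \<phi> \<in> L2 M"
    and T_zero: "(\<lambda>x. 0) \<in> T"
    and T_lin: "\<phi> \<in> T \<Longrightarrow> \<psi> \<in> T \<Longrightarrow> (\<lambda>x. a * \<phi> x + b * \<psi> x) \<in> T"
    and L_T: "\<phi> \<in> T \<Longrightarrow> L \<phi> \<in> T"
    and L_lin: "\<phi> \<in> T \<Longrightarrow> \<psi> \<in> T \<Longrightarrow> L (\<lambda>x. a * \<phi> x + b * \<psi> x) = (\<lambda>x. a * L \<phi> x + b * L \<psi> x)"
    and L_sym: "\<phi> \<in> T \<Longrightarrow> \<psi> \<in> T \<Longrightarrow> ip M (L \<phi>) \<psi> = ip M \<phi> (L \<psi>)"
    and compactness: "\<epsilon> > 0 \<Longrightarrow> \<exists>N q. (\<forall>j<N. q j \<in> L2 M) \<and>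
      (\<forall>\<phi>\<in>T. ip M \<phi> \<phi> \<le> \<epsilon> * (ip M \<phi> \<phi> + ip M (L \<phi>) (L \<phi>)) + (\<Sum>j<(N::nat). (ip M \<phi> (q j))\<^sup>2))"
begin

text \<open>The closure of the graph of \<open>L\<close> on \<open>T\<close>: \<open>w\<close> is a
  weak Laplacian of \<open>u\<close>. It is a relation because \<open>w\<close> is determined only
  almost everywhere.\<close>

definition graph_clos :: "('a \<Rightarrow> real) \<Rightarrow> ('a \<Rightarrow> real) \<Rightarrow> bool" where
  "graph_clos u w \<longleftrightarrow> u \<in> L2 M \<and> w \<in> L2 M \<and>
     (\<exists>\<phi>. (\<forall>n. \<phi> n \<in> T) \<and> L2lim M \<phi> u \<and> L2lim M (\<lambda>n. L (\<phi> n)) w)"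

text \<open>Arranged to unfold to the same set as \<open>clamped_eigenspace\<close> when the locale
  is instantiated.\<close>

definition eigensp :: "real \<Rightarrow> ('a \<Rightarrow> real) set" where
  "eigensp \<mu> = {u. (\<exists>w. graph_clos u w) \<and> (\<forall>\<phi>\<in>T. ip M u (L (L \<phi>)) = \<mu> * ip M u \<phi>)}"

lemma graph_clos_L2: "graph_clos u w \<Longrightarrow> u \<in> L2 M" "graph_clos u w \<Longrightarrow> w \<in> L2 M"
  by (auto simp: graph_clos_def)

lemma graph_clos_T: "\<phi> \<in> T \<Longrightarrow> graph_clos \<phi> (L \<phi>)"
  unfolding graph_clos_def by (auto intro!: T_L2 L_T exI[of _ "\<lambda>_. \<phi>"] simp: L2lim_def)

lemma graph_closE:
  assumes "graph_clos u w"
  obtains \<phi> where "\<And>n. \<phi> n \<in> T" "\<And>n. \<phi> n \<in> L2 M" "\<And>n. L (\<phi> n) \<in> L2 M"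
    "L2lim M \<phi> u" "L2lim M (\<lambda>n. L (\<phi> n)) w"
  using assms T_L2 L_T unfolding graph_clos_def by blast

lemma graph_clos_lin:
  assumes "graph_clos u w" "graph_clos v s"
  shows "graph_clos (\<lambda>x. a * u x + b * v x) (\<lambda>x. a * w x + b * s x)"
proof -
  obtain \<phi> where \<phi>: "\<And>n. \<phi> n \<in> T" "\<And>n. \<phi> n \<in> L2 M" "\<And>n. L (\<phi> n) \<in> L2 M"
    "L2lim M \<phi> u" "L2lim M (\<lambda>n. L (\<phi> n)) w" using assms(1) by (rule graph_closE) blast
  obtain \<psi> where \<psi>: "\<And>n. \<psi> n \<in> T" "\<And>n. \<psi> n \<in> L2 M" "\<And>n. L (\<psi> n) \<in> L2 M"
    "L2lim M \<psi> v" "L2lim M (\<lambda>n. L (\<psi> n)) s" using assms(2) by (rule graph_closE) blast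
  have "L2lim M (\<lambda>n x. a * \<phi> n x + b * \<psi> n x) (\<lambda>x. a * u x + b * v x)"
    using assms \<phi> \<psi> by (intro L2lim_lin) (auto simp: graph_clos_def)
  moreover have "L2lim M (\<lambda>n x. a * L (\<phi> n) x + b * L (\<psi> n) x) (\<lambda>x. a * w x + b * s x)"
    using assms \<phi> \<psi> by (intro L2lim_lin) (auto simp: graph_clos_def)
  moreover have "(\<lambda>n x. a * L (\<phi> n) x + b * L (\<psi> n) x) = (\<lambda>n. L (\<lambda>x. a * \<phi> n x + b * \<psi> n x))"
    using \<phi> \<psi> L_lin by presburger
  ultimately show ?thesis
    using assms \<phi> \<psi> T_lin L2_lin unfolding graph_clos_def
    by (auto intro!: exI[of _ "\<lambda>n x. a * \<phi> n x + b * \<psi> n x"])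
qed

lemma graph_clos_diff_sum:
  assumes "finite J" "graph_clos p q" "\<And>j. j \<in> J \<Longrightarrow> graph_clos (u j) (w j)"
  shows "graph_clos (\<lambda>x. p x - (\<Sum>j\<in>J. b j * u j x)) (\<lambda>x. q x - (\<Sum>j\<in>J. b j * w j x))"
  using assms(1,3)
proof (induction J)
  case (insert i I)
  have "graph_clos (\<lambda>x. 1 * (p x - (\<Sum>j\<in>I. b j * u j x)) + (- b i) * u i x)
      (\<lambda>x. 1 * (q x - (\<Sum>j\<in>I. b j * w j x)) + (- b i) * w i x)"
    using insert by (intro graph_clos_lin) auto
  then show ?case using insert by (simp add: algebra_simps)
qed (use assms(2) in simp)

lemma graph_clos_ip_sym:
  assumes "graph_clos u w" "graph_clos v s"
  shows "ip M w v = ip M u s"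
proof -
  obtain \<phi> where \<phi>: "\<And>n. \<phi> n \<in> T" "\<And>n. \<phi> n \<in> L2 M" "\<And>n. L (\<phi> n) \<in> L2 M"
    "L2lim M \<phi> u" "L2lim M (\<lambda>n. L (\<phi> n)) w" using assms(1) by (rule graph_closE) blast
  obtain \<psi> where \<psi>: "\<And>n. \<psi> n \<in> T" "\<And>n. \<psi> n \<in> L2 M" "\<And>n. L (\<psi> n) \<in> L2 M"
    "L2lim M \<psi> v" "L2lim M (\<lambda>n. L (\<psi> n)) s" using assms(2) by (rule graph_closE) blast
  have "(\<lambda>n. ip M (L (\<phi> n)) (\<psi> n)) \<longlonglongrightarrow> ip M w v"
    using \<phi> \<psi> assms by (intro L2lim_ip2) (auto simp: graph_clos_def)
  moreover have "(\<lambda>n. ip M (\<phi> n) (L (\<psi> n))) \<longlonglongrightarrow> ip M u s"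
    using \<phi> \<psi> assms by (intro L2lim_ip2) (auto simp: graph_clos_def)
  moreover have "ip M (L (\<phi> n)) (\<psi> n) = ip M (\<phi> n) (L (\<psi> n))" for n
    using \<phi> \<psi> L_sym by blast
  ultimately show ?thesis using LIMSEQ_unique by simp
qed

text \<open>The weak equation tests \<open>u\<close> against \<open>L (L \<phi>)\<close>, which is
  not controlled by the graph norm of \<phi>. Moving one \<open>L\<close> onto \<open>u\<close>
  leaves only \<open>L \<phi>\<close>, and the identity then extends from \<open>T\<close> to the
  closure.\<close>

lemma eigensp_ip:
  assumes "u \<in> eigensp \<mu>" "graph_clos u w" "graph_clos v s"
  shows "ip M w s = \<mu> * ip M u v"
proof -
  obtain \<psi> where \<psi>: "\<And>n. \<psi> n \<in> T" "\<And>n. \<psi> n \<in> L2 M" "\<And>n. L (\<psi> n) \<in> L2 M"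
    "L2lim M \<psi> v" "L2lim M (\<lambda>n. L (\<psi> n)) s" using assms(3) by (rule graph_closE) blast
  have "(\<lambda>n. ip M (L (\<psi> n)) w) \<longlonglongrightarrow> ip M s w"
    using \<psi> assms by (intro L2lim_ip) (auto simp: graph_clos_def)
  moreover have "(\<lambda>n. \<mu> * ip M (\<psi> n) u) \<longlonglongrightarrow> \<mu> * ip M v u"
    using \<psi> assms by (intro tendsto_mult_left L2lim_ip) (auto simp: graph_clos_def)
  moreover have "ip M (L (\<psi> n)) w = \<mu> * ip M (\<psi> n) u" for n
  proof -
    have "ip M w (L (\<psi> n)) = ip M u (L (L (\<psi> n)))"
      using graph_clos_ip_sym[OF assms(2) graph_clos_T[OF L_T[OF \<psi>(1)]]] .
    then show ?thesis
      using assms(1) \<psi>(1) by (simp add: eigensp_def ip_commute[of M "L (\<psi> n)"] ip_commute[of M "\<psi> n"])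
  qed
  ultimately have "ip M s w = \<mu> * ip M v u" using LIMSEQ_unique by simp
  then show ?thesis by (simp add: ip_commute[of M s] ip_commute[of M v])
qed

lemma eigenspI:
  assumes "graph_clos u w" "\<And>\<phi>. \<phi> \<in> T \<Longrightarrow> ip M w (L \<phi>) = \<mu> * ip M u \<phi>"
  shows "u \<in> eigensp \<mu>"
  unfolding eigensp_def using assms graph_clos_ip_sym[OF assms(1) graph_clos_T[OF L_T]] by auto

lemma eigensp_L2: "eigensp \<mu> \<subseteq> L2 M"
  by (auto simp: eigensp_def graph_clos_def)

lemma eigensp_lin:
  assumes "u \<in> eigensp \<mu>" "v \<in> eigensp \<mu>"
  shows "(\<lambda>x. a * u x + b * v x) \<in> eigensp \<mu>"
proof -
  have "u \<in> L2 M" "v \<in> L2 M" using assms eigensp_L2 by auto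
  then have "ip M (\<lambda>x. a * u x + b * v x) (L (L \<phi>)) = \<mu> * ip M (\<lambda>x. a * u x + b * v x) \<phi>"
    if "\<phi> \<in> T" for \<phi>
    using assms that T_L2 L_T by (simp add: ip_lin_left eigensp_def algebra_simps)
  then show ?thesis using assms graph_clos_lin unfolding eigensp_def by blast
qed

lemma eigensp_orth:
  assumes "u \<in> eigensp \<mu>" "v \<in> eigensp \<nu>" "\<mu> \<noteq> \<nu>"
  shows "ip M u v = 0"
proof -
  obtain w s where ws: "graph_clos u w" "graph_clos v s" using assms by (auto simp: eigensp_def)
  have "\<mu> * ip M u v = \<nu> * ip M v u"
    using eigensp_ip[OF assms(1) ws] eigensp_ip[OF assms(2) ws(2,1)] by (metis ip_commute)
  then show ?thesis using assms(3) by (simp add: ip_commute[of M v u])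
qed

text \<open>\<open>N\<close> and \<open>q\<close> depend on \<epsilon> alone, so both sides of the
  inequality are continuous in the graph norm.\<close>

lemma graph_clos_compactness:
  assumes "\<epsilon> > 0"
  obtains N q where "\<And>j. j < (N::nat) \<Longrightarrow> q j \<in> L2 M"
    "\<And>u w. graph_clos u w \<Longrightarrow> ip M u u \<le> \<epsilon> * (ip M u u + ip M w w) + (\<Sum>j<N. (ip M u (q j))\<^sup>2)"
proof -
  obtain N q where q: "\<And>j. j < (N::nat) \<Longrightarrow> q j \<in> L2 M"
    and le: "\<And>\<phi>. \<phi> \<in> T \<Longrightarrow> ip M \<phi> \<phi> \<le> \<epsilon> * (ip M \<phi> \<phi> + ip M (L \<phi>) (L \<phi>)) + (\<Sum>j<N. (ip M \<phi> (q j))\<^sup>2)"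
    using compactness[OF assms] by blast
  have "ip M u u \<le> \<epsilon> * (ip M u u + ip M w w) + (\<Sum>j<N. (ip M u (q j))\<^sup>2)" if uw: "graph_clos u w" for u w
  proof -
    obtain \<phi> where \<phi>: "\<And>n. \<phi> n \<in> T" "\<And>n. \<phi> n \<in> L2 M" "\<And>n. L (\<phi> n) \<in> L2 M"
      "L2lim M \<phi> u" "L2lim M (\<lambda>n. L (\<phi> n)) w" using uw by (rule graph_closE) blast
    have u: "u \<in> L2 M" "w \<in> L2 M" using uw by (auto simp: graph_clos_def)
    have "(\<lambda>n. \<epsilon> * (ip M (\<phi> n) (\<phi> n) + ip M (L (\<phi> n)) (L (\<phi> n))) + (\<Sum>j<N. (ip M (\<phi> n) (q j))\<^sup>2))
      \<longlonglongrightarrow> \<epsilon> * (ip M u u + ip M w w) + (\<Sum>j<N. (ip M u (q j))\<^sup>2)"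
      using \<phi> u q by (intro tendsto_intros L2lim_ip L2lim_ip2) auto
    moreover have "(\<lambda>n. ip M (\<phi> n) (\<phi> n)) \<longlonglongrightarrow> ip M u u"
      using \<phi> u by (intro L2lim_ip2) auto
    ultimately show ?thesis using le[OF \<phi>(1)] by (intro LIMSEQ_le) auto
  qed
  then show ?thesis using that q by blast
qed

text \<open>A diagonal choice: the n-th pair is replaced by a test function within
  \<open>1 / Suc n\<close> in both squared distances. For squared distances the triangle inequality
  holds with a factor 2.\<close>

lemma graph_clos_closed:
  assumes yz: "\<And>n. graph_clos (y n) (z n)" and lim: "L2lim M y u" "L2lim M z w" and L2: "u \<in> L2 M" "w \<in> L2 M"
  shows "graph_clos u w"
proof -
  define D where "D f g = ip M (\<lambda>x. f x - g x) (\<lambda>x. f x - g x)" for f g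
  have tri: "D f h \<le> 2 * D f g + 2 * D g h" if "f \<in> L2 M" "g \<in> L2 M" "h \<in> L2 M" for f g h
  proof -
    define p q where "p = (\<lambda>x. f x - g x)" and "q = (\<lambda>x. g x - h x)"
    have pq: "p \<in> L2 M" "q \<in> L2 M" using that by (auto simp: p_def q_def intro: L2_diff)
    have "(\<lambda>x. f x - h x) = (\<lambda>x. 1 * p x + 1 * q x)" by (auto simp: p_def q_def)
    moreover have "0 \<le> ip M (\<lambda>x. 1 * p x + (-1) * q x) (\<lambda>x. 1 * p x + (-1) * q x)" by (rule ip_self_nonneg)
    ultimately show ?thesis
      unfolding D_def using ip_lin_lin[OF pq, of 1 1] ip_lin_lin[OF pq, of 1 "-1"]
      by (simp add: p_def q_def)
  qed
  have "\<exists>\<phi>\<in>T. D \<phi> (y n) < 1 / Suc n \<and> D (L \<phi>) (z n) < 1 / Suc n" for n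
  proof -
    obtain \<phi> where \<phi>: "\<And>k. \<phi> k \<in> T" "L2lim M \<phi> (y n)" "L2lim M (\<lambda>k. L (\<phi> k)) (z n)"
      using yz[of n] by (rule graph_closE) blast
    have "eventually (\<lambda>k. D (\<phi> k) (y n) < 1 / Suc n) sequentially"
      "eventually (\<lambda>k. D (L (\<phi> k)) (z n) < 1 / Suc n) sequentially"
      using \<phi>(2,3) unfolding L2lim_iff D_def by (auto intro!: order_tendstoD)
    then have "eventually (\<lambda>k. D (\<phi> k) (y n) < 1 / Suc n \<and> D (L (\<phi> k)) (z n) < 1 / Suc n) sequentially"
      by eventually_elim simp
    then show ?thesis using \<phi>(1) by (auto simp: eventually_sequentially)
  qed
  then obtain \<phi> where \<phi>: "\<And>n. \<phi> n \<in> T" "\<And>n. D (\<phi> n) (y n) < 1 / Suc n" "\<And>n. D (L (\<phi> n)) (z n) < 1 / Suc n"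
    by metis
  have pos: "\<bar>D f g\<bar> = D f g" for f g by (simp add: D_def ip_self_nonneg)
  have "L2lim M \<phi> u"
    unfolding L2lim_iff D_def[symmetric]
  proof (rule tendsto_zero_bounded)
    show "(\<lambda>n. 2 * (1 / Suc n) + 2 * D (y n) u) \<longlonglongrightarrow> 2 * 0 + 2 * 0"
      using lim(1) unfolding L2lim_iff D_def[symmetric] by (intro tendsto_intros LIMSEQ_Suc[OF lim_1_over_n])
    show "\<bar>D (\<phi> n) u\<bar> \<le> 2 * (1 / Suc n) + 2 * D (y n) u" for n
      using tri[of "\<phi> n" "y n" u] \<phi>(2)[of n] T_L2[OF \<phi>(1)] yz[of n] L2 unfolding pos by (auto simp: graph_clos_def)
  qed simp
  moreover have "L2lim M (\<lambda>n. L (\<phi> n)) w"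
    unfolding L2lim_iff D_def[symmetric]
  proof (rule tendsto_zero_bounded)
    show "(\<lambda>n. 2 * (1 / Suc n) + 2 * D (z n) w) \<longlonglongrightarrow> 2 * 0 + 2 * 0"
      using lim(2) unfolding L2lim_iff D_def[symmetric] by (intro tendsto_intros LIMSEQ_Suc[OF lim_1_over_n])
    show "\<bar>D (L (\<phi> n)) w\<bar> \<le> 2 * (1 / Suc n) + 2 * D (z n) w" for n
      using tri[of "L (\<phi> n)" "z n" w] \<phi>(3)[of n] T_L2[OF L_T[OF \<phi>(1)]] yz[of n] L2 unfolding pos by (auto simp: graph_clos_def)
  qed simp
  ultimately show ?thesis using L2 \<phi>(1) by (auto simp: graph_clos_def)
qed

text \<open>If the infimum \<open>Q\<close> of the Rayleigh quotient over the orthogonal complement of the \<open>u j\<close> were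
  below \<open>\<Lambda>\<close>, it would be attained and \<open>Q\<close> would be a further eigenvalue. A minimising sequence
  converges because its differences \<open>d\<close> satisfy \<open>\<parallel>Ld\<parallel>\<^sup>2 \<le> Q \<parallel>d\<parallel>\<^sup>2 + o(1)\<close> by the parallelogram law, so
  that the compactness inequality for a single small \<open>\<epsilon>\<close> suffices.\<close>

lemma rayleigh_bound:
  fixes u w :: "nat \<Rightarrow> 'a \<Rightarrow> real" and ev :: "nat \<Rightarrow> real"
  assumes J: "finite J" and uw: "\<And>j. j \<in> J \<Longrightarrow> graph_clos (u j) (w j)" "\<And>j. j \<in> J \<Longrightarrow> u j \<in> eigensp (ev j)"
    and on: "\<And>i j. i \<in> J \<Longrightarrow> j \<in> J \<Longrightarrow> ip M (u i) (u j) = (if i = j then 1 else 0)"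
    and gap: "\<And>Q y. Q < \<Lambda> \<Longrightarrow> y \<in> eigensp Q \<Longrightarrow> (\<And>j. j \<in> J \<Longrightarrow> ip M y (u j) = 0) \<Longrightarrow> ip M y y = 0"
    and y: "graph_clos y0 z0" "\<And>j. j \<in> J \<Longrightarrow> ip M y0 (u j) = 0"
  shows "\<Lambda> * ip M y0 y0 \<le> ip M z0 z0"
proof (rule ccontr)
  assume "\<not> \<Lambda> * ip M y0 y0 \<le> ip M z0 z0"
  then have neg: "ip M z0 z0 < \<Lambda> * ip M y0 y0" by simp
  define adm where "adm y z \<longleftrightarrow> graph_clos y z \<and> (\<forall>j\<in>J. ip M y (u j) = 0)" for y z
  define S where "S = {ip M z z | y z. adm y z \<and> ip M y y = 1}"
  define Q where "Q = Inf S"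
  have uL: "u j \<in> L2 M" if "j \<in> J" for j using uw(1)[OF that] by (rule graph_clos_L2)
  have adm_lin: "adm (\<lambda>x. a * y x + b * v x) (\<lambda>x. a * z x + b * s x)" if "adm y z" "adm v s" for y z v s a b
    using that uL graph_clos_lin graph_clos_L2(1) unfolding adm_def by (auto simp: ip_lin_left)
  \<comment> \<open>Scalings are written as combinations with second coefficient 0, so that the
    closure under linear combinations applies literally.\<close>
  have adm_scale: "ip M (\<lambda>x. a * z x + 0 * z x) (\<lambda>x. a * z x + 0 * z x) = a\<^sup>2 * ip M z z" if "z \<in> L2 M" for a z
    using ip_lin_lin[OF that that, of a 0] by simp
  have normalize: "ip M z z / ip M y y \<in> S" if "adm y z" "ip M y y > 0" for y z
  proof -
    define a where "a = 1 / sqrt (ip M y y)"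
    have a: "a\<^sup>2 = 1 / ip M y y" using that by (simp add: a_def power_divide)
    have "y \<in> L2 M" "z \<in> L2 M" using that graph_clos_L2 by (auto simp: adm_def)
    then have sc: "ip M z z / ip M y y = ip M (\<lambda>x. a * z x + 0 * z x) (\<lambda>x. a * z x + 0 * z x)"
      "ip M (\<lambda>x. a * y x + 0 * y x) (\<lambda>x. a * y x + 0 * y x) = 1"
      using that(2) by (simp_all only: adm_scale a) auto
    show ?thesis unfolding S_def mem_Collect_eq
      by (intro exI[of _ "\<lambda>x. a * y x + 0 * y x"] exI[of _ "\<lambda>x. a * z x + 0 * z x"] conjI)
        (fact sc adm_lin[OF that(1) that(1), of a 0])+
  qed
  have y0: "adm y0 z0" using y by (simp add: adm_def)
  have y0p: "ip M y0 y0 > 0"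
    using neg ip_self_nonneg[of M y0] ip_self_nonneg[of M z0] by (cases "ip M y0 y0 = 0") auto
  have bdd: "bdd_below S" unfolding S_def by (rule bdd_belowI[of _ 0]) (auto simp: ip_self_nonneg)
  have ne: "S \<noteq> {}" using normalize[OF y0 y0p] by auto
  have Q\<Lambda>: "Q < \<Lambda>"
  proof -
    have "ip M z0 z0 / ip M y0 y0 < \<Lambda>" using neg y0p by (simp add: field_simps)
    then show ?thesis unfolding Q_def using cInf_lower[OF normalize[OF y0 y0p] bdd] by linarith
  qed
  have Q0: "Q \<ge> 0" unfolding Q_def using ne by (intro cInf_greatest) (auto simp: S_def ip_self_nonneg)
  have Qle: "Q * ip M y y \<le> ip M z z" if "adm y z" for y z
  proof (cases "ip M y y = 0")
    case True
    then show ?thesis by (simp add: ip_self_nonneg)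
  next
    case False
    then have p: "ip M y y > 0" using ip_self_nonneg[of M y] by simp
    have "Q \<le> ip M z z / ip M y y" unfolding Q_def using normalize[OF that p] bdd by (rule cInf_lower)
    then show ?thesis using p by (simp add: field_simps)
  qed
  have "\<exists>y z. adm y z \<and> ip M y y = 1 \<and> ip M z z < Q + 1 / Suc n" for n
  proof -
    have "\<exists>q\<in>S. q < Q + 1 / Suc n" unfolding Q_def using ne by (intro cInf_lessD) auto
    then show ?thesis by (auto simp: S_def)
  qed
  then obtain y z where yz: "\<And>n. adm (y n) (z n)" "\<And>n. ip M (y n) (y n) = 1" "\<And>n. ip M (z n) (z n) < Q + 1 / Suc n"
    by metis
  have yL: "y n \<in> L2 M" "z n \<in> L2 M" for n using yz(1)[of n] graph_clos_L2 by (auto simp: adm_def)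
  \<comment> \<open>With this \<epsilon> the term \<epsilon> (1 + Q) d equals d / 2 and can be
    absorbed into the left-hand side.\<close>
  define \<epsilon> where "\<epsilon> = 1 / (2 * (1 + Q))"
  have \<epsilon>: "\<epsilon> > 0" "\<epsilon> * (1 + Q) = 1 / 2" "\<epsilon> \<le> 1 / 2" using Q0 by (auto simp: \<epsilon>_def field_simps)
  obtain N q where q: "\<And>j. j < (N::nat) \<Longrightarrow> q j \<in> L2 M"
    and comp: "\<And>u w. graph_clos u w \<Longrightarrow> ip M u u \<le> \<epsilon> * (ip M u u + ip M w w) + (\<Sum>j<N. (ip M u (q j))\<^sup>2)"
    using graph_clos_compactness[OF \<epsilon>(1)] by blast
  have "bounded (range (\<lambda>n. ip M (y n) (q j)))" if "j < N" for j
    using ip_abs_le[OF yL(1) q[OF that]] yz(2) by (auto simp: bounded_iff)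
  then obtain r where r: "strict_mono r" "\<And>j. j < N \<Longrightarrow> convergent (\<lambda>n. ip M (y (r n)) (q j))"
    using bounded_family_convergent_subseq[of N "\<lambda>n j. ip M (y n) (q j)"] by blast
  define Y Z where "Y = y \<circ> r" and "Z = z \<circ> r"
  have YZ: "adm (Y n) (Z n)" "ip M (Y n) (Y n) = 1" "Y n \<in> L2 M" "Z n \<in> L2 M" for n
    using yz yL by (auto simp: Y_def Z_def)
  have Zlt: "ip M (Z n) (Z n) \<le> Q + 1 / Suc n" for n
  proof -
    have "1 / real (Suc (r n)) \<le> 1 / real (Suc n)"
      using strict_mono_imp_increasing[OF r(1), of n] by (intro divide_left_mono) auto
    then show ?thesis using yz(3)[of "r n"] by (simp add: Z_def)
  qed
  define l where "l j = lim (\<lambda>n. ip M (Y n) (q j))" for j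
  have l: "(\<lambda>n. ip M (Y n) (q j)) \<longlonglongrightarrow> l j" if "j < N" for j
    using r(2)[OF that] by (simp add: l_def Y_def convergent_LIMSEQ_iff o_def)
  define c where "c n = (\<Sum>j<N. (ip M (Y n) (q j) - l j)\<^sup>2)" for n
  have c: "c \<longlonglongrightarrow> 0"
  proof -
    have "c \<longlonglongrightarrow> (\<Sum>j<N. (l j - l j)\<^sup>2)" unfolding c_def using l by (intro tendsto_intros) auto
    then show ?thesis by simp
  qed
  have dY: "ip M (\<lambda>x. Y m x - Y n x) (\<lambda>x. Y m x - Y n x) \<le> (2 / Suc m + 4 * c m) + (2 / Suc n + 4 * c n)"
   and dZ: "ip M (\<lambda>x. Z m x - Z n x) (\<lambda>x. Z m x - Z n x) \<le>
      (Q * (2 / Suc m + 4 * c m) + 2 / Suc m) + (Q * (2 / Suc n + 4 * c n) + 2 / Suc n)" for m n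
  proof -
    define d e where "d = ip M (\<lambda>x. Y m x - Y n x) (\<lambda>x. Y m x - Y n x)"
      and "e = ip M (\<lambda>x. Z m x - Z n x) (\<lambda>x. Z m x - Z n x)"
    have sub: "ip M (\<lambda>x. f x - g x) (\<lambda>x. f x - g x) = 2 * ip M f f + 2 * ip M g g - ip M (\<lambda>x. 1 * f x + 1 * g x) (\<lambda>x. 1 * f x + 1 * g x)"
      if "f \<in> L2 M" "g \<in> L2 M" for f g
      using ip_lin_lin[OF that, of 1 1] ip_lin_lin[OF that, of 1 "-1"] by simp
    \<comment> \<open>The sum of \<open>Y m\<close> and \<open>Y n\<close> is admissible, so its
      quotient is at least \<open>Q\<close>; this lower bound for the sum becomes an upper bound for
      the difference of \<open>Z m\<close> and \<open>Z n\<close>.\<close>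
    have "Q * ip M (\<lambda>x. 1 * Y m x + 1 * Y n x) (\<lambda>x. 1 * Y m x + 1 * Y n x)
      \<le> ip M (\<lambda>x. 1 * Z m x + 1 * Z n x) (\<lambda>x. 1 * Z m x + 1 * Z n x)"
      by (intro Qle adm_lin YZ)
    moreover have "ip M (\<lambda>x. 1 * Y m x + 1 * Y n x) (\<lambda>x. 1 * Y m x + 1 * Y n x) = 4 - d"
      using sub[OF YZ(3) YZ(3), of m n] YZ(2) by (simp add: d_def)
    ultimately have "e \<le> 2 * ip M (Z m) (Z m) + 2 * ip M (Z n) (Z n) - Q * (4 - d)"
      using sub[OF YZ(4) YZ(4), of m n] by (simp add: e_def)
    then have e: "e \<le> Q * d + 2 / Suc m + 2 / Suc n"
      using Zlt[of m] Zlt[of n] by (simp add: algebra_simps)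
    have cl: "graph_clos (\<lambda>x. 1 * Y m x + (-1) * Y n x) (\<lambda>x. 1 * Z m x + (-1) * Z n x)"
      using adm_lin[OF YZ(1) YZ(1)] unfolding adm_def by blast
    have "(ip M (\<lambda>x. Y m x - Y n x) (q j))\<^sup>2 \<le> 2 * (ip M (Y m) (q j) - l j)\<^sup>2 + 2 * (ip M (Y n) (q j) - l j)\<^sup>2"
      if "j < N" for j
    proof -
      define a b where "a = ip M (Y m) (q j) - l j" and "b = ip M (Y n) (q j) - l j"
      have "ip M (\<lambda>x. Y m x - Y n x) (q j) = a - b"
        using YZ q[OF that] by (simp add: ip_diff_left a_def b_def)
      moreover have "(a - b)\<^sup>2 \<le> 2 * a\<^sup>2 + 2 * b\<^sup>2"
        using zero_le_power2[of "a + b"] by (simp add: power2_eq_square algebra_simps)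
      ultimately show ?thesis by (simp add: a_def b_def)
    qed
    then have "(\<Sum>j<N. (ip M (\<lambda>x. Y m x - Y n x) (q j))\<^sup>2) \<le> 2 * c m + 2 * c n"
      unfolding c_def sum_distrib_left sum.distrib[symmetric] by (intro sum_mono) auto
    then have "d \<le> \<epsilon> * (d + e) + 2 * c m + 2 * c n"
      using comp[OF cl] by (simp add: d_def e_def)
    moreover have "\<epsilon> * (d + e) \<le> \<epsilon> * (d + (Q * d + 2 / Suc m + 2 / Suc n))"
      using e \<epsilon>(1) by (intro mult_left_mono) auto
    moreover have "\<epsilon> * (d + (Q * d + 2 / Suc m + 2 / Suc n)) = (\<epsilon> * (1 + Q)) * d + \<epsilon> * (2 / Suc m + 2 / Suc n)"
      by (simp add: algebra_simps)
    moreover have "(\<epsilon> * (1 + Q)) * d + \<epsilon> * (2 / Suc m + 2 / Suc n) \<le> 1 / 2 * d + 1 / 2 * (2 / Suc m + 2 / Suc n)"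
      unfolding \<epsilon>(2) using \<epsilon>(3) by (intro add_left_mono mult_right_mono) auto
    \<comment> \<open>The absorption, isolated over plain variables: \<open>d\<close> occurs on the
      right with factor 1/2.\<close>
    moreover have "d \<le> p + 4 * a + (p' + 4 * a')"
      if "d \<le> E + 2 * a + 2 * a'" "E \<le> F" "F = G" "G \<le> 1 / 2 * d + 1 / 2 * (p + p')" for p p' a a' E F G
      using that by argo
    ultimately show d: "ip M (\<lambda>x. Y m x - Y n x) (\<lambda>x. Y m x - Y n x) \<le> (2 / Suc m + 4 * c m) + (2 / Suc n + 4 * c n)"
      unfolding d_def[symmetric] by blast
    have "Q * d \<le> Q * ((2 / Suc m + 4 * c m) + (2 / Suc n + 4 * c n))"
      unfolding d_def using d Q0 by (intro mult_left_mono)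
    then show "ip M (\<lambda>x. Z m x - Z n x) (\<lambda>x. Z m x - Z n x) \<le>
      (Q * (2 / Suc m + 4 * c m) + 2 / Suc m) + (Q * (2 / Suc n + 4 * c n) + 2 / Suc n)"
      unfolding e_def[symmetric] using e by (simp add: algebra_simps)
  qed
  have bY: "(\<lambda>n. 2 / Suc n + 4 * c n) \<longlonglongrightarrow> 0"
    using tendsto_add[OF tendsto_mult_left[OF LIMSEQ_Suc[OF lim_1_over_n], of "2::real"] tendsto_mult_left[OF c, of 4]]
    by simp
  have bZ: "(\<lambda>n. Q * (2 / Suc n + 4 * c n) + 2 / Suc n) \<longlonglongrightarrow> 0"
    using tendsto_add[OF tendsto_mult_left[OF bY, of Q] tendsto_mult_left[OF LIMSEQ_Suc[OF lim_1_over_n], of "2::real"]]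
    by simp
  obtain v where v: "v \<in> L2 M" "L2lim M Y v" using L2_complete_bound[OF YZ(3) bY dY] by blast
  obtain s where s: "s \<in> L2 M" "L2lim M Z s" using L2_complete_bound[OF YZ(4) bZ dZ] by blast
  have vs: "graph_clos v s" using graph_clos_closed[OF _ v(2) s(2) v(1) s(1)] YZ(1) by (auto simp: adm_def)
  have vu: "ip M v (u j) = 0" if "j \<in> J" for j
    using L2lim_ip[OF v(2) YZ(3) v(1) uL[OF that]] YZ(1) that by (simp add: adm_def LIMSEQ_const_iff)
  have vadm: "adm v s" using vs vu by (simp add: adm_def)
  have v1: "ip M v v = 1"
    using L2lim_ip2[OF v(2) YZ(3) v(1) v(2) YZ(3) v(1)] by (simp add: YZ LIMSEQ_const_iff)
  have "(\<lambda>n. Q + 1 / Suc n) \<longlonglongrightarrow> Q"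
    using tendsto_add[OF tendsto_const LIMSEQ_Suc[OF lim_1_over_n], of Q] by simp
  then have "ip M s s \<le> Q"
    using L2lim_ip2[OF s(2) YZ(4) s(1) s(2) YZ(4) s(1)] Zlt by (intro LIMSEQ_le) auto
  then have sQ: "ip M s s = Q" using Qle[OF vadm] v1 by simp
  \<comment> \<open>The Euler-Lagrange equation along \<open>v + t a\<close>: since \<open>v\<close>
    attains \<open>Q\<close>, the difference of the two sides is a nonnegative polynomial in
    \<open>t\<close> without constant term.\<close>
  have EL: "ip M s b = Q * ip M v a" if "adm a b" for a b
  proof -
    have ab: "a \<in> L2 M" "b \<in> L2 M" using that graph_clos_L2 by (auto simp: adm_def)
    have "0 \<le> 2 * t * (ip M s b - Q * ip M v a) + t\<^sup>2 * (ip M b b - Q * ip M a a)" for t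
      using Qle[OF adm_lin[OF vadm that, of 1 t]]
      unfolding ip_lin_lin[OF v(1) ab(1)] ip_lin_lin[OF s(1) ab(2)] v1 sQ
      by (simp add: algebra_simps)
    from linear_le_quadratic_imp_zero[OF this] show ?thesis by simp
  qed
  have "v \<in> eigensp Q"
  proof (rule eigenspI[OF vs])
    fix \<phi> assume \<phi>: "\<phi> \<in> T"
    have \<phi>L: "\<phi> \<in> L2 M" "L \<phi> \<in> L2 M" using \<phi> T_L2 L_T by auto
    have wL: "w j \<in> L2 M" if "j \<in> J" for j using uw(1)[OF that] by (rule graph_clos_L2)
    \<comment> \<open>An arbitrary test function is made admissible by subtracting its components
      along the \<open>u j\<close>. They contribute nothing to the equation, because
      \<open>v\<close> is orthogonal to \<open>u j\<close> and, by the weak equation for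
      \<open>u j\<close>, \<open>s\<close> is orthogonal to \<open>w j\<close>.\<close>
    define a where "a = (\<lambda>x. \<phi> x - (\<Sum>j\<in>J. ip M \<phi> (u j) * u j x))"
    define b where "b = (\<lambda>x. L \<phi> x - (\<Sum>j\<in>J. ip M \<phi> (u j) * w j x))"
    have "graph_clos a b" unfolding a_def b_def using J graph_clos_T[OF \<phi>] uw(1) by (rule graph_clos_diff_sum)
    moreover have "ip M a (u i) = 0" if "i \<in> J" for i
    proof -
      have "ip M a (u i) = ip M \<phi> (u i) - (\<Sum>j\<in>J. ip M \<phi> (u j) * ip M (u j) (u i))"
        unfolding a_def using \<phi>L uL that
        by (subst ip_diff_left) (auto intro!: L2_sum L2_cmult simp: ip_sum_left L2_cmult ip_cmult_left)
      also have "(\<Sum>j\<in>J. ip M \<phi> (u j) * ip M (u j) (u i)) = (\<Sum>j\<in>J. if j = i then ip M \<phi> (u j) else 0)"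
        using on that by (intro sum.cong) auto
      finally show ?thesis using J that by simp
    qed
    ultimately have "ip M s b = Q * ip M v a" by (intro EL) (auto simp: adm_def)
    moreover have "ip M v a = ip M v \<phi>"
      unfolding a_def using \<phi>L uL v(1) vu by (subst ip_diff_sum_right) auto
    moreover have "ip M s (w j) = 0" if "j \<in> J" for j
      using eigensp_ip[OF uw(2)[OF that] uw(1)[OF that] vs] vu[OF that] by (simp add: ip_commute[of M "w j"] ip_commute[of M "u j"])
    then have "ip M s b = ip M s (L \<phi>)"
      unfolding b_def using \<phi>L wL s(1) by (subst ip_diff_sum_right) auto
    ultimately show "ip M s (L \<phi>) = Q * ip M v \<phi>" by simp
  qed
  then have "ip M v v = 0" using Q\<Lambda> vu by (intro gap) auto
  then show False using v1 by simp
qed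

text \<open>The Rayleigh bound for \<phi> minus its projection. On the side of \<open>L\<close> the
  projection removes exactly \<open>ev j\<close> times the squared coefficients, because
  \<open>ip M (w j) (L \<phi>)\<close> is \<open>ev j\<close> times the coefficient and the
  \<open>w j\<close> are orthogonal with squared norms \<open>ev j\<close>.\<close>

lemma rayleigh_bound_projected:
  fixes u w :: "nat \<Rightarrow> 'a \<Rightarrow> real" and ev :: "nat \<Rightarrow> real"
  assumes J: "finite J" and uw: "\<And>j. j \<in> J \<Longrightarrow> graph_clos (u j) (w j)" "\<And>j. j \<in> J \<Longrightarrow> u j \<in> eigensp (ev j)"
    and on: "\<And>i j. i \<in> J \<Longrightarrow> j \<in> J \<Longrightarrow> ip M (u i) (u j) = (if i = j then 1 else 0)"
    and gap: "\<And>Q y. Q < \<Lambda> \<Longrightarrow> y \<in> eigensp Q \<Longrightarrow> (\<And>j. j \<in> J \<Longrightarrow> ip M y (u j) = 0) \<Longrightarrow> ip M y y = 0"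
    and \<phi>: "\<phi> \<in> T"
  shows "\<Lambda> * (ip M \<phi> \<phi> - (\<Sum>j\<in>J. (ip M \<phi> (u j))\<^sup>2)) \<le> ip M (L \<phi>) (L \<phi>) - (\<Sum>j\<in>J. ev j * (ip M \<phi> (u j))\<^sup>2)"
proof -
  have uL: "u j \<in> L2 M" "w j \<in> L2 M" if "j \<in> J" for j using uw(1)[OF that] by (auto simp: graph_clos_def)
  have \<phi>L: "\<phi> \<in> L2 M" "L \<phi> \<in> L2 M" using \<phi> T_L2 L_T by auto
  define b where "b j = ip M \<phi> (u j)" for j
  have wL: "ip M (w j) (L \<phi>) = ev j * b j" if "j \<in> J" for j
    using eigensp_ip[OF uw(2,1)[OF that] graph_clos_T[OF \<phi>]] by (simp add: b_def ip_commute[of M "u j"])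
  have ww: "ip M (w i) (w j) = (if i = j then ev i else 0)" if "i \<in> J" "j \<in> J" for i j
    using eigensp_ip[OF uw(2,1)[OF that(1)] uw(1)[OF that(2)]] on[OF that] by simp
  define y z where "y = (\<lambda>x. \<phi> x - (\<Sum>j\<in>J. b j * u j x))" and "z = (\<lambda>x. L \<phi> x - (\<Sum>j\<in>J. b j * w j x))"
  have yz: "graph_clos y z" unfolding y_def z_def using J graph_clos_T[OF \<phi>] uw(1) by (rule graph_clos_diff_sum)
  have yu: "ip M y (u i) = 0" if "i \<in> J" for i
  proof -
    have "ip M y (u i) = ip M \<phi> (u i) - (\<Sum>j\<in>J. b j * ip M (u j) (u i))"
      unfolding y_def using \<phi>L uL that
      by (subst ip_diff_left) (auto intro!: L2_sum L2_cmult simp: ip_sum_left L2_cmult ip_cmult_left)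
    also have "(\<Sum>j\<in>J. b j * ip M (u j) (u i)) = (\<Sum>j\<in>J. if j = i then b j else 0)"
      using on that by (intro sum.cong) auto
    finally show ?thesis using J that by (simp add: b_def)
  qed
  have "\<Lambda> * ip M y y \<le> ip M z z"
    by (rule rayleigh_bound[where J = J and u = u and w = w and ev = ev]) (fact J uw on gap yz yu)+
  moreover have "ip M y y = ip M \<phi> \<phi> - (\<Sum>j\<in>J. (b j)\<^sup>2)"
    unfolding y_def b_def using ip_proj_orthonormal[OF J \<phi>L(1) \<phi>L(1), of u] uL on by (simp add: power2_eq_square)
  moreover have "ip M z z = ip M (L \<phi>) (L \<phi>) - (\<Sum>j\<in>J. ev j * (b j)\<^sup>2)"
  proof -
    have "(\<Sum>i\<in>J. \<Sum>j\<in>J. b i * b j * ip M (w i) (w j)) = (\<Sum>i\<in>J. \<Sum>j\<in>J. if i = j then ev i * (b i)\<^sup>2 else 0)"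
      using ww by (intro sum.cong refl) (auto simp: power2_eq_square)
    also have "\<dots> = (\<Sum>i\<in>J. ev i * (b i)\<^sup>2)" using J by simp
    finally show ?thesis
      unfolding z_def using J \<phi>L uL wL
      by (subst ip_proj) (auto simp: ip_commute[of M "L \<phi>" "w _"] power2_eq_square algebra_simps sum.distrib[symmetric]
          intro!: sum.cong)
  qed
  ultimately show ?thesis by (simp add: b_def)
qed

end

section \<open>The commutator inequality\<close>

text \<open>Only the symmetric part of \<open>F\<close> contributes to the double sum.\<close>

lemma sum_antisymmetrize:
  fixes F :: "'i \<Rightarrow> 'i \<Rightarrow> real"
  assumes "\<And>i j. i \<in> J \<Longrightarrow> j \<in> J \<Longrightarrow> F i j + F j i \<le> 0"
  shows "(\<Sum>i\<in>J. \<Sum>j\<in>J. F i j) \<le> 0"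
proof -
  have "2 * (\<Sum>i\<in>J. \<Sum>j\<in>J. F i j) = (\<Sum>i\<in>J. \<Sum>j\<in>J. F i j) + (\<Sum>j\<in>J. \<Sum>i\<in>J. F i j)"
    by (subst (2) sum.swap) simp
  also have "\<dots> = (\<Sum>i\<in>J. \<Sum>j\<in>J. F i j + F j i)" by (simp add: sum.distrib)
  also have "\<dots> \<le> 0" using assms by (intro sum_nonpos) auto
  finally show ?thesis by simp
qed

lemma Im_class_pos:
  assumes "(f, g) \<in> Im_class \<Lambda>" "0 < x" "x < \<Lambda>"
  shows "0 < f x" "0 < g x" "0 < (f x)\<^sup>2 / (g x * (\<Lambda> - x))"
proof -
  have "\<forall>x\<in>{0<..<\<Lambda>}. 0 < f x \<and> 0 < g x" using assms(1) by (simp add: Im_class_def)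
  then show "0 < f x" "0 < g x" using assms(2,3) by auto
  then show "0 < (f x)\<^sup>2 / (g x * (\<Lambda> - x))" using assms(3) by simp
qed

text \<open>The defining condition of \<open>Im_class\<close> is the discriminant condition for this quadratic form.\<close>

lemma Im_class_quadratic_form:
  fixes f g :: "real \<Rightarrow> real"
  assumes fg: "(f, g) \<in> Im_class \<Lambda>" and x: "0 < x" "x < \<Lambda>" and y: "0 < y" "y < \<Lambda>" and \<beta>: "\<beta> > 0"
  shows "\<beta> * ((g x - g y) * (x - y)) * a\<^sup>2
    - 1 / \<beta> * ((f x)\<^sup>2 / (g x * (\<Lambda> - x)) + (f y)\<^sup>2 / (g y * (\<Lambda> - y))) * t\<^sup>2 - 2 * (f x - f y) * (a * t) \<le> 0"
proof -
  define h where "h = (f x)\<^sup>2 / (g x * (\<Lambda> - x)) + (f y)\<^sup>2 / (g y * (\<Lambda> - y))"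
  define B where "B = f x - f y"
  define G where "G = (g x - g y) * (x - y)"
  have h: "h > 0"
    using Im_class_pos(3)[OF fg x] Im_class_pos(3)[OF fg y] by (simp add: h_def)
  \<comment> \<open>For equal arguments, as with a multiple eigenvalue, the class imposes nothing,
    but then \<open>B\<close> and \<open>G\<close> both vanish. Elsewhere the condition is
    multiplied by \<open>(x - y)\<^sup>2\<close>.\<close>
  have disc: "B\<^sup>2 + h * G \<le> 0"
  proof (cases "x = y")
    case True
    then show ?thesis by (simp add: B_def G_def)
  next
    case False
    then have "((f x - f y) / (x - y))\<^sup>2 + h * ((g x - g y) / (x - y)) \<le> 0"
      using fg x y unfolding Im_class_def h_def by auto
    then have "(((f x - f y) / (x - y))\<^sup>2 + h * ((g x - g y) / (x - y))) * (x - y)\<^sup>2 \<le> 0"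
      by (simp add: mult_nonpos_nonneg)
    also have "(((f x - f y) / (x - y))\<^sup>2 + h * ((g x - g y) / (x - y))) * (x - y)\<^sup>2 = B\<^sup>2 + h * G"
    proof -
      define d where "d = x - y"
      have "d \<noteq> 0" using False by (simp add: d_def)
      then show ?thesis
        unfolding B_def G_def d_def[symmetric] by (simp add: distrib_right power_divide power2_eq_square)
    qed
    finally show ?thesis .
  qed
  \<comment> \<open>The factor h / \<beta> completes the square; what is left is the discriminant
    times \<open>a\<^sup>2\<close>.\<close>
  have "(h / \<beta>) * (\<beta> * G * a\<^sup>2 - 1 / \<beta> * h * t\<^sup>2 - 2 * B * (a * t)) = (B\<^sup>2 + h * G) * a\<^sup>2 - (B * a + h / \<beta> * t)\<^sup>2"
    using \<beta> by (simp add: power2_eq_square field_simps)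
  also have "\<dots> \<le> 0" using disc mult_nonpos_nonneg[OF disc, of "a\<^sup>2"] by (smt (verit) zero_le_power2)
  finally have "\<beta> * G * a\<^sup>2 - 1 / \<beta> * h * t\<^sup>2 - 2 * B * (a * t) \<le> 0"
    using h \<beta> divide_pos_pos[OF h \<beta>] by (simp only: mult_le_0_iff) linarith
  then show ?thesis by (simp add: h_def G_def B_def)
qed

text \<open>The minimum over \<beta> is at \<beta> = sqrt (H / W), where both terms equal sqrt (W
  H).\<close>

lemma two_mult_sqrt_bound:
  fixes F W H :: real
  assumes "W > 0" "H > 0" "\<And>\<beta>. \<beta> > 0 \<Longrightarrow> 2 * F \<le> \<beta> * W + 1 / \<beta> * H"
  shows "F \<le> sqrt W * sqrt H"
proof -
  have "2 * F \<le> (sqrt H / sqrt W) * W + 1 / (sqrt H / sqrt W) * H"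
    using assms by (intro assms(3)) simp
  also have "(sqrt H / sqrt W) * W = sqrt W * sqrt H"
    using assms by (simp add: field_simps flip: real_sqrt_mult) (simp add: real_sqrt_mult)
  also have "1 / (sqrt H / sqrt W) * H = sqrt W * sqrt H"
    using assms by (simp add: field_simps flip: real_sqrt_mult) (simp add: real_sqrt_mult)
  finally show ?thesis by (simp add: mult.commute)
qed

text \<open>All that is kept of the eigenmap and the geometry. The gradient has been eliminated: by
  Green's formula \<open>- 4 * lam * ip M \<phi> (L \<phi>)\<close> is 4 lam times the squared norm
  of the gradient of \<phi>.\<close>

locale clamped_eigenmap = clamped +
  fixes X :: "'p::finite \<Rightarrow> 'a \<Rightarrow> real" and lam :: real
  assumes X_meas: "X p \<in> borel_measurable M"
    and X_sphere: "(\<Sum>p\<in>UNIV. (X p x)\<^sup>2) = 1"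
    and X_T: "\<phi> \<in> T \<Longrightarrow> (\<lambda>x. X p x * \<phi> x) \<in> T"
    and X_commutator: "\<phi> \<in> T \<Longrightarrow>
      (\<Sum>p\<in>UNIV. X p x * (L (\<lambda>x. X p x * \<phi> x) x - X p x * L \<phi> x)) = - lam * \<phi> x"
    and commutator_bound: "\<phi> \<in> T \<Longrightarrow>
      (\<Sum>p\<in>UNIV. ip M (\<lambda>x. L (\<lambda>x. X p x * \<phi> x) x - X p x * L \<phi> x) (\<lambda>x. L (\<lambda>x. X p x * \<phi> x) x - X p x * L \<phi> x))
        \<le> lam\<^sup>2 * ip M \<phi> \<phi> - 4 * lam * ip M \<phi> (L \<phi>)"
    and lam_pos: "lam > 0"
begin

definition com :: "'p \<Rightarrow> ('a \<Rightarrow> real) \<Rightarrow> 'a \<Rightarrow> real" where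
  "com p \<phi> x = L (\<lambda>x. X p x * \<phi> x) x - X p x * L \<phi> x"

lemma X_bound: "\<bar>X p x\<bar> \<le> 1"
proof -
  have "(X p x)\<^sup>2 \<le> (\<Sum>p\<in>UNIV. (X p x)\<^sup>2)" by (rule member_le_sum) auto
  then show ?thesis by (simp add: X_sphere abs_square_le_1)
qed

lemma X_L2: "u \<in> L2 M \<Longrightarrow> (\<lambda>x. X p x * u x) \<in> L2 M"
  by (rule L2_mult_bounded[OF _ X_meas X_bound])

lemma com_T: "\<phi> \<in> T \<Longrightarrow> com p \<phi> \<in> T"
  using T_lin[of "L (\<lambda>x. X p x * \<phi> x)" "\<lambda>x. X p x * L \<phi> x" 1 "-1"]
  by (simp add: com_def[abs_def] L_T X_T)

text \<open>Moves \<open>X p\<close> to the other factor, so that the sum over \<open>p\<close> is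
  taken pointwise, where the sphere and commutator identities apply.\<close>

lemma sum_ip_X:
  assumes "\<And>p. \<alpha> p \<in> L2 M" "\<gamma> \<in> L2 M"
  shows "(\<Sum>p\<in>UNIV. ip M (\<alpha> p) (\<lambda>x. X p x * \<gamma> x)) = ip M (\<lambda>x. \<Sum>p\<in>UNIV. X p x * \<alpha> p x) \<gamma>"
proof -
  have "ip M (\<lambda>x. \<Sum>p\<in>UNIV. X p x * \<alpha> p x) \<gamma> = (\<Sum>p\<in>UNIV. ip M (\<lambda>x. X p x * \<alpha> p x) \<gamma>)"
    using assms X_L2 by (intro ip_sum_left) auto
  also have "\<dots> = (\<Sum>p\<in>UNIV. ip M (\<alpha> p) (\<lambda>x. X p x * \<gamma> x))"
    by (simp add: ip_def mult_ac)
  finally show ?thesis by simp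
qed

lemma sum_ip_X_X:
  assumes "\<gamma> \<in> L2 M"
  shows "(\<Sum>p\<in>UNIV. ip M (\<lambda>x. X p x * \<gamma> x) (\<lambda>x. X p x * \<gamma> x)) = ip M \<gamma> \<gamma>"
proof -
  have "(\<Sum>p\<in>UNIV. X p x * (X p x * \<gamma> x)) = \<gamma> x" for x
  proof -
    have "(\<Sum>p\<in>UNIV. X p x * (X p x * \<gamma> x)) = (\<Sum>p\<in>UNIV. (X p x)\<^sup>2) * \<gamma> x"
      unfolding sum_distrib_right by (simp add: power2_eq_square mult.assoc)
    then show ?thesis by (simp add: X_sphere)
  qed
  then show ?thesis using sum_ip_X[of "\<lambda>p x. X p x * \<gamma> x" \<gamma>] assms X_L2 by simp
qed

lemma sum_ip_com_X:
  assumes "\<phi> \<in> T" "\<gamma> \<in> L2 M"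
  shows "(\<Sum>p\<in>UNIV. ip M (com p \<phi>) (\<lambda>x. X p x * \<gamma> x)) = - lam * ip M \<phi> \<gamma>"
  using sum_ip_X[of "\<lambda>p. com p \<phi>" \<gamma>] com_T[OF assms(1)] T_L2 assms
  by (simp add: com_def X_commutator ip_cmult_left[of M "- lam", simplified])

lemma sum_ip_com_com:
  "\<phi> \<in> T \<Longrightarrow> (\<Sum>p\<in>UNIV. ip M (com p \<phi>) (com p \<phi>)) \<le> lam\<^sup>2 * ip M \<phi> \<phi> - 4 * lam * ip M \<phi> (L \<phi>)"
  using commutator_bound by (simp add: com_def[abs_def])

text \<open>\<open>L\<close> of the product with \<open>X p\<close> is the commutator plus
  \<open>X p\<close> times \<open>L \<phi>\<close>. The cross terms sum to
  \<open>- 2 * lam * ip M \<phi> (L \<phi>)\<close>, which together with the 4 of the commutator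
  bound gives the 6.\<close>

lemma sum_ip_L_X:
  assumes \<phi>: "\<phi> \<in> T"
  shows "(\<Sum>p\<in>UNIV. ip M (L (\<lambda>x. X p x * \<phi> x)) (L (\<lambda>x. X p x * \<phi> x)))
    \<le> ip M (L \<phi>) (L \<phi>) + lam\<^sup>2 * ip M \<phi> \<phi> - 6 * lam * ip M \<phi> (L \<phi>)"
proof -
  have L2: "com p \<phi> \<in> L2 M" "L \<phi> \<in> L2 M" "(\<lambda>x. X p x * L \<phi> x) \<in> L2 M" for p
    using T_L2 com_T L_T X_L2 \<phi> by auto
  have "ip M (L (\<lambda>x. X p x * \<phi> x)) (L (\<lambda>x. X p x * \<phi> x))
    = ip M (com p \<phi>) (com p \<phi>) + 2 * ip M (com p \<phi>) (\<lambda>x. X p x * L \<phi> x)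
      + ip M (\<lambda>x. X p x * L \<phi> x) (\<lambda>x. X p x * L \<phi> x)" for p
  proof -
    have "L (\<lambda>x. X p x * \<phi> x) = (\<lambda>x. 1 * com p \<phi> x + 1 * (X p x * L \<phi> x))"
      by (simp add: com_def)
    then show ?thesis using ip_lin_lin[OF L2(1,3), of 1 p 1 p] by simp
  qed
  then show ?thesis
    using sum_ip_com_X[OF \<phi> L2(2)] sum_ip_X_X[OF L2(2)] sum_ip_com_com[OF \<phi>]
    by (simp add: sum.distrib flip: sum_distrib_left)
qed

text \<open>Here \<open>y\<close> and \<open>z\<close> are the parts of \<open>X p\<close> times
  \<open>v\<close> and of \<open>com p v\<close> orthogonal to the \<open>u j\<close>. Nonnegativity
  of the norm of a combination bounds their inner product, \<open>y\<close> is controlled by the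
  Rayleigh bound, and summation over \<open>p\<close> turns the products of \<open>com p v\<close>
  with \<open>X p\<close> times \<open>v\<close> into \<open>- lam * ip M v v\<close>. The number
  \<mu> becomes \<open>ev i\<close> when \<open>v\<close> tends to \<open>u i\<close>.\<close>

lemma commutator_test_inequality:
  fixes u :: "nat \<Rightarrow> 'a \<Rightarrow> real" and ev :: "nat \<Rightarrow> real"
  assumes J: "finite J" and u: "\<And>j. j \<in> J \<Longrightarrow> u j \<in> L2 M"
    and on: "\<And>i j. i \<in> J \<Longrightarrow> j \<in> J \<Longrightarrow> ip M (u i) (u j) = (if i = j then 1 else 0)"
    and ray: "\<And>\<phi>. \<phi> \<in> T \<Longrightarrow> \<Lambda> * (ip M \<phi> \<phi> - (\<Sum>j\<in>J. (ip M \<phi> (u j))\<^sup>2)) \<le> ip M (L \<phi>) (L \<phi>) - (\<Sum>j\<in>J. ev j * (ip M \<phi> (u j))\<^sup>2)"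
    and pos: "F > 0" "G > 0" "\<beta> > 0" "\<mu> < \<Lambda>" and v: "v \<in> T"
  defines "a \<equiv> \<lambda>p j. ip M (\<lambda>x. X p x * v x) (u j)" and "t \<equiv> \<lambda>p j. ip M (com p v) (u j)"
  shows "F * (2 * lam * ip M v v + 2 * (\<Sum>p\<in>UNIV. \<Sum>j\<in>J. a p j * t p j))
    \<le> \<beta> * G * (ip M (L v) (L v) + lam\<^sup>2 * ip M v v - 6 * lam * ip M v (L v) - \<mu> * ip M v v
          + (\<Sum>p\<in>UNIV. \<Sum>j\<in>J. (\<mu> - ev j) * (a p j)\<^sup>2))
      + 1 / \<beta> * (F\<^sup>2 / (G * (\<Lambda> - \<mu>))) * (lam\<^sup>2 * ip M v v - 4 * lam * ip M v (L v) - (\<Sum>p\<in>UNIV. \<Sum>j\<in>J. (t p j)\<^sup>2))"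
proof -
  have L2: "com p v \<in> L2 M" "v \<in> L2 M" "(\<lambda>x. X p x * v x) \<in> L2 M" for p
    using T_L2 com_T X_T v by auto
  define h where "h = F\<^sup>2 / (G * (\<Lambda> - \<mu>))"
  define A where "A p = ip M (\<lambda>x. X p x * v x) (\<lambda>x. X p x * v x) - (\<Sum>j\<in>J. (a p j)\<^sup>2)" for p
  define B where "B p = ip M (com p v) (com p v) - (\<Sum>j\<in>J. (t p j)\<^sup>2)" for p
  define C where "C p = ip M (com p v) (\<lambda>x. X p x * v x) - (\<Sum>j\<in>J. a p j * t p j)" for p
  define D where "D p = ip M (L (\<lambda>x. X p x * v x)) (L (\<lambda>x. X p x * v x)) - (\<Sum>j\<in>J. ev j * (a p j)\<^sup>2) - \<mu> * A p" for p
  have key: "- 2 * F * C p \<le> \<beta> * G * D p + 1 / \<beta> * h * B p" for p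
  proof -
    define y z where "y = (\<lambda>x. X p x * v x - (\<Sum>j\<in>J. a p j * u j x))"
      and "z = (\<lambda>x. com p v x - (\<Sum>j\<in>J. t p j * u j x))"
    have yz: "y \<in> L2 M" "z \<in> L2 M"
      unfolding y_def z_def using L2 u by (auto intro!: L2_diff L2_sum L2_cmult)
    have yy: "ip M y y = A p" "ip M z z = B p" "ip M z y = C p"
      unfolding y_def z_def a_def t_def A_def B_def C_def
      using J L2 u on by (subst ip_proj_orthonormal; auto simp: power2_eq_square mult.commute)+
    \<comment> \<open>This weight makes \<open>F\<^sup>2 / s\<close> equal to h / \<beta> and leaves
      \<beta> G times (\<Lambda> - \<mu>) \<open>A p\<close>, in which \<open>ray\<close> bounds
      (\<Lambda> - \<mu>) \<open>A p\<close> by \<open>D p\<close>.\<close>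
    define s where "s = \<beta> * G * (\<Lambda> - \<mu>)"
    have s: "s > 0" using pos by (simp add: s_def)
    have "0 \<le> s\<^sup>2 * A p + 2 * s * F * C p + F\<^sup>2 * B p"
      using ip_self_nonneg[of M "\<lambda>x. s * y x + F * z x"] ip_lin_lin[OF yz, of s F] yy
      by (simp add: ip_commute[of M y z])
    then have "0 \<le> (s\<^sup>2 * A p + 2 * s * F * C p + F\<^sup>2 * B p) / s" using s by simp
    then have "- 2 * F * C p \<le> s * A p + F\<^sup>2 / s * B p"
      using s by (simp add: field_simps power2_eq_square)
    also have "F\<^sup>2 / s = 1 / \<beta> * h" using pos by (simp add: s_def h_def)
    also have "s * A p = \<beta> * G * ((\<Lambda> - \<mu>) * A p)" by (simp add: s_def)
    also have "\<dots> \<le> \<beta> * G * D p"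
      using ray[OF X_T[OF v], of p] pos unfolding D_def A_def a_def
      by (intro mult_left_mono) (auto simp: algebra_simps)
    finally show ?thesis by simp
  qed
  have "(\<Sum>p\<in>UNIV. - 2 * F * C p) \<le> (\<Sum>p\<in>UNIV. \<beta> * G * D p + 1 / \<beta> * h * B p)"
    by (intro sum_mono key)
  then have "- 2 * F * (\<Sum>p\<in>UNIV. C p) \<le> \<beta> * G * (\<Sum>p\<in>UNIV. D p) + 1 / \<beta> * h * (\<Sum>p\<in>UNIV. B p)"
    by (simp only: sum.distrib sum_distrib_left)
  moreover have "(\<Sum>p\<in>UNIV. C p) = - lam * ip M v v - (\<Sum>p\<in>UNIV. \<Sum>j\<in>J. a p j * t p j)"
    unfolding C_def sum_subtractf using sum_ip_com_X[OF v L2(2)] by simp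
  moreover have "\<beta> * G * (\<Sum>p\<in>UNIV. D p) \<le> \<beta> * G * (ip M (L v) (L v) + lam\<^sup>2 * ip M v v - 6 * lam * ip M v (L v) - \<mu> * ip M v v
          + (\<Sum>p\<in>UNIV. \<Sum>j\<in>J. (\<mu> - ev j) * (a p j)\<^sup>2))"
  proof (rule mult_left_mono)
    have "D p = ip M (L (\<lambda>x. X p x * v x)) (L (\<lambda>x. X p x * v x)) - \<mu> * ip M (\<lambda>x. X p x * v x) (\<lambda>x. X p x * v x)
        + (\<Sum>j\<in>J. (\<mu> - ev j) * (a p j)\<^sup>2)" for p
      unfolding D_def A_def by (simp add: algebra_simps sum_subtractf sum_distrib_left)
    then have "(\<Sum>p\<in>UNIV. D p) = (\<Sum>p\<in>UNIV. ip M (L (\<lambda>x. X p x * v x)) (L (\<lambda>x. X p x * v x)))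
        - \<mu> * ip M v v + (\<Sum>p\<in>UNIV. \<Sum>j\<in>J. (\<mu> - ev j) * (a p j)\<^sup>2)"
      using sum_ip_X_X[OF L2(2)] by (simp add: sum.distrib sum_subtractf flip: sum_distrib_left)
    then show "(\<Sum>p\<in>UNIV. D p) \<le> ip M (L v) (L v) + lam\<^sup>2 * ip M v v - 6 * lam * ip M v (L v) - \<mu> * ip M v v
          + (\<Sum>p\<in>UNIV. \<Sum>j\<in>J. (\<mu> - ev j) * (a p j)\<^sup>2)"
      using sum_ip_L_X[OF v] by simp
  qed (use pos in simp)
  moreover have "1 / \<beta> * h * (\<Sum>p\<in>UNIV. B p) \<le> 1 / \<beta> * h * (lam\<^sup>2 * ip M v v - 4 * lam * ip M v (L v) - (\<Sum>p\<in>UNIV. \<Sum>j\<in>J. (t p j)\<^sup>2))"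
    using sum_ip_com_com[OF v] pos unfolding B_def sum_subtractf
    by (intro mult_left_mono) (auto simp: h_def)
  ultimately show ?thesis unfolding h_def by (simp add: algebra_simps)
qed

lemma ip_X_swap: "ip M (\<lambda>x. X p x * f x) g = ip M (\<lambda>x. X p x * g x) f"
  by (simp add: ip_def mult_ac)

text \<open>\<open>lam\<close> is a factor of every term free of coefficients and is cancelled only
  after summation over \<open>i\<close>. The weight \<beta> is the same for all \<open>i\<close>,
  which allows the pairing of (i, j) with (j, i), and is optimised last.\<close>

lemma commutator_inequality:
  fixes u w :: "nat \<Rightarrow> 'a \<Rightarrow> real" and ev :: "nat \<Rightarrow> real" and f g :: "real \<Rightarrow> real"
  assumes J: "finite J" and uw: "\<And>j. j \<in> J \<Longrightarrow> graph_clos (u j) (w j)" "\<And>j. j \<in> J \<Longrightarrow> u j \<in> eigensp (ev j)"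
    and on: "\<And>i j. i \<in> J \<Longrightarrow> j \<in> J \<Longrightarrow> ip M (u i) (u j) = (if i = j then 1 else 0)"
    and gap: "\<And>Q y. Q < \<Lambda> \<Longrightarrow> y \<in> eigensp Q \<Longrightarrow> (\<And>j. j \<in> J \<Longrightarrow> ip M y (u j) = 0) \<Longrightarrow> ip M y y = 0"
    and ev: "\<And>j. j \<in> J \<Longrightarrow> 0 < ev j" "\<And>j. j \<in> J \<Longrightarrow> ev j < \<Lambda>"
    and fg: "(f, g) \<in> Im_class \<Lambda>"
  shows "(\<Sum>i\<in>J. f (ev i)) \<le> sqrt (\<Sum>i\<in>J. g (ev i) * (lam + 6 * sqrt (ev i)))
      * sqrt (\<Sum>i\<in>J. (f (ev i))\<^sup>2 / (g (ev i) * (\<Lambda> - ev i)) * (lam + 4 * sqrt (ev i)))"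
\<comment> \<open>The optimisation in \<beta> asks for positive \<open>W\<close> and
  \<open>H\<close>, hence for a nonempty \<open>J\<close>; for empty \<open>J\<close> both sides are
  0.\<close>
proof (cases "J = {}")
  case False
  define F G h where "F i = f (ev i)" and "G i = g (ev i)" and "h i = (f (ev i))\<^sup>2 / (g (ev i) * (\<Lambda> - ev i))" for i
  have pos: "F i > 0" "G i > 0" "h i > 0" if "i \<in> J" for i
    using Im_class_pos[OF fg ev[OF that]] by (simp_all add: F_def G_def h_def)
  have L2: "u j \<in> L2 M" "w j \<in> L2 M" if "j \<in> J" for j using uw(1)[OF that] by (auto simp: graph_clos_def)
  have ray: "\<Lambda> * (ip M \<phi> \<phi> - (\<Sum>j\<in>J. (ip M \<phi> (u j))\<^sup>2)) \<le> ip M (L \<phi>) (L \<phi>) - (\<Sum>j\<in>J. ev j * (ip M \<phi> (u j))\<^sup>2)"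
    if "\<phi> \<in> T" for \<phi>
    by (rule rayleigh_bound_projected[where w = w]) (fact J uw on gap that)+
  define a where "a p i j = ip M (\<lambda>x. X p x * u i x) (u j)" for p i j
  \<comment> \<open>The limit of \<open>ip M (com p (\<phi> n)) (u j)\<close> along an approximation
    of \<open>u i\<close>: symmetry replaces \<open>L\<close> by the weak Laplacian
    \<open>w j\<close>, so that only square integrable functions remain and antisymmetry in
    \<open>i\<close> and \<open>j\<close> becomes visible.\<close>
  define t where "t p i j = ip M (\<lambda>x. X p x * u i x) (w j) - ip M (\<lambda>x. X p x * w i x) (u j)" for p i j
  have a_sym: "a p j i = a p i j" for p i j unfolding a_def by (rule ip_X_swap)
  have t_anti: "t p j i = - t p i j" for p i j
    unfolding t_def using ip_X_swap[of p "u j" "w i"] ip_X_swap[of p "w j" "u i"] by simp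
  have single: "F i * (2 * lam + 2 * (\<Sum>p\<in>UNIV. \<Sum>j\<in>J. a p i j * t p i j))
    \<le> \<beta> * G i * (lam * (lam + 6 * sqrt (ev i)) + (\<Sum>p\<in>UNIV. \<Sum>j\<in>J. (ev i - ev j) * (a p i j)\<^sup>2))
      + 1 / \<beta> * h i * (lam * (lam + 4 * sqrt (ev i)) - (\<Sum>p\<in>UNIV. \<Sum>j\<in>J. (t p i j)\<^sup>2))"
    if i: "i \<in> J" and \<beta>: "\<beta> > 0" for i \<beta>
  proof -
    obtain \<phi> where \<phi>: "\<And>n. \<phi> n \<in> T" "\<And>n. \<phi> n \<in> L2 M" "\<And>n. L (\<phi> n) \<in> L2 M"
      "L2lim M \<phi> (u i)" "L2lim M (\<lambda>n. L (\<phi> n)) (w i)" using uw(1)[OF i] by (rule graph_closE) blast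
    have a_lim: "(\<lambda>n. ip M (\<lambda>x. X p x * \<phi> n x) (u j)) \<longlonglongrightarrow> a p i j" if "j \<in> J" for p j
      unfolding a_def using \<phi> L2 that i X_L2
      by (intro L2lim_ip L2lim_mult_bounded[OF _ _ _ X_meas X_bound]) auto
    have t_lim: "(\<lambda>n. ip M (com p (\<phi> n)) (u j)) \<longlonglongrightarrow> t p i j" if "j \<in> J" for p j
    proof -
      have "ip M (com p (\<phi> n)) (u j) = ip M (\<lambda>x. X p x * \<phi> n x) (w j) - ip M (\<lambda>x. X p x * L (\<phi> n) x) (u j)" for n
      proof -
        have "ip M (com p (\<phi> n)) (u j) = ip M (L (\<lambda>x. X p x * \<phi> n x)) (u j) - ip M (\<lambda>x. X p x * L (\<phi> n) x) (u j)"
          unfolding com_def[abs_def] using T_L2[OF L_T[OF X_T[OF \<phi>(1)]]] X_L2[OF \<phi>(3)] L2 that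
          by (intro ip_diff_left) auto
        moreover have "ip M (L (\<lambda>x. X p x * \<phi> n x)) (u j) = ip M (\<lambda>x. X p x * \<phi> n x) (w j)"
          using graph_clos_ip_sym[OF graph_clos_T[OF X_T[OF \<phi>(1)]] uw(1)[OF that]] by blast
        ultimately show ?thesis by simp
      qed
      moreover have "(\<lambda>n. ip M (\<lambda>x. X p x * \<phi> n x) (w j) - ip M (\<lambda>x. X p x * L (\<phi> n) x) (u j)) \<longlonglongrightarrow> t p i j"
        unfolding t_def using \<phi> L2 that i X_L2
        by (intro tendsto_diff L2lim_ip L2lim_mult_bounded[OF _ _ _ X_meas X_bound]) auto
      ultimately show ?thesis by simp
    qed
    have ww: "ip M (w i) (w i) = ev i"
      using eigensp_ip[OF uw(2)[OF i] uw(1)[OF i] uw(1)[OF i]] on[OF i i] by simp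
    define e where "e = ip M (u i) (w i)"
    \<comment> \<open>On the manifold \<open>- e\<close> is the Dirichlet energy of
      \<open>u i\<close>. As \<open>w i\<close> has norm \<open>sqrt (ev i)\<close>, this is where
      the square root of the eigenvalue enters.\<close>
    have e: "- e \<le> sqrt (ev i)"
      using ip_abs_le[OF L2[OF i]] on[OF i i] ww by (simp add: e_def)
    have lims: "(\<lambda>n. ip M (\<phi> n) (\<phi> n)) \<longlonglongrightarrow> 1" "(\<lambda>n. ip M (L (\<phi> n)) (L (\<phi> n))) \<longlonglongrightarrow> ev i"
      "(\<lambda>n. ip M (\<phi> n) (L (\<phi> n))) \<longlonglongrightarrow> e"
      using L2lim_ip2[OF \<phi>(4,2) L2(1)[OF i] \<phi>(4,2) L2(1)[OF i]]
        L2lim_ip2[OF \<phi>(5,3) L2(2)[OF i] \<phi>(5,3) L2(2)[OF i]]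
        L2lim_ip2[OF \<phi>(4,2) L2(1)[OF i] \<phi>(5,3) L2(2)[OF i]] on[OF i i] ww
      by (simp_all add: e_def)
    have "F i * (2 * lam * 1 + 2 * (\<Sum>p\<in>UNIV. \<Sum>j\<in>J. a p i j * t p i j))
      \<le> \<beta> * G i * (ev i + lam\<^sup>2 * 1 - 6 * lam * e - ev i * 1 + (\<Sum>p\<in>UNIV. \<Sum>j\<in>J. (ev i - ev j) * (a p i j)\<^sup>2))
        + 1 / \<beta> * h i * (lam\<^sup>2 * 1 - 4 * lam * e - (\<Sum>p\<in>UNIV. \<Sum>j\<in>J. (t p i j)\<^sup>2))"
    proof (rule LIMSEQ_le)
      show "(\<lambda>n. F i * (2 * lam * ip M (\<phi> n) (\<phi> n) + 2 * (\<Sum>p\<in>UNIV. \<Sum>j\<in>J. ip M (\<lambda>x. X p x * \<phi> n x) (u j) * ip M (com p (\<phi> n)) (u j))))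
        \<longlonglongrightarrow> F i * (2 * lam * 1 + 2 * (\<Sum>p\<in>UNIV. \<Sum>j\<in>J. a p i j * t p i j))"
        by (intro tendsto_intros lims a_lim t_lim)
      show "(\<lambda>n. \<beta> * G i * (ip M (L (\<phi> n)) (L (\<phi> n)) + lam\<^sup>2 * ip M (\<phi> n) (\<phi> n) - 6 * lam * ip M (\<phi> n) (L (\<phi> n)) - ev i * ip M (\<phi> n) (\<phi> n)
          + (\<Sum>p\<in>UNIV. \<Sum>j\<in>J. (ev i - ev j) * (ip M (\<lambda>x. X p x * \<phi> n x) (u j))\<^sup>2))
        + 1 / \<beta> * h i * (lam\<^sup>2 * ip M (\<phi> n) (\<phi> n) - 4 * lam * ip M (\<phi> n) (L (\<phi> n)) - (\<Sum>p\<in>UNIV. \<Sum>j\<in>J. (ip M (com p (\<phi> n)) (u j))\<^sup>2)))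
        \<longlonglongrightarrow> \<beta> * G i * (ev i + lam\<^sup>2 * 1 - 6 * lam * e - ev i * 1 + (\<Sum>p\<in>UNIV. \<Sum>j\<in>J. (ev i - ev j) * (a p i j)\<^sup>2))
        + 1 / \<beta> * h i * (lam\<^sup>2 * 1 - 4 * lam * e - (\<Sum>p\<in>UNIV. \<Sum>j\<in>J. (t p i j)\<^sup>2))"
        by (intro tendsto_intros lims a_lim t_lim)
      show "\<exists>N. \<forall>n\<ge>N. F i * (2 * lam * ip M (\<phi> n) (\<phi> n) + 2 * (\<Sum>p\<in>UNIV. \<Sum>j\<in>J. ip M (\<lambda>x. X p x * \<phi> n x) (u j) * ip M (com p (\<phi> n)) (u j)))
        \<le> \<beta> * G i * (ip M (L (\<phi> n)) (L (\<phi> n)) + lam\<^sup>2 * ip M (\<phi> n) (\<phi> n) - 6 * lam * ip M (\<phi> n) (L (\<phi> n)) - ev i * ip M (\<phi> n) (\<phi> n)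
          + (\<Sum>p\<in>UNIV. \<Sum>j\<in>J. (ev i - ev j) * (ip M (\<lambda>x. X p x * \<phi> n x) (u j))\<^sup>2))
        + 1 / \<beta> * h i * (lam\<^sup>2 * ip M (\<phi> n) (\<phi> n) - 4 * lam * ip M (\<phi> n) (L (\<phi> n)) - (\<Sum>p\<in>UNIV. \<Sum>j\<in>J. (ip M (com p (\<phi> n)) (u j))\<^sup>2))"
        using commutator_test_inequality[OF J L2(1) on ray pos(1,2)[OF i] \<beta> ev(2)[OF i] \<phi>(1)]
        unfolding h_def F_def G_def by blast
    qed
    also have "\<beta> * G i * (ev i + lam\<^sup>2 * 1 - 6 * lam * e - ev i * 1 + (\<Sum>p\<in>UNIV. \<Sum>j\<in>J. (ev i - ev j) * (a p i j)\<^sup>2))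
      \<le> \<beta> * G i * (lam * (lam + 6 * sqrt (ev i)) + (\<Sum>p\<in>UNIV. \<Sum>j\<in>J. (ev i - ev j) * (a p i j)\<^sup>2))"
      using mult_left_mono[OF e, of lam] lam_pos pos[OF i] \<beta>
      by (intro mult_left_mono) (auto simp: power2_eq_square algebra_simps)
    also have "1 / \<beta> * h i * (lam\<^sup>2 * 1 - 4 * lam * e - (\<Sum>p\<in>UNIV. \<Sum>j\<in>J. (t p i j)\<^sup>2))
      \<le> 1 / \<beta> * h i * (lam * (lam + 4 * sqrt (ev i)) - (\<Sum>p\<in>UNIV. \<Sum>j\<in>J. (t p i j)\<^sup>2))"
      using mult_left_mono[OF e, of lam] lam_pos pos[OF i] \<beta>
      by (intro mult_left_mono) (auto simp: power2_eq_square algebra_simps)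
    finally show ?thesis by simp
  qed
  define W H where "W = (\<Sum>i\<in>J. G i * (lam + 6 * sqrt (ev i)))" and "H = (\<Sum>i\<in>J. h i * (lam + 4 * sqrt (ev i)))"
  have main: "2 * (\<Sum>i\<in>J. F i) \<le> \<beta> * W + 1 / \<beta> * H" if \<beta>: "\<beta> > 0" for \<beta>
  proof -
    \<comment> \<open>Everything that depends on the unknown coefficients. Exchanging
      \<open>i\<close> and \<open>j\<close> keeps \<open>a\<close> and reverses \<open>t\<close>, so
      \<open>E p i j + E p j i\<close> is the form treated in
      \<open>Im_class_quadratic_form\<close>.\<close>
    define E where "E p i j = \<beta> * G i * ((ev i - ev j) * (a p i j)\<^sup>2) - 1 / \<beta> * h i * (t p i j)\<^sup>2
      - 2 * F i * (a p i j * t p i j)" for p i j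
    have "E p i j + E p j i \<le> 0" if "i \<in> J" "j \<in> J" for p i j
    proof -
      have "E p i j + E p j i = \<beta> * ((G i - G j) * (ev i - ev j)) * (a p i j)\<^sup>2
        - 1 / \<beta> * (h i + h j) * (t p i j)\<^sup>2 - 2 * (F i - F j) * (a p i j * t p i j)"
        unfolding E_def a_sym[of p j i] t_anti[of p j i] by (simp add: algebra_simps)
      then show ?thesis
        using Im_class_quadratic_form[OF fg ev[OF that(1)] ev[OF that(2)] \<beta>]
        by (simp add: F_def G_def h_def)
    qed
    then have E: "(\<Sum>i\<in>J. \<Sum>j\<in>J. E p i j) \<le> 0" for p by (rule sum_antisymmetrize)
    have "lam * (2 * (\<Sum>i\<in>J. F i)) = (\<Sum>i\<in>J. F i * (2 * lam))"
      unfolding sum_distrib_left by (simp add: mult_ac)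
    also have "\<dots> \<le> (\<Sum>i\<in>J. \<beta> * G i * (lam * (lam + 6 * sqrt (ev i))) + 1 / \<beta> * h i * (lam * (lam + 4 * sqrt (ev i)))
        + (\<Sum>p\<in>UNIV. \<Sum>j\<in>J. E p i j))"
    proof (rule sum_mono)
      fix i assume "i \<in> J"
      have "(\<Sum>p\<in>UNIV. \<Sum>j\<in>J. E p i j) = \<beta> * G i * (\<Sum>p\<in>UNIV. \<Sum>j\<in>J. (ev i - ev j) * (a p i j)\<^sup>2)
        - 1 / \<beta> * h i * (\<Sum>p\<in>UNIV. \<Sum>j\<in>J. (t p i j)\<^sup>2) - 2 * F i * (\<Sum>p\<in>UNIV. \<Sum>j\<in>J. a p i j * t p i j)"
        unfolding E_def by (simp add: sum_subtractf sum_distrib_left)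
      then show "F i * (2 * lam) \<le> \<beta> * G i * (lam * (lam + 6 * sqrt (ev i))) + 1 / \<beta> * h i * (lam * (lam + 4 * sqrt (ev i)))
        + (\<Sum>p\<in>UNIV. \<Sum>j\<in>J. E p i j)"
        using single[OF \<open>i \<in> J\<close> \<beta>] by (simp only: distrib_left right_diff_distrib)
    qed
    also have "\<dots> = lam * (\<beta> * W + 1 / \<beta> * H) + (\<Sum>p\<in>UNIV. \<Sum>i\<in>J. \<Sum>j\<in>J. E p i j)"
      unfolding W_def H_def sum.distrib by (subst (3) sum.swap) (simp add: sum_distrib_left algebra_simps)
    also have "\<dots> \<le> lam * (\<beta> * W + 1 / \<beta> * H)" using E by (simp add: sum_nonpos)
    finally show ?thesis using lam_pos by simp
  qed
  have "W > 0" "H > 0"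
    unfolding W_def H_def using False J lam_pos pos ev
    by (auto intro!: sum_pos mult_pos_pos add_pos_nonneg simp: less_imp_le)
  from two_mult_sqrt_bound[OF this main] show ?thesis by (simp add: F_def G_def h_def W_def H_def)
qed simp

text \<open>The bases of the separate eigenspaces are threaded into one orthonormal sequence in step
  with \<open>ev\<close>, through a bijection between the basis of each eigenspace and the indices
  at which \<open>ev\<close> takes that value.\<close>

theorem universal_inequality:
  fixes ev :: "nat \<Rightarrow> real" and f g :: "real \<Rightarrow> real"
  assumes ev1: "0 < ev 1" and mono: "\<And>i. i \<ge> 1 \<Longrightarrow> ev i \<le> ev (i + 1)"
    and lim: "filterlim ev at_top sequentially"
    and dim: "\<And>\<mu>. has_dim_AE M (eigensp \<mu>) (card {i. i \<ge> 1 \<and> ev i = \<mu>})"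
    and k: "ev k < ev (k + 1)"
    and fg: "(f, g) \<in> Im_class (ev (k + 1))"
  shows "(\<Sum>i=1..k. f (ev i)) \<le> sqrt (\<Sum>i=1..k. g (ev i) * (lam + 6 * sqrt (ev i)))
      * sqrt (\<Sum>i=1..k. (f (ev i))\<^sup>2 / (g (ev i) * (ev (k + 1) - ev i)) * (lam + 4 * sqrt (ev i)))"
proof -
  have mono': "ev i \<le> ev j" if "1 \<le> i" "i \<le> j" for i j
    using that(2,1)
  proof (induction j rule: dec_induct)
    case (step n)
    then show ?case using mono[of n] by simp
  qed simp
  define I where "I \<mu> = {i. i \<ge> 1 \<and> ev i = \<mu>}" for \<mu>
  \<comment> \<open>\<open>card\<close> of an infinite level set would be 0, and the dimension
    hypothesis would then claim a trivial eigenspace; divergence of \<open>ev\<close> excludes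
    this.\<close>
  have fin: "finite (I \<mu>)" for \<mu>
  proof -
    obtain N where N: "\<And>n. n \<ge> N \<Longrightarrow> ev n \<ge> \<mu> + 1"
      using lim unfolding filterlim_at_top eventually_sequentially by blast
    have "I \<mu> \<subseteq> {..N}"
    proof
      fix i assume "i \<in> I \<mu>"
      then show "i \<in> {..N}" using N[of i] by (cases "i \<ge> N") (auto simp: I_def)
    qed
    then show ?thesis using finite_subset by blast
  qed
  have "\<exists>e. (\<forall>j<card (I \<mu>). e j \<in> eigensp \<mu>) \<and>
      (\<forall>i<card (I \<mu>). \<forall>j<card (I \<mu>). ip M (e i) (e j) = (if i = j then 1 else 0)) \<and>
      (\<forall>y\<in>eigensp \<mu>. (\<forall>j<card (I \<mu>). ip M y (e j) = 0) \<longrightarrow> ip M y y = 0)" for \<mu>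
  proof (rule orthonormal_basis[OF eigensp_L2 eigensp_lin dim])
    fix e
    assume "\<And>j. j < card {i. i \<ge> 1 \<and> ev i = \<mu>} \<Longrightarrow> e j \<in> eigensp \<mu>"
      "\<And>i j. i < card {i. i \<ge> 1 \<and> ev i = \<mu>} \<Longrightarrow> j < card {i. i \<ge> 1 \<and> ev i = \<mu>} \<Longrightarrow> ip M (e i) (e j) = (if i = j then 1 else 0)"
      "\<And>y. y \<in> eigensp \<mu> \<Longrightarrow> (\<And>j. j < card {i. i \<ge> 1 \<and> ev i = \<mu>} \<Longrightarrow> ip M y (e j) = 0) \<Longrightarrow> ip M y y = 0"
    then show ?thesis unfolding I_def by blast
  qed
  then obtain e where e: "\<And>\<mu> j. j < card (I \<mu>) \<Longrightarrow> e \<mu> j \<in> eigensp \<mu>"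
    and on: "\<And>\<mu> i j. i < card (I \<mu>) \<Longrightarrow> j < card (I \<mu>) \<Longrightarrow> ip M (e \<mu> i) (e \<mu> j) = (if i = j then 1 else 0)"
    and complete: "\<And>\<mu> y. y \<in> eigensp \<mu> \<Longrightarrow> (\<And>j. j < card (I \<mu>) \<Longrightarrow> ip M y (e \<mu> j) = 0) \<Longrightarrow> ip M y y = 0"
    by metis
  have "\<exists>h. bij_betw h {0..<card (I \<mu>)} (I \<mu>)" for \<mu>
    using ex_bij_betw_nat_finite[OF fin] .
  then obtain h where h: "\<And>\<mu>. bij_betw (h \<mu>) {0..<card (I \<mu>)} (I \<mu>)" by metis
  define idx where "idx i = inv_into {0..<card (I (ev i))} (h (ev i)) i" for i
  have idx: "idx i < card (I (ev i))" "h (ev i) (idx i) = i" if "i \<ge> 1" for i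
  proof -
    have "i \<in> h (ev i) ` {0..<card (I (ev i))}"
      using bij_betw_imp_surj_on[OF h] that by (simp add: I_def)
    then have "inv_into {0..<card (I (ev i))} (h (ev i)) i \<in> {0..<card (I (ev i))}"
      "h (ev i) (inv_into {0..<card (I (ev i))} (h (ev i)) i) = i"
      by (rule inv_into_into, rule f_inv_into_f)
    then show "idx i < card (I (ev i))" "h (ev i) (idx i) = i"
      unfolding idx_def by simp_all
  qed
  define u where "u i = e (ev i) (idx i)" for i
  have u: "u i \<in> eigensp (ev i)" if "i \<ge> 1" for i
    unfolding u_def using e idx that by blast
  then have "\<exists>w. graph_clos (u i) w" if "i \<ge> 1" for i
    using that unfolding eigensp_def by blast
  then obtain w where w: "\<And>i. i \<ge> 1 \<Longrightarrow> graph_clos (u i) (w i)" by metis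
  have uon: "ip M (u i) (u j) = (if i = j then 1 else 0)" if "i \<ge> 1" "j \<ge> 1" for i j
  proof (cases "ev i = ev j")
    case True
    then have "idx i = idx j \<longleftrightarrow> i = j" using idx(2)[OF that(1)] idx(2)[OF that(2)] by metis
    then show ?thesis
      using on[OF idx(1)[OF that(1)]] idx(1)[OF that(2)] True by (simp add: u_def)
  next
    case False
    then show ?thesis using eigensp_orth[OF u[OF that(1)] u[OF that(2)]] by auto
  qed
  show ?thesis
  proof (rule commutator_inequality[where u = u and w = w])
    \<comment> \<open>Every index of the eigenvalue \<open>Q\<close> is at most \<open>k\<close>,
      since \<open>ev\<close> is nondecreasing and \<open>Q < ev (k + 1)\<close>, so
      \<open>y\<close> is orthogonal to a full basis of the eigenspace. If \<open>Q\<close> is no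
      eigenvalue, that basis is empty and completeness alone makes \<open>y\<close> null.\<close>
    fix Q y assume Q: "Q < ev (k + 1)" and y: "y \<in> eigensp Q" "\<And>j. j \<in> {1..k} \<Longrightarrow> ip M y (u j) = 0"
    show "ip M y y = 0"
    proof (rule complete[OF y(1)])
      fix n assume n: "n < card (I Q)"
      define j where "j = h Q n"
      have j: "j \<ge> 1" "ev j = Q"
        using bij_betwE[OF h[of Q]] n by (auto simp: j_def I_def)
      have "j \<le> k"
      proof (rule ccontr)
        assume "\<not> j \<le> k"
        then show False using mono'[of "k + 1" j] Q j by simp
      qed
      have "idx j = n"
        using inv_into_f_f[OF bij_betw_imp_inj_on[OF h[of Q]], of n] n j by (simp add: idx_def j_def)
      then show "ip M y (e Q n) = 0" using y(2)[of j] j \<open>j \<le> k\<close> by (simp add: u_def)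
    qed
  next
    fix j assume "j \<in> {1..k}"
    then show "0 < ev j" "ev j < ev (k + 1)" using mono'[of 1 j] mono'[of j k] ev1 k by auto
  qed (use u w uon fg in auto)
qed

end

section \<open>Calculus of functions of class \<open>C\<^sup>k\<close>\<close>

lemma has_derivative_pderiv:
  assumes "v differentiable at y"
  shows "(v has_derivative (\<lambda>h. \<Sum>i\<in>UNIV. h $ i * pderiv_at i v y)) (at y)"
proof -
  define D where "D = frechet_derivative v (at y)"
  have D: "(v has_derivative D) (at y)" using assms by (simp add: frechet_derivative_works D_def)
  then have lin: "linear D" by (rule has_derivative_linear)
  have "D h = (\<Sum>i\<in>UNIV. h $ i * pderiv_at i v y)" for h
  proof -
    have "D h = D (\<Sum>i\<in>UNIV. h $ i *\<^sub>R axis i 1)" by (simp add: basis_expansion[of h, simplified scalar_mult_eq_scaleR])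
    also have "\<dots> = (\<Sum>i\<in>UNIV. h $ i * pderiv_at i v y)"
      using lin by (simp add: linear_sum linear_scale pderiv_at_def D_def)
    finally show ?thesis .
  qed
  then have "D = (\<lambda>h. \<Sum>i\<in>UNIV. h $ i * pderiv_at i v y)" by auto
  then show ?thesis using D by simp
qed

lemma pderiv_at_eq:
  assumes "(v has_derivative D) (at y)"
  shows "pderiv_at i v y = D (axis i 1)"
  using frechet_derivative_at[OF assms] by (simp add: pderiv_at_def)

lemma differentiable_at_cong_open:
  assumes "u differentiable at y" "open S" "y \<in> S" "\<And>z. z \<in> S \<Longrightarrow> u z = v z"
  shows "v differentiable at y"
proof -
  obtain D where "(u has_derivative D) (at y)" using assms(1) by (auto simp: differentiable_def)
  then have "(v has_derivative D) (at y)"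
    by (rule has_derivative_transform_within_open[OF _ assms(2,3)]) (use assms in auto)
  then show ?thesis by (auto simp: differentiable_def)
qed

text \<open>Covers points of non-differentiability as well: there \<open>frechet_derivative\<close>
  chooses from the same empty predicate for both functions.\<close>

lemma pderiv_at_cong_open:
  assumes "open S" "y \<in> S" "\<And>z. z \<in> S \<Longrightarrow> u z = v z"
  shows "pderiv_at i u y = pderiv_at i v y"
proof (cases "u differentiable at y")
  case True
  then have "(u has_derivative frechet_derivative u (at y)) (at y)" by (simp add: frechet_derivative_works)
  then have *: "(v has_derivative frechet_derivative u (at y)) (at y)"
    by (rule has_derivative_transform_within_open[OF _ assms(1,2)]) (use assms in auto)
  show ?thesis using pderiv_at_eq[OF *, of i] by (simp add: pderiv_at_def)
next
  case False
  have "\<not> v differentiable at y"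
    using False differentiable_at_cong_open[OF _ assms(1,2), of v u] assms(3) by auto
  then have "(\<lambda>f'. (v has_derivative f') (at y)) = (\<lambda>f'. (u has_derivative f') (at y))"
    using False by (auto simp: differentiable_def)
  then show ?thesis unfolding pderiv_at_def frechet_derivative_def by simp
qed

lemma Ck_on_cong:
  assumes "open S" "\<And>y. y \<in> S \<Longrightarrow> u y = v y" "Ck_on k S u"
  shows "Ck_on k S v"
  using assms(2,3)
proof (induction k arbitrary: u v)
  case 0
  then show ?case by (simp cong: continuous_on_cong)
next
  case (Suc k)
  have "v differentiable_on S"
    using Suc.prems assms(1) differentiable_at_cong_open[of u _ S v]
    by (simp add: differentiable_on_eq_differentiable_at)
  moreover have "Ck_on k S (pderiv_at i v)" for i
  proof (rule Suc.IH)
    show "Ck_on k S (pderiv_at i u)" using Suc.prems(2) by simp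
    show "pderiv_at i u y = pderiv_at i v y" if "y \<in> S" for y
      by (rule pderiv_at_cong_open[OF assms(1) that]) (rule Suc.prems(1))
  qed
  ultimately show ?case by simp
qed

lemma Ck_on_subset: "Ck_on k S u \<Longrightarrow> S' \<subseteq> S \<Longrightarrow> Ck_on k S' u"
  by (induction k arbitrary: u) (auto intro: continuous_on_subset differentiable_on_subset)

lemma Ck_on_imp_continuous_on: "Ck_on k S u \<Longrightarrow> continuous_on S u"
  by (cases k) (auto intro: differentiable_imp_continuous_on)

lemma Ck_on_SucD: "Ck_on (Suc k) S u \<Longrightarrow> Ck_on k S u"
  by (induction k arbitrary: u) (auto intro: differentiable_imp_continuous_on)

lemma Ck_on_le: "Ck_on k S u \<Longrightarrow> j \<le> k \<Longrightarrow> Ck_on j S u"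
proof (induction k)
  case (Suc k)
  then show ?case using Ck_on_SucD by (cases "j = Suc k") auto
qed simp

lemma Ck_on_differentiable_at:
  assumes "Ck_on (Suc k) S u" "open S" "y \<in> S"
  shows "u differentiable at y"
  using assms by (simp add: differentiable_on_eq_differentiable_at)

lemma pderiv_at_const [simp]: "pderiv_at i (\<lambda>_. c) = (\<lambda>_. 0)"
  by (intro ext) (simp add: pderiv_at_eq[OF has_derivative_const])

lemma pderiv_at_lin:
  assumes "u differentiable at y" "v differentiable at y"
  shows "pderiv_at i (\<lambda>z. a * u z + b * v z) y = a * pderiv_at i u y + b * pderiv_at i v y"
proof -
  have "((\<lambda>z. a * u z + b * v z) has_derivative (\<lambda>h. a * frechet_derivative u (at y) h + b * frechet_derivative v (at y) h)) (at y)"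
    using assms by (intro derivative_intros) (simp_all add: frechet_derivative_works)
  from pderiv_at_eq[OF this] show ?thesis by (simp add: pderiv_at_def)
qed

lemma pderiv_at_mult:
  assumes "u differentiable at y" "v differentiable at y"
  shows "pderiv_at i (\<lambda>z. u z * v z) y = u y * pderiv_at i v y + pderiv_at i u y * v y"
proof -
  have "((\<lambda>z. u z * v z) has_derivative (\<lambda>h. u y * frechet_derivative v (at y) h + frechet_derivative u (at y) h * v y)) (at y)"
    using assms by (intro has_derivative_mult) (simp_all add: frechet_derivative_works)
  from pderiv_at_eq[OF this] show ?thesis by (simp add: pderiv_at_def)
qed

lemma pderiv_at_comp_real:
  assumes "u differentiable at y" "(f has_real_derivative D) (at (u y))"
  shows "pderiv_at i (\<lambda>z. f (u z)) y = D * pderiv_at i u y" "(\<lambda>z. f (u z)) differentiable at y"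
proof -
  have f: "(f has_derivative (\<lambda>t. D * t)) (at (u y))" using assms(2) by (simp add: has_field_derivative_def)
  have u: "(u has_derivative frechet_derivative u (at y)) (at y)" using assms(1) by (simp add: frechet_derivative_works)
  have *: "((\<lambda>z. f (u z)) has_derivative (\<lambda>h. D * frechet_derivative u (at y) h)) (at y)"
    by (rule has_derivative_compose[OF u f])
  show "pderiv_at i (\<lambda>z. f (u z)) y = D * pderiv_at i u y" using pderiv_at_eq[OF *] by (simp add: pderiv_at_def)
  show "(\<lambda>z. f (u z)) differentiable at y" using * by (auto simp: differentiable_def)
qed

lemma Ck_on_const: "Ck_on k S (\<lambda>_. c)"
  by (induction k arbitrary: c) auto

lemma Ck_on_lin:
  assumes S: "open S" and "Ck_on k S u" "Ck_on k S v"
  shows "Ck_on k S (\<lambda>z. a * u z + b * v z)"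
  using assms(2,3)
proof (induction k arbitrary: u v)
  case 0
  then show ?case by (auto intro!: continuous_intros)
next
  case (Suc k)
  have "Ck_on k S (pderiv_at i (\<lambda>z. a * u z + b * v z))" for i
    by (rule Ck_on_cong[OF S _ Suc.IH[of "pderiv_at i u" "pderiv_at i v"]])
      (use Suc.prems in \<open>auto simp: pderiv_at_lin Ck_on_differentiable_at[OF _ S]\<close>)
  then show ?case using Suc.prems by (auto intro!: differentiable_on_add differentiable_on_mult)
qed

lemma Ck_on_add: "open S \<Longrightarrow> Ck_on k S u \<Longrightarrow> Ck_on k S v \<Longrightarrow> Ck_on k S (\<lambda>z. u z + v z)"
  using Ck_on_lin[of S k u v 1 1] by simp

lemma Ck_on_diff: "open S \<Longrightarrow> Ck_on k S u \<Longrightarrow> Ck_on k S v \<Longrightarrow> Ck_on k S (\<lambda>z. u z - v z)"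
  using Ck_on_lin[of S k u v 1 "-1"] by simp

lemma Ck_on_mult:
  assumes S: "open S" and "Ck_on k S u" "Ck_on k S v"
  shows "Ck_on k S (\<lambda>z. u z * v z)"
  using assms(2,3)
proof (induction k arbitrary: u v)
  case 0
  then show ?case by (auto intro!: continuous_intros)
next
  case (Suc k)
  have "Ck_on k S (\<lambda>z. u z * pderiv_at i v z + pderiv_at i u z * v z)" for i
    using Suc.prems Suc.prems[THEN Ck_on_SucD] by (intro Ck_on_add[OF S] Suc.IH) auto
  then have "Ck_on k S (pderiv_at i (\<lambda>z. u z * v z))" for i
    by (rule Ck_on_cong[OF S, rotated]) (use Suc.prems in \<open>auto simp: pderiv_at_mult Ck_on_differentiable_at[OF _ S]\<close>)
  then show ?case using Suc.prems by (auto intro!: differentiable_on_mult)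
qed

lemma Ck_on_sum:
  assumes "open S" "\<And>j. j \<in> J \<Longrightarrow> Ck_on k S (u j)"
  shows "Ck_on k S (\<lambda>z. \<Sum>j\<in>J. u j z)"
  using assms(2) by (induction J rule: infinite_finite_induct) (auto intro!: Ck_on_const Ck_on_add[OF assms(1)])

lemma Ck_on_prod:
  assumes "open S" "\<And>j. j \<in> J \<Longrightarrow> Ck_on k S (u j)"
  shows "Ck_on k S (\<lambda>z. \<Prod>j\<in>J. u j z)"
  using assms(2) by (induction J rule: infinite_finite_induct) (auto intro!: Ck_on_const Ck_on_mult[OF assms(1)])

text \<open>The derivative is a product of powers of \<open>1 / u\<close> and a derivative of
  \<open>u\<close>, so the statement for \<open>k\<close> reproduces itself for
  \<open>Suc k\<close>; the square root below works alike.\<close>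

lemma Ck_on_inverse:
  assumes S: "open S" and "Ck_on k S u" "\<And>y. y \<in> S \<Longrightarrow> u y \<noteq> 0"
  shows "Ck_on k S (\<lambda>z. 1 / u z)"
  using assms(2)
proof (induction k)
  case 0
  then show ?case using assms(3) by (auto intro!: continuous_intros)
next
  case (Suc k)
  have u: "u differentiable at y" if "y \<in> S" for y using Suc.prems that by (rule Ck_on_differentiable_at[OF _ S])
  have D: "((\<lambda>t. 1 / t) has_real_derivative - (1 / u y) * (1 / u y)) (at (u y))" if "y \<in> S" for y
    using assms(3)[OF that] by (auto intro!: derivative_eq_intros)
  have "Ck_on k S (\<lambda>z. (-1) * ((1 / u z) * (1 / u z)) * pderiv_at i u z)" for i
    using Suc.prems Ck_on_SucD[OF Suc.prems] by (intro Ck_on_mult[OF S] Ck_on_const Suc.IH) auto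
  note * = Ck_on_cong[OF S _ this]
  have "Ck_on k S (pderiv_at i (\<lambda>z. 1 / u z))" for i
    by (rule *[of i]) (simp add: pderiv_at_comp_real(1)[OF u D])
  moreover have "(\<lambda>z. 1 / u z) differentiable_on S"
    using pderiv_at_comp_real(2)[OF u D] S by (simp add: differentiable_on_eq_differentiable_at)
  ultimately show ?case by simp
qed

lemma Ck_on_divide:
  assumes "open S" "Ck_on k S u" "Ck_on k S v" "\<And>y. y \<in> S \<Longrightarrow> v y \<noteq> 0"
  shows "Ck_on k S (\<lambda>z. u z / v z)"
  using Ck_on_mult[OF assms(1,2) Ck_on_inverse[OF assms(1,3,4)]] by simp

lemma Ck_on_sqrt:
  assumes S: "open S" and "Ck_on k S u" "\<And>y. y \<in> S \<Longrightarrow> u y > 0"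
  shows "Ck_on k S (\<lambda>z. sqrt (u z))"
  using assms(2)
proof (induction k)
  case 0
  then show ?case by (auto intro!: continuous_intros)
next
  case (Suc k)
  have u: "u differentiable at y" if "y \<in> S" for y using Suc.prems that by (rule Ck_on_differentiable_at[OF _ S])
  have D: "(sqrt has_real_derivative 1 / (2 * sqrt (u y))) (at (u y))" if "y \<in> S" for y
    using assms(3)[OF that] by (auto intro!: derivative_eq_intros simp: field_simps)
  have "Ck_on k S (\<lambda>z. (1 / (2 * sqrt (u z))) * pderiv_at i u z)" for i
  proof (intro Ck_on_mult[OF S] Ck_on_inverse[OF S] Ck_on_const)
    show "Ck_on k S (\<lambda>z. sqrt (u z))" using Suc Ck_on_SucD by blast
    show "2 * sqrt (u y) \<noteq> 0" if "y \<in> S" for y using assms(3)[OF that] by simp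
    show "Ck_on k S (pderiv_at i u)" using Suc.prems by simp
  qed
  note * = Ck_on_cong[OF S _ this]
  have "Ck_on k S (pderiv_at i (\<lambda>z. sqrt (u z)))" for i
    by (rule *[of i]) (simp add: pderiv_at_comp_real(1)[OF u D])
  moreover have "(\<lambda>z. sqrt (u z)) differentiable_on S"
    using pderiv_at_comp_real(2)[OF u D] S by (simp add: differentiable_on_eq_differentiable_at)
  ultimately show ?case by simp
qed

section \<open>Determinants and inverse matrices\<close>

lemma Ck_on_det:
  fixes G :: "real^'n \<Rightarrow> real^'m^'m"
  assumes S: "open S" and "\<And>i j. Ck_on k S (\<lambda>z. G z $ i $ j)"
  shows "Ck_on k S (\<lambda>z. det (G z))"
  unfolding det_def using assms by (intro Ck_on_sum Ck_on_mult Ck_on_const Ck_on_prod) auto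

lemma matrix_inv:
  fixes A :: "real^'n^'n"
  assumes "invertible A"
  shows "A ** matrix_inv A = mat 1" "matrix_inv A ** A = mat 1"
  using someI_ex[OF assms[unfolded invertible_def]] by (simp_all add: matrix_inv_def)

text \<open>Cramer's rule displays the entries of the inverse as quotients of determinants, hence as
  smooth functions of the entries.\<close>

lemma matrix_inv_component:
  fixes A :: "real^'n^'n"
  assumes "det A \<noteq> 0"
  shows "matrix_inv A $ k $ j = det (\<chi> i l. if l = k then axis j 1 $ i else A $ i $ l) / det A"
proof -
  have inv: "invertible A" using assms by (simp add: invertible_det_nz)
  have "A *v (matrix_inv A *v axis j 1) = axis j 1"
    by (simp add: matrix_vector_mul_assoc matrix_inv[OF inv])
  then have "matrix_inv A *v axis j 1 = (\<chi> k. det (\<chi> i l. if l = k then axis j 1 $ i else A $ i $ l) / det A)"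
    using cramer[OF assms] by blast
  moreover have "(matrix_inv A *v axis j 1) $ k = matrix_inv A $ k $ j"
    by (simp add: matrix_vector_mul_component inner_axis)
  ultimately show ?thesis by simp
qed

lemma Ck_on_matrix_inv:
  fixes G :: "real^'n \<Rightarrow> real^'m^'m"
  assumes S: "open S" and G: "\<And>i j. Ck_on k S (\<lambda>z. G z $ i $ j)" and nz: "\<And>y. y \<in> S \<Longrightarrow> det (G y) \<noteq> 0"
  shows "Ck_on k S (\<lambda>z. matrix_inv (G z) $ i $ j)"
proof -
  have "Ck_on k S (\<lambda>z. det (\<chi> p l. if l = i then axis j 1 $ p else G z $ p $ l) / det (G z))"
  proof (intro Ck_on_divide Ck_on_det S G nz)
    fix p l show "Ck_on k S (\<lambda>z. (\<chi> p l. if l = i then axis j 1 $ p else G z $ p $ l) $ p $ l)"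
      using G by (cases "l = i") (auto intro: Ck_on_const)
  qed
  then show ?thesis
    by (rule Ck_on_cong[OF S, rotated]) (simp add: matrix_inv_component[OF nz])
qed

lemma Ck_on_Union:
  assumes "\<And>S. S \<in> F \<Longrightarrow> open S" "\<And>S. S \<in> F \<Longrightarrow> Ck_on k S u"
  shows "Ck_on k (\<Union>F) u"
  using assms(2)
proof (induction k arbitrary: u)
  case 0
  then show ?case using assms(1) by (auto intro: continuous_on_open_Union)
next
  case (Suc k)
  have "u differentiable_on \<Union>F"
    using Suc.prems assms(1) by (auto simp: differentiable_on_eq_differentiable_at open_Union)
  then show ?case using Suc by auto
qed

text \<open>The gluing step for extensions by zero: the function is given by a formula on one open
  set and vanishes on another.\<close>

lemma Ck_on_Un:
  assumes "open S" "open T" "Ck_on k S u" "Ck_on k T u"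
  shows "Ck_on k (S \<union> T) u"
proof -
  have "open V \<and> Ck_on k V u" if "V \<in> {S, T}" for V using assms that by blast
  then show ?thesis using Ck_on_Union[of "{S, T}" k u] by simp
qed

section \<open>Change of variables\<close>

text \<open>The change of variables theorem of the library requires the index type to be well-ordered.
  \<open>'n idx\<close> is a well-ordered copy of an arbitrary finite index type.\<close>

typedef ('n::finite) idx = "{..<CARD('n)}"
  by (rule exI[of _ 0]) simp

instantiation idx :: (finite) linorder
begin

definition less_eq_idx :: "'a idx \<Rightarrow> 'a idx \<Rightarrow> bool" where
  "less_eq_idx x y \<longleftrightarrow> Rep_idx x \<le> Rep_idx y"

definition less_idx :: "'a idx \<Rightarrow> 'a idx \<Rightarrow> bool" where
  "less_idx x y \<longleftrightarrow> Rep_idx x < Rep_idx y"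

instance
  by standard (auto simp: less_eq_idx_def less_idx_def Rep_idx_inject)

end

instance idx :: (finite) finite
proof
  have "inj (Rep_idx :: 'a idx \<Rightarrow> nat)" by (simp add: inj_def Rep_idx_inject)
  moreover have "finite (range (Rep_idx :: 'a idx \<Rightarrow> nat))"
    by (rule finite_subset[of _ "{..<CARD('a)}"]) (use Rep_idx in auto)
  ultimately show "finite (UNIV :: 'a idx set)" by (simp add: finite_image_iff)
qed

instance idx :: (finite) wellorder
proof
  fix P :: "'a idx \<Rightarrow> bool" and a
  assume *: "\<And>x. (\<And>y. y < x \<Longrightarrow> P y) \<Longrightarrow> P x"
  show "P a"
  proof (induction "Rep_idx a" arbitrary: a rule: less_induct)
    case less
    then show ?case using * unfolding less_idx_def by blast
  qed
qed

lemma card_idx: "CARD('n::finite idx) = CARD('n)"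
  using type_definition.card[OF type_definition_idx] by simp

text \<open>Conjugation with \<open>e\<close> is a sign-preserving bijection between the
  permutations of the two index types.\<close>

lemma det_reindex:
  fixes A :: "real^'n^'n" and e :: "'m::finite \<Rightarrow> 'n"
  assumes e: "bij e"
  shows "det (\<chi> i j. A $ e i $ e j) = det A"
proof -
  let ?\<Phi> = "map_permutation UNIV e"
  have inj: "inj e" and surj: "surj e" using e by (auto simp: bij_def)
  have \<Phi>: "?\<Phi> p = e \<circ> p \<circ> inv e" for p
    using surj by (auto simp: map_permutation_def restrict_id_def)
  have bij: "bij_betw ?\<Phi> {p. p permutes UNIV} {p. p permutes UNIV}"
  proof (rule bij_betw_byWitness[where f' = "\<lambda>q. inv e \<circ> q \<circ> e"])
    show "\<forall>p\<in>{p. p permutes UNIV}. inv e \<circ> ?\<Phi> p \<circ> e = p"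
      using inj by (auto simp: \<Phi> fun_eq_iff inv_f_f)
    show "\<forall>q\<in>{q. q permutes UNIV}. ?\<Phi> (inv e \<circ> q \<circ> e) = q"
      using surj by (auto simp: \<Phi> fun_eq_iff surj_f_inv_f)
    show "?\<Phi> ` {p. p permutes UNIV} \<subseteq> {p. p permutes UNIV}"
      using map_permutation_permutes[OF e] by blast
    show "(\<lambda>q. inv e \<circ> q \<circ> e) ` {q. q permutes UNIV} \<subseteq> {p. p permutes UNIV}"
      using e by (auto intro!: bij_imp_permutes bij_comp bij_imp_bij_inv dest: permutes_bij)
  qed
  have "det A = (\<Sum>q\<in>{q. q permutes UNIV}. of_int (sign q) * (\<Prod>i\<in>UNIV. A $ i $ q i))"
    by (simp add: det_def)
  also have "\<dots> = (\<Sum>p\<in>{p. p permutes UNIV}. of_int (sign (?\<Phi> p)) * (\<Prod>i\<in>UNIV. A $ i $ ?\<Phi> p i))"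
    by (rule sum.reindex_bij_betw[OF bij, symmetric])
  also have "\<dots> = (\<Sum>p\<in>{p. p permutes UNIV}. of_int (sign p) * (\<Prod>i\<in>UNIV. A $ e i $ e (p i)))"
  proof (rule sum.cong[OF refl])
    fix p :: "'m \<Rightarrow> 'm" assume p: "p \<in> {p. p permutes UNIV}"
    have "(\<Prod>i\<in>UNIV. A $ i $ ?\<Phi> p i) = (\<Prod>i\<in>UNIV. A $ e i $ ?\<Phi> p (e i))"
      by (rule prod.reindex_bij_betw[OF e, symmetric])
    then show "of_int (sign (?\<Phi> p)) * (\<Prod>i\<in>UNIV. A $ i $ ?\<Phi> p i) = of_int (sign p) * (\<Prod>i\<in>UNIV. A $ e i $ e (p i))"
      using p inj sign_map_permutation[of e UNIV p] by (simp add: \<Phi> inv_f_f)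
  qed
  also have "\<dots> = det (\<chi> i j. A $ e i $ e j)" by (simp add: det_def)
  finally show ?thesis by simp
qed

definition reindex :: "('m \<Rightarrow> 'n) \<Rightarrow> real^'n \<Rightarrow> real^'m" where
  "reindex e x = (\<chi> i. x $ e i)"

lemma reindex_nth [simp]: "reindex e x $ i = x $ e i"
  by (simp add: reindex_def)

lemma linear_reindex: "linear (reindex e)"
  by (rule linearI) (auto simp: vec_eq_iff)

lemma reindex_inverse [simp]:
  assumes "bij e"
  shows "reindex (inv e) (reindex e x) = x" "reindex e (reindex (inv e) y) = y"
  using assms by (auto simp: vec_eq_iff bij_def surj_f_inv_f inv_f_f)

lemma continuous_on_reindex: "continuous_on S (reindex e)"
  by (simp add: linear_reindex linear_continuous_on linear_linear)

lemma measurable_reindex [measurable]: "reindex e \<in> borel \<rightarrow>\<^sub>M borel"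
  by (intro borel_measurable_continuous_onI continuous_on_reindex)

text \<open>Permuting coordinates maps boxes to boxes with the same side lengths, and boxes
  determine Lebesgue measure.\<close>

lemma distr_reindex:
  fixes e :: "'m::finite \<Rightarrow> 'n::finite"
  assumes e: "bij e"
  shows "distr lborel lborel (reindex e) = lborel"
proof (rule lborel_eqI[symmetric])
  fix l u :: "real^'m"
  assume le: "\<And>b. b \<in> Basis \<Longrightarrow> l \<bullet> b \<le> u \<bullet> b"
  then have le': "l $ i \<le> u $ i" for i
    using le[of "axis i 1"] by (simp add: inner_axis)
  have Bprod: "(\<Prod>b\<in>Basis. (u' - l') \<bullet> b) = (\<Prod>i\<in>UNIV. (u' - l') $ i)" for u' l' :: "real^'k::finite"
  proof -
    have B: "Basis = range (\<lambda>i::'k. axis i (1::real))" by (auto simp: Basis_vec_def)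
    show ?thesis unfolding B
      by (subst prod.reindex) (auto simp: inj_def axis_eq_axis inner_axis)
  qed
  have inv: "inv e (e i) = i" "e (inv e j) = j" for i j using e by (auto simp: bij_def surj_f_inv_f inv_f_f)
  have "emeasure (distr lborel lborel (reindex e)) (box l u) = emeasure lborel (reindex e -` box l u)"
    by (subst emeasure_distr) auto
  also have "reindex e -` box l u = box (reindex (inv e) l) (reindex (inv e) u)"
  proof -
    have "(\<forall>i. l $ i < x $ e i \<and> x $ e i < u $ i) \<longleftrightarrow> (\<forall>j. l $ inv e j < x $ j \<and> x $ j < u $ inv e j)" for x
      using inv by metis
    then show ?thesis by (auto simp: mem_box_cart)
  qed
  also have "emeasure lborel \<dots> = (\<Prod>b\<in>Basis. (reindex (inv e) u - reindex (inv e) l) \<bullet> b)"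
    using le' by (intro emeasure_lborel_box) (auto simp: Basis_vec_def inner_axis)
  also have "(\<Prod>b\<in>Basis. (reindex (inv e) u - reindex (inv e) l) \<bullet> b) = (\<Prod>j\<in>UNIV. (u - l) $ inv e j)"
    unfolding Bprod by simp
  also have "\<dots> = (\<Prod>b\<in>Basis. (u - l) \<bullet> b)"
    unfolding Bprod by (rule prod.reindex_bij_betw[OF bij_imp_bij_inv[OF e]])
  finally show "emeasure (distr lborel lborel (reindex e)) (box l u) = (\<Prod>b\<in>Basis. (u - l) \<bullet> b)" .
qed auto

lemma nn_integral_eq_integral_on:
  fixes f :: "'a::euclidean_space \<Rightarrow> real"
  assumes f: "f absolutely_integrable_on S" "\<And>x. x \<in> S \<Longrightarrow> 0 \<le> f x"
  shows "(\<integral>\<^sup>+x. ennreal (indicator S x * f x) \<partial>lebesgue) = ennreal (integral S f)"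
proof -
  have "integrable lebesgue (\<lambda>x. indicator S x * f x)" using f(1) by (simp add: set_integrable_def)
  then have "(\<integral>\<^sup>+x. ennreal (indicator S x * f x) \<partial>lebesgue) = ennreal (\<integral>x. indicator S x * f x \<partial>lebesgue)"
    using f(2) by (intro nn_integral_eq_integral) (auto simp: indicator_def)
  also have "(\<integral>x. indicator S x * f x \<partial>lebesgue) = integral S f"
    using set_lebesgue_integral_eq_integral(2)[OF f(1)] by (simp add: set_lebesgue_integral_def)
  finally show ?thesis .
qed

lemma absolutely_integrable_on_iff_nn_integral:
  fixes f :: "'a::euclidean_space \<Rightarrow> real"
  assumes "(\<lambda>x. indicator S x * f x) \<in> borel_measurable lebesgue" "\<And>x. x \<in> S \<Longrightarrow> 0 \<le> f x"
  shows "f absolutely_integrable_on S \<longleftrightarrow> (\<integral>\<^sup>+x. ennreal (indicator S x * f x) \<partial>lebesgue) < \<infinity>"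
proof -
  have "0 \<le> indicator S x * f x" for x using assms(2) by (auto simp: indicator_def)
  then have "integrable lebesgue (\<lambda>x. indicator S x * f x) \<longleftrightarrow> (\<integral>\<^sup>+x. ennreal (indicator S x * f x) \<partial>lebesgue) < \<infinity>"
    using assms(1) by (simp add: integrable_iff_bounded)
  then show ?thesis by (simp add: set_integrable_def)
qed

text \<open>The underlying theorem concerns absolutely integrable vector-valued functions, hence the
  detour through \<open>real^1\<close>. Nonnegative functions with infinite integral are covered
  because integrability on one side is equivalent to integrability on the other.\<close>

lemma nn_integral_change_of_variables_wellorder:
  fixes g :: "real^'m::{finite,wellorder} \<Rightarrow> real^'m::_" and f :: "real^'m::_ \<Rightarrow> real"
  assumes S: "S \<in> sets lebesgue"
    and der: "\<And>x. x \<in> S \<Longrightarrow> (g has_derivative g' x) (at x within S)" and inj: "inj_on g S"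
    and f: "\<And>y. y \<in> g ` S \<Longrightarrow> 0 \<le> f y"
    and m: "(\<lambda>y. indicator (g ` S) y * f y) \<in> borel_measurable lebesgue"
      "(\<lambda>x. indicator S x * (\<bar>det (matrix (g' x))\<bar> * f (g x))) \<in> borel_measurable lebesgue"
  shows "(\<integral>\<^sup>+y. ennreal (indicator (g ` S) y * f y) \<partial>lebesgue)
    = (\<integral>\<^sup>+x. ennreal (indicator S x * (\<bar>det (matrix (g' x))\<bar> * f (g x))) \<partial>lebesgue)"
proof -
  let ?h = "\<lambda>x. \<bar>det (matrix (g' x))\<bar> * f (g x)"
  have "(\<lambda>x. \<bar>det (matrix (g' x))\<bar> *\<^sub>R vec (f (g x)) :: real^1) absolutely_integrable_on S \<and>
      integral S (\<lambda>x. \<bar>det (matrix (g' x))\<bar> *\<^sub>R vec (f (g x)) :: real^1) = vec b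
    \<longleftrightarrow> (\<lambda>y. vec (f y) :: real^1) absolutely_integrable_on (g ` S) \<and> integral (g ` S) (\<lambda>y. vec (f y) :: real^1) = vec b" for b
    by (rule has_absolute_integral_change_of_variables[OF S der inj])
  then have cov: "?h absolutely_integrable_on S \<and> integral S ?h = b
    \<longleftrightarrow> f absolutely_integrable_on (g ` S) \<and> integral (g ` S) f = b" for b
    by (simp add: absolutely_integrable_on_1_iff integral_on_1_eq)
  have h: "0 \<le> ?h x" if "x \<in> S" for x using f that by simp
  show ?thesis
  proof (cases "f absolutely_integrable_on (g ` S)")
    case True
    then have "?h absolutely_integrable_on S" "integral S ?h = integral (g ` S) f"
      using cov by blast+
    then show ?thesis
      using nn_integral_eq_integral_on[OF True f] nn_integral_eq_integral_on[of S ?h] h by simp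
  next
    case False
    then have "\<not> ?h absolutely_integrable_on S" using cov by blast
    then show ?thesis
      using False absolutely_integrable_on_iff_nn_integral[OF m(1) f] absolutely_integrable_on_iff_nn_integral[OF m(2) h]
      by (simp add: less_top[symmetric])
  qed
qed

text \<open>The map is conjugated by the coordinate permutations \<open>P\<close> and
  \<open>Q\<close>, which preserve Lebesgue measure and the Jacobian determinant. Borel
  measurability survives composition with \<open>Q\<close> and makes the passage between
  \<open>lebesgue\<close> and \<open>lborel\<close> harmless.\<close>

theorem nn_integral_change_of_variables:
  fixes g :: "real^'n::finite \<Rightarrow> real^'n" and f :: "real^'n \<Rightarrow> real"
  assumes S: "S \<in> sets borel"
    and der: "\<And>x. x \<in> S \<Longrightarrow> (g has_derivative g' x) (at x within S)" and inj: "inj_on g S"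
    and f: "\<And>y. y \<in> g ` S \<Longrightarrow> 0 \<le> f y"
    and m: "(\<lambda>y. indicator (g ` S) y * f y) \<in> borel_measurable borel"
      "(\<lambda>x. indicator S x * (\<bar>det (matrix (g' x))\<bar> * f (g x))) \<in> borel_measurable borel"
  shows "(\<integral>\<^sup>+y. ennreal (indicator (g ` S) y * f y) \<partial>lborel)
    = (\<integral>\<^sup>+x. ennreal (indicator S x * (\<bar>det (matrix (g' x))\<bar> * f (g x))) \<partial>lborel)"
proof -
  obtain e :: "'n idx \<Rightarrow> 'n" where e: "bij e"
    using finite_same_card_bij[of "UNIV :: 'n idx set" "UNIV :: 'n set"] by (auto simp: card_idx)
  define P Q where "P = reindex e" and "Q = reindex (inv e)"
  have PQ: "Q (P x) = x" "P (Q y) = y" for x y using e by (auto simp: P_def Q_def)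
  have lin: "linear P" "linear Q" by (auto simp: P_def Q_def linear_reindex)
  have [measurable]: "P \<in> borel \<rightarrow>\<^sub>M borel" "Q \<in> borel \<rightarrow>\<^sub>M borel" by (auto simp: P_def Q_def)
  define S' where "S' = Q -` S"
  define h where "h = P \<circ> g \<circ> Q"
  define h' where "h' y = P \<circ> g' (Q y) \<circ> Q" for y
  have S'S: "y \<in> S' \<longleftrightarrow> Q y \<in> S" for y by (simp add: S'_def)
  have S'borel: "S' \<in> sets borel" unfolding S'_def using measurable_sets[of Q borel borel S] S by simp
  have im: "y \<in> h ` S' \<longleftrightarrow> Q y \<in> g ` S" for y
  proof
    assume "Q y \<in> g ` S"
    then obtain x where x: "x \<in> S" "Q y = g x" by auto
    then have "y = h (P x)" using PQ by (metis comp_apply h_def)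
    then show "y \<in> h ` S'" using x PQ by (auto simp: S'_def)
  qed (auto simp: h_def S'_def PQ)
  have det: "det (matrix (h' y)) = det (matrix (g' (Q y)))" for y
  proof -
    have "inv e i = j \<longleftrightarrow> i = e j" for i j
      using e by (metis bij_inv_eq_iff)
    then have "Q (axis j 1) = axis (e j) 1" for j
      unfolding Q_def by (simp add: vec_eq_iff axis_def)
    then have "matrix (h' y) = (\<chi> i j. matrix (g' (Q y)) $ e i $ e j)"
      by (simp add: matrix_def h'_def P_def)
    then show ?thesis using det_reindex[OF e] by simp
  qed
  have main: "(\<integral>\<^sup>+y. ennreal (indicator (h ` S') y * f (Q y)) \<partial>lebesgue)
    = (\<integral>\<^sup>+x. ennreal (indicator S' x * (\<bar>det (matrix (h' x))\<bar> * f (Q (h x)))) \<partial>lebesgue)"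
  proof (rule nn_integral_change_of_variables_wellorder)
    show "S' \<in> sets lebesgue" using S'borel by simp
    show "inj_on h S'"
    proof (rule inj_onI)
      fix x y assume "x \<in> S'" "y \<in> S'" "h x = h y"
      then have "g (Q x) = g (Q y)" using PQ(1) by (metis comp_apply h_def)
      then have "Q x = Q y" using inj \<open>x \<in> S'\<close> \<open>y \<in> S'\<close> by (simp add: S'S inj_on_def)
      then show "x = y" using PQ(2) by metis
    qed
    show "(h has_derivative h' y) (at y within S')" if "y \<in> S'" for y
    proof -
      have Q: "(Q has_derivative Q) (at y within S')" and P: "(P has_derivative P) (at x within X)" for x X
        using lin by (auto intro: linear_imp_has_derivative)
      have "(g has_derivative g' (Q y)) (at (Q y) within Q ` S')"
        by (rule has_derivative_subset[OF der]) (use that in \<open>auto simp: S'_def\<close>)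
      from diff_chain_within[OF diff_chain_within[OF Q this] P]
      show ?thesis by (simp add: h_def h'_def o_assoc)
    qed
    show "0 \<le> f (Q y)" if "y \<in> h ` S'" for y using f im that by auto
    have "(\<lambda>y. indicator (h ` S') y * f (Q y)) = (\<lambda>y. indicator (g ` S) (Q y) * f (Q y))"
      using im by (auto simp: indicator_def)
    also have "\<dots> \<in> borel_measurable borel" using measurable_compose[of Q borel borel, OF _ m(1)] by simp
    finally show "(\<lambda>y. indicator (h ` S') y * f (Q y)) \<in> borel_measurable lebesgue"
      by (simp add: measurable_completion)
    have "(\<lambda>y. indicator S' y * (\<bar>det (matrix (h' y))\<bar> * f (Q (h y)))) = (\<lambda>y. indicator S (Q y) * (\<bar>det (matrix (g' (Q y)))\<bar> * f (g (Q y))))"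
      by (auto simp: S'_def det h_def PQ indicator_def)
    also have "\<dots> \<in> borel_measurable borel" using measurable_compose[of Q borel borel, OF _ m(2)] by simp
    finally show "(\<lambda>y. indicator S' y * (\<bar>det (matrix (h' y))\<bar> * f (Q (h y)))) \<in> borel_measurable lebesgue"
      by (simp add: measurable_completion)
  qed
  have distr: "(\<integral>\<^sup>+y. ennreal (F (Q y)) \<partial>lebesgue) = (\<integral>\<^sup>+x. ennreal (F x) \<partial>lborel)"
    if [measurable]: "F \<in> borel_measurable borel" for F :: "real^'n \<Rightarrow> real"
  proof -
    have "(\<integral>\<^sup>+y. ennreal (F (Q y)) \<partial>lebesgue) = (\<integral>\<^sup>+y. ennreal (F (Q y)) \<partial>lborel)"
      by (rule nn_integral_completion)
    also have "\<dots> = (\<integral>\<^sup>+x. ennreal (F x) \<partial>distr lborel lborel Q)"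
      by (subst nn_integral_distr) auto
    also have "distr lborel lborel Q = lborel"
      unfolding Q_def by (rule distr_reindex[OF bij_imp_bij_inv[OF e]])
    finally show ?thesis .
  qed
  have im_eq: "(\<lambda>y. indicator (h ` S') y * f (Q y)) = (\<lambda>y. indicator (g ` S) (Q y) * f (Q y))"
    using im by (auto simp: indicator_def)
  have dom_eq: "(\<lambda>y. indicator S' y * (\<bar>det (matrix (h' y))\<bar> * f (Q (h y)))) = (\<lambda>y. indicator S (Q y) * (\<bar>det (matrix (g' (Q y)))\<bar> * f (g (Q y))))"
    by (auto simp: S'_def det h_def PQ indicator_def)
  show ?thesis
    using main unfolding fun_cong[OF im_eq] fun_cong[OF dom_eq] distr[OF m(1)] distr[OF m(2)] .
qed

section \<open>Riemannian manifolds\<close>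

text \<open>The segment from the identity to \<open>G\<close> consists of positive definite, hence
  invertible, matrices; the determinant starts at 1 and cannot reach 0.\<close>

lemma det_pos_of_positive_definite:
  fixes G :: "real^'n^'n"
  assumes pos: "\<And>v. v \<noteq> 0 \<Longrightarrow> v \<bullet> (G *v v) > 0"
  shows "det G > 0"
proof (rule ccontr)
  assume "\<not> det G > 0"
  define P where "P t = (1 - t) *\<^sub>R mat 1 + t *\<^sub>R G" for t :: real
  have nz: "det (P t) \<noteq> 0" if "0 \<le> t" "t \<le> 1" for t
  proof
    assume "det (P t) = 0"
    then obtain v where v: "v \<noteq> 0" "P t *v v = 0"
      using invertible_det_nz[of "P t"] invertible_left_inverse matrix_left_invertible_ker by blast
    have "P t *v v = (1 - t) *\<^sub>R v + t *\<^sub>R (G *v v)"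
      by (simp add: P_def matrix_vector_mult_add_rdistrib flip: scaleR_matrix_vector_assoc)
    then have "v \<bullet> (P t *v v) = (1 - t) * (v \<bullet> v) + t * (v \<bullet> (G *v v))"
      by (simp add: inner_add_right)
    moreover have "\<dots> > 0"
    proof (cases "t = 0")
      case False
      then have "t * (v \<bullet> (G *v v)) > 0" using pos[OF v(1)] that by simp
      then show ?thesis using that by (simp add: add_nonneg_pos)
    qed (use v in simp)
    ultimately show False using v by simp
  qed
  have P0: "det (P 0) = 1" and P1: "P 1 = G" by (simp_all add: P_def)
  have "continuous_on {0..1} (\<lambda>t. det (P t))"
    unfolding P_def det_def by (intro continuous_intros)
  then have "\<exists>t\<ge>0. t \<le> 1 \<and> det (P t) = 0"
    using IVT2'[of "\<lambda>t. det (P t)" 1 0 0] P0 P1 \<open>\<not> det G > 0\<close> by auto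
  then show False using nz by blast
qed

lemma suminf_emeasure_Int:
  assumes "\<And>i::nat. S i \<in> sets K" "disjoint_family S" "B \<in> sets K"
  shows "(\<Sum>i. emeasure K (B \<inter> S i)) = emeasure K (B \<inter> (\<Union>i. S i))"
proof -
  have "(\<Sum>i. emeasure K (B \<inter> S i)) = emeasure K (\<Union>i. B \<inter> S i)"
  proof (rule suminf_emeasure)
    show "range (\<lambda>i. B \<inter> S i) \<subseteq> sets K" using assms by (intro image_subsetI sets.Int)
    show "disjoint_family (\<lambda>i. B \<inter> S i)" using assms(2) unfolding disjoint_family_on_def by blast
  qed
  then show ?thesis by (simp only: Int_UN_distrib)
qed

section \<open>Charts, transition maps and the components of the metric\<close>

locale riemannian =
  fixes A :: "('a::{t2_space, second_countable_topology}, 'n::finite) chart set"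
    and gM :: "('a, 'n) metric"
  assumes riem: "riemannian_manifold A gM"
begin

abbreviation R :: "('a, 'n) chart \<Rightarrow> (real^'n) set" where "R \<equiv> chart_range"

definition dens :: "('a, 'n) chart \<Rightarrow> real^'n \<Rightarrow> real" where
  "dens c y = sqrt (det (gM c y))"

definition ginv :: "('a, 'n) chart \<Rightarrow> 'n \<Rightarrow> 'n \<Rightarrow> real^'n \<Rightarrow> real" where
  "ginv c i j y = matrix_inv (gM c y) $ i $ j"

lemma atlas: "smooth_atlas A"
  using riem by (simp add: riemannian_manifold_def)

lemma chart_exists: "\<exists>c\<in>A. x \<in> fst c"
  using atlas unfolding smooth_atlas_def by blast

lemma open_dom: "c \<in> A \<Longrightarrow> open (fst c)"
  and open_R: "c \<in> A \<Longrightarrow> open (R c)"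
  and homeo: "c \<in> A \<Longrightarrow> homeomorphism (fst c) (R c) (snd c) (chart_inv c)"
  using atlas unfolding smooth_atlas_def by blast+

lemma chart_inv_snd: "c \<in> A \<Longrightarrow> x \<in> fst c \<Longrightarrow> chart_inv c (snd c x) = x"
  by (rule homeomorphism_apply1[OF homeo])

lemma snd_chart_inv: "c \<in> A \<Longrightarrow> y \<in> R c \<Longrightarrow> snd c (chart_inv c y) = y"
  by (rule homeomorphism_apply2[OF homeo])

lemma snd_R: "x \<in> fst c \<Longrightarrow> snd c x \<in> R c"
  by (simp add: chart_range_def)

lemma chart_inv_dom: "y \<in> R c \<Longrightarrow> chart_inv c y \<in> fst c"
  by (simp add: chart_range_def chart_inv_def inv_into_into)

lemma cont_snd: "c \<in> A \<Longrightarrow> continuous_on (fst c) (snd c)"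
  by (rule homeomorphism_cont1[OF homeo])

lemma cont_chart_inv: "c \<in> A \<Longrightarrow> continuous_on (R c) (chart_inv c)"
  by (rule homeomorphism_cont2[OF homeo])

lemma snd_image:
  assumes "c \<in> A" "B \<subseteq> fst c"
  shows "snd c ` B = {y \<in> R c. chart_inv c y \<in> B}"
proof (intro equalityI subsetI)
  fix y assume "y \<in> snd c ` B"
  then obtain x where x: "x \<in> B" "y = snd c x" by blast
  then have "x \<in> fst c" using assms(2) by blast
  then show "y \<in> {y \<in> R c. chart_inv c y \<in> B}" using x chart_inv_snd[OF assms(1)] snd_R by simp
next
  fix y assume y: "y \<in> {y \<in> R c. chart_inv c y \<in> B}"
  then have "y = snd c (chart_inv c y)" using snd_chart_inv[OF assms(1), of y] by simp
  then show "y \<in> snd c ` B" using y by blast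
qed

lemma open_snd_image:
  assumes "c \<in> A" "open B" "B \<subseteq> fst c"
  shows "open (snd c ` B)"
proof -
  have "snd c ` B = R c \<inter> chart_inv c -` B" using snd_image[OF assms(1,3)] by auto
  then show ?thesis
    using continuous_open_preimage[OF cont_chart_inv[OF assms(1)] open_R[OF assms(1)] assms(2)] by simp
qed

lemma open_overlap: "c \<in> A \<Longrightarrow> d \<in> A \<Longrightarrow> open (snd c ` (fst c \<inter> fst d))"
  by (intro open_snd_image open_Int open_dom) auto

lemma measurable_chart_inv:
  assumes "c \<in> A"
  shows "chart_inv c \<in> borel_measurable (restrict_space borel (R c))"
  by (rule borel_measurable_continuous_on_restrict[OF cont_chart_inv[OF assms]])

lemma borel_snd_image:
  assumes "c \<in> A" "B \<in> sets borel" "B \<subseteq> fst c"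
  shows "snd c ` B \<in> sets borel"
proof -
  have "chart_inv c -` B \<inter> space (restrict_space borel (R c)) \<in> sets (restrict_space borel (R c))"
    using measurable_chart_inv[OF assms(1)] assms(2) by (rule measurable_sets)
  then have "chart_inv c -` B \<inter> R c \<in> sets borel"
    using open_R[OF assms(1)] by (subst (asm) sets_restrict_space_iff) (auto simp: space_restrict_space)
  moreover have "snd c ` B = chart_inv c -` B \<inter> R c" using snd_image[OF assms(1,3)] by auto
  ultimately show ?thesis by simp
qed

lemma metric_smooth: "c \<in> A \<Longrightarrow> Ck_on k (R c) (\<lambda>y. gM c y $ i $ j)"
  using riem unfolding riemannian_manifold_def smooth_on_def by blast

lemma metric_sym: "c \<in> A \<Longrightarrow> y \<in> R c \<Longrightarrow> transpose (gM c y) = gM c y"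
  and metric_pos: "c \<in> A \<Longrightarrow> y \<in> R c \<Longrightarrow> v \<noteq> 0 \<Longrightarrow> v \<bullet> (gM c y *v v) > 0"
  using riem unfolding riemannian_manifold_def by blast+

lemma det_metric_pos: "c \<in> A \<Longrightarrow> y \<in> R c \<Longrightarrow> det (gM c y) > 0"
  using det_pos_of_positive_definite metric_pos by blast

lemma dens_pos: "c \<in> A \<Longrightarrow> y \<in> R c \<Longrightarrow> dens c y > 0"
  using det_metric_pos by (simp add: dens_def)

lemma Ck_on_dens: "c \<in> A \<Longrightarrow> Ck_on k (R c) (dens c)"
  unfolding dens_def[abs_def]
  by (intro Ck_on_sqrt Ck_on_det metric_smooth open_R det_metric_pos)

lemma Ck_on_ginv: "c \<in> A \<Longrightarrow> Ck_on k (R c) (ginv c i j)"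
  unfolding ginv_def[abs_def]
  by (intro Ck_on_matrix_inv metric_smooth open_R less_imp_neq[OF det_metric_pos, symmetric])

lemma metric_transform:
  assumes "c \<in> A" "d \<in> A" "y \<in> snd c ` (fst c \<inter> fst d)"
  defines "J \<equiv> matrix (frechet_derivative (transition c d) (at y))"
  shows "gM c y = transpose J ** gM d (transition c d y) ** J"
  using riem assms unfolding riemannian_manifold_def Let_def by blast

lemma transition_smooth:
  "c \<in> A \<Longrightarrow> d \<in> A \<Longrightarrow> Ck_on k (snd c ` (fst c \<inter> fst d)) (\<lambda>y. transition c d y $ i)"
  using atlas unfolding smooth_atlas_def smooth_on_def by blast

lemma transition_has_derivative:
  assumes "c \<in> A" "d \<in> A" "y \<in> snd c ` (fst c \<inter> fst d)"
  shows "(transition c d has_derivative frechet_derivative (transition c d) (at y)) (at y)"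
proof -
  have "(\<lambda>y. transition c d y $ i) differentiable at y" for i
    using Ck_on_differentiable_at[OF transition_smooth[OF assms(1,2), of "Suc 0"] open_overlap[OF assms(1,2)] assms(3)] .
  then have "transition c d differentiable at y"
    by (subst differentiable_componentwise_within) (auto simp: Basis_vec_def inner_axis)
  then show ?thesis by (simp add: frechet_derivative_works)
qed

lemma transition_inj:
  assumes "c \<in> A" "d \<in> A"
  shows "inj_on (transition c d) (snd c ` (fst c \<inter> fst d))"
proof (rule inj_onI)
  fix y z assume yz: "y \<in> snd c ` (fst c \<inter> fst d)" "z \<in> snd c ` (fst c \<inter> fst d)"
    and eq: "transition c d y = transition c d z"
  obtain x x' where x: "x \<in> fst c \<inter> fst d" "y = snd c x" "x' \<in> fst c \<inter> fst d" "z = snd c x'"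
    using yz by blast
  then have "snd d x = snd d x'" using eq assms by (simp add: transition_def chart_inv_snd)
  then have "x = x'" using x chart_inv_snd[OF assms(2)] by (metis IntD2)
  then show "y = z" using x by simp
qed

lemma transition_image:
  assumes "c \<in> A" "B \<subseteq> fst c"
  shows "transition c d ` snd c ` B = snd d ` B"
  unfolding image_image transition_def
  using assms(2) by (intro image_cong[OF refl]) (simp add: chart_inv_snd[OF assms(1)] subset_iff)

text \<open>Determinants in the transformation law: \<open>det (gM c y)\<close> is the squared
  Jacobian determinant times the determinant in the other chart.\<close>

lemma dens_transform:
  assumes "c \<in> A" "d \<in> A" "y \<in> snd c ` (fst c \<inter> fst d)"
  shows "dens c y = \<bar>det (matrix (frechet_derivative (transition c d) (at y)))\<bar> * dens d (transition c d y)"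
  unfolding dens_def
  by (subst metric_transform[OF assms])
    (simp add: det_mul det_transpose real_sqrt_mult mult.commute mult.left_commute flip: power2_eq_square)

lemma measurable_dens:
  assumes "c \<in> A" "S \<in> sets borel" "S \<subseteq> R c"
  shows "(\<lambda>y. indicator S y * dens c y) \<in> borel_measurable borel"
proof -
  have "continuous_on S (dens c)"
    using Ck_on_imp_continuous_on[OF Ck_on_dens[OF assms(1), of 0]] assms(3) by (rule continuous_on_subset)
  from borel_measurable_continuous_on_indicator[OF assms(2) this] show ?thesis by simp
qed

text \<open>The Jacobian of the transition map is exactly the quotient of the densities. This is the
  compatibility from which the global volume is assembled.\<close>

lemma chart_volume_transform:
  assumes c: "c \<in> A" and d: "d \<in> A" and B: "B \<in> sets borel" "B \<subseteq> fst c \<inter> fst d"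
  shows "(\<integral>\<^sup>+y. ennreal (indicator (snd d ` B) y * dens d y) \<partial>lborel)
    = (\<integral>\<^sup>+y. ennreal (indicator (snd c ` B) y * dens c y) \<partial>lborel)"
proof -
  let ?J = "\<lambda>y. frechet_derivative (transition c d) (at y)"
  have sub: "snd c ` B \<subseteq> snd c ` (fst c \<inter> fst d)" using B by blast
  have BR: "snd c ` B \<subseteq> R c" "snd d ` B \<subseteq> R d" using B snd_R by blast+
  have Bb: "snd c ` B \<in> sets borel" "snd d ` B \<in> sets borel" using borel_snd_image[OF c] borel_snd_image[OF d] B by blast+
  have im: "transition c d ` snd c ` B = snd d ` B" using transition_image[OF c] B by blast
  have eq: "(\<lambda>y. indicator (snd c ` B) y * (\<bar>det (matrix (?J y))\<bar> * dens d (transition c d y)))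
    = (\<lambda>y. indicator (snd c ` B) y * dens c y)"
  proof
    fix y
    show "indicator (snd c ` B) y * (\<bar>det (matrix (?J y))\<bar> * dens d (transition c d y)) = indicator (snd c ` B) y * dens c y"
    proof (cases "y \<in> snd c ` B")
      case True
      then have "y \<in> snd c ` (fst c \<inter> fst d)" using sub by blast
      from dens_transform[OF c d this] show ?thesis by simp
    qed simp
  qed
  have "(\<integral>\<^sup>+y. ennreal (indicator (transition c d ` snd c ` B) y * dens d y) \<partial>lborel)
    = (\<integral>\<^sup>+y. ennreal (indicator (snd c ` B) y * (\<bar>det (matrix (?J y))\<bar> * dens d (transition c d y))) \<partial>lborel)"
  proof (rule nn_integral_change_of_variables)
    show "snd c ` B \<in> sets borel" by (fact Bb)
    show "(transition c d has_derivative ?J y) (at y within snd c ` B)" if "y \<in> snd c ` B" for y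
      using transition_has_derivative[OF c d] sub that by (meson has_derivative_at_withinI subsetD)
    show "inj_on (transition c d) (snd c ` B)" using transition_inj[OF c d] sub by (rule inj_on_subset)
    show "0 \<le> dens d y" if "y \<in> transition c d ` snd c ` B" for y
      using that BR dens_pos[OF d, of y] unfolding im by (simp add: less_imp_le subset_iff)
    show "(\<lambda>y. indicator (transition c d ` snd c ` B) y * dens d y) \<in> borel_measurable borel"
      unfolding im using measurable_dens[OF d Bb(2) BR(2)] .
    show "(\<lambda>y. indicator (snd c ` B) y * (\<bar>det (matrix (?J y))\<bar> * dens d (transition c d y))) \<in> borel_measurable borel"
      unfolding eq using measurable_dens[OF c Bb(1) BR(1)] .
  qed
  then show ?thesis unfolding im fun_cong[OF eq] .
qed

section \<open>The Riemannian volume measure\<close>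

definition chart_measure :: "('a, 'n) chart \<Rightarrow> 'a measure" where
  "chart_measure c = distr (density (restrict_space lborel (R c)) (\<lambda>y. ennreal (dens c y))) borel (chart_inv c)"

lemma sets_chart_measure [simp]: "sets (chart_measure c) = sets borel"
  by (simp add: chart_measure_def)

lemma measurable_chart_inv':
  "c \<in> A \<Longrightarrow> chart_inv c \<in> density (restrict_space lborel (R c)) f \<rightarrow>\<^sub>M borel"
  using measurable_chart_inv[of c] by (simp add: measurable_def space_restrict_space sets_restrict_space)

lemma measurable_dens':
  "c \<in> A \<Longrightarrow> dens c \<in> borel_measurable (restrict_space lborel (R c))"
  using borel_measurable_continuous_on_restrict[OF Ck_on_imp_continuous_on[OF Ck_on_dens[of c 0]]]
  by (simp add: measurable_def space_restrict_space sets_restrict_space)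

lemma nn_integral_chart_measure:
  assumes c: "c \<in> A" and [measurable]: "F \<in> borel_measurable borel"
  shows "(\<integral>\<^sup>+x. F x \<partial>chart_measure c)
    = (\<integral>\<^sup>+y. ennreal (dens c y) * F (chart_inv c y) * indicator (R c) y \<partial>lborel)"
proof -
  have m: "(\<lambda>y. F (chart_inv c y)) \<in> borel_measurable (restrict_space lborel (R c))"
    using measurable_compose[OF measurable_chart_inv[OF c] assms(2)]
    by (simp add: measurable_def space_restrict_space sets_restrict_space)
  have "(\<integral>\<^sup>+x. F x \<partial>chart_measure c) = (\<integral>\<^sup>+y. F (chart_inv c y) \<partial>density (restrict_space lborel (R c)) (\<lambda>y. ennreal (dens c y)))"
    unfolding chart_measure_def using measurable_chart_inv'[OF c] by (subst nn_integral_distr) auto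
  also have "\<dots> = (\<integral>\<^sup>+y. ennreal (dens c y) * F (chart_inv c y) \<partial>restrict_space lborel (R c))"
    using measurable_dens'[OF c] m by (subst nn_integral_density) auto
  also have "\<dots> = (\<integral>\<^sup>+y. ennreal (dens c y) * F (chart_inv c y) * indicator (R c) y \<partial>lborel)"
    using open_R[OF c] by (subst nn_integral_restrict_space) auto
  finally show ?thesis .
qed

lemma emeasure_chart_measure:
  assumes c: "c \<in> A" and B: "B \<in> sets borel" "B \<subseteq> fst c"
  shows "emeasure (chart_measure c) B = (\<integral>\<^sup>+y. ennreal (indicator (snd c ` B) y * dens c y) \<partial>lborel)"
proof -
  have "emeasure (chart_measure c) B = (\<integral>\<^sup>+x. indicator B x \<partial>chart_measure c)"
    using B by simp
  also have "\<dots> = (\<integral>\<^sup>+y. ennreal (dens c y) * indicator B (chart_inv c y) * indicator (R c) y \<partial>lborel)"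
    using B by (intro nn_integral_chart_measure c) auto
  also have "\<dots> = (\<integral>\<^sup>+y. ennreal (indicator (snd c ` B) y * dens c y) \<partial>lborel)"
    using snd_image[OF c B(2)] by (intro nn_integral_cong) (auto simp: indicator_def)
  finally show ?thesis .
qed

lemma chart_measure_compat:
  assumes "c \<in> A" "d \<in> A" "B \<in> sets borel" "B \<subseteq> fst c \<inter> fst d"
  shows "emeasure (chart_measure c) B = emeasure (chart_measure d) B"
  using chart_volume_transform[OF assms] assms by (simp add: emeasure_chart_measure)

text \<open>Second countability enters through Lindelof's theorem; indexing by natural numbers is
  what \<open>disjointed\<close> asks for.\<close>

lemma countable_charts:
  "\<exists>C :: nat \<Rightarrow> ('a, 'n) chart. (\<forall>n. C n \<in> A) \<and> (\<Union>n. fst (C n)) = UNIV"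
proof -
  have op: "\<And>S. S \<in> fst ` A \<Longrightarrow> open S" using open_dom by auto
  obtain F where F: "F \<subseteq> fst ` A" "countable F" "\<Union>F = \<Union>(fst ` A)"
    using Lindelof[OF op] by metis
  have cover: "\<Union>(fst ` A) = UNIV" using chart_exists by auto
  then have "F \<noteq> {}" using F by auto
  have "\<exists>c\<in>A. fst c = from_nat_into F n" for n
  proof -
    have "from_nat_into F n \<in> fst ` A" using from_nat_into[OF \<open>F \<noteq> {}\<close>, of n] F(1) by blast
    then show ?thesis by force
  qed
  then obtain C where C: "\<And>n. C n \<in> A" "\<And>n. fst (C n) = from_nat_into F n" by metis
  have "(\<Union>n. fst (C n)) = UNIV"
    unfolding C(2) using range_from_nat_into[OF \<open>F \<noteq> {}\<close> F(2)] F(3) cover by simp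
  then show ?thesis using C(1) by blast
qed

text \<open>The manifold is cut into countably many disjoint Borel pieces \<open>D n\<close>, each
  inside one chart, and the chart measures of the pieces are added. Agreement with any other chart
  holds piece by piece.\<close>

lemma volume_exists:
  "\<exists>M. sets M = sets borel \<and> (\<forall>c\<in>A. \<forall>B\<in>sets borel. B \<subseteq> fst c \<longrightarrow> emeasure M B = emeasure (chart_measure c) B)"
proof -
  from countable_charts obtain C :: "nat \<Rightarrow> ('a, 'n) chart"
    where "\<forall>n. C n \<in> A" and C2: "(\<Union>n. fst (C n)) = UNIV" by (elim exE conjE)
  then have C1: "C n \<in> A" for n by (elim allE)
  note C = C1 C2
  define D where "D = disjointed (\<lambda>n. fst (C n))"
  have D: "D n \<in> sets borel" "D n \<subseteq> fst (C n)" for n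
  proof -
    have "range (\<lambda>n. fst (C n)) \<subseteq> sets borel" using open_dom[OF C(1)] by (intro image_subsetI borel_open)
    then show "D n \<in> sets borel" unfolding D_def using sets.range_disjointed_sets by blast
    show "D n \<subseteq> fst (C n)" unfolding D_def by (rule disjointed_subset)
  qed
  have Dd: "disjoint_family D" "(\<Union>n. D n) = UNIV"
    using C(2) by (auto simp: D_def disjoint_family_disjointed UN_disjointed_eq)
  define \<mu> where "\<mu> B = (\<Sum>n. emeasure (chart_measure (C n)) (B \<inter> D n))" for B
  define M where "M = measure_of UNIV (sets borel) \<mu>"
  have sets_M: "sets M = sets borel" unfolding M_def by (simp add: sets.sigma_sets_eq[of borel, simplified])
  have em: "emeasure M B = \<mu> B" if "B \<in> sets borel" for B
  proof (rule emeasure_measure_of[OF M_def])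
    show "sets borel \<subseteq> Pow UNIV" by simp
    show "B \<in> sets M" using that sets_M by simp
    show "positive (sets M) \<mu>" by (simp add: positive_def \<mu>_def)
    show "countably_additive (sets M) \<mu>"
    proof (rule countably_additiveI)
      fix S :: "nat \<Rightarrow> 'a set" assume S: "range S \<subseteq> sets M" "disjoint_family S" "(\<Union>i. S i) \<in> sets M"
      \<comment> \<open>The inner series is written as an integral over a counting measure, so that
        exchanging the two series is an instance of monotone convergence.\<close>
      have "(\<Sum>i. \<mu> (S i)) = (\<Sum>i. \<integral>\<^sup>+n. emeasure (chart_measure (C n)) (S i \<inter> D n) \<partial>count_space UNIV)"
        unfolding \<mu>_def by (simp add: nn_integral_count_space_nat)
      also have "\<dots> = (\<integral>\<^sup>+n. (\<Sum>i. emeasure (chart_measure (C n)) (S i \<inter> D n)) \<partial>count_space UNIV)"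
        by (rule nn_integral_suminf[symmetric]) simp
      also have "\<dots> = (\<integral>\<^sup>+n. emeasure (chart_measure (C n)) ((\<Union>i. S i) \<inter> D n) \<partial>count_space UNIV)"
      proof (rule nn_integral_cong)
        fix n
        have "S i \<in> sets borel" for i using S(1) sets_M by blast
        then show "(\<Sum>i. emeasure (chart_measure (C n)) (S i \<inter> D n)) = emeasure (chart_measure (C n)) ((\<Union>i. S i) \<inter> D n)"
          unfolding Int_commute[of _ "D n"] using S(2) D(1) by (intro suminf_emeasure_Int) simp_all
      qed
      also have "\<dots> = \<mu> (\<Union>i. S i)" unfolding \<mu>_def by (simp add: nn_integral_count_space_nat)
      finally show "(\<Sum>i. \<mu> (S i)) = \<mu> (\<Union>i. S i)" .
    qed
  qed
  have "emeasure M B = emeasure (chart_measure c) B" if c: "c \<in> A" and B: "B \<in> sets borel" "B \<subseteq> fst c" for c B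
  proof -
    have "emeasure M B = (\<Sum>n. emeasure (chart_measure c) (B \<inter> D n))"
      unfolding em[OF B(1)] \<mu>_def
    proof (intro suminf_cong chart_measure_compat c C(1))
      fix n
      show "B \<inter> D n \<in> sets borel" using B(1) D(1) by (rule sets.Int)
      show "B \<inter> D n \<subseteq> fst (C n) \<inter> fst c" using B(2) D(2) by blast
    qed
    also have "\<dots> = emeasure (chart_measure c) (B \<inter> (\<Union>n. D n))"
      using D(1) B(1) Dd(1) by (intro suminf_emeasure_Int) simp_all
    also have "B \<inter> (\<Union>n. D n) = B" using Dd(2) by simp
    finally show ?thesis .
  qed
  then show ?thesis using sets_M by blast
qed

text \<open>A Borel set is cut along disjoint pieces lying in single charts, where both measures are
  prescribed.\<close>

lemma volume_unique:
  assumes M: "sets M = sets borel" "\<And>c B. c \<in> A \<Longrightarrow> B \<in> sets borel \<Longrightarrow> B \<subseteq> fst c \<Longrightarrow> emeasure M B = emeasure (chart_measure c) B"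
    and N: "sets N = sets borel" "\<And>c B. c \<in> A \<Longrightarrow> B \<in> sets borel \<Longrightarrow> B \<subseteq> fst c \<Longrightarrow> emeasure N B = emeasure (chart_measure c) B"
  shows "M = N"
proof (rule measure_eqI)
  fix B assume "B \<in> sets M"
  then have B: "B \<in> sets borel" using M by simp
  from countable_charts obtain C :: "nat \<Rightarrow> ('a, 'n) chart"
    where "\<forall>n. C n \<in> A" and C2: "(\<Union>n. fst (C n)) = UNIV" by (elim exE conjE)
  then have C1: "C n \<in> A" for n by (elim allE)
  note C = C1 C2
  define D where "D = disjointed (\<lambda>n. fst (C n))"
  have D: "D n \<in> sets borel" "D n \<subseteq> fst (C n)" for n
  proof -
    have "range (\<lambda>n. fst (C n)) \<subseteq> sets borel" using open_dom[OF C(1)] by (intro image_subsetI borel_open)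
    then show "D n \<in> sets borel" unfolding D_def using sets.range_disjointed_sets by blast
    show "D n \<subseteq> fst (C n)" unfolding D_def by (rule disjointed_subset)
  qed
  have Dd: "disjoint_family D" "(\<Union>n. D n) = UNIV"
    using C(2) by (auto simp: D_def disjoint_family_disjointed UN_disjointed_eq)
  have "emeasure K B = (\<Sum>n. emeasure K (B \<inter> D n))" if "sets K = sets borel" for K
    using suminf_emeasure_Int[of D K B] D(1) B Dd that by simp
  moreover have "emeasure M (B \<inter> D n) = emeasure N (B \<inter> D n)" for n
  proof -
    have "B \<inter> D n \<in> sets borel" "B \<inter> D n \<subseteq> fst (C n)" using B D[of n] by blast+
    then show ?thesis using M(2)[OF C(1)] N(2)[OF C(1)] by metis
  qed
  ultimately show "emeasure M B = emeasure N B" using M N by simp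
qed (use M N in simp)

definition vol :: "'a measure" where "vol = riem_volume A gM"

text \<open>\<open>riem_volume\<close> is a definite description, so its properties become available
  only through existence and uniqueness together.\<close>

lemma sets_vol: "sets vol = sets borel"
  and emeasure_vol: "c \<in> A \<Longrightarrow> B \<in> sets borel \<Longrightarrow> B \<subseteq> fst c \<Longrightarrow> emeasure vol B = emeasure (chart_measure c) B"
proof -
  from volume_exists obtain M where M: "sets M = sets borel"
    "\<forall>c\<in>A. \<forall>B\<in>sets borel. B \<subseteq> fst c \<longrightarrow> emeasure M B = emeasure (chart_measure c) B"
    by (elim exE conjE)
  have eq: "(\<integral>\<^sup>+y\<in>snd c ` B. ennreal (sqrt (det (gM c y))) \<partial>lborel) = emeasure (chart_measure c) B"
    if "c \<in> A" "B \<in> sets borel" "B \<subseteq> fst c" for c B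
    unfolding emeasure_chart_measure[OF that] dens_def
    by (intro nn_integral_cong) (simp split: split_indicator)
  have "riem_volume A gM = M"
    unfolding riem_volume_def
  proof (rule the_equality)
    show "sets M = sets borel \<and> (\<forall>c\<in>A. \<forall>B\<in>sets borel. B \<subseteq> fst c \<longrightarrow>
        emeasure M B = (\<integral>\<^sup>+y\<in>snd c ` B. ennreal (sqrt (det (gM c y))) \<partial>lborel))"
      using M by (intro conjI ballI impI) (simp_all only: eq)
    fix N assume N: "sets N = sets borel \<and> (\<forall>c\<in>A. \<forall>B\<in>sets borel. B \<subseteq> fst c \<longrightarrow>
        emeasure N B = (\<integral>\<^sup>+y\<in>snd c ` B. ennreal (sqrt (det (gM c y))) \<partial>lborel))"
    show "N = M"
    proof (rule volume_unique)
      show "emeasure N B = emeasure (chart_measure c) B" if "c \<in> A" "B \<in> sets borel" "B \<subseteq> fst c" for c B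
        using N that eq[OF that] by simp
      show "emeasure M B = emeasure (chart_measure c) B" if "c \<in> A" "B \<in> sets borel" "B \<subseteq> fst c" for c B
        using M(2) that by simp
    qed (use M N in simp_all)
  qed
  then have "vol = M" by (simp add: vol_def)
  then show "sets vol = sets borel" "c \<in> A \<Longrightarrow> B \<in> sets borel \<Longrightarrow> B \<subseteq> fst c \<Longrightarrow> emeasure vol B = emeasure (chart_measure c) B"
    using M by simp_all
qed

end

section \<open>Integration by parts in Euclidean space\<close>

lemma integrable_compact_support:
  fixes v :: "'b::euclidean_space \<Rightarrow> real"
  assumes "continuous_on UNIV v" "compact K" "\<And>x. x \<notin> K \<Longrightarrow> v x = 0"
  shows "integrable lborel v"
proof -
  have "integrable lborel (\<lambda>x. indicator K x *\<^sub>R v x)"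
    using assms(2) continuous_on_subset[OF assms(1)] by (intro borel_integrable_compact) auto
  moreover have "(\<lambda>x. indicator K x *\<^sub>R v x) = v" using assms(3) by (auto simp: indicator_def fun_eq_iff)
  ultimately show ?thesis by simp
qed

lemma integral_translation:
  fixes v :: "'b::euclidean_space \<Rightarrow> real"
  assumes "v \<in> borel_measurable borel"
  shows "(\<integral>x. v (x + h) \<partial>lborel) = (\<integral>x. v x \<partial>lborel)"
proof -
  have "(\<integral>x. v x \<partial>lborel) = (\<integral>x. v x \<partial>distr lborel borel ((+) h))" by (simp add: lborel_distr_plus)
  also have "\<dots> = (\<integral>x. v (h + x) \<partial>lborel)" using assms by (intro integral_distr) auto
  finally show ?thesis by (simp add: add.commute)
qed

lemma integrable_translation:
  fixes v :: "'b::euclidean_space \<Rightarrow> real"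
  assumes "integrable lborel v"
  shows "integrable lborel (\<lambda>x. v (x + h))"
proof -
  have "integrable (distr lborel borel ((+) h)) v" using assms by (simp add: lborel_distr_plus)
  then have "integrable lborel (\<lambda>x. v (h + x))" by (subst (asm) integrable_distr_eq) (use assms in auto)
  then show ?thesis by (simp add: add.commute)
qed

lemma pderiv_at_line:
  assumes "v differentiable at (x + s *\<^sub>R axis i 1)"
  shows "((\<lambda>s. v (x + s *\<^sub>R axis i 1)) has_real_derivative pderiv_at i v (x + s *\<^sub>R axis i 1)) (at s)"
proof -
  let ?z = "x + s *\<^sub>R axis i 1"
  have 1: "((\<lambda>s. x + s *\<^sub>R axis i 1) has_derivative (\<lambda>t. t *\<^sub>R axis i 1)) (at s)"
    by (auto intro!: derivative_eq_intros)
  have "(v has_derivative frechet_derivative v (at ?z)) (at ?z)" using assms by (simp add: frechet_derivative_works)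
  from has_derivative_compose[OF 1 this]
  have "((\<lambda>s. v (x + s *\<^sub>R axis i 1)) has_derivative (\<lambda>t. frechet_derivative v (at ?z) (t *\<^sub>R axis i 1))) (at s)" .
  moreover have "frechet_derivative v (at ?z) (t *\<^sub>R axis i 1) = pderiv_at i v ?z * t" for t
    using linear_frechet_derivative[OF assms] by (simp add: linear_scale pderiv_at_def)
  ultimately show ?thesis by (simp add: has_field_derivative_def)
qed

lemma Ck_on_UNIV_compact_support_pderiv:
  assumes "Ck_on (Suc 0) UNIV v" "compact K" "\<And>x. x \<notin> K \<Longrightarrow> v x = 0"
  shows "continuous_on UNIV v" "continuous_on UNIV (pderiv_at i v)" "x \<notin> K \<Longrightarrow> pderiv_at i v x = 0"
proof -
  show "continuous_on UNIV v" using Ck_on_imp_continuous_on[OF assms(1)] .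
  show "continuous_on UNIV (pderiv_at i v)" using assms(1) by simp
  assume "x \<notin> K"
  then have "pderiv_at i v x = pderiv_at i (\<lambda>_. 0) x"
    using assms(2,3) by (intro pderiv_at_cong_open[of "- K"]) (auto simp: compact_imp_closed open_Compl)
  then show "pderiv_at i v x = 0" by simp
qed

text \<open>The difference quotients have vanishing integral by translation invariance and converge
  dominatedly to the partial derivative.\<close>

lemma integral_pderiv_eq_0:
  fixes v :: "real^'n \<Rightarrow> real"
  assumes v: "Ck_on (Suc 0) UNIV v" and K: "compact K" "\<And>x. x \<notin> K \<Longrightarrow> v x = 0"
  shows "integrable lborel (pderiv_at i v)" "(\<integral>x. pderiv_at i v x \<partial>lborel) = 0"
proof -
  note cont = Ck_on_UNIV_compact_support_pderiv[OF v K]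
  show int: "integrable lborel (pderiv_at i v)"
    using integrable_compact_support[OF cont(2) K(1)] cont(3) by blast
  have diff: "v differentiable at x" for x using Ck_on_differentiable_at[OF v] by simp
  define e :: "real^'n" where "e = axis i 1"
  define t where "t n = 1 / real (Suc n)" for n
  have t: "0 < t n" "t n \<le> 1" for n by (auto simp: t_def)
  have t0: "t \<longlonglongrightarrow> 0" unfolding t_def[abs_def] by (rule LIMSEQ_Suc[OF lim_1_over_n])
  define q where "q n x = (v (x + t n *\<^sub>R e) - v x) / t n" for n x
  have "compact (pderiv_at i v ` K)" using cont(2) K(1) by (intro compact_continuous_image) (auto intro: continuous_on_subset)
  from compact_imp_bounded[OF this] obtain B where B: "\<And>y. y \<in> K \<Longrightarrow> \<bar>pderiv_at i v y\<bar> \<le> B"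
    by (auto simp: bounded_iff)
  define B' where "B' = max B 0"
  have B': "\<bar>pderiv_at i v y\<bar> \<le> B'" for y
    using B[of y] cont(3)[of y] by (cases "y \<in> K") (auto simp: B'_def)
  \<comment> \<open>Contains the support of every difference quotient, because the step widths lie
    between 0 and 1; it carries the integrable majorant.\<close>
  define K' where "K' = (\<lambda>(a, s). a - s *\<^sub>R e) ` (K \<times> {0..1})"
  have K': "compact K'"
    unfolding K'_def split_def using K(1) by (intro compact_continuous_image compact_Times continuous_intros) auto
  have q0: "q n x = 0" if "x \<notin> K'" for n x
  proof -
    have "x + s *\<^sub>R e \<notin> K" if "0 \<le> s" "s \<le> 1" for s
    proof
      assume "x + s *\<^sub>R e \<in> K"
      then have "(\<lambda>(a, s). a - s *\<^sub>R e) (x + s *\<^sub>R e, s) \<in> K'" unfolding K'_def using that by (intro imageI) auto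
      then show False using \<open>x \<notin> K'\<close> by simp
    qed
    from this[of 0] this[of "t n"] show ?thesis using t[of n] K(2) by (simp add: q_def)
  qed
  have qB: "\<bar>q n x\<bar> \<le> B'" for n x
  proof -
    obtain z where "v (x + t n *\<^sub>R e) - v (x + 0 *\<^sub>R e) = (t n - 0) * pderiv_at i v (x + z *\<^sub>R e)"
      using MVT2[of 0 "t n" "\<lambda>s. v (x + s *\<^sub>R e)" "\<lambda>s. pderiv_at i v (x + s *\<^sub>R e)"] t[of n] pderiv_at_line[OF diff]
      by (auto simp: e_def)
    then have "q n x = pderiv_at i v (x + z *\<^sub>R e)" using t[of n] by (simp add: q_def)
    then show ?thesis using B' by simp
  qed
  have lim: "(\<lambda>n. q n x) \<longlonglongrightarrow> pderiv_at i v x" for x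
  proof -
    have "((\<lambda>s. v (x + s *\<^sub>R e)) has_real_derivative pderiv_at i v x) (at 0)"
      using pderiv_at_line[where v = v and x = x and s = 0 and i = i] diff by (simp add: e_def)
    then have "((\<lambda>h. (v (x + h *\<^sub>R e) - v x) / h) \<longlongrightarrow> pderiv_at i v x) (at 0)"
      by (simp add: DERIV_def)
    moreover have "filterlim t (at 0) sequentially"
      unfolding filterlim_at using t t0 by (simp add: less_imp_neq[symmetric])
    ultimately show ?thesis unfolding q_def by (rule filterlim_compose)
  qed
  have vint: "integrable lborel v" using integrable_compact_support[OF cont(1) K] .
  have [measurable]: "v \<in> borel_measurable borel" "pderiv_at i v \<in> borel_measurable borel"
    using cont by (auto intro: borel_measurable_continuous_onI)
  have "(\<lambda>n. \<integral>x. q n x \<partial>lborel) \<longlonglongrightarrow> (\<integral>x. pderiv_at i v x \<partial>lborel)"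
  proof (rule integral_dominated_convergence)
    show "pderiv_at i v \<in> borel_measurable lborel" by simp
    show "q n \<in> borel_measurable lborel" for n unfolding q_def by measurable
    show "integrable lborel (\<lambda>x. indicator K' x *\<^sub>R B')" using K' by (intro borel_integrable_compact) auto
    show "AE x in lborel. (\<lambda>n. q n x) \<longlonglongrightarrow> pderiv_at i v x" using lim by simp
    show "AE x in lborel. norm (q n x) \<le> indicator K' x *\<^sub>R B'" for n
      using qB q0 by (auto simp: indicator_def)
  qed
  moreover have "(\<integral>x. q n x \<partial>lborel) = 0" for n
    unfolding q_def using vint integrable_translation[OF vint] integral_translation[of v]
    by simp
  ultimately show "(\<integral>x. pderiv_at i v x \<partial>lborel) = 0" by (simp add: LIMSEQ_const_iff)
qed

text \<open>Order one serves for the cut-off functions and for the change of coordinates of first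
  derivatives; the invariance of the Laplacian is later derived from the latter by
  integration.\<close>

lemma Ck_on_comp_1:
  fixes \<tau> :: "real^'n \<Rightarrow> real^'m"
  assumes S: "open S" and \<beta>: "Ck_on (Suc 0) U \<beta>" "open U" and \<tau>: "\<And>k. Ck_on (Suc 0) S (\<lambda>y. \<tau> y $ k)"
    and im: "\<And>y. y \<in> S \<Longrightarrow> \<tau> y \<in> U"
  shows "Ck_on (Suc 0) S (\<lambda>y. \<beta> (\<tau> y))"
    and "y \<in> S \<Longrightarrow> pderiv_at i (\<lambda>y. \<beta> (\<tau> y)) y = (\<Sum>k\<in>UNIV. pderiv_at i (\<lambda>y. \<tau> y $ k) y * pderiv_at k \<beta> (\<tau> y))"
proof -
  have D: "((\<lambda>y. \<beta> (\<tau> y)) has_derivative (\<lambda>h. \<Sum>k\<in>UNIV. frechet_derivative (\<lambda>y. \<tau> y $ k) (at y) h * pderiv_at k \<beta> (\<tau> y))) (at y)"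
    if y: "y \<in> S" for y
  proof -
    define D where "D h = (\<chi> k. frechet_derivative (\<lambda>y. \<tau> y $ k) (at y) h)" for h
    have "((\<lambda>y. \<tau> y $ k) has_derivative (\<lambda>h. D h $ k)) (at y)" for k
      using Ck_on_differentiable_at[OF \<tau> S y, of k] by (simp add: D_def frechet_derivative_works[symmetric])
    then have \<tau>': "(\<tau> has_derivative D) (at y)"
      by (subst has_derivative_componentwise_within) (auto simp: Basis_vec_def inner_axis)
    have "\<beta> differentiable at (\<tau> y)" using Ck_on_differentiable_at[OF \<beta> im[OF y]] .
    from has_derivative_compose[OF \<tau>' has_derivative_pderiv[OF this]]
    show ?thesis by (simp add: D_def)
  qed
  show pd: "y \<in> S \<Longrightarrow> pderiv_at i (\<lambda>y. \<beta> (\<tau> y)) y = (\<Sum>k\<in>UNIV. pderiv_at i (\<lambda>y. \<tau> y $ k) y * pderiv_at k \<beta> (\<tau> y))" for y i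
    using pderiv_at_eq[OF D] by (simp add: pderiv_at_def)
  have "continuous_on S (\<lambda>y. \<tau> y $ k)" for k using Ck_on_imp_continuous_on[OF \<tau>] .
  then have \<tau>c: "continuous_on S \<tau>" by (subst continuous_on_componentwise) (auto simp: Basis_vec_def inner_axis)
  have "continuous_on S (\<lambda>y. \<Sum>k\<in>UNIV. pderiv_at i (\<lambda>y. \<tau> y $ k) y * pderiv_at k \<beta> (\<tau> y))" for i
  proof (intro continuous_intros)
    show "continuous_on S (pderiv_at i (\<lambda>y. \<tau> y $ k))" for k using \<tau>[of k] by simp
    show "continuous_on S (\<lambda>y. pderiv_at k \<beta> (\<tau> y))" for k
      using \<beta>(1) im by (intro continuous_on_compose2[OF _ \<tau>c, of U]) auto
  qed
  then have "continuous_on S (pderiv_at i (\<lambda>y. \<beta> (\<tau> y)))" for i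
    by (rule continuous_on_eq) (simp add: pd)
  moreover have "(\<lambda>y. \<beta> (\<tau> y)) differentiable_on S"
    using D S by (auto simp: differentiable_on_eq_differentiable_at differentiable_def)
  ultimately show "Ck_on (Suc 0) S (\<lambda>y. \<beta> (\<tau> y))" by simp
qed

section \<open>Cut-off functions\<close>

lemma Ck_on_coord: "Ck_on k S (\<lambda>y::real^'n. y $ i)"
proof -
  have D: "((\<lambda>y. y $ i) has_derivative (\<lambda>h. h $ i)) (at y)" for y :: "real^'n"
    by (rule bounded_linear.has_derivative[OF bounded_linear_vec_nth has_derivative_ident])
  then have "pderiv_at j (\<lambda>y. y $ i) = (\<lambda>y. axis j 1 $ i)" for j
    using pderiv_at_eq[OF D] by blast
  moreover have "(\<lambda>y. y $ i) differentiable_on S"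
    using D by (auto simp: differentiable_on_def differentiable_def intro: has_derivative_at_withinI)
  ultimately show ?thesis by (cases k) (auto simp: Ck_on_const intro: continuous_intros)
qed

text \<open>Squaring the positive part of r^2 - |y - y0|^2 makes it continuously differentiable
  across the sphere. Class C^1 is what Green's formula asks of the function multiplied with the
  Laplacian.\<close>

lemma bump_exists:
  fixes y0 :: "real^'n"
  assumes "r > 0"
  obtains \<beta> :: "real^'n \<Rightarrow> real" where "Ck_on (Suc 0) UNIV \<beta>" "\<And>y. 0 \<le> \<beta> y" "\<beta> y0 > 0" "\<And>y. y \<notin> cball y0 r \<Longrightarrow> \<beta> y = 0"
proof -
  define s where "s y = r\<^sup>2 - (\<Sum>i\<in>UNIV. (y $ i - y0 $ i) * (y $ i - y0 $ i))" for y :: "real^'n"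
  have sn: "s y = r\<^sup>2 - (norm (y - y0))\<^sup>2" for y
    by (simp add: s_def power2_norm_eq_inner inner_vec_def)
  have sC: "Ck_on (Suc 0) UNIV s"
    unfolding s_def by (intro Ck_on_diff Ck_on_const Ck_on_sum Ck_on_mult Ck_on_coord open_UNIV)
  then have sd: "s differentiable at y" for y using Ck_on_differentiable_at[OF sC] by simp
  have mD: "((\<lambda>t::real. (max 0 t)\<^sup>2) has_real_derivative 2 * max 0 t) (at t)" for t
  proof -
    consider "t < 0" | "t > 0" | "t = 0" by linarith
    then show ?thesis
    proof cases
      case 1
      have "((\<lambda>t::real. 0) has_real_derivative 0) (at t)" by simp
      then have "((\<lambda>t::real. (max 0 t)\<^sup>2) has_real_derivative 0) (at t)"
        by (rule has_field_derivative_transform_within_open[of _ _ _ "{..<0}"]) (use 1 in auto)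
      then show ?thesis using 1 by simp
    next
      case 2
      have "((\<lambda>t::real. t\<^sup>2) has_real_derivative 2 * t) (at t)" by (auto intro!: derivative_eq_intros)
      then have "((\<lambda>t::real. (max 0 t)\<^sup>2) has_real_derivative 2 * t) (at t)"
        by (rule has_field_derivative_transform_within_open[of _ _ _ "{0<..}"]) (use 2 in auto)
      then show ?thesis using 2 by simp
    next
      case 3
      have "((\<lambda>h::real. (max 0 h)\<^sup>2 / h) \<longlongrightarrow> 0) (at 0)"
      proof (rule Lim_null_comparison)
        show "\<forall>\<^sub>F h in at 0. norm ((max 0 h)\<^sup>2 / h) \<le> \<bar>h::real\<bar>"
          by (rule always_eventually) (auto simp: max_def power2_eq_square)
        show "((\<lambda>h::real. \<bar>h\<bar>) \<longlongrightarrow> 0) (at 0)" by (intro tendsto_eq_intros) auto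
      qed
      then show ?thesis using 3 by (simp add: DERIV_def)
    qed
  qed
  define \<beta> where "\<beta> y = (max 0 (s y))\<^sup>2" for y
  have pd: "pderiv_at i \<beta> y = 2 * max 0 (s y) * pderiv_at i s y" "\<beta> differentiable at y" for i y
    unfolding \<beta>_def using pderiv_at_comp_real[OF sd mD] by auto
  have "continuous_on UNIV (pderiv_at i \<beta>)" for i
    unfolding pd(1)[abs_def] using sC Ck_on_imp_continuous_on[OF sC] by (intro continuous_intros) auto
  then have "Ck_on (Suc 0) UNIV \<beta>"
    using pd(2) by (simp add: differentiable_on_eq_differentiable_at)
  moreover have "\<beta> y0 > 0" using assms by (simp add: \<beta>_def sn)
  moreover have "\<beta> y = 0" if "y \<notin> cball y0 r" for y
  proof -
    have "r < norm (y - y0)" using that by (simp add: dist_norm norm_minus_commute)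
    then have "r\<^sup>2 \<le> (norm (y - y0))\<^sup>2" using assms by (intro power_mono) auto
    then show ?thesis by (simp add: \<beta>_def sn)
  qed
  ultimately show ?thesis using that[of \<beta>] by (auto simp: \<beta>_def)
qed

section \<open>Functions and integrals on a Riemannian manifold\<close>

context riemannian
begin

definition Cn :: "nat \<Rightarrow> ('a \<Rightarrow> real) \<Rightarrow> bool" where
  "Cn k u \<longleftrightarrow> (\<forall>c\<in>A. Ck_on k (R c) (\<lambda>y. u (chart_inv c y)))"

lemma CnD: "Cn k u \<Longrightarrow> c \<in> A \<Longrightarrow> Ck_on k (R c) (\<lambda>y. u (chart_inv c y))"
  by (simp add: Cn_def)

lemma smooth_fun_iff_Cn: "smooth_fun A u \<longleftrightarrow> (\<forall>k. Cn k u)"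
  unfolding smooth_fun_def smooth_on_def Cn_def comp_def by blast

lemma Cn_const: "Cn k (\<lambda>_. a)"
  unfolding Cn_def by (intro ballI Ck_on_const)

lemma Cn_lin: "Cn k u \<Longrightarrow> Cn k v \<Longrightarrow> Cn k (\<lambda>x. a * u x + b * v x)"
  unfolding Cn_def using Ck_on_lin[OF open_R] by blast

lemma Cn_mult: "Cn k u \<Longrightarrow> Cn k v \<Longrightarrow> Cn k (\<lambda>x. u x * v x)"
  unfolding Cn_def using Ck_on_mult[OF open_R] by blast

lemma Cn_sum: "(\<And>j. j \<in> J \<Longrightarrow> Cn k (u j)) \<Longrightarrow> Cn k (\<lambda>x. \<Sum>j\<in>J. u j x)"
  unfolding Cn_def by (intro ballI Ck_on_sum open_R) blast+

lemma Cn_le: "Cn k u \<Longrightarrow> j \<le> k \<Longrightarrow> Cn j u"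
  unfolding Cn_def using Ck_on_le by blast

lemma Cn_imp_continuous: 
  assumes "Cn k u"
  shows "continuous_on UNIV u"
proof -
  have "isCont u x" for x
  proof -
    obtain c where c: "c \<in> A" "x \<in> fst c" using chart_exists by blast
    have "continuous_on (fst c) (\<lambda>x. u (chart_inv c (snd c x)))"
      using Ck_on_imp_continuous_on[OF CnD[OF assms c(1)]] snd_R
      by (intro continuous_on_compose2[OF _ cont_snd[OF c(1)], of "R c"]) blast+
    then have "continuous_on (fst c) u"
      by (rule continuous_on_eq) (simp add: chart_inv_snd[OF c(1)])
    then show ?thesis using c open_dom[OF c(1)] by (simp add: continuous_on_eq_continuous_at)
  qed
  then show ?thesis by (simp add: continuous_at_imp_continuous_on)
qed

lemma continuous_imp_Cn_0: "continuous_on UNIV u \<Longrightarrow> Cn 0 u"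
  unfolding Cn_def Ck_on.simps using continuous_on_compose2[OF _ cont_chart_inv subset_UNIV] by blast

lemma Cn_measurable: "Cn k u \<Longrightarrow> u \<in> borel_measurable borel"
  using Cn_imp_continuous borel_measurable_continuous_onI by blast

text \<open>Where \<open>s\<close> vanishes the quotient is \<open>0\<close>.\<close>

lemma Cn_divide:
  assumes u: "Cn k u" and s: "Cn k s" and K: "closed K" "\<And>x. x \<notin> K \<Longrightarrow> u x = 0" "\<And>x. x \<in> K \<Longrightarrow> s x \<noteq> 0"
  shows "Cn k (\<lambda>x. u x / s x)"
  unfolding Cn_def
proof
  fix c assume c: "c \<in> A"
  have "open (s -` (- {0}))" using Cn_imp_continuous[OF s] by (rule open_vimage[rotated]) auto
  \<comment> \<open>On \<open>P1\<close> the denominator is nonzero, on \<open>P2\<close> the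
    numerator vanishes identically; together they cover the chart range.\<close>
  define P1 where "P1 = R c \<inter> chart_inv c -` (s -` (- {0}))"
  define P2 where "P2 = R c \<inter> chart_inv c -` (- K)"
  have P: "open P1" "open P2"
    unfolding P1_def P2_def using \<open>open (s -` (- {0}))\<close> K(1)
    by (intro continuous_open_preimage[OF cont_chart_inv[OF c] open_R[OF c]]; simp add: open_Compl)+
  have "Ck_on k P1 (\<lambda>y. u (chart_inv c y) / s (chart_inv c y))"
    by (intro Ck_on_divide P Ck_on_subset[OF CnD[OF u c]] Ck_on_subset[OF CnD[OF s c]]) (simp_all add: P1_def)
  moreover have "Ck_on k P2 (\<lambda>y. u (chart_inv c y) / s (chart_inv c y))"
    by (rule Ck_on_cong[OF P(2) _ Ck_on_const[of k P2 0]]) (simp add: P2_def K)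
  ultimately have "Ck_on k (P1 \<union> P2) (\<lambda>y. u (chart_inv c y) / s (chart_inv c y))"
    by (rule Ck_on_Un[OF P])
  then show "Ck_on k (R c) (\<lambda>y. u (chart_inv c y) / s (chart_inv c y))"
  proof (rule Ck_on_subset)
    show "R c \<subseteq> P1 \<union> P2"
    proof
      fix y assume y: "y \<in> R c"
      show "y \<in> P1 \<union> P2" using K(3)[of "chart_inv c y"] y by (simp add: P1_def P2_def) argo
    qed
  qed
qed

text \<open>Extension by zero from a chart range to Euclidean space. Both the chart range and the
  complement of the compact image of \<open>S\<close> are open, and the function is regular on
  each.\<close>

lemma Ck_on_extend:
  assumes c: "c \<in> A" and h: "Ck_on k (R c) h" and S: "compact S" "S \<subseteq> fst c"
    and z: "\<And>y. y \<in> R c \<Longrightarrow> chart_inv c y \<notin> S \<Longrightarrow> h y = 0"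
  shows "Ck_on k UNIV (\<lambda>y. indicator (R c) y * h y)" "compact (snd c ` S)"
    "y \<notin> snd c ` S \<Longrightarrow> indicator (R c) y * h y = 0"
proof -
  show comp: "compact (snd c ` S)"
    using S continuous_on_subset[OF cont_snd[OF c]] by (intro compact_continuous_image) auto
  have eq: "indicator (R c) y * h y = 0" if "y \<notin> snd c ` S" for y
    using z[of y] that snd_image[OF c S(2)] by (cases "y \<in> R c") auto
  then show "y \<notin> snd c ` S \<Longrightarrow> indicator (R c) y * h y = 0" .
  have 1: "Ck_on k (R c) (\<lambda>y. indicator (R c) y * h y)"
    by (rule Ck_on_cong[OF open_R[OF c] _ h]) simp
  have op: "open (- (snd c ` S))" using comp by (simp add: compact_imp_closed open_Compl)
  have 2: "Ck_on k (- (snd c ` S)) (\<lambda>y. indicator (R c) y * h y)"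
    by (rule Ck_on_cong[OF op _ Ck_on_const[of k _ 0]]) (use eq in simp)
  have "snd c ` S \<subseteq> R c" using S(2) unfolding chart_range_def by (rule image_mono)
  then have "UNIV \<subseteq> R c \<union> - (snd c ` S)" by blast
  with Ck_on_Un[OF open_R[OF c] op 1 2] show "Ck_on k UNIV (\<lambda>y. indicator (R c) y * h y)"
    by (rule Ck_on_subset)
qed

lemma restrict_vol:
  assumes "c \<in> A"
  shows "restrict_space vol (fst c) = restrict_space (chart_measure c) (fst c)"
proof (rule measure_eqI)
  show "sets (restrict_space vol (fst c)) = sets (restrict_space (chart_measure c) (fst c))"
    by (simp add: sets_restrict_space sets_vol)
  fix B assume "B \<in> sets (restrict_space vol (fst c))"
  then have B: "B \<in> sets borel" "B \<subseteq> fst c"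
    using open_dom[OF assms] by (auto simp: sets_restrict_space_iff sets_vol)
  have sp: "space vol = UNIV" "space (chart_measure c) = UNIV"
    using sets_eq_imp_space_eq[OF sets_vol] sets_eq_imp_space_eq[OF sets_chart_measure] by simp_all
  show "emeasure (restrict_space vol (fst c)) B = emeasure (restrict_space (chart_measure c) (fst c)) B"
    using B open_dom[OF assms] emeasure_vol[OF assms B]
    by (simp add: emeasure_restrict_space sets_vol sp)
qed

lemma space_vol [simp]: "space vol = UNIV"
  using sets_eq_imp_space_eq[OF sets_vol] by simp

lemma measurable_vol [simp]: "measurable vol N = measurable borel N"
  by (rule measurable_cong_sets[OF sets_vol refl])

text \<open>The bridge from integrals on the manifold to Lebesgue integrals. Since
  \<open>vol\<close> is prescribed by the chart measure only inside \<open>fst c\<close>, both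
  measures are first restricted to that set, on which \<open>F\<close> is concentrated.\<close>

lemma vol_chart:
  assumes c: "c \<in> A" and F: "F \<in> borel_measurable borel" and F0: "\<And>x. x \<notin> fst c \<Longrightarrow> F x = (0::real)"
  shows "integrable vol F \<longleftrightarrow> integrable lborel (\<lambda>y. indicator (R c) y * (dens c y * F (chart_inv c y)))"
    and "(\<integral>x. F x \<partial>vol) = (\<integral>y. indicator (R c) y * (dens c y * F (chart_inv c y)) \<partial>lborel)"
proof -
  have Fi: "(\<lambda>x. indicator (fst c) x * F x) = F" using F0 by (auto simp: indicator_def fun_eq_iff)
  have dom: "fst c \<in> sets borel" using open_dom[OF c] by simp
  have spc: "space (chart_measure c) = UNIV"
    using sets_eq_imp_space_eq[OF sets_chart_measure] by simp
  have m: "(\<lambda>y. F (chart_inv c y)) \<in> borel_measurable (restrict_space lborel (R c))"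
    using measurable_compose[OF measurable_chart_inv[OF c] F]
    by (simp add: measurable_def space_restrict_space sets_restrict_space)
  have dp: "AE y in restrict_space lborel (R c). 0 \<le> dens c y"
    using dens_pos[OF c] by (intro AE_I2) (simp add: space_restrict_space less_imp_le)
  have RF: "R c \<inter> space lborel \<in> sets lborel" using open_R[OF c] by simp
  have "integrable vol F \<longleftrightarrow> integrable (restrict_space vol (fst c)) F"
    using integrable_restrict_space[of "fst c" vol F] dom by (simp add: Fi sets_vol)
  also have "\<dots> \<longleftrightarrow> integrable (chart_measure c) F"
    unfolding restrict_vol[OF c] using integrable_restrict_space[of "fst c" "chart_measure c" F] dom by (simp add: Fi spc)
  also have "\<dots> \<longleftrightarrow> integrable (density (restrict_space lborel (R c)) (\<lambda>y. ennreal (dens c y))) (\<lambda>y. F (chart_inv c y))"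
    unfolding chart_measure_def by (rule integrable_distr_eq[OF measurable_chart_inv'[OF c] F])
  also have "\<dots> \<longleftrightarrow> integrable (restrict_space lborel (R c)) (\<lambda>y. dens c y *\<^sub>R F (chart_inv c y))"
    by (rule integrable_density[OF m measurable_dens'[OF c] dp])
  also have "\<dots> \<longleftrightarrow> integrable lborel (\<lambda>y. indicator (R c) y *\<^sub>R (dens c y *\<^sub>R F (chart_inv c y)))"
    by (rule integrable_restrict_space[OF RF])
  finally show "integrable vol F \<longleftrightarrow> integrable lborel (\<lambda>y. indicator (R c) y * (dens c y * F (chart_inv c y)))"
    by simp
  have "(\<integral>x. F x \<partial>vol) = (\<integral>x. F x \<partial>restrict_space vol (fst c))"
    using integral_restrict_space[of "fst c" vol F] dom by (simp add: Fi sets_vol)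
  also have "\<dots> = (\<integral>x. F x \<partial>chart_measure c)"
    unfolding restrict_vol[OF c] using integral_restrict_space[of "fst c" "chart_measure c" F] dom by (simp add: Fi spc)
  also have "\<dots> = (\<integral>y. F (chart_inv c y) \<partial>density (restrict_space lborel (R c)) (\<lambda>y. ennreal (dens c y)))"
    unfolding chart_measure_def by (rule integral_distr[OF measurable_chart_inv'[OF c] F])
  also have "\<dots> = (\<integral>y. dens c y *\<^sub>R F (chart_inv c y) \<partial>restrict_space lborel (R c))"
    by (rule integral_density[OF m measurable_dens'[OF c] dp])
  also have "\<dots> = (\<integral>y. indicator (R c) y *\<^sub>R (dens c y *\<^sub>R F (chart_inv c y)) \<partial>lborel)"
    by (rule integral_restrict_space[OF RF])
  finally show "(\<integral>x. F x \<partial>vol) = (\<integral>y. indicator (R c) y * (dens c y * F (chart_inv c y)) \<partial>lborel)"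
    by simp
qed

section \<open>Differentials and the product of gradients\<close>

definition dd :: "('a, 'n) chart \<Rightarrow> ('a \<Rightarrow> real) \<Rightarrow> real^'n \<Rightarrow> real^'n" where
  "dd c u y = (\<chi> i. pderiv_at i (\<lambda>z. u (chart_inv c z)) y)"

text \<open>The inner product of the gradients of \<open>u\<close> and \<open>v\<close> in the chart
  \<open>c\<close>: the inverse metric applied to the two differentials.\<close>

definition gp :: "('a, 'n) chart \<Rightarrow> ('a \<Rightarrow> real) \<Rightarrow> ('a \<Rightarrow> real) \<Rightarrow> real^'n \<Rightarrow> real" where
  "gp c u v y = dd c u y \<bullet> (matrix_inv (gM c y) *v dd c v y)"

lemma grad_eq: "grad gM u c y = matrix_inv (gM c y) *v dd c u y"
  by (simp add: grad_def dd_def comp_def)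

lemma transition_chart_inv:
  assumes "c \<in> A" "d \<in> A" "y \<in> snd c ` (fst c \<inter> fst d)"
  shows "transition c d y \<in> R d" "chart_inv d (transition c d y) = chart_inv c y"
proof -
  obtain x where x: "x \<in> fst c" "x \<in> fst d" "y = snd c x" using assms(3) by blast
  then have \<tau>: "transition c d y = snd d x" by (simp add: transition_def chart_inv_snd[OF assms(1)])
  show "transition c d y \<in> R d" unfolding \<tau> using x by (intro snd_R)
  show "chart_inv d (transition c d y) = chart_inv c y"
    unfolding \<tau> using x by (simp add: chart_inv_snd[OF assms(1)] chart_inv_snd[OF assms(2)])
qed

lemma Ck_on_chart_change:
  assumes c: "c \<in> A" and d: "d \<in> A" and u: "Ck_on (Suc 0) (R d) (\<lambda>y. u (chart_inv d y))"
  shows "Ck_on (Suc 0) (snd c ` (fst c \<inter> fst d)) (\<lambda>y. u (chart_inv c y))"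
    and "y \<in> snd c ` (fst c \<inter> fst d) \<Longrightarrow>
      dd c u y = transpose (matrix (frechet_derivative (transition c d) (at y))) *v dd d u (transition c d y)"
proof -
  let ?O = "snd c ` (fst c \<inter> fst d)"
  note O = open_overlap[OF c d]
  have comp1: "Ck_on (Suc 0) ?O (\<lambda>y. u (chart_inv d (transition c d y)))"
    by (rule Ck_on_comp_1(1)[OF O u open_R[OF d] transition_smooth[OF c d]]) (rule transition_chart_inv(1)[OF c d])
  have comp2: "pderiv_at i (\<lambda>y. u (chart_inv d (transition c d y))) y = (\<Sum>k\<in>UNIV.
      pderiv_at i (\<lambda>y. transition c d y $ k) y * pderiv_at k (\<lambda>y. u (chart_inv d y)) (transition c d y))"
    if "y \<in> ?O" for i y
    by (rule Ck_on_comp_1(2)[OF O u open_R[OF d] transition_smooth[OF c d] _ that]) (rule transition_chart_inv(1)[OF c d])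
  have eq: "u (chart_inv d (transition c d z)) = u (chart_inv c z)" if "z \<in> ?O" for z
    using transition_chart_inv(2)[OF c d that] by simp
  show "Ck_on (Suc 0) ?O (\<lambda>y. u (chart_inv c y))"
    by (rule Ck_on_cong[OF O _ comp1]) (rule eq)
  assume y: "y \<in> ?O"
  have J: "matrix (frechet_derivative (transition c d) (at y)) $ k $ i = pderiv_at i (\<lambda>y. transition c d y $ k) y" for k i
    using pderiv_at_eq[OF bounded_linear.has_derivative[OF bounded_linear_vec_nth transition_has_derivative[OF c d y]]]
    by (simp add: matrix_def)
  have "dd c u y $ i = (\<Sum>k\<in>UNIV. pderiv_at i (\<lambda>y. transition c d y $ k) y * dd d u (transition c d y) $ k)" for i
  proof -
    have "dd c u y $ i = pderiv_at i (\<lambda>z. u (chart_inv d (transition c d z))) y"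
      unfolding dd_def vec_lambda_beta by (rule pderiv_at_cong_open[OF O y]) (use eq in simp)
    then show ?thesis using comp2[OF y] by (simp add: dd_def)
  qed
  then show "dd c u y = transpose (matrix (frechet_derivative (transition c d) (at y))) *v dd d u (transition c d y)"
    by (simp add: vec_eq_iff matrix_vector_mult_def transpose_def J)
qed

lemma metric_inv:
  assumes "c \<in> A" "y \<in> R c"
  shows "gM c y ** matrix_inv (gM c y) = mat 1" "matrix_inv (gM c y) ** gM c y = mat 1"
  using matrix_inv[of "gM c y"] det_metric_pos[OF assms] by (simp_all add: invertible_det_nz)

text \<open>With \<open>w\<close> the gradient of \<open>v\<close> in the chart \<open>c\<close>,
  the transformation law of the metric identifies \<open>J *v w\<close> with the gradient in
  \<open>d\<close>; the transposed Jacobian can be cancelled because a positive determinant of the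
  metric forces det J \<noteq> 0. Differentials transform by that same transpose, so the two changes
  cancel in the inner product.\<close>

lemma gp_invariant:
  assumes c: "c \<in> A" and d: "d \<in> A" and x: "x \<in> fst c" "x \<in> fst d" and u: "Cn (Suc 0) u" and v: "Cn (Suc 0) v"
  shows "gp c u v (snd c x) = gp d u v (snd d x)"
proof -
  define y where "y = snd c x"
  have y: "y \<in> snd c ` (fst c \<inter> fst d)" using x by (simp add: y_def)
  define z where "z = transition c d y"
  have z: "z = snd d x" using x by (simp add: z_def y_def transition_def chart_inv_snd[OF c])
  define J where "J = matrix (frechet_derivative (transition c d) (at y))"
  have G: "gM c y = transpose J ** gM d z ** J" using metric_transform[OF c d y] by (simp add: J_def z_def)
  have yR: "y \<in> R c" using x by (simp add: y_def snd_R)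
  have zR: "z \<in> R d" using x by (simp add: z snd_R)
  have "det J \<noteq> 0" using det_metric_pos[OF c yR] by (auto simp: G det_mul)
  then have JT: "transpose J *v a = transpose J *v b \<Longrightarrow> a = b" for a b
    using inj_matrix_vector_mult[of "transpose J"] by (auto simp: invertible_det_nz det_transpose inj_def)
  have du: "dd c u y = transpose J *v dd d u z" and dv: "dd c v y = transpose J *v dd d v z"
    using Ck_on_chart_change(2)[OF c d CnD[OF u d] y] Ck_on_chart_change(2)[OF c d CnD[OF v d] y]
    by (simp_all add: J_def z_def)
  define w where "w = matrix_inv (gM c y) *v dd c v y"
  have "gM c y *v w = dd c v y"
    unfolding w_def matrix_vector_mul_assoc metric_inv[OF c yR] by simp
  then have "transpose J *v (gM d z *v (J *v w)) = transpose J *v dd d v z"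
    by (simp only: G dv matrix_vector_mul_assoc matrix_mul_assoc)
  then have "gM d z *v (J *v w) = dd d v z" by (rule JT)
  then have "matrix_inv (gM d z) *v dd d v z = (matrix_inv (gM d z) ** gM d z) *v (J *v w)"
    by (simp only: matrix_vector_mul_assoc[symmetric])
  then have Jw: "J *v w = matrix_inv (gM d z) *v dd d v z" by (simp add: metric_inv[OF d zR])
  have "gp c u v y = (transpose J *v dd d u z) \<bullet> w" by (simp add: gp_def w_def du)
  also have "\<dots> = dd d u z \<bullet> (J *v w)" by (simp add: dot_lmul_matrix inner_commute flip: vector_transpose_matrix)
  finally show ?thesis by (simp add: gp_def Jw y_def z)
qed

text \<open>In another chart \<open>d\<close> the bump is a composition with the transition map on
  the overlap and zero off \<open>S\<close>. As \<open>S\<close> is closed, by the Hausdorff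
  property, these descriptions hold on two open sets covering the range of \<open>d\<close>.\<close>

lemma bump_on_manifold:
  assumes c: "c \<in> A" and U: "open U" "U \<subseteq> fst c" "x0 \<in> U"
  shows "\<exists>\<eta> S. Cn (Suc 0) \<eta> \<and> (\<forall>x. 0 \<le> \<eta> x) \<and> \<eta> x0 > 0 \<and> compact S \<and> S \<subseteq> U \<and> (\<forall>x. x \<notin> S \<longrightarrow> \<eta> x = 0)"
proof -
  define y0 where "y0 = snd c x0"
  have "open (snd c ` U)" by (rule open_snd_image[OF c U(1,2)])
  moreover have "y0 \<in> snd c ` U" using U(3) by (simp add: y0_def)
  ultimately obtain r where r: "r > 0" "cball y0 r \<subseteq> snd c ` U" using open_contains_cball by blast
  obtain \<beta> :: "real^'n \<Rightarrow> real" where \<beta>: "Ck_on (Suc 0) UNIV \<beta>" "\<And>y. 0 \<le> \<beta> y" "\<beta> y0 > 0" "\<And>y. y \<notin> cball y0 r \<Longrightarrow> \<beta> y = 0"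
    using bump_exists[OF r(1)] by blast
  define S where "S = chart_inv c ` cball y0 r"
  define \<eta> where "\<eta> x = (if x \<in> fst c then \<beta> (snd c x) else 0)" for x
  have ballR: "cball y0 r \<subseteq> R c" using r(2) U(2) snd_R by blast
  have S: "compact S" unfolding S_def
    using continuous_on_subset[OF cont_chart_inv[OF c] ballR] by (intro compact_continuous_image) auto
  have SU: "S \<subseteq> U"
  proof
    fix x assume "x \<in> S"
    then obtain y where y: "y \<in> cball y0 r" "x = chart_inv c y" unfolding S_def by blast
    then obtain z where z: "z \<in> U" "y = snd c z" using r(2) by blast
    then have "x = z" using y U(2) chart_inv_snd[OF c, of z] by blast
    then show "x \<in> U" using z by simp
  qed
  have \<eta>0: "\<eta> x = 0" if "x \<notin> S" for x
  proof (cases "x \<in> fst c")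
    case True
    have "snd c x \<notin> cball y0 r"
    proof
      assume "snd c x \<in> cball y0 r"
      then have "chart_inv c (snd c x) \<in> S" unfolding S_def by (rule imageI)
      then show False using that chart_inv_snd[OF c True] by simp
    qed
    then show ?thesis using \<beta>(4) by (simp add: \<eta>_def)
  qed (simp add: \<eta>_def)
  have "Cn (Suc 0) \<eta>"
    unfolding Cn_def
  proof
    fix d assume d: "d \<in> A"
    let ?O = "snd d ` (fst d \<inter> fst c)"
    note O = open_overlap[OF d c]
    have comp: "Ck_on (Suc 0) ?O (\<lambda>y. \<beta> (transition d c y))"
      by (rule Ck_on_comp_1(1)[OF O \<beta>(1) open_UNIV transition_smooth[OF d c]]) simp
    have eq: "\<beta> (transition d c y) = \<eta> (chart_inv d y)" if "y \<in> ?O" for y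
    proof -
      have "chart_inv d y \<in> fst c"
        using that snd_image[OF d, of "fst d \<inter> fst c"] by auto
      then show ?thesis by (simp add: \<eta>_def transition_def)
    qed
    have 1: "Ck_on (Suc 0) ?O (\<lambda>y. \<eta> (chart_inv d y))"
      by (rule Ck_on_cong[OF O _ comp]) (rule eq)
    define P where "P = R d \<inter> chart_inv d -` (- S)"
    have P: "open P" unfolding P_def
      by (intro continuous_open_preimage[OF cont_chart_inv[OF d] open_R[OF d]]) (simp add: S compact_imp_closed open_Compl)
    have 2: "Ck_on (Suc 0) P (\<lambda>y. \<eta> (chart_inv d y))"
      by (rule Ck_on_cong[OF P _ Ck_on_const[of _ P 0]]) (simp add: P_def \<eta>0)
    have "R d \<subseteq> ?O \<union> P"
    proof
      fix y assume y: "y \<in> R d"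
      show "y \<in> ?O \<union> P"
      proof (cases "chart_inv d y \<in> S")
        case True
        then have "chart_inv d y \<in> fst d \<inter> fst c" using SU U(2) chart_inv_dom[OF y] by blast
        then have "snd d (chart_inv d y) \<in> ?O" by (rule imageI)
        then show ?thesis by (simp add: snd_chart_inv[OF d y])
      qed (simp add: P_def y)
    qed
    with Ck_on_Un[OF O P 1 2] show "Ck_on (Suc 0) (R d) (\<lambda>y. \<eta> (chart_inv d y))"
      by (rule Ck_on_subset)
  qed
  moreover have "\<eta> x0 > 0" using \<beta>(3) U(2,3) by (simp add: \<eta>_def y0_def subset_iff)
  moreover have "0 \<le> \<eta> x" for x using \<beta>(2) by (simp add: \<eta>_def)
  ultimately show ?thesis using S SU \<eta>0
    by (intro exI[of _ \<eta>] exI[of _ S] conjI allI impI)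
qed

text \<open>One bump is centred at every point, and compactness selects finitely many of them; this
  is why the indices are points.\<close>

lemma bump_cover:
  assumes "compact K"
  shows "\<exists>I (c :: 'a \<Rightarrow> ('a, 'n) chart) \<eta> S. finite I \<and> (\<forall>i. c i \<in> A \<and> Cn (Suc 0) (\<eta> i) \<and>
    (\<forall>x. 0 \<le> \<eta> i x) \<and> compact (S i) \<and> S i \<subseteq> fst (c i) \<and> (\<forall>x. x \<notin> S i \<longrightarrow> \<eta> i x = 0)) \<and>
    (\<forall>x\<in>K. (\<Sum>i\<in>I. \<eta> i x) > 0)"
proof -
  define P where "P c \<eta> S \<longleftrightarrow> c \<in> A \<and> Cn (Suc 0) \<eta> \<and> (\<forall>x. 0 \<le> \<eta> x) \<and> compact S \<and> S \<subseteq> fst c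
    \<and> (\<forall>x. x \<notin> S \<longrightarrow> \<eta> x = 0)" for c \<eta> S
  have "\<forall>p. \<exists>c \<eta> S. P c \<eta> S \<and> \<eta> p > 0"
  proof
    fix p
    obtain c where c: "c \<in> A" "p \<in> fst c" using chart_exists by blast
    from bump_on_manifold[OF c(1) open_dom[OF c(1)] order_refl c(2)]
    obtain \<eta> S where "Cn (Suc 0) \<eta>" "\<forall>x. 0 \<le> \<eta> x" "\<eta> p > 0" "compact S" "S \<subseteq> fst c" "\<forall>x. x \<notin> S \<longrightarrow> \<eta> x = 0"
      by (elim exE conjE)
    then have "P c \<eta> S \<and> \<eta> p > 0" unfolding P_def using c(1) by (intro conjI)
    then show "\<exists>c \<eta> S. P c \<eta> S \<and> \<eta> p > 0" by (intro exI)
  qed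
  then obtain c \<eta> S where *: "\<And>p. P (c p) (\<eta> p) (S p)" "\<And>p. \<eta> p p > 0"
    by metis
  have nn: "0 \<le> \<eta> p x" and Cn1: "Cn (Suc 0) (\<eta> p)" for p x using *(1)[of p] by (simp_all add: P_def)
  define U where "U p = \<eta> p -` {0<..}" for p
  have opU: "open (U p)" for p unfolding U_def by (rule open_vimage[OF _ Cn_imp_continuous[OF Cn1]]) simp
  have "K \<subseteq> (\<Union>p\<in>K. U p)" using *(2) by (auto simp: U_def)
  from compactE_image[OF assms opU this] obtain I where I: "I \<subseteq> K" "finite I" "K \<subseteq> (\<Union>p\<in>I. U p)"
    by metis
  have "(\<Sum>i\<in>I. \<eta> i x) > 0" if "x \<in> K" for x
  proof -
    have "x \<in> (\<Union>p\<in>I. U p)" using I(3) that by blast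
    then obtain p where p: "p \<in> I" "\<eta> p x > 0" by (auto simp: U_def)
    then show ?thesis using I(2) nn by (intro sum_pos2[of I p])
  qed
  then have "finite I \<and> (\<forall>i. P (c i) (\<eta> i) (S i)) \<and> (\<forall>x\<in>K. (\<Sum>i\<in>I. \<eta> i x) > 0)"
    using I(2) *(1) by (intro conjI allI ballI)
  then show ?thesis unfolding P_def by (intro exI)
qed

section \<open>Partitions of unity and integrability\<close>

lemma integrable_vol_compact_chart:
  assumes c: "c \<in> A" and S: "compact S" "S \<subseteq> fst c" and F: "Cn 0 F" "\<And>x. x \<notin> S \<Longrightarrow> F x = 0"
  shows "integrable vol F"
proof -
  have h: "Ck_on 0 (R c) (\<lambda>y. dens c y * F (chart_inv c y))"
    by (intro Ck_on_mult open_R c Ck_on_dens CnD F)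
  have "continuous_on UNIV (\<lambda>y. indicator (R c) y * (dens c y * F (chart_inv c y)))"
    using Ck_on_extend(1)[OF c h S] F(2) by simp
  then have "integrable lborel (\<lambda>y. indicator (R c) y * (dens c y * F (chart_inv c y)))"
    using Ck_on_extend(2,3)[OF c h S] F(2) by (intro integrable_compact_support) auto
  then show ?thesis
    using vol_chart(1)[OF c Cn_measurable[OF F(1)]] F(2) S(2) by blast
qed

text \<open>Partition of unity, in the form of a decomposition of a compactly supported function.\<close>

definition decomposition :: "'a set \<Rightarrow> 'a set \<Rightarrow> ('a \<Rightarrow> ('a, 'n) chart) \<Rightarrow> ('a \<Rightarrow> 'a set) \<Rightarrow> ('a \<Rightarrow> 'a \<Rightarrow> real) \<Rightarrow> bool" where
  "decomposition K I c S \<rho> \<longleftrightarrow> finite I \<and> (\<forall>i. c i \<in> A) \<and> (\<forall>i. compact (S i)) \<and> (\<forall>i. S i \<subseteq> fst (c i)) \<and>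
    (\<forall>i k \<phi>. k \<le> Suc 0 \<longrightarrow> Cn k \<phi> \<longrightarrow> (\<forall>x. x \<notin> K \<longrightarrow> \<phi> x = 0) \<longrightarrow> Cn k (\<lambda>x. \<rho> i x * \<phi> x)) \<and>
    (\<forall>i x. x \<notin> S i \<longrightarrow> \<rho> i x = 0) \<and> (\<forall>x\<in>K. (\<Sum>i\<in>I. \<rho> i x) = 1)"

lemma decompositionD:
  assumes "decomposition K I c S \<rho>"
  shows "finite I" "c i \<in> A" "compact (S i)" "S i \<subseteq> fst (c i)"
    "k \<le> Suc 0 \<Longrightarrow> Cn k \<phi> \<Longrightarrow> (\<And>x. x \<notin> K \<Longrightarrow> \<phi> x = 0) \<Longrightarrow> Cn k (\<lambda>x. \<rho> i x * \<phi> x)"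
    "x \<notin> S i \<Longrightarrow> \<rho> i x = 0"
  using assms unfolding decomposition_def by simp_all

lemma decomposition_sum:
  assumes "decomposition K I c S \<rho>" "x \<notin> K \<Longrightarrow> \<phi> x = 0"
  shows "(\<Sum>i\<in>I. \<rho> i x * \<phi> x) = \<phi> x"
proof (cases "x \<in> K")
  case True
  then have "(\<Sum>i\<in>I. \<rho> i x) = 1" using assms(1) by (simp add: decomposition_def)
  then show ?thesis by (simp flip: sum_distrib_right)
qed (use assms(2) in simp)

text \<open>\<open>\<rho> i\<close> is a bump divided by the sum of all bumps, which may vanish away
  from \<open>K\<close>; so regularity is claimed only for products with functions vanishing off
  \<open>K\<close>, and only up to the order 1 of the bumps.\<close>

lemma decomposition_exists:
  assumes K: "compact K"
  shows "\<exists>I c S \<rho>. decomposition K I c S \<rho>"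
proof -
  from bump_cover[OF K] obtain I and c :: "'a \<Rightarrow> ('a, 'n) chart" and \<eta> S where I: "finite I"
    and *: "\<forall>i. c i \<in> A \<and> Cn (Suc 0) (\<eta> i) \<and> (\<forall>x. 0 \<le> \<eta> i x) \<and> compact (S i) \<and> S i \<subseteq> fst (c i) \<and> (\<forall>x. x \<notin> S i \<longrightarrow> \<eta> i x = 0)"
    and pos: "\<forall>x\<in>K. (\<Sum>i\<in>I. \<eta> i x) > 0"
    by (elim exE conjE)
  have \<eta>C: "Cn (Suc 0) (\<eta> i)" and \<eta>0: "x \<notin> S i \<Longrightarrow> \<eta> i x = 0" for i x using * by simp_all
  define s where "s x = (\<Sum>i\<in>I. \<eta> i x)" for x
  have s: "Cn (Suc 0) s" unfolding s_def using \<eta>C by (rule Cn_sum)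
  have s0: "s x \<noteq> 0" if "x \<in> K" for x using pos that by (force simp: s_def)
  define \<rho> where "\<rho> i x = \<eta> i x / s x" for i x
  have "Cn k (\<lambda>x. \<rho> i x * \<phi> x)" if k: "k \<le> Suc 0" and \<phi>: "Cn k \<phi>" "\<forall>x. x \<notin> K \<longrightarrow> \<phi> x = 0" for i k \<phi>
  proof -
    have "Cn k (\<lambda>x. (\<eta> i x * \<phi> x) / s x)"
      by (rule Cn_divide[OF Cn_mult[OF Cn_le[OF \<eta>C k] \<phi>(1)] Cn_le[OF s k] compact_imp_closed[OF K]])
        (simp_all add: \<phi>(2) s0)
    then show ?thesis by (simp add: \<rho>_def)
  qed
  moreover have "(\<Sum>i\<in>I. \<rho> i x) = 1" if "x \<in> K" for x
    using s0[OF that] by (simp add: \<rho>_def flip: sum_divide_distrib s_def)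
  moreover have "\<rho> i x = 0" if "x \<notin> S i" for i x using \<eta>0[OF that] by (simp add: \<rho>_def)
  ultimately have "decomposition K I c S \<rho>"
    unfolding decomposition_def using I * by (intro conjI allI impI ballI) simp_all
  then show ?thesis by (intro exI)
qed

lemma integrable_vol_compact:
  fixes F :: "'a \<Rightarrow> real"
  assumes K: "compact K" and F: "continuous_on UNIV F" "\<And>x. x \<notin> K \<Longrightarrow> F x = 0"
  shows "integrable vol F"
proof -
  from decomposition_exists[OF K] obtain I c S \<rho> where d: "decomposition K I c S \<rho>" by (elim exE)
  note * = decompositionD[OF d]
  have "integrable vol (\<lambda>x. \<rho> i x * F x)" for i
    by (rule integrable_vol_compact_chart[OF *(2)[of i] *(3)[of i] *(4)[of i] *(5)[OF _ continuous_imp_Cn_0[OF F(1)] F(2)]])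
      (simp_all add: *(6))
  then have "integrable vol (\<lambda>x. \<Sum>i\<in>I. \<rho> i x * F x)" by (intro Bochner_Integration.integrable_sum)
  moreover have "(\<lambda>x. \<Sum>i\<in>I. \<rho> i x * F x) = F"
    using decomposition_sum[OF d F(2)] by (intro ext)
  ultimately show ?thesis by simp
qed

section \<open>Gradient and Laplacian\<close>

text \<open>The components of sqrt (det g) grad u, whose Euclidean divergence is sqrt (det g) times
  the Laplacian.\<close>

definition flux :: "('a, 'n) chart \<Rightarrow> ('a \<Rightarrow> real) \<Rightarrow> 'n \<Rightarrow> real^'n \<Rightarrow> real" where
  "flux c u i y = dens c y * (\<Sum>j\<in>UNIV. ginv c i j y * dd c u y $ j)"

text \<open>The Laplacian evaluated in a prescribed chart, whereas \<open>laplacian\<close> uses the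
  chart picked by \<open>chart_at\<close>.\<close>

definition lapc :: "('a, 'n) chart \<Rightarrow> ('a \<Rightarrow> real) \<Rightarrow> real^'n \<Rightarrow> real" where
  "lapc c u y = (\<Sum>i\<in>UNIV. pderiv_at i (flux c u i) y) / dens c y"

lemma Ck_on_dd: "Cn (Suc k) u \<Longrightarrow> c \<in> A \<Longrightarrow> Ck_on k (R c) (\<lambda>y. dd c u y $ i)"
  using CnD[of "Suc k" u c] by (simp add: dd_def)

lemma Ck_on_flux: "Cn (Suc k) u \<Longrightarrow> c \<in> A \<Longrightarrow> Ck_on k (R c) (flux c u i)"
  unfolding flux_def[abs_def]
  by (intro Ck_on_mult Ck_on_sum open_R Ck_on_dens Ck_on_ginv Ck_on_dd)

lemma Ck_on_lapc:
  assumes "Cn (Suc (Suc k)) u" "c \<in> A"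
  shows "Ck_on k (R c) (lapc c u)"
proof -
  have "Ck_on k (R c) (pderiv_at i (flux c u i))" for i
    using Ck_on_flux[OF assms, of i] by simp
  then show ?thesis
    unfolding lapc_def[abs_def] using assms(2)
    by (intro Ck_on_divide Ck_on_sum open_R Ck_on_dens less_imp_neq[OF dens_pos, symmetric])
qed

lemma gp_sum: "gp c u v y = (\<Sum>i\<in>UNIV. dd c u y $ i * (\<Sum>j\<in>UNIV. ginv c i j y * dd c v y $ j))"
  by (simp add: gp_def inner_vec_def matrix_vector_mult_def ginv_def)

lemma Ck_on_gp: "Cn (Suc k) u \<Longrightarrow> Cn (Suc k) v \<Longrightarrow> c \<in> A \<Longrightarrow> Ck_on k (R c) (gp c u v)"
  unfolding gp_sum[abs_def]
  by (intro Ck_on_mult Ck_on_sum open_R Ck_on_ginv Ck_on_dd)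

lemma gp_flux: "dens c y * gp c u v y = (\<Sum>i\<in>UNIV. dd c u y $ i * flux c v i y)"
  by (simp add: gp_sum flux_def sum_distrib_left mult_ac)

lemma dd_zero:
  assumes c: "c \<in> A" and W: "open W" "\<And>x. x \<in> W \<Longrightarrow> u x = 0" and y: "y \<in> R c" "chart_inv c y \<in> W"
  shows "dd c u y = 0"
proof -
  have op: "open (R c \<inter> chart_inv c -` W)"
    by (rule continuous_open_preimage[OF cont_chart_inv[OF c] open_R[OF c] W(1)])
  have "pderiv_at i (\<lambda>z. u (chart_inv c z)) y = pderiv_at i (\<lambda>_. 0) y" for i
    by (rule pderiv_at_cong_open[OF op]) (use y W(2) in simp_all)
  then show ?thesis by (simp add: dd_def vec_eq_iff)
qed

lemma lapc_zero:
  assumes c: "c \<in> A" and W: "open W" "\<And>x. x \<in> W \<Longrightarrow> u x = 0" and y: "y \<in> R c" "chart_inv c y \<in> W"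
  shows "lapc c u y = 0"
proof -
  have op: "open (R c \<inter> chart_inv c -` W)"
    by (rule continuous_open_preimage[OF cont_chart_inv[OF c] open_R[OF c] W(1)])
  have "pderiv_at i (flux c u i) y = pderiv_at i (\<lambda>_. 0) y" for i
  proof (rule pderiv_at_cong_open[OF op])
    fix z assume "z \<in> R c \<inter> chart_inv c -` W"
    then have "dd c u z = 0" by (intro dd_zero[OF c W]) simp_all
    then show "flux c u i z = 0" by (simp add: flux_def)
  qed (use y in simp)
  then show ?thesis by (simp add: lapc_def)
qed

text \<open>The product rule makes the integrand the Euclidean divergence of \<eta> times the flux,
  extended by zero; its integral vanishes by \<open>integral_pderiv_eq_0\<close>.\<close>

lemma local_Green:
  assumes c: "c \<in> A" and S: "compact S" "S \<subseteq> fst c" and \<eta>: "Cn (Suc 0) \<eta>" "\<And>x. x \<notin> S \<Longrightarrow> \<eta> x = 0"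
    and u: "Cn (Suc (Suc 0)) u"
  defines "F \<equiv> \<lambda>y. indicator (R c) y * (dens c y * (\<eta> (chart_inv c y) * lapc c u y + gp c \<eta> u y))"
  shows "integrable lborel F" "(\<integral>y. F y \<partial>lborel) = 0"
proof -
  define h where "h i y = \<eta> (chart_inv c y) * flux c u i y" for i y
  define V where "V i y = indicator (R c) y * h i y" for i y
  have hC: "Ck_on (Suc 0) (R c) (h i)" for i
    unfolding h_def[abs_def] by (intro Ck_on_mult open_R c CnD[OF \<eta>(1)] Ck_on_flux u)
  have h0: "h i y = 0" if "y \<in> R c" "chart_inv c y \<notin> S" for i y using \<eta>(2)[OF that(2)] by (simp add: h_def)
  have VC: "Ck_on (Suc 0) UNIV (V i)" for i
    unfolding V_def[abs_def] by (rule Ck_on_extend(1)[OF c hC S]) (rule h0)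
  have V0: "V i y = 0" if "y \<notin> snd c ` S" for i y
    unfolding V_def by (rule Ck_on_extend(3)[OF c hC S _ that]) (rule h0)
  have comp: "compact (snd c ` S)"
    using S continuous_on_subset[OF cont_snd[OF c]] by (intro compact_continuous_image) auto
  have SR: "snd c ` S \<subseteq> R c" using S(2) unfolding chart_range_def by (rule image_mono)
  have F: "F y = (\<Sum>i\<in>UNIV. pderiv_at i (V i) y)" for y
  proof (cases "y \<in> R c")
    case True
    have ud: "flux c u i differentiable at y" "(\<lambda>z. \<eta> (chart_inv c z)) differentiable at y" for i
      using Ck_on_differentiable_at[OF Ck_on_flux[OF u c] open_R[OF c] True]
        Ck_on_differentiable_at[OF CnD[OF \<eta>(1) c] open_R[OF c] True] .
    have "pderiv_at i (V i) y = pderiv_at i (h i) y" for i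
      by (rule pderiv_at_cong_open[OF open_R[OF c] True]) (simp add: V_def)
    also have "pderiv_at i (h i) y = \<eta> (chart_inv c y) * pderiv_at i (flux c u i) y + dd c \<eta> y $ i * flux c u i y" for i
      unfolding h_def[abs_def] using pderiv_at_mult[OF ud(2) ud(1)] by (simp add: dd_def)
    finally have "(\<Sum>i\<in>UNIV. pderiv_at i (V i) y) = \<eta> (chart_inv c y) * (\<Sum>i\<in>UNIV. pderiv_at i (flux c u i) y) + dens c y * gp c \<eta> u y"
      by (simp add: sum.distrib sum_distrib_left gp_flux)
    also have "(\<Sum>i\<in>UNIV. pderiv_at i (flux c u i) y) = dens c y * lapc c u y"
      using dens_pos[OF c True] by (simp add: lapc_def)
    finally show ?thesis using True by (simp add: F_def algebra_simps)
  next
    case False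
    then have "y \<notin> snd c ` S" using SR by blast
    then have "pderiv_at i (V i) y = 0" for i
      using Ck_on_UNIV_compact_support_pderiv(3)[OF VC comp V0] by blast
    then show ?thesis using False by (simp add: F_def)
  qed
  have int: "integrable lborel (pderiv_at i (V i))" "(\<integral>y. pderiv_at i (V i) y \<partial>lborel) = 0" for i
    using integral_pderiv_eq_0[OF VC comp V0] by blast+
  have F': "F = (\<lambda>y. \<Sum>i\<in>UNIV. pderiv_at i (V i) y)" using F by (intro ext)
  show "integrable lborel F" unfolding F' using int(1) by (intro Bochner_Integration.integrable_sum)
  show "(\<integral>y. F y \<partial>lborel) = 0" unfolding F' using int by (subst Bochner_Integration.integral_sum) simp_all
qed

lemma chart_fun_measurable:
  fixes G :: "real^'n \<Rightarrow> real"
  assumes "c \<in> A" "continuous_on (R c) G"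
  shows "(\<lambda>x. indicator (fst c) x * G (snd c x)) \<in> borel_measurable borel"
proof -
  have "continuous_on (fst c) (\<lambda>x. G (snd c x))"
    using snd_R by (intro continuous_on_compose2[OF assms(2) cont_snd[OF assms(1)]]) blast
  from borel_measurable_continuous_on_indicator[OF _ this] open_dom[OF assms(1)] show ?thesis by simp
qed

text \<open>The two local expressions have the same integral against every bump function, by the
  invariance of the gradient product.\<close>

lemma lapc_le:
  assumes c: "c \<in> A" and d: "d \<in> A" and x0: "x0 \<in> fst c" "x0 \<in> fst d" and u: "Cn (Suc (Suc 0)) u"
  shows "lapc c u (snd c x0) \<le> lapc d u (snd d x0)"
proof (rule ccontr)
  assume neg: "\<not> lapc c u (snd c x0) \<le> lapc d u (snd d x0)"
  define \<delta> where "\<delta> x = lapc c u (snd c x) - lapc d u (snd d x)" for x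
  let ?O = "fst c \<inter> fst d"
  have cont: "continuous_on (R e) (lapc e u)" if "e \<in> A" for e
    using Ck_on_lapc[OF u that] by simp
  have "continuous_on ?O \<delta>"
    unfolding \<delta>_def
    using continuous_on_compose2[OF cont[OF c] continuous_on_subset[OF cont_snd[OF c], of ?O]]
      continuous_on_compose2[OF cont[OF d] continuous_on_subset[OF cont_snd[OF d], of ?O]] snd_R
    by (intro continuous_on_diff) (simp_all add: image_subset_iff)
  then have W: "open (?O \<inter> \<delta> -` {0<..})"
    by (rule continuous_open_preimage) (simp_all add: open_Int open_dom c d)
  have "x0 \<in> ?O \<inter> \<delta> -` {0<..}" using x0 neg by (simp add: \<delta>_def)
  from bump_on_manifold[OF c W _ this]
  obtain \<eta> S where \<eta>: "Cn (Suc 0) \<eta>" "\<forall>x. 0 \<le> \<eta> x" "\<eta> x0 > 0" and S: "compact S" "S \<subseteq> ?O \<inter> \<delta> -` {0<..}"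
    and \<eta>0': "\<forall>x. x \<notin> S \<longrightarrow> \<eta> x = 0" by blast
  have \<eta>0: "\<eta> x = 0" if "x \<notin> S" for x using \<eta>0' that by simp
  have Sop: "open (- S)" using S(1) by (simp add: compact_imp_closed open_Compl)
  define G where "G e y = \<eta> (chart_inv e y) * lapc e u y + gp e \<eta> u y" for e y
  \<comment> \<open>The local integrand of Green's formula as a function on the manifold, set to 0
    off the chart domain.\<close>
  define F where "F e x = indicator (fst e) x * G e (snd e x)" for e x
  have FS: "F e x = 0" if "x \<notin> S" "e \<in> A" for e x
  proof (cases "x \<in> fst e")
    case True
    then have x: "chart_inv e (snd e x) = x" "snd e x \<in> R e" using that by (simp_all add: chart_inv_snd snd_R)
    then have "dd e \<eta> (snd e x) = 0"
      using dd_zero[OF that(2) Sop, of \<eta> "snd e x"] \<eta>0 that(1) by simp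
    then show ?thesis by (simp add: F_def G_def gp_def x \<eta>0[OF that(1)])
  qed (simp add: F_def)
  have FG: "F e (chart_inv e y) = G e y" if "e \<in> A" "y \<in> R e" for e y
    using that by (simp add: F_def chart_inv_dom snd_chart_inv)
  have Fint: "integrable vol (F e)" "(\<integral>x. F e x \<partial>vol) = 0" if e: "e \<in> A" and Se: "S \<subseteq> fst e" for e
  proof -
    have "Ck_on 0 (R e) (G e)"
      unfolding G_def[abs_def]
      by (intro Ck_on_add Ck_on_mult open_R e Ck_on_lapc u Ck_on_gp Cn_le[OF u] \<eta> CnD Cn_le[OF \<eta>(1)]) simp_all
    then have m: "F e \<in> borel_measurable borel"
      unfolding F_def[abs_def] using e by (intro chart_fun_measurable) simp_all
    have z: "F e x = 0" if "x \<notin> fst e" for x using that by (simp add: F_def)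
    have eq: "(\<lambda>y. indicator (R e) y * (dens e y * F e (chart_inv e y))) = (\<lambda>y. indicator (R e) y * (dens e y * G e y))"
      using FG[OF e] by (simp add: fun_eq_iff indicator_def)
    note LG = local_Green[OF e S(1) Se \<eta>(1) \<eta>0 u]
    show "integrable vol (F e)" using vol_chart(1)[OF e m z] LG(1) unfolding eq by (simp add: G_def)
    show "(\<integral>x. F e x \<partial>vol) = 0" using vol_chart(2)[OF e m z] LG(2) unfolding eq by (simp add: G_def)
  qed
  have Scd: "S \<subseteq> fst c" "S \<subseteq> fst d" using S(2) by blast+
  \<comment> \<open>The gradient terms cancel in the difference by \<open>gp_invariant\<close>; what
    remains is \<eta> \<delta>, nonnegative with vanishing integral.\<close>
  define H where "H x = F c x - F d x" for x
  have H: "H x = \<eta> x * \<delta> x" if "x \<in> ?O" for x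
  proof -
    have "gp c \<eta> u (snd c x) = gp d \<eta> u (snd d x)"
      using that by (intro gp_invariant c d \<eta>(1) Cn_le[OF u]) simp_all
    then show ?thesis
      using that by (simp add: H_def F_def G_def \<delta>_def chart_inv_snd[OF c] chart_inv_snd[OF d] algebra_simps)
  qed
  have Hnn: "0 \<le> H x" for x
  proof (cases "x \<in> S")
    case True
    then have "x \<in> ?O" "\<delta> x > 0" using S(2) by auto
    then show ?thesis using H \<eta>(2) by simp
  qed (simp add: H_def FS c d)
  have Hint: "integrable vol H" "(\<integral>x. H x \<partial>vol) = 0"
    unfolding H_def[abs_def] using Fint[OF c Scd(1)] Fint[OF d Scd(2)] by simp_all
  have Hm: "H \<in> borel_measurable borel" using borel_measurable_integrable[OF Hint(1)] by simp
  have Hz: "H x = 0" if "x \<notin> fst c" for x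
  proof -
    have "x \<notin> S" using that Scd(1) by blast
    then show ?thesis by (simp add: H_def FS c d)
  qed
  let ?h = "\<lambda>y. indicator (R c) y * (dens c y * H (chart_inv c y))"
  have hint: "integrable lborel ?h" "(\<integral>y. ?h y \<partial>lborel) = 0"
    using vol_chart[OF c Hm Hz] Hint by simp_all
  have "0 \<le> ?h y" for y using Hnn dens_pos[OF c] by (simp add: indicator_def less_imp_le)
  then have AE: "AE y in lborel. ?h y = 0"
    using hint integral_nonneg_eq_0_iff_AE[OF hint(1)] by simp
  \<comment> \<open>A nonempty open set of coordinates on which the integrand is positive; it would
    have to be negligible.\<close>
  define Z where "Z = snd c ` ((?O \<inter> \<delta> -` {0<..}) \<inter> \<eta> -` {0<..})"
  have opZ: "open Z" unfolding Z_def
    using W open_vimage[OF _ Cn_imp_continuous[OF \<eta>(1)], of "{0<..}"]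
    by (intro open_snd_image[OF c] open_Int[OF W]) auto
  have "snd c x0 \<in> Z" unfolding Z_def using x0 \<eta>(3) neg by (simp add: \<delta>_def)
  have Zpos: "?h y \<noteq> 0" if yZ: "y \<in> Z" for y
  proof -
    obtain x where x: "x \<in> ?O" "\<delta> x > 0" "\<eta> x > 0" "y = snd c x" using yZ by (auto simp: Z_def)
    then have "H x > 0" "y \<in> R c" "chart_inv c y = x" by (simp_all add: H snd_R chart_inv_snd[OF c])
    then show ?thesis using dens_pos[OF c, of y] by simp
  qed
  have "AE y in lborel. y \<notin> Z"
    using AE by eventually_elim (use Zpos in blast)
  then have "Z \<in> null_sets lborel"
    using opZ AE_iff_null_sets[of Z lborel] by simp
  then have "negligible Z"
    using null_sets_completionI[of Z lborel] by (simp add: negligible_iff_null_sets)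
  then show False using open_not_negligible[OF opZ] \<open>snd c x0 \<in> Z\<close> by blast
qed

section \<open>The global Laplacian and gradient product\<close>

lemma chart_at: "chart_at A x \<in> A" "x \<in> fst (chart_at A x)"
proof -
  have "\<exists>c. c \<in> A \<and> x \<in> fst c" using chart_exists[of x] by blast
  then have "chart_at A x \<in> A \<and> x \<in> fst (chart_at A x)"
    unfolding chart_at_def by (rule someI_ex)
  then show "chart_at A x \<in> A" "x \<in> fst (chart_at A x)" by simp_all
qed

abbreviation lap :: "('a \<Rightarrow> real) \<Rightarrow> 'a \<Rightarrow> real" where "lap \<equiv> laplacian A gM"

text \<open>The inner product of two gradients as a function on the manifold (carre du
  champ).\<close>

definition Gam :: "('a \<Rightarrow> real) \<Rightarrow> ('a \<Rightarrow> real) \<Rightarrow> 'a \<Rightarrow> real" where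
  "Gam u v x = gp (chart_at A x) u v (snd (chart_at A x) x)"

lemma lap_eq_lapc_chart_at: "lap u x = lapc (chart_at A x) u (snd (chart_at A x) x)"
proof -
  have "(\<lambda>z. sqrt (det (gM c z)) * grad gM u c z $ i) = flux c u i" for c i
    by (simp add: fun_eq_iff flux_def grad_eq dens_def ginv_def matrix_vector_mult_def)
  then show ?thesis by (simp add: laplacian_def divergence_def Let_def lapc_def dens_def)
qed

lemma lap_chart:
  assumes "Cn (Suc (Suc 0)) u" "c \<in> A" "x \<in> fst c"
  shows "lap u x = lapc c u (snd c x)"
  unfolding lap_eq_lapc_chart_at
  using lapc_le[OF assms(2) chart_at(1) assms(3) chart_at(2) assms(1)]
    lapc_le[OF chart_at(1) assms(2) chart_at(2) assms(3) assms(1)] by simp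

lemma Gam_chart:
  assumes "Cn (Suc 0) u" "Cn (Suc 0) v" "c \<in> A" "x \<in> fst c"
  shows "Gam u v x = gp c u v (snd c x)"
  unfolding Gam_def by (rule gp_invariant[OF chart_at(1) assms(3) chart_at(2) assms(4) assms(1,2)])

lemma Cn_lap:
  assumes u: "Cn (Suc (Suc k)) u"
  shows "Cn k (lap u)"
  unfolding Cn_def
proof
  fix c assume c: "c \<in> A"
  have u2: "Cn (Suc (Suc 0)) u" using Cn_le[OF u] by simp
  show "Ck_on k (R c) (\<lambda>y. lap u (chart_inv c y))"
    by (rule Ck_on_cong[OF open_R[OF c] _ Ck_on_lapc[OF u c]])
      (simp add: lap_chart[OF u2 c] chart_inv_dom snd_chart_inv[OF c])
qed

lemma Cn_Gam:
  assumes u: "Cn (Suc k) u" and v: "Cn (Suc k) v"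
  shows "Cn k (Gam u v)"
  unfolding Cn_def
proof
  fix c assume c: "c \<in> A"
  have u1: "Cn (Suc 0) u" "Cn (Suc 0) v" using Cn_le[OF u] Cn_le[OF v] by simp_all
  show "Ck_on k (R c) (\<lambda>y. Gam u v (chart_inv c y))"
    by (rule Ck_on_cong[OF open_R[OF c] _ Ck_on_gp[OF u v c]])
      (simp add: Gam_chart[OF u1 c] chart_inv_dom snd_chart_inv[OF c])
qed

lemma lap_zero:
  assumes "open W" "\<And>x. x \<in> W \<Longrightarrow> u x = 0" "x \<in> W"
  shows "lap u x = 0"
  unfolding lap_eq_lapc_chart_at
  by (rule lapc_zero[OF chart_at(1) assms(1,2)]) (simp_all add: snd_R chart_at chart_inv_snd assms(3))

lemma Gam_zero:
  assumes "open W" "\<And>x. x \<in> W \<Longrightarrow> u x = 0" "x \<in> W"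
  shows "Gam u v x = 0"
proof -
  have "dd (chart_at A x) u (snd (chart_at A x) x) = 0"
    by (rule dd_zero[OF chart_at(1) assms(1,2)]) (simp_all add: snd_R chart_at chart_inv_snd assms(3))
  then show ?thesis by (simp add: Gam_def gp_def)
qed

section \<open>Symmetry, linearity and product rules\<close>

lemma ginv_sym: "c \<in> A \<Longrightarrow> y \<in> R c \<Longrightarrow> ginv c i j y = ginv c j i y"
proof -
  assume c: "c \<in> A" "y \<in> R c"
  let ?G = "gM c y" and ?H = "matrix_inv (gM c y)"
  have "transpose ?H ** ?G = mat 1"
    using arg_cong[OF metric_inv(1)[OF c], of transpose] by (simp add: matrix_transpose_mul metric_sym[OF c] transpose_mat)
  then have "transpose ?H ** ?G ** ?H = ?H" by simp
  then have "transpose ?H = ?H" by (simp add: metric_inv[OF c] flip: matrix_mul_assoc)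
  then have "transpose ?H $ j $ i = ?H $ j $ i" by simp
  then show ?thesis by (simp add: ginv_def transpose_def)
qed

lemma gp_commute:
  assumes "c \<in> A" "y \<in> R c"
  shows "gp c u v y = gp c v u y"
proof -
  have "gp c u v y = (\<Sum>i\<in>UNIV. \<Sum>j\<in>UNIV. ginv c i j y * (dd c u y $ i * dd c v y $ j))"
    by (simp add: gp_sum sum_distrib_left mult_ac)
  also have "\<dots> = (\<Sum>j\<in>UNIV. \<Sum>i\<in>UNIV. ginv c j i y * (dd c u y $ i * dd c v y $ j))"
    by (subst sum.swap) (simp add: ginv_sym[OF assms])
  also have "\<dots> = gp c v u y"
    by (simp add: gp_sum sum_distrib_left mult_ac)
  finally show ?thesis .
qed

lemma Gam_commute: "Gam u v x = Gam v u x"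
  unfolding Gam_def by (rule gp_commute) (simp_all add: chart_at snd_R)

lemma dd_lin:
  assumes "Cn (Suc 0) u" "Cn (Suc 0) v" "c \<in> A" "y \<in> R c"
  shows "dd c (\<lambda>x. a * u x + b * v x) y = a *\<^sub>R dd c u y + b *\<^sub>R dd c v y"
  using pderiv_at_lin[OF Ck_on_differentiable_at[OF CnD[OF assms(1,3)] open_R[OF assms(3)] assms(4)]
      Ck_on_differentiable_at[OF CnD[OF assms(2,3)] open_R[OF assms(3)] assms(4)]]
  by (simp add: dd_def vec_eq_iff)

lemma dd_mult:
  assumes "Cn (Suc 0) u" "Cn (Suc 0) v" "c \<in> A" "y \<in> R c"
  shows "dd c (\<lambda>x. u x * v x) y = u (chart_inv c y) *\<^sub>R dd c v y + v (chart_inv c y) *\<^sub>R dd c u y"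
  using pderiv_at_mult[OF Ck_on_differentiable_at[OF CnD[OF assms(1,3)] open_R[OF assms(3)] assms(4)]
      Ck_on_differentiable_at[OF CnD[OF assms(2,3)] open_R[OF assms(3)] assms(4)]]
  by (simp add: dd_def vec_eq_iff)

lemma Gam_lin_left:
  assumes "Cn (Suc 0) u" "Cn (Suc 0) v"
  shows "Gam (\<lambda>x. a * u x + b * v x) w x = a * Gam u w x + b * Gam v w x"
  unfolding Gam_def gp_def
  by (subst dd_lin[OF assms chart_at(1)]) (simp_all add: snd_R chart_at inner_add_left)

lemma Gam_mult_left:
  assumes "Cn (Suc 0) u" "Cn (Suc 0) v"
  shows "Gam (\<lambda>x. u x * v x) w x = u x * Gam v w x + v x * Gam u w x"
  unfolding Gam_def gp_def
  by (subst dd_mult[OF assms chart_at(1)]) (simp_all add: snd_R chart_at inner_add_left chart_inv_snd)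

lemma Gam_sum_left:
  assumes "\<And>i. i \<in> I \<Longrightarrow> Cn (Suc 0) (u i)"
  shows "Gam (\<lambda>x. \<Sum>i\<in>I. u i x) w x = (\<Sum>i\<in>I. Gam (u i) w x)"
  using assms
proof (induction I rule: infinite_finite_induct)
  case (insert i I)
  have "Gam (\<lambda>x. 1 * u i x + 1 * (\<Sum>j\<in>I. u j x)) w x = 1 * Gam (u i) w x + 1 * Gam (\<lambda>x. \<Sum>j\<in>I. u j x) w x"
    by (intro Gam_lin_left Cn_sum insert.prems) simp_all
  then show ?case using insert by simp
qed (simp_all add: Gam_zero[of UNIV])

lemma lapc_lin:
  assumes "Cn (Suc (Suc 0)) u" "Cn (Suc (Suc 0)) v" "c \<in> A" "y \<in> R c"
  shows "lapc c (\<lambda>x. a * u x + b * v x) y = a * lapc c u y + b * lapc c v y"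
proof -
  have uv1: "Cn (Suc 0) u" "Cn (Suc 0) v" using Cn_le[OF assms(1)] Cn_le[OF assms(2)] by simp_all
  have fl: "flux c (\<lambda>x. a * u x + b * v x) i z = a * flux c u i z + b * flux c v i z" if "z \<in> R c" for i z
    by (simp add: flux_def dd_lin[OF uv1 assms(3) that] distrib_left sum.distrib sum_distrib_left mult_ac)
  have "pderiv_at i (flux c (\<lambda>x. a * u x + b * v x) i) y = a * pderiv_at i (flux c u i) y + b * pderiv_at i (flux c v i) y" for i
  proof -
    have "pderiv_at i (flux c (\<lambda>x. a * u x + b * v x) i) y = pderiv_at i (\<lambda>z. a * flux c u i z + b * flux c v i z) y"
      by (rule pderiv_at_cong_open[OF open_R[OF assms(3)] assms(4) fl])
    also have "\<dots> = a * pderiv_at i (flux c u i) y + b * pderiv_at i (flux c v i) y"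
      by (rule pderiv_at_lin[OF Ck_on_differentiable_at[OF Ck_on_flux[OF assms(1,3)] open_R[OF assms(3)] assms(4)]
          Ck_on_differentiable_at[OF Ck_on_flux[OF assms(2,3)] open_R[OF assms(3)] assms(4)]])
    finally show ?thesis .
  qed
  then show ?thesis by (simp add: lapc_def sum.distrib sum_distrib_left add_divide_distrib)
qed

lemma lap_lin:
  assumes "Cn (Suc (Suc 0)) u" "Cn (Suc (Suc 0)) v"
  shows "lap (\<lambda>x. a * u x + b * v x) = (\<lambda>x. a * lap u x + b * lap v x)"
  unfolding lap_eq_lapc_chart_at[abs_def] using assms by (simp add: lapc_lin chart_at snd_R)

text \<open>The flux of a product obeys the product rule. Differentiating it once more leaves two
  mixed terms, which agree by the symmetry of the inverse metric and give the factor 2.\<close>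

lemma lapc_mult:
  assumes "Cn (Suc (Suc 0)) u" "Cn (Suc (Suc 0)) v" "c \<in> A" "y \<in> R c"
  shows "lapc c (\<lambda>x. u x * v x) y = u (chart_inv c y) * lapc c v y + v (chart_inv c y) * lapc c u y + 2 * gp c u v y"
proof -
  have uv1: "Cn (Suc 0) u" "Cn (Suc 0) v" using Cn_le[OF assms(1)] Cn_le[OF assms(2)] by simp_all
  let ?u = "\<lambda>z. u (chart_inv c z)" and ?v = "\<lambda>z. v (chart_inv c z)"
  note ud = Ck_on_differentiable_at[OF CnD[OF uv1(1) assms(3)] open_R[OF assms(3)] assms(4)]
    and vd = Ck_on_differentiable_at[OF CnD[OF uv1(2) assms(3)] open_R[OF assms(3)] assms(4)]
    and fu = Ck_on_differentiable_at[OF Ck_on_flux[OF assms(1,3)] open_R[OF assms(3)] assms(4)]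
    and fv = Ck_on_differentiable_at[OF Ck_on_flux[OF assms(2,3)] open_R[OF assms(3)] assms(4)]
  have fl: "flux c (\<lambda>x. u x * v x) i z = ?u z * flux c v i z + ?v z * flux c u i z" if "z \<in> R c" for i z
    by (simp add: flux_def dd_mult[OF uv1 assms(3) that] distrib_left sum.distrib sum_distrib_left mult_ac)
  have "pderiv_at i (flux c (\<lambda>x. u x * v x) i) y = ?u y * pderiv_at i (flux c v i) y + dd c u y $ i * flux c v i y
      + (?v y * pderiv_at i (flux c u i) y + dd c v y $ i * flux c u i y)" for i
  proof -
    have "pderiv_at i (flux c (\<lambda>x. u x * v x) i) y = pderiv_at i (\<lambda>z. 1 * (?u z * flux c v i z) + 1 * (?v z * flux c u i z)) y"
      by (rule pderiv_at_cong_open[OF open_R[OF assms(3)] assms(4)]) (simp add: fl)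
    also have "\<dots> = 1 * pderiv_at i (\<lambda>z. ?u z * flux c v i z) y + 1 * pderiv_at i (\<lambda>z. ?v z * flux c u i z) y"
      by (rule pderiv_at_lin; intro differentiable_mult ud vd fu fv)
    also have "pderiv_at i (\<lambda>z. ?u z * flux c v i z) y = ?u y * pderiv_at i (flux c v i) y + dd c u y $ i * flux c v i y"
      using pderiv_at_mult[OF ud fv] by (simp add: dd_def)
    also have "pderiv_at i (\<lambda>z. ?v z * flux c u i z) y = ?v y * pderiv_at i (flux c u i) y + dd c v y $ i * flux c u i y"
      using pderiv_at_mult[OF vd fu] by (simp add: dd_def)
    finally show ?thesis by simp
  qed
  then have "(\<Sum>i\<in>UNIV. pderiv_at i (flux c (\<lambda>x. u x * v x) i) y) = ?u y * (\<Sum>i\<in>UNIV. pderiv_at i (flux c v i) y)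
      + dens c y * gp c u v y + (?v y * (\<Sum>i\<in>UNIV. pderiv_at i (flux c u i) y) + dens c y * gp c v u y)"
    by (simp add: gp_flux sum.distrib sum_distrib_left)
  then show ?thesis
    using dens_pos[OF assms(3,4)] gp_commute[OF assms(3,4), of v u]
    by (simp add: lapc_def add_divide_distrib)
qed

lemma lap_mult:
  assumes "Cn (Suc (Suc 0)) u" "Cn (Suc (Suc 0)) v"
  shows "lap (\<lambda>x. u x * v x) x = u x * lap v x + v x * lap u x + 2 * Gam u v x"
  unfolding lap_eq_lapc_chart_at Gam_def using assms
  by (simp add: lapc_mult chart_at snd_R chart_inv_snd)

text \<open>The sum of the |g_ij| bounds the quadratic form of g by the squared Euclidean norm, so
  the form of the inverse is bounded from below correspondingly. This compares Euclidean with
  Riemannian gradients in the chart estimates.\<close>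

lemma ginv_pos:
  assumes c: "c \<in> A" "y \<in> R c"
  shows "0 \<le> p \<bullet> (matrix_inv (gM c y) *v p)"
    and "(norm p)\<^sup>2 \<le> (\<Sum>i\<in>UNIV. \<Sum>j\<in>UNIV. \<bar>gM c y $ i $ j\<bar>) * (p \<bullet> (matrix_inv (gM c y) *v p))"
proof -
  define q where "q = matrix_inv (gM c y) *v p"
  have p: "p = gM c y *v q" unfolding q_def matrix_vector_mul_assoc metric_inv[OF c] by simp
  have pq: "p \<bullet> q = q \<bullet> (gM c y *v q)" by (simp add: p inner_commute)
  have nn: "0 \<le> v \<bullet> (gM c y *v v)" for v
    using metric_pos[OF c, of v] by (cases "v = 0") (simp_all add: less_imp_le)
  show "0 \<le> p \<bullet> (matrix_inv (gM c y) *v p)" using nn[of q] by (simp add: q_def[symmetric] pq)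
  define K where "K = (\<Sum>i\<in>UNIV. \<Sum>j\<in>UNIV. \<bar>gM c y $ i $ j\<bar>)"
  have K: "v \<bullet> (gM c y *v v) \<le> K * (norm v)\<^sup>2" for v
  proof -
    have "v \<bullet> (gM c y *v v) = (\<Sum>i\<in>UNIV. \<Sum>j\<in>UNIV. gM c y $ i $ j * (v $ i * v $ j))"
      by (simp add: inner_vec_def matrix_vector_mult_def sum_distrib_left mult_ac)
    also have "\<dots> \<le> (\<Sum>i\<in>UNIV. \<Sum>j\<in>UNIV. \<bar>gM c y $ i $ j\<bar> * (norm v)\<^sup>2)"
    proof (intro sum_mono)
      fix i j
      have "gM c y $ i $ j * (v $ i * v $ j) \<le> \<bar>gM c y $ i $ j * (v $ i * v $ j)\<bar>" by simp
      also have "\<dots> = \<bar>gM c y $ i $ j\<bar> * (\<bar>v $ i\<bar> * \<bar>v $ j\<bar>)" by (simp add: abs_mult)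
      also have "\<dots> \<le> \<bar>gM c y $ i $ j\<bar> * (norm v * norm v)"
        by (intro mult_left_mono mult_mono component_le_norm_cart) simp_all
      finally show "gM c y $ i $ j * (v $ i * v $ j) \<le> \<bar>gM c y $ i $ j\<bar> * (norm v)\<^sup>2" by (simp add: power2_eq_square)
    qed
    finally show ?thesis by (simp add: K_def sum_distrib_right)
  qed
  have sym: "a \<bullet> (gM c y *v b) = b \<bullet> (gM c y *v a)" for a b
    using metric_sym[OF c] by (metis dot_lmul_matrix inner_commute vector_transpose_matrix)
  text \<open>Cauchy-Schwarz for the form \<open>gM c y\<close> applied to \<open>p\<close> and \<open>q\<close>, as \<open>p \<bullet> p = p \<bullet> (gM c y *v q)\<close>.\<close>
  have cs: "0 \<le> p \<bullet> (gM c y *v p) - 2 * t * (p \<bullet> p) + t\<^sup>2 * (p \<bullet> q)" for t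
  proof -
    have "0 \<le> (p - t *\<^sub>R q) \<bullet> (gM c y *v (p - t *\<^sub>R q))" by (rule nn)
    also have "\<dots> = p \<bullet> (gM c y *v p) - t * (p \<bullet> (gM c y *v q)) - t * (q \<bullet> (gM c y *v p)) + t\<^sup>2 * (q \<bullet> (gM c y *v q))"
      by (simp add: matrix_vector_mult_diff_distrib matrix_vector_mult_scaleR inner_diff_left inner_diff_right power2_eq_square algebra_simps)
    also have "q \<bullet> (gM c y *v p) = p \<bullet> p" using sym[of q p] p by simp
    also have "p \<bullet> (gM c y *v q) = p \<bullet> p" using p by simp
    also have "q \<bullet> (gM c y *v q) = p \<bullet> q" using pq by simp
    finally show ?thesis by simp
  qed
  show "(norm p)\<^sup>2 \<le> K * (p \<bullet> (matrix_inv (gM c y) *v p))"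
    unfolding q_def[symmetric]
  proof (cases "K = 0")
    case True
    \<comment> \<open>For K = 0 the constant term of the quadratic is at most 0; a small positive t
      then forces p = 0.\<close>
    have "2 * (p \<bullet> p) \<le> p \<bullet> q * t" if "t > 0" for t
    proof -
      have "2 * t * (p \<bullet> p) \<le> t\<^sup>2 * (p \<bullet> q)" using cs[of t] K[of p] True by simp
      then have "t * (2 * (p \<bullet> p)) \<le> t * (p \<bullet> q * t)" by (simp add: power2_eq_square mult_ac)
      then show ?thesis using that by simp
    qed
    from this[of "1 / (\<bar>p \<bullet> q\<bar> + 1) * (p \<bullet> p)"] this[of 1]
    have "p \<bullet> p \<le> 0"
    proof (cases "p \<bullet> p = 0")
      case False
      then have pp: "p \<bullet> p > 0" by simp
      define t where "t = 1 / (\<bar>p \<bullet> q\<bar> + 1) * (p \<bullet> p)"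
      have t: "t > 0" using pp by (simp add: t_def add_nonneg_pos)
      have "2 * (p \<bullet> p) \<le> p \<bullet> q * t" by (rule \<open>\<And>t. t > 0 \<Longrightarrow> 2 * (p \<bullet> p) \<le> p \<bullet> q * t\<close>[OF t])
      also have "p \<bullet> q * t \<le> (\<bar>p \<bullet> q\<bar> + 1) * t" using t by (intro mult_right_mono) auto
      also have "\<dots> = p \<bullet> p" by (simp add: t_def add_nonneg_pos)
      finally show ?thesis using pp by simp
    qed simp
    then show "(norm p)\<^sup>2 \<le> K * (p \<bullet> q)" using True by (simp add: power2_norm_eq_inner)
  next
    case False
    then have Kp: "K > 0" by (simp add: K_def sum_nonneg order_less_le)
    have "0 \<le> K * (p \<bullet> p) - 2 * K * (p \<bullet> p) + K\<^sup>2 * (p \<bullet> q)"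
      using cs[of K] K[of p] by (simp add: power2_norm_eq_inner)
    then have "K * (p \<bullet> p) \<le> K * (K * (p \<bullet> q))" by (simp add: power2_eq_square)
    then show "(norm p)\<^sup>2 \<le> K * (p \<bullet> q)" using Kp by (simp add: power2_norm_eq_inner)
  qed
qed

lemma Gam_nonneg: "0 \<le> Gam u u x"
  unfolding Gam_def gp_def by (rule ginv_pos(1)) (simp_all add: chart_at snd_R)

text \<open>The discriminant of a nonnegative quadratic, with the degenerate case at points where
  the gradient of \<open>v\<close> vanishes.\<close>

lemma Gam_Cauchy_Schwarz:
  assumes u: "Cn (Suc 0) u" and v: "Cn (Suc 0) v"
  shows "(Gam u v x)\<^sup>2 \<le> Gam u u x * Gam v v x"
proof -
  have q: "0 \<le> a\<^sup>2 * Gam u u x + 2 * a * b * Gam u v x + b\<^sup>2 * Gam v v x" for a b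
  proof -
    have w: "Cn (Suc 0) (\<lambda>x. a * u x + b * v x)" by (rule Cn_lin[OF u v])
    have "0 \<le> Gam (\<lambda>x. a * u x + b * v x) (\<lambda>x. a * u x + b * v x) x" by (rule Gam_nonneg)
    also have "\<dots> = a * Gam u (\<lambda>x. a * u x + b * v x) x + b * Gam v (\<lambda>x. a * u x + b * v x) x"
      by (rule Gam_lin_left[OF u v])
    also have "\<dots> = a * Gam (\<lambda>x. a * u x + b * v x) u x + b * Gam (\<lambda>x. a * u x + b * v x) v x"
      by (simp only: Gam_commute[of u "\<lambda>x. a * u x + b * v x"] Gam_commute[of v "\<lambda>x. a * u x + b * v x"])
    also have "\<dots> = a\<^sup>2 * Gam u u x + 2 * a * b * Gam u v x + b\<^sup>2 * Gam v v x"
      by (simp add: Gam_lin_left[OF u v] Gam_commute[of v u] power2_eq_square algebra_simps)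
    finally show ?thesis .
  qed
  show ?thesis
  proof (cases "Gam v v x = 0")
    case True
    have "Gam u v x = 0"
    proof (rule ccontr)
      assume *: "Gam u v x \<noteq> 0"
      have "0 \<le> Gam u u x - (Gam u u x + 1)"
        using q[of 1 "- (Gam u u x + 1) / (2 * Gam u v x)"] True * by (simp add: field_simps)
      then show False by simp
    qed
    then show ?thesis using True by simp
  next
    case False
    then have p: "Gam v v x > 0" using Gam_nonneg[of v x] by simp
    have "0 \<le> Gam v v x * (Gam u u x * Gam v v x - (Gam u v x)\<^sup>2)"
      using q[of "Gam v v x" "- Gam u v x"] by (simp add: algebra_simps power2_eq_square)
    then show ?thesis using p by (simp add: zero_le_mult_iff)
  qed
qed

theorem Green:
  assumes K: "compact K" and \<phi>: "Cn (Suc 0) \<phi>" "\<And>x. x \<notin> K \<Longrightarrow> \<phi> x = 0" and u: "Cn (Suc (Suc 0)) u"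
  shows "integrable vol (\<lambda>x. \<phi> x * lap u x)" "integrable vol (Gam \<phi> u)"
    "(\<integral>x. \<phi> x * lap u x \<partial>vol) = - (\<integral>x. Gam \<phi> u x \<partial>vol)"
proof -
  have u1: "Cn (Suc 0) u" using Cn_le[OF u] by simp
  have Kop: "open (- K)" using K by (simp add: compact_imp_closed open_Compl)
  show i1: "integrable vol (\<lambda>x. \<phi> x * lap u x)"
    using \<phi>(2) by (intro integrable_vol_compact[OF K] continuous_on_mult Cn_imp_continuous[OF \<phi>(1)]
      Cn_imp_continuous[OF Cn_lap[OF u]]) simp
  show i2: "integrable vol (Gam \<phi> u)"
    using \<phi>(2) by (intro integrable_vol_compact[OF K] Cn_imp_continuous[OF Cn_Gam[OF \<phi>(1) u1]] Gam_zero[OF Kop]) simp_all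
  from decomposition_exists[OF K] obtain I c S \<rho> where d: "decomposition K I c S \<rho>" by (elim exE)
  note * = decompositionD[OF d]
  have piece: "integrable vol (\<lambda>x. \<rho> i x * \<phi> x * lap u x + Gam (\<lambda>x. \<rho> i x * \<phi> x) u x)"
    "(\<integral>x. \<rho> i x * \<phi> x * lap u x + Gam (\<lambda>x. \<rho> i x * \<phi> x) u x \<partial>vol) = 0" for i
  proof -
    define \<psi> where "\<psi> x = \<rho> i x * \<phi> x" for x
    have \<psi>: "Cn (Suc 0) \<psi>" unfolding \<psi>_def using *(5)[OF order_refl \<phi>] .
    have \<psi>0: "\<psi> x = 0" if "x \<notin> S i" for x using *(6)[OF that] by (simp add: \<psi>_def)
    have Sop: "open (- S i)" using *(3) by (simp add: compact_imp_closed open_Compl)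
    \<comment> \<open>In a chart only the sum of the two terms is a divergence, so each piece is
      integrated as a whole and the terms are separated after summation over the pieces.\<close>
    define F where "F x = \<psi> x * lap u x + Gam \<psi> u x" for x
    have "Cn 0 F" unfolding F_def
      using Cn_lin[OF Cn_mult[OF Cn_le[OF \<psi>, of 0] Cn_lap[OF u]] Cn_Gam[OF \<psi> u1], of 1 1] by simp
    then have m: "F \<in> borel_measurable borel" by (rule Cn_measurable)
    have z: "F x = 0" if "x \<notin> fst (c i)" for x
    proof -
      have "x \<in> - S i" using that *(4) by blast
      then show ?thesis using Gam_zero[OF Sop, of \<psi> x u] \<psi>0 by (simp add: F_def)
    qed
    have eq: "(\<lambda>y. indicator (R (c i)) y * (dens (c i) y * F (chart_inv (c i) y)))
      = (\<lambda>y. indicator (R (c i)) y * (dens (c i) y * (\<psi> (chart_inv (c i) y) * lapc (c i) u y + gp (c i) \<psi> u y)))"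
    proof
      fix y
      show "indicator (R (c i)) y * (dens (c i) y * F (chart_inv (c i) y))
        = indicator (R (c i)) y * (dens (c i) y * (\<psi> (chart_inv (c i) y) * lapc (c i) u y + gp (c i) \<psi> u y))"
        by (cases "y \<in> R (c i)")
          (simp_all add: F_def lap_chart[OF u *(2)[of i]] Gam_chart[OF \<psi> u1 *(2)[of i]] chart_inv_dom snd_chart_inv[OF *(2)[of i]])
    qed
    note LG = local_Green[OF *(2) *(3) *(4) \<psi> \<psi>0 u]
    have "integrable vol F" using vol_chart(1)[OF *(2)[of i] m z] LG(1) unfolding eq by simp
    moreover have "(\<integral>x. F x \<partial>vol) = 0" using vol_chart(2)[OF *(2)[of i] m z] LG(2) unfolding eq by simp
    ultimately show "integrable vol (\<lambda>x. \<rho> i x * \<phi> x * lap u x + Gam (\<lambda>x. \<rho> i x * \<phi> x) u x)"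
      "(\<integral>x. \<rho> i x * \<phi> x * lap u x + Gam (\<lambda>x. \<rho> i x * \<phi> x) u x \<partial>vol) = 0"
      by (simp_all add: F_def[abs_def] \<psi>_def[abs_def])
  qed
  have \<phi>sum: "(\<lambda>x. \<Sum>i\<in>I. \<rho> i x * \<phi> x) = \<phi>" using decomposition_sum[OF d \<phi>(2)] by (intro ext)
  have "\<phi> x * lap u x + Gam \<phi> u x = (\<Sum>i\<in>I. \<rho> i x * \<phi> x * lap u x + Gam (\<lambda>x. \<rho> i x * \<phi> x) u x)" for x
  proof -
    have "Gam (\<lambda>x. \<Sum>i\<in>I. \<rho> i x * \<phi> x) u x = (\<Sum>i\<in>I. Gam (\<lambda>x. \<rho> i x * \<phi> x) u x)"
      by (rule Gam_sum_left) (rule *(5)[OF order_refl \<phi>])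
    then have "Gam \<phi> u x = (\<Sum>i\<in>I. Gam (\<lambda>x. \<rho> i x * \<phi> x) u x)" by (simp only: \<phi>sum)
    moreover have "\<phi> x = (\<Sum>i\<in>I. \<rho> i x * \<phi> x)" using fun_cong[OF \<phi>sum, of x] by simp
    then have "\<phi> x * lap u x = (\<Sum>i\<in>I. \<rho> i x * \<phi> x * lap u x)" by (metis sum_distrib_right)
    ultimately show ?thesis by (simp add: sum.distrib)
  qed
  then have "(\<integral>x. \<phi> x * lap u x + Gam \<phi> u x \<partial>vol) = (\<Sum>i\<in>I. \<integral>x. \<rho> i x * \<phi> x * lap u x + Gam (\<lambda>x. \<rho> i x * \<phi> x) u x \<partial>vol)"
    using piece(1) by (simp add: Bochner_Integration.integral_sum)
  then show "(\<integral>x. \<phi> x * lap u x \<partial>vol) = - (\<integral>x. Gam \<phi> u x \<partial>vol)"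
    using i1 i2 by (simp add: piece(2))
qed

end

section \<open>A compactness inequality in Euclidean space\<close>

definition gsq :: "(real^'n \<Rightarrow> real) \<Rightarrow> real^'n \<Rightarrow> real" where
  "gsq v x = (\<Sum>i\<in>UNIV. (pderiv_at i v x)\<^sup>2)"

lemma gsq_nonneg: "0 \<le> gsq v x"
  by (simp add: gsq_def sum_nonneg)

text \<open>Cauchy-Schwarz against the indicator of \<open>Q\<close>.\<close>

lemma set_integral_square_le:
  fixes w :: "'b \<Rightarrow> real"
  assumes Q: "Q \<in> sets M" "emeasure M Q < \<infinity>" and w: "(\<lambda>x. indicator Q x * w x) \<in> L2 M"
  shows "(\<integral>x. indicator Q x * w x \<partial>M)\<^sup>2 \<le> measure M Q * (\<integral>x. indicator Q x * (w x)\<^sup>2 \<partial>M)"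
proof -
  have ind: "(\<lambda>x. indicator Q x :: real) \<in> L2 M"
    using Q by (simp add: L2_def power2_eq_square flip: indicator_inter_arith)
  have "ip M (indicator Q) (\<lambda>x. indicator Q x * w x) = (\<integral>x. indicator Q x * w x \<partial>M)"
    unfolding ip_def by (rule Bochner_Integration.integral_cong) (simp_all add: indicator_def)
  moreover have "ip M (indicator Q) (indicator Q) = measure M Q"
    using Q sets.sets_into_space[OF Q(1)] by (simp add: ip_def Int_absorb2 flip: indicator_inter_arith)
  moreover have "ip M (\<lambda>x. indicator Q x * w x) (\<lambda>x. indicator Q x * w x) = (\<integral>x. indicator Q x * (w x)\<^sup>2 \<partial>M)"
    unfolding ip_def by (rule Bochner_Integration.integral_cong) (simp_all add: indicator_def power2_eq_square)
  ultimately show ?thesis using ip_Cauchy_Schwarz[OF ind w] by simp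
qed

lemma continuous_L2_indicator:
  fixes w :: "'b::euclidean_space \<Rightarrow> real"
  assumes "Q \<in> sets borel" "bounded Q" "continuous_on UNIV w"
  shows "(\<lambda>x. indicator Q x * w x) \<in> L2 lborel"
proof -
  have [measurable]: "w \<in> borel_measurable borel" using assms(3) by (rule borel_measurable_continuous_onI)
  have [measurable]: "Q \<in> sets borel" by fact
  obtain a where a: "Q \<subseteq> cbox (- a) a" using bounded_subset_cbox_symmetric[OF assms(2)] by blast
  have "continuous_on (cbox (- a) a) (\<lambda>x. (w x)\<^sup>2)"
    by (intro continuous_on_power continuous_on_subset[OF assms(3)]) simp
  from borel_integrable_compact[OF compact_cbox this]
  have "integrable lborel (\<lambda>x. indicator (cbox (- a) a) x *\<^sub>R (w x)\<^sup>2)" .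
  then have "integrable lborel (\<lambda>x. (indicator Q x * w x)\<^sup>2)"
    by (rule Bochner_Integration.integrable_bound) (use a in \<open>auto simp: indicator_def\<close>)
  then show ?thesis by (simp add: L2_def)
qed

text \<open>The fundamental theorem along the segment from x to x + h and Cauchy-Schwarz in the
  parameter give a pointwise bound; Tonelli and translation invariance of the measure then remove
  the parameter. Nonnegative integrals include the case of infinite energy.\<close>

lemma translation_estimate:
  fixes v :: "real^'n \<Rightarrow> real"
  assumes v: "Ck_on (Suc 0) UNIV v"
  shows "(\<integral>\<^sup>+x. ennreal ((v (x + h) - v x)\<^sup>2) \<partial>lborel) \<le> ennreal ((norm h)\<^sup>2) * (\<integral>\<^sup>+x. ennreal (gsq v x) \<partial>lborel)"
proof -
  have diff: "v differentiable at x" for x using Ck_on_differentiable_at[OF v] by simp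
  have pc: "continuous_on UNIV (pderiv_at i v)" for i using v by simp
  have [measurable]: "pderiv_at i v \<in> borel_measurable borel" for i
    using pc by (rule borel_measurable_continuous_onI)
  have gm [measurable]: "gsq v \<in> borel_measurable borel" unfolding gsq_def[abs_def] by measurable
  have pt: "ennreal ((v (x + h) - v x)\<^sup>2) \<le> (\<integral>\<^sup>+t. ennreal (indicator {0..1::real} t) * ennreal ((norm h)\<^sup>2 * gsq v (x + t *\<^sub>R h)) \<partial>lborel)" for x
  proof -
    define f where "f t = (\<Sum>i\<in>UNIV. h $ i * pderiv_at i v (x + t *\<^sub>R h))" for t :: real
    have D: "((\<lambda>t. v (x + t *\<^sub>R h)) has_vector_derivative f t) (at t within {0..1})" for t
    proof -
      have 1: "((\<lambda>t. x + t *\<^sub>R h) has_derivative (\<lambda>s. s *\<^sub>R h)) (at t)" by (auto intro!: derivative_eq_intros)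
      have "((\<lambda>t. v (x + t *\<^sub>R h)) has_derivative (\<lambda>s. s * f t)) (at t)"
        using has_derivative_compose[OF 1 has_derivative_pderiv[OF diff]] by (simp add: f_def sum_distrib_left mult_ac)
      then show ?thesis by (simp add: has_vector_derivative_def has_derivative_at_withinI)
    qed
    have fc: "continuous_on UNIV f" unfolding f_def
      by (intro continuous_intros continuous_on_compose2[OF pc]) auto
    have ftc: "(\<integral>t. indicator {0..1} t *\<^sub>R f t \<partial>lborel) = v (x + 1 *\<^sub>R h) - v (x + 0 *\<^sub>R h)"
      by (rule integral_FTC_atLeastAtMost[OF _ D continuous_on_subset[OF fc]]) simp_all
    have fL: "(\<lambda>t. indicator {0..1} t * f t) \<in> L2 lborel"
      using fc by (intro continuous_L2_indicator) auto
    have "(v (x + h) - v x)\<^sup>2 \<le> measure lborel {0..1::real} * (\<integral>t. indicator {0..1} t * (f t)\<^sup>2 \<partial>lborel)"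
      using set_integral_square_le[OF _ _ fL] ftc by simp
    then have "ennreal ((v (x + h) - v x)\<^sup>2) \<le> ennreal (\<integral>t. indicator {0..1} t * (f t)\<^sup>2 \<partial>lborel)"
      by (simp add: ennreal_leI)
    also have "\<dots> = (\<integral>\<^sup>+t. ennreal (indicator {0..1} t * (f t)\<^sup>2) \<partial>lborel)"
    proof (rule nn_integral_eq_integral[symmetric])
      have "(\<lambda>t. (indicator {0..1} t * f t)\<^sup>2) = (\<lambda>t. indicator {0..1} t * (f t)\<^sup>2)"
        by (auto simp: indicator_def)
      then show "integrable lborel (\<lambda>t. indicator {0..1} t * (f t)\<^sup>2)" using fL by (simp add: L2_def)
    qed simp
    also have "\<dots> \<le> (\<integral>\<^sup>+t. ennreal (indicator {0..1::real} t) * ennreal ((norm h)\<^sup>2 * gsq v (x + t *\<^sub>R h)) \<partial>lborel)"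
    proof (rule nn_integral_mono)
      fix t :: real
      have "f t = h \<bullet> (\<chi> i. pderiv_at i v (x + t *\<^sub>R h))" by (simp add: f_def inner_vec_def)
      then have "\<bar>f t\<bar> \<le> norm h * norm (\<chi> i. pderiv_at i v (x + t *\<^sub>R h))"
        using Cauchy_Schwarz_ineq2 by metis
      then have "(f t)\<^sup>2 \<le> (norm h * norm (\<chi> i. pderiv_at i v (x + t *\<^sub>R h)))\<^sup>2"
        by (metis abs_ge_zero power2_abs power_mono)
      also have "\<dots> = (norm h)\<^sup>2 * gsq v (x + t *\<^sub>R h)"
        unfolding power_mult_distrib power2_norm_eq_inner by (simp add: inner_vec_def gsq_def power2_eq_square)
      finally show "ennreal (indicator {0..1} t * (f t)\<^sup>2) \<le> ennreal (indicator {0..1::real} t) * ennreal ((norm h)\<^sup>2 * gsq v (x + t *\<^sub>R h))"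
        by (auto simp: indicator_def intro: ennreal_leI)
    qed
    finally show ?thesis .
  qed
  have tr: "(\<integral>\<^sup>+x. ennreal ((norm h)\<^sup>2 * gsq v (x + t *\<^sub>R h)) \<partial>lborel) = ennreal ((norm h)\<^sup>2) * (\<integral>\<^sup>+x. ennreal (gsq v x) \<partial>lborel)" for t
  proof -
    have "(\<integral>\<^sup>+x. ennreal ((norm h)\<^sup>2 * gsq v (x + t *\<^sub>R h)) \<partial>lborel) = (\<integral>\<^sup>+x. ennreal ((norm h)\<^sup>2 * gsq v (t *\<^sub>R h + x)) \<partial>lborel)"
      by (simp add: add.commute)
    also have "\<dots> = (\<integral>\<^sup>+x. ennreal ((norm h)\<^sup>2 * gsq v x) \<partial>distr lborel borel ((+) (t *\<^sub>R h)))"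
      by (subst nn_integral_distr) simp_all
    also have "\<dots> = ennreal ((norm h)\<^sup>2) * (\<integral>\<^sup>+x. ennreal (gsq v x) \<partial>lborel)"
      by (simp add: lborel_distr_plus ennreal_mult gsq_nonneg nn_integral_cmult)
    finally show ?thesis .
  qed
  have "(\<integral>\<^sup>+x. ennreal ((v (x + h) - v x)\<^sup>2) \<partial>lborel)
    \<le> (\<integral>\<^sup>+x. \<integral>\<^sup>+t. ennreal (indicator {0..1::real} t) * ennreal ((norm h)\<^sup>2 * gsq v (x + t *\<^sub>R h)) \<partial>lborel \<partial>lborel)"
    by (intro nn_integral_mono pt)
  also have "\<dots> = (\<integral>\<^sup>+t. \<integral>\<^sup>+x. ennreal (indicator {0..1::real} t) * ennreal ((norm h)\<^sup>2 * gsq v (x + t *\<^sub>R h)) \<partial>lborel \<partial>lborel)"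
    by (rule lborel_pair.Fubini') measurable
  also have "\<dots> = (\<integral>\<^sup>+t. ennreal (indicator {0..1::real} t) * (ennreal ((norm h)\<^sup>2) * (\<integral>\<^sup>+x. ennreal (gsq v x) \<partial>lborel)) \<partial>lborel)"
    by (simp add: nn_integral_cmult tr)
  also have "\<dots> = ennreal ((norm h)\<^sup>2) * (\<integral>\<^sup>+x. ennreal (gsq v x) \<partial>lborel)"
    by (simp add: nn_integral_multc ennreal_indicator)
  finally show ?thesis .
qed

text \<open>For \<delta> > 0 these are half-open cubes of side \<delta>; with \<open>floor\<close>
  every point lies in exactly one of them.\<close>

definition cell :: "real \<Rightarrow> int^'n \<Rightarrow> (real^'n) set" where
  "cell \<delta> z = {x. \<forall>i. \<lfloor>x $ i / \<delta>\<rfloor> = z $ i}"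

lemma cell_iff:
  fixes z :: "int^'n" and \<delta> :: real
  assumes "\<delta> > 0"
  shows "x \<in> cell \<delta> z \<longleftrightarrow> (\<forall>i. \<delta> * z $ i \<le> x $ i \<and> x $ i < \<delta> * (z $ i + 1))"
  unfolding cell_def mem_Collect_eq floor_eq_iff using assms by (simp add: field_simps)

lemma cell_borel [measurable]: "cell \<delta> (z :: int^'n) \<in> sets borel"
proof -
  have "cell \<delta> z = (\<Inter>i\<in>UNIV. (\<lambda>x::real^'n. \<lfloor>x $ i / \<delta>\<rfloor>) -` {z $ i} \<inter> space borel)" by (auto simp: cell_def)
  also have "\<dots> \<in> sets borel"
  proof (rule sets.finite_INT)
    fix i
    show "(\<lambda>x::real^'n. \<lfloor>x $ i / \<delta>\<rfloor>) -` {z $ i} \<inter> space borel \<in> sets borel"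
      by (rule measurable_sets[of _ borel "count_space UNIV"]) auto
  qed auto
  finally show ?thesis .
qed

text \<open>The volume is squeezed between those of an open and a closed box with the same
  sides.\<close>

lemma cell_bounds:
  fixes \<delta> :: real
  assumes \<delta>: "\<delta> > 0"
  defines "a \<equiv> \<lambda>z :: int^'n. \<chi> i. \<delta> * z $ i" and "b \<equiv> \<lambda>z :: int^'n. \<chi> i. \<delta> * (z $ i + 1)"
  shows "box (a z) (b z) \<subseteq> cell \<delta> z" "cell \<delta> z \<subseteq> cbox (a z) (b z)"
    "emeasure lborel (cell \<delta> z) = ennreal (\<delta> ^ CARD('n))"
proof -
  show sub: "box (a z) (b z) \<subseteq> cell \<delta> z" "cell \<delta> z \<subseteq> cbox (a z) (b z)"
    unfolding subset_iff cell_iff[OF \<delta>] mem_box_cart by (auto simp: a_def b_def less_imp_le)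
  have le: "x \<bullet> a z \<le> x \<bullet> b z" if "x \<in> Basis" for x
    using that \<delta> by (auto simp: Basis_vec_def inner_axis' a_def b_def)
  have "(\<Prod>x\<in>Basis. (b z - a z) \<bullet> x) = (\<Prod>x\<in>(Basis :: (real^'n) set). \<delta>)"
    by (rule prod.cong) (auto simp: Basis_vec_def inner_axis a_def b_def algebra_simps)
  then have pr: "(\<Prod>x\<in>Basis. (b z - a z) \<bullet> x) = \<delta> ^ CARD('n)" by simp
  have "emeasure lborel (box (a z) (b z)) = ennreal (\<delta> ^ CARD('n))"
    using emeasure_lborel_box[of "a z" "b z"] le pr by (simp add: inner_commute)
  moreover have "emeasure lborel (cbox (a z) (b z)) = ennreal (\<delta> ^ CARD('n))"
    using emeasure_lborel_cbox[of "a z" "b z"] le pr by (simp add: inner_commute)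
  ultimately show "emeasure lborel (cell \<delta> z) = ennreal (\<delta> ^ CARD('n))"
    using emeasure_mono[OF sub(1), of lborel] emeasure_mono[OF sub(2), of lborel] by simp
qed

lemma finite_int_vec_bounded: "finite {z :: int^'n. \<forall>i. z $ i \<in> F}" if "finite F"
proof -
  have "{z :: int^'n. \<forall>i. z $ i \<in> F} \<subseteq> vec_lambda ` (PiE UNIV (\<lambda>_. F))"
  proof
    fix z :: "int^'n" assume "z \<in> {z. \<forall>i. z $ i \<in> F}"
    then have "vec_lambda (vec_nth z) \<in> vec_lambda ` (PiE UNIV (\<lambda>_. F))" by (intro imageI) auto
    then show "z \<in> vec_lambda ` (PiE UNIV (\<lambda>_. F))" by simp
  qed
  moreover have "finite (vec_lambda ` (PiE UNIV (\<lambda>_. F)) :: (int^'n) set)"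
    using that by (intro finite_imageI finite_PiE) auto
  ultimately show ?thesis by (rule finite_subset)
qed

lemma finite_cells:
  fixes \<delta> :: real
  assumes "bounded K" "\<delta> > 0"
  shows "finite {z :: int^'n. cell \<delta> z \<inter> K \<noteq> {}}"
proof -
  obtain B where B: "\<And>x. x \<in> K \<Longrightarrow> norm x \<le> B" using assms(1) by (auto simp: bounded_iff)
  define N where "N = \<lceil>B / \<delta>\<rceil> + 1"
  have "{z :: int^'n. cell \<delta> z \<inter> K \<noteq> {}} \<subseteq> {z. \<forall>i. z $ i \<in> {- N..N}}"
  proof (intro subsetI CollectI allI)
    fix z :: "int^'n" and i assume "z \<in> {z. cell \<delta> z \<inter> K \<noteq> {}}"
    then obtain x where x: "x \<in> cell \<delta> z" "x \<in> K" by auto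
    have "\<bar>x $ i\<bar> \<le> B" using B[OF x(2)] component_le_norm_cart[of x i] by linarith
    then have "\<bar>x $ i / \<delta>\<bar> \<le> B / \<delta>" using assms(2) by (simp add: divide_right_mono)
    then have "x $ i / \<delta> \<le> N - 1" "- (N - 1) \<le> x $ i / \<delta>" unfolding N_def by linarith+
    then have "\<lfloor>x $ i / \<delta>\<rfloor> \<le> N" "- N \<le> \<lfloor>x $ i / \<delta>\<rfloor>" by linarith+
    moreover have "z $ i = \<lfloor>x $ i / \<delta>\<rfloor>" using x(1) by (simp add: cell_def)
    ultimately show "z $ i \<in> {- N..N}" by simp
  qed
  then show ?thesis using finite_int_vec_bounded[of "{- N..N}"] finite_subset by blast
qed

text \<open>Cauchy-Schwarz over the cell, followed by the substitution y = x + h. Two points of a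
  cell differ by a vector of the cube [-\<delta>, \<delta>]^n, a range of h that does not depend on
  x, so that the order of integration can be exchanged later.\<close>

lemma cell_average_estimate:
  fixes v :: "real^'n \<Rightarrow> real" and \<delta> :: real
  assumes \<delta>: "\<delta> > 0" and v: "continuous_on UNIV v" and x: "x \<in> cell \<delta> z"
  shows "ennreal ((v x - (\<integral>y. indicator (cell \<delta> z) y * v y \<partial>lborel) / \<delta> ^ CARD('n))\<^sup>2)
    \<le> ennreal (1 / \<delta> ^ CARD('n)) * (\<integral>\<^sup>+h. indicator (cbox (\<chi> i. - \<delta>) (\<chi> i. \<delta>)) h * ennreal ((v (x + h) - v x)\<^sup>2) \<partial>lborel)"
proof -
  let ?Q = "cell \<delta> z" and ?H = "cbox (\<chi> i. - \<delta>) (\<chi> i. \<delta>) :: (real^'n) set"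
  define m where "m = \<delta> ^ CARD('n)"
  have m: "m > 0" using \<delta> by (simp add: m_def)
  have em: "emeasure lborel ?Q = ennreal m" using cell_bounds(3)[OF \<delta>] by (simp add: m_def)
  have me: "measure lborel ?Q = m" using em m by (simp add: measure_def)
  have bd: "bounded ?Q" using cell_bounds(2)[OF \<delta>] bounded_cbox bounded_subset by blast
  have [measurable]: "v \<in> borel_measurable borel" using v by (rule borel_measurable_continuous_onI)
  have L: "(\<lambda>y. indicator ?Q y * w y) \<in> L2 lborel" if "continuous_on UNIV w" for w :: "real^'n \<Rightarrow> real"
    using that by (intro continuous_L2_indicator bd) auto
  have int: "integrable lborel (\<lambda>y. indicator ?Q y * w y)" if "continuous_on UNIV w" for w :: "real^'n \<Rightarrow> real"
  proof -
    have "integrable lborel (\<lambda>y. (indicator ?Q y * 1) * (indicator ?Q y * w y))"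
      using L2_mult_integrable[OF L[OF continuous_on_const, of 1] L[OF that]] .
    moreover have "(\<lambda>y. (indicator ?Q y * 1) * (indicator ?Q y * w y)) = (\<lambda>y. indicator ?Q y * w y)"
      by (auto simp: indicator_def)
    ultimately show ?thesis by simp
  qed
  have "v x - (\<integral>y. indicator ?Q y * v y \<partial>lborel) / m = (\<integral>y. indicator ?Q y * (v x - v y) \<partial>lborel) / m"
  proof -
    have "(\<integral>y. indicator ?Q y * (v x - v y) \<partial>lborel) = (\<integral>y. indicator ?Q y * v x \<partial>lborel) - (\<integral>y. indicator ?Q y * v y \<partial>lborel)"
      using int[OF continuous_on_const, of "v x"] int[OF v] by (simp add: right_diff_distrib)
    also have "(\<integral>y. indicator ?Q y * v x \<partial>lborel) = m * v x" by (simp add: me)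
    finally show ?thesis using m by (simp add: diff_divide_distrib)
  qed
  moreover have "(\<integral>y. indicator ?Q y * (v x - v y) \<partial>lborel)\<^sup>2 \<le> m * (\<integral>y. indicator ?Q y * (v x - v y)\<^sup>2 \<partial>lborel)"
    using set_integral_square_le[OF _ _ L, of "\<lambda>y. v x - v y"] v em me by (simp add: continuous_on_diff)
  ultimately have "(v x - (\<integral>y. indicator ?Q y * v y \<partial>lborel) / m)\<^sup>2 \<le> 1 / m * (\<integral>y. indicator ?Q y * (v x - v y)\<^sup>2 \<partial>lborel)"
    using m by (simp add: power_divide power2_eq_square field_simps)
  then have "ennreal ((v x - (\<integral>y. indicator ?Q y * v y \<partial>lborel) / m)\<^sup>2)
      \<le> ennreal (1 / m) * ennreal (\<integral>y. indicator ?Q y * (v x - v y)\<^sup>2 \<partial>lborel)"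
    using m by (simp add: ennreal_mult[symmetric] ennreal_leI)
  also have "ennreal (\<integral>y. indicator ?Q y * (v x - v y)\<^sup>2 \<partial>lborel) = (\<integral>\<^sup>+y. ennreal (indicator ?Q y * (v x - v y)\<^sup>2) \<partial>lborel)"
    using v by (intro nn_integral_eq_integral[symmetric] int continuous_intros) simp_all
  also have "\<dots> \<le> (\<integral>\<^sup>+y. indicator ?H (y - x) * ennreal ((v y - v x)\<^sup>2) \<partial>lborel)"
  proof (rule nn_integral_mono)
    fix y
    show "ennreal (indicator ?Q y * (v x - v y)\<^sup>2) \<le> indicator ?H (y - x) * ennreal ((v y - v x)\<^sup>2)"
    proof (cases "y \<in> ?Q")
      case True
      have "- \<delta> \<le> y $ i - x $ i \<and> y $ i - x $ i \<le> \<delta>" for i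
      proof -
        have "\<delta> * z $ i \<le> x $ i" "x $ i < \<delta> * z $ i + \<delta>" "\<delta> * z $ i \<le> y $ i" "y $ i < \<delta> * z $ i + \<delta>"
          using x True unfolding cell_iff[OF \<delta>] by (simp_all add: distrib_left)
        then show ?thesis by linarith
      qed
      then have "y - x \<in> ?H" by (simp add: mem_box_cart)
      then show ?thesis using True by (simp add: power2_commute)
    qed simp
  qed
  also have "\<dots> = (\<integral>\<^sup>+y. indicator ?H (y - x) * ennreal ((v y - v x)\<^sup>2) \<partial>distr lborel borel ((+) x))"
    by (simp add: lborel_distr_plus)
  also have "\<dots> = (\<integral>\<^sup>+h. indicator ?H h * ennreal ((v (x + h) - v x)\<^sup>2) \<partial>lborel)"
    by (subst nn_integral_distr) simp_all
  finally show ?thesis by (simp add: m_def mult_left_mono)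
qed

text \<open>Poincare's inequality on all cells at once, from v^2 \<le> 2 (v - avg)^2 + 2 avg^2. In
  the constant, 2^n is the volume of [-\<delta>, \<delta>]^n divided by that of a cell, and n
  \<delta>^2 bounds |h|^2. Compactness of \<open>K\<close> leaves finitely many cells.\<close>

lemma grid_inequality:
  fixes K :: "(real^'n) set" and \<delta> :: real
  assumes K: "compact K" and \<delta>: "\<delta> > 0" and v: "Ck_on (Suc 0) UNIV v" "\<And>x. x \<notin> K \<Longrightarrow> v x = 0"
  shows "(\<integral>x. (v x)\<^sup>2 \<partial>lborel) \<le> 2 * 2 ^ CARD('n) * CARD('n) * \<delta>\<^sup>2 * (\<integral>x. gsq v x \<partial>lborel)
    + (\<Sum>z | cell \<delta> z \<inter> K \<noteq> {}. 2 / \<delta> ^ CARD('n) * (\<integral>x. indicator (cell \<delta> z) x * v x \<partial>lborel)\<^sup>2)"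
proof -
  let ?Z = "{z :: int^'n. cell \<delta> z \<inter> K \<noteq> {}}" and ?H = "cbox (\<chi> i. - \<delta>) (\<chi> i. \<delta>) :: (real^'n) set"
  define n where "n = CARD('n)"
  define m where "m = \<delta> ^ n"
  have m: "m > 0" using \<delta> by (simp add: m_def)
  have finZ: "finite ?Z" using finite_cells[OF compact_imp_bounded[OF K] \<delta>] .
  note cont = Ck_on_UNIV_compact_support_pderiv[OF v(1) K v(2)]
  have vc: "continuous_on UNIV v" using cont(1) .
  have [measurable]: "v \<in> borel_measurable borel" using vc by (rule borel_measurable_continuous_onI)
  have gc: "continuous_on UNIV (gsq v)" unfolding gsq_def[abs_def] using cont(2) by (intro continuous_intros)
  have gint: "integrable lborel (gsq v)"
    using cont(3) by (intro integrable_compact_support[OF gc K]) (simp add: gsq_def)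
  have vint: "integrable lborel (\<lambda>x. (v x)\<^sup>2)"
    using v(2) by (intro integrable_compact_support[OF _ K] continuous_intros vc) simp
  have emc: "emeasure lborel (cell \<delta> z) = ennreal m" for z :: "int^'n"
    using cell_bounds(3)[OF \<delta>, of z] by (simp add: m_def n_def)
  define avg where "avg z = (\<integral>y. indicator (cell \<delta> z) y * v y \<partial>lborel) / m" for z
  have pt: "ennreal ((v x)\<^sup>2) \<le> 2 * (ennreal (1 / m) * (\<integral>\<^sup>+h. indicator ?H h * ennreal ((v (x + h) - v x)\<^sup>2) \<partial>lborel))
      + (\<Sum>z\<in>?Z. indicator (cell \<delta> z) x * ennreal (2 * (avg z)\<^sup>2))" for x
  proof (cases "x \<in> K")
    case True
    define z where "z = (\<chi> i. \<lfloor>x $ i / \<delta>\<rfloor>)"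
    have xz: "x \<in> cell \<delta> z" by (simp add: cell_def z_def)
    then have zZ: "z \<in> ?Z" using True by auto
    have "(v x)\<^sup>2 \<le> 2 * (v x - avg z)\<^sup>2 + 2 * (avg z)\<^sup>2"
    proof -
      have "0 \<le> (v x - 2 * avg z)\<^sup>2" by simp
      then show ?thesis by (simp add: power2_eq_square algebra_simps)
    qed
    then have "ennreal ((v x)\<^sup>2) \<le> ennreal (2 * (v x - avg z)\<^sup>2 + 2 * (avg z)\<^sup>2)" by (rule ennreal_leI)
    also have "\<dots> = 2 * ennreal ((v x - avg z)\<^sup>2) + indicator (cell \<delta> z) x * ennreal (2 * (avg z)\<^sup>2)"
      using xz by (simp add: ennreal_mult)
    also have "\<dots> \<le> 2 * (ennreal (1 / m) * (\<integral>\<^sup>+h. indicator ?H h * ennreal ((v (x + h) - v x)\<^sup>2) \<partial>lborel))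
      + (\<Sum>z\<in>?Z. indicator (cell \<delta> z) x * ennreal (2 * (avg z)\<^sup>2))"
      using cell_average_estimate[OF \<delta> vc xz] finZ zZ
      by (intro add_mono mult_left_mono member_le_sum) (simp_all add: avg_def m_def n_def)
    finally show ?thesis .
  next
    case False
    then show ?thesis using v(2) by simp
  qed
  have Hm: "emeasure lborel ?H = ennreal ((2 * \<delta>) ^ n)"
  proof -
    have "(\<Prod>b\<in>Basis. ((\<chi> i. \<delta>) - (\<chi> i. - \<delta>) :: real^'n) \<bullet> b) = (\<Prod>b\<in>(Basis :: (real^'n) set). 2 * \<delta>)"
      by (rule prod.cong) (auto simp: Basis_vec_def inner_axis)
    then have pr: "(\<Prod>b\<in>Basis. ((\<chi> i. \<delta>) - (\<chi> i. - \<delta>) :: real^'n) \<bullet> b) = (2 * \<delta>) ^ n" by (simp add: n_def)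
    have "(\<chi> i. - \<delta>) \<bullet> b \<le> (\<chi> i. \<delta>) \<bullet> b" if "b \<in> Basis" for b :: "real^'n"
      using that \<delta> by (auto simp: Basis_vec_def inner_axis)
    from emeasure_lborel_cbox[OF this] show ?thesis unfolding pr by simp
  qed
  have Hn: "(norm h)\<^sup>2 \<le> n * \<delta>\<^sup>2" if "h \<in> ?H" for h
  proof -
    have "(norm h)\<^sup>2 = (\<Sum>i\<in>UNIV. (h $ i)\<^sup>2)"
      unfolding power2_norm_eq_inner by (simp add: inner_vec_def power2_eq_square)
    also have "\<dots> \<le> (\<Sum>i\<in>(UNIV :: 'n set). \<delta>\<^sup>2)"
    proof (rule sum_mono)
      fix i
      have "- \<delta> \<le> h $ i \<and> h $ i \<le> \<delta>" using that by (simp add: mem_box_cart)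
      then have "\<bar>h $ i\<bar> \<le> \<bar>\<delta>\<bar>" using \<delta> by (simp add: abs_le_iff)
      then show "(h $ i)\<^sup>2 \<le> \<delta>\<^sup>2" by (simp add: abs_le_square_iff)
    qed
    finally show ?thesis by (simp add: n_def)
  qed
  let ?g = "\<integral>\<^sup>+x. ennreal (gsq v x) \<partial>lborel"
  have "(\<integral>\<^sup>+x. (\<integral>\<^sup>+h. indicator ?H h * ennreal ((v (x + h) - v x)\<^sup>2) \<partial>lborel) \<partial>lborel)
    = (\<integral>\<^sup>+h. (\<integral>\<^sup>+x. indicator ?H h * ennreal ((v (x + h) - v x)\<^sup>2) \<partial>lborel) \<partial>lborel)"
    by (rule lborel_pair.Fubini') measurable
  also have "\<dots> \<le> (\<integral>\<^sup>+h. indicator ?H h * (ennreal (n * \<delta>\<^sup>2) * ?g) \<partial>lborel)"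
  proof (rule nn_integral_mono)
    fix h :: "real^'n"
    have "(\<integral>\<^sup>+x. indicator ?H h * ennreal ((v (x + h) - v x)\<^sup>2) \<partial>lborel) = indicator ?H h * (\<integral>\<^sup>+x. ennreal ((v (x + h) - v x)\<^sup>2) \<partial>lborel)"
      by (rule nn_integral_cmult) measurable
    also have "\<dots> \<le> indicator ?H h * (ennreal ((norm h)\<^sup>2) * ?g)"
      by (intro mult_left_mono translation_estimate v) simp
    also have "\<dots> \<le> indicator ?H h * (ennreal (n * \<delta>\<^sup>2) * ?g)"
    proof (cases "h \<in> ?H")
      case True
      then show ?thesis using Hn[OF True] by (intro mult_left_mono mult_right_mono ennreal_leI) simp_all
    qed simp
    finally show "(\<integral>\<^sup>+x. indicator ?H h * ennreal ((v (x + h) - v x)\<^sup>2) \<partial>lborel) \<le> indicator ?H h * (ennreal (n * \<delta>\<^sup>2) * ?g)" .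
  qed
  also have "\<dots> = ennreal ((2 * \<delta>) ^ n) * (ennreal (n * \<delta>\<^sup>2) * ?g)"
    by (simp add: nn_integral_multc Hm)
  finally have dbl: "(\<integral>\<^sup>+x. (\<integral>\<^sup>+h. indicator ?H h * ennreal ((v (x + h) - v x)\<^sup>2) \<partial>lborel) \<partial>lborel)
    \<le> ennreal ((2 * \<delta>) ^ n) * (ennreal (n * \<delta>\<^sup>2) * ?g)" .
  have gE: "?g = ennreal (\<integral>x. gsq v x \<partial>lborel)"
    using gint by (intro nn_integral_eq_integral AE_I2 gsq_nonneg)
  have g0: "0 \<le> (\<integral>x. gsq v x \<partial>lborel)" by (intro integral_nonneg_AE AE_I2 gsq_nonneg)
  have "ennreal (\<integral>x. (v x)\<^sup>2 \<partial>lborel) = (\<integral>\<^sup>+x. ennreal ((v x)\<^sup>2) \<partial>lborel)"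
    using vint by (intro nn_integral_eq_integral[symmetric]) auto
  also have "\<dots> \<le> (\<integral>\<^sup>+x. 2 * (ennreal (1 / m) * (\<integral>\<^sup>+h. indicator ?H h * ennreal ((v (x + h) - v x)\<^sup>2) \<partial>lborel))
      + (\<Sum>z\<in>?Z. indicator (cell \<delta> z) x * ennreal (2 * (avg z)\<^sup>2)) \<partial>lborel)"
    by (intro nn_integral_mono pt)
  also have "\<dots> = 2 * (ennreal (1 / m) * (\<integral>\<^sup>+x. (\<integral>\<^sup>+h. indicator ?H h * ennreal ((v (x + h) - v x)\<^sup>2) \<partial>lborel) \<partial>lborel))
      + (\<Sum>z\<in>?Z. ennreal m * ennreal (2 * (avg z)\<^sup>2))"
    by (simp add: nn_integral_add nn_integral_cmult nn_integral_sum nn_integral_multc emc)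
  also have "\<dots> \<le> 2 * (ennreal (1 / m) * (ennreal ((2 * \<delta>) ^ n) * (ennreal (n * \<delta>\<^sup>2) * ?g)))
      + (\<Sum>z\<in>?Z. ennreal m * ennreal (2 * (avg z)\<^sup>2))"
    by (intro add_mono mult_left_mono dbl order_refl) simp_all
  also have "\<dots> = ennreal (2 * (1 / m * ((2 * \<delta>) ^ n * (n * \<delta>\<^sup>2 * (\<integral>x. gsq v x \<partial>lborel)))) + (\<Sum>z\<in>?Z. m * (2 * (avg z)\<^sup>2)))"
  proof -
    have 1: "2 * (ennreal (1 / m) * (ennreal ((2 * \<delta>) ^ n) * (ennreal (n * \<delta>\<^sup>2) * ?g)))
      = ennreal (2 * (1 / m * ((2 * \<delta>) ^ n * (n * \<delta>\<^sup>2 * (\<integral>x. gsq v x \<partial>lborel)))))"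
      using m \<delta> g0 unfolding gE by (simp flip: ennreal_mult' ennreal_numeral)
    have 2: "(\<Sum>z\<in>?Z. ennreal m * ennreal (2 * (avg z)\<^sup>2)) = ennreal (\<Sum>z\<in>?Z. m * (2 * (avg z)\<^sup>2))"
      using m by (subst sum_ennreal[symmetric]) (simp_all add: ennreal_mult)
    show ?thesis
      unfolding 1 2 using m \<delta> g0 by (intro ennreal_plus[symmetric] sum_nonneg) simp_all
  qed
  finally have "(\<integral>x. (v x)\<^sup>2 \<partial>lborel) \<le> 2 * (1 / m * ((2 * \<delta>) ^ n * (n * \<delta>\<^sup>2 * (\<integral>x. gsq v x \<partial>lborel)))) + (\<Sum>z\<in>?Z. m * (2 * (avg z)\<^sup>2))"
    using m \<delta> g0 by (subst (asm) ennreal_le_iff) (auto intro!: add_nonneg_nonneg mult_nonneg_nonneg sum_nonneg)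
  also have "2 * (1 / m * ((2 * \<delta>) ^ n * (n * \<delta>\<^sup>2 * (\<integral>x. gsq v x \<partial>lborel)))) = 2 * 2 ^ n * n * \<delta>\<^sup>2 * (\<integral>x. gsq v x \<partial>lborel)"
    using m by (simp add: m_def power_mult_distrib)
  also have "(\<Sum>z\<in>?Z. m * (2 * (avg z)\<^sup>2)) = (\<Sum>z\<in>?Z. 2 / m * (\<integral>x. indicator (cell \<delta> z) x * v x \<partial>lborel)\<^sup>2)"
    using m by (intro sum.cong refl) (simp add: avg_def power2_eq_square)
  finally show ?thesis by (simp add: n_def m_def)
qed

section \<open>Compactness on a relatively compact domain\<close>

context riemannian
begin

lemma borel_chart_fun:
  assumes c: "c \<in> A" and G: "G \<in> borel_measurable borel"
  shows "(\<lambda>x. indicator (fst c) x * (G (snd c x) :: real)) \<in> borel_measurable borel"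
proof -
  have "snd c \<in> borel_measurable (restrict_space borel (fst c))"
    by (rule borel_measurable_continuous_on_restrict[OF cont_snd[OF c]])
  then have "(\<lambda>x. G (snd c x)) \<in> borel_measurable (restrict_space borel (fst c))"
    using G by (rule measurable_compose)
  moreover have "fst c \<inter> space borel \<in> sets borel" using open_dom[OF c] by simp
  ultimately show ?thesis by (simp add: borel_measurable_restrict_space_iff)
qed

text \<open>In the chart \<open>c\<close> the cut-off function \<open>\<eta> \<phi>\<close> is a compactly supported function on Euclidean
  space, to which the grid inequality applies; the metric is comparable to the Euclidean one on
  the compact set \<open>S\<close>.\<close>

lemma chart_compactness:
  assumes c: "c \<in> A" and \<eta>: "Cn (Suc 0) \<eta>" and S: "compact S" "S \<subseteq> fst c" and \<eta>0: "\<And>x. x \<notin> S \<Longrightarrow> \<eta> x = 0"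
    and \<epsilon>: "\<epsilon> > 0"
  shows "\<exists>(J :: (int^'n) set) q. finite J \<and> (\<forall>j\<in>J. q j \<in> borel_measurable borel \<and> integrable vol (\<lambda>x. (q j x)\<^sup>2)) \<and>
    (\<forall>\<phi> K. Cn (Suc 0) \<phi> \<longrightarrow> compact K \<longrightarrow> (\<forall>x. x \<notin> K \<longrightarrow> \<phi> x = 0) \<longrightarrow>
      (\<integral>x. (\<eta> x * \<phi> x)\<^sup>2 \<partial>vol) \<le> \<epsilon> * (\<integral>x. (\<phi> x)\<^sup>2 + Gam \<phi> \<phi> x \<partial>vol) + (\<Sum>j\<in>J. (\<integral>x. \<phi> x * q j x \<partial>vol)\<^sup>2))"
proof -
  define Kc where "Kc = snd c ` S"
  have KR: "Kc \<subseteq> R c" using S(2) unfolding Kc_def chart_range_def by (rule image_mono)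
  have Kcomp: "compact Kc"
    unfolding Kc_def using S continuous_on_subset[OF cont_snd[OF c]] by (intro compact_continuous_image) auto
  have notK: "\<eta> (chart_inv c y) = 0" if "y \<in> R c" "y \<notin> Kc" for y
  proof (rule \<eta>0)
    show "chart_inv c y \<notin> S"
    proof
      assume "chart_inv c y \<in> S"
      then have "snd c (chart_inv c y) \<in> Kc" unfolding Kc_def by (rule imageI)
      then show False using that by (simp add: snd_chart_inv[OF c])
    qed
  qed
  have bnd: "\<exists>B\<ge>0. \<forall>y\<in>Kc. \<bar>f y\<bar> \<le> B" if "Ck_on 0 (R c) f" for f
  proof -
    have "continuous_on Kc f" using that KR by (auto intro: continuous_on_subset)
    then have "bounded (f ` Kc)" using Kcomp compact_continuous_image compact_imp_bounded by blast
    then obtain B where "\<forall>y\<in>Kc. \<bar>f y\<bar> \<le> B" by (auto simp: bounded_iff)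
    then have "\<forall>y\<in>Kc. \<bar>f y\<bar> \<le> max B 0" by (auto simp: le_max_iff_disj)
    then show ?thesis by (intro exI[of _ "max B 0"]) simp
  qed
  let ?\<eta> = "\<lambda>y. \<eta> (chart_inv c y)"
  have \<eta>c: "Ck_on 0 (R c) ?\<eta>" using CnD[OF Cn_le[OF \<eta>, of 0] c] by simp
  obtain d1 where d1: "d1 \<ge> 0" "\<And>y. y \<in> Kc \<Longrightarrow> \<bar>dens c y\<bar> \<le> d1"
    using bnd[OF Ck_on_dens[OF c]] by blast
  have dinv: "Ck_on k (R c) (\<lambda>y. 1 / dens c y)" for k
    by (intro Ck_on_inverse open_R c Ck_on_dens less_imp_neq[OF dens_pos, symmetric])
  obtain d2 where d2: "d2 \<ge> 0" "\<And>y. y \<in> Kc \<Longrightarrow> \<bar>1 / dens c y\<bar> \<le> d2"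
    using bnd[OF dinv] by blast
  obtain E1 where E1: "E1 \<ge> 0" "\<And>y. y \<in> Kc \<Longrightarrow> \<bar>?\<eta> y * ?\<eta> y\<bar> \<le> E1"
    using bnd[OF Ck_on_mult[OF open_R[OF c] \<eta>c \<eta>c]] by blast
  have "Ck_on 0 (R c) (\<lambda>y. \<Sum>i\<in>UNIV. dd c \<eta> y $ i * dd c \<eta> y $ i)"
    by (intro Ck_on_sum Ck_on_mult open_R c Ck_on_dd \<eta>)
  from bnd[OF this] obtain E2 where E2: "E2 \<ge> 0" "\<And>y. y \<in> Kc \<Longrightarrow> \<bar>\<Sum>i\<in>UNIV. dd c \<eta> y $ i * dd c \<eta> y $ i\<bar> \<le> E2"
    by blast
  have "\<forall>i j. \<exists>B\<ge>0. \<forall>y\<in>Kc. \<bar>gM c y $ i $ j\<bar> \<le> B" using bnd[OF metric_smooth[OF c]] by blast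
  then obtain g where g: "\<And>i j. g i j \<ge> 0" "\<And>i j y. y \<in> Kc \<Longrightarrow> \<bar>gM c y $ i $ j\<bar> \<le> g i j" by metis
  define G1 where "G1 = (\<Sum>i\<in>UNIV. \<Sum>j\<in>UNIV. g i j)"
  have G1: "G1 \<ge> 0" "\<And>y. y \<in> Kc \<Longrightarrow> (\<Sum>i\<in>UNIV. \<Sum>j\<in>UNIV. \<bar>gM c y $ i $ j\<bar>) \<le> G1"
    unfolding G1_def using g by (auto intro!: sum_nonneg sum_mono)
  \<comment> \<open>Bounds the Euclidean energy of \<eta> \<phi> on the compact set: the factors 2
    come from squaring a sum, \<open>E1\<close> and \<open>E2\<close> bound \<eta>^2 and its squared
    differential, \<open>G1\<close> compares the gradient norms, and \<open>d2\<close> restores the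
    density.\<close>
  define C where "C = d2 * (2 * E1 * G1 + 2 * E2)"
  have C0: "C \<ge> 0" using d2 E1 E2 G1 by (simp add: C_def)
  define m where "m = 2 * 2 ^ CARD('n) * CARD('n)"
  have m0: "m \<ge> 0" by (simp add: m_def)
  \<comment> \<open>Chosen so that \<open>d1 * (m * \<delta>\<^sup>2) * C \<le> \<epsilon>\<close>;
    the summand 1 keeps the denominator positive.\<close>
  define \<delta> where "\<delta> = sqrt (\<epsilon> / (1 + d1 * m * C))"
  have \<delta>: "\<delta> > 0" using \<epsilon> d1 m0 C0 by (simp add: \<delta>_def add_pos_nonneg)
  have \<delta>2: "d1 * (m * \<delta>\<^sup>2) * C \<le> \<epsilon>"
  proof -
    have p: "1 + d1 * m * C > 0" using d1 m0 C0 by (simp add: add_pos_nonneg)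
    then have "\<delta>\<^sup>2 * (1 + d1 * m * C) = \<epsilon>" using \<epsilon> by (simp add: \<delta>_def)
    then have "\<delta>\<^sup>2 * (d1 * m * C) = \<epsilon> - \<delta>\<^sup>2" by (simp add: algebra_simps)
    then show ?thesis by (simp add: mult_ac)
  qed
  define J where "J = {z :: int^'n. cell \<delta> z \<inter> Kc \<noteq> {}}"
  have finJ: "finite J" unfolding J_def by (rule finite_cells[OF compact_imp_bounded[OF Kcomp] \<delta>])
  \<comment> \<open>Its square absorbs the weight of the cell integrals in the grid inequality and
    the bound \<open>d1\<close> of the density.\<close>
  define wt where "wt = sqrt (d1 * (2 / \<delta> ^ CARD('n)))"
  have wt2: "wt\<^sup>2 = d1 * (2 / \<delta> ^ CARD('n))" using d1 \<delta> by (simp add: wt_def)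
  define w where "w y = indicator (R c) y * (?\<eta> y * (1 / dens c y))" for y
  have wc: "continuous_on UNIV w"
  proof -
    have "Ck_on 0 UNIV w" unfolding w_def
      by (rule Ck_on_extend(1)[OF c Ck_on_mult[OF open_R[OF c] \<eta>c dinv] S]) (simp add: \<eta>0)
    then show ?thesis by simp
  qed
  \<comment> \<open>Division by the density in \<open>w\<close> cancels the volume element, so that
    integrating \<phi> against \<open>q z\<close> gives \<open>wt\<close> times the integral of the
    cut-off function over the cell.\<close>
  define q where "q z x = wt * (indicator (fst c) x * (indicator (cell \<delta> z) (snd c x) * w (snd c x)))" for z x
  have qm: "q z \<in> borel_measurable borel" for z
  proof -
    have [measurable]: "w \<in> borel_measurable borel" using wc by (rule borel_measurable_continuous_onI)
    show ?thesis unfolding q_def[abs_def]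
      by (intro borel_measurable_times borel_measurable_const borel_chart_fun[OF c, of "\<lambda>y. indicator (cell \<delta> z) y * w y"]) measurable
  qed
  have qz: "q z x = 0" if "x \<notin> fst c" for z x using that by (simp add: q_def)
  have qint: "integrable vol (\<lambda>x. (q z x)\<^sup>2)" for z
  proof -
    define h where "h y = ?\<eta> y * (?\<eta> y * (1 / dens c y))" for y
    have hC: "Ck_on 0 (R c) h" unfolding h_def[abs_def] by (intro Ck_on_mult open_R c \<eta>c dinv)
    have h0: "h y = 0" if "y \<in> R c" "chart_inv c y \<notin> S" for y using \<eta>0 that by (simp add: h_def)
    have "continuous_on UNIV (\<lambda>y. indicator (R c) y * h y)"
      using Ck_on_extend(1)[OF c hC S h0] by simp
    moreover have "indicator (R c) y * h y = 0" if "y \<notin> snd c ` S" for y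
      by (rule Ck_on_extend(3)[OF c hC S _ that]) (rule h0)
    ultimately have "integrable lborel (\<lambda>y. indicator (R c) y * h y)"
      using Kcomp[unfolded Kc_def] by (intro integrable_compact_support) auto
    then have int: "integrable lborel (\<lambda>y. wt\<^sup>2 * (indicator (cell \<delta> z) y *\<^sub>R (indicator (R c) y * h y)))"
      by (intro integrable_mult_right integrable_mult_indicator) simp_all
    have eq: "(\<lambda>y. indicator (R c) y * (dens c y * (q z (chart_inv c y))\<^sup>2)) = (\<lambda>y. wt\<^sup>2 * (indicator (cell \<delta> z) y *\<^sub>R (indicator (R c) y * h y)))"
    proof
      fix y
      show "indicator (R c) y * (dens c y * (q z (chart_inv c y))\<^sup>2) = wt\<^sup>2 * (indicator (cell \<delta> z) y *\<^sub>R (indicator (R c) y * h y))"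
      proof (cases "y \<in> R c")
        case True
        then show ?thesis using dens_pos[OF c True]
          by (simp add: q_def w_def h_def chart_inv_dom snd_chart_inv[OF c] power2_eq_square indicator_def)
      qed simp
    qed
    have "(\<lambda>x. (q z x)\<^sup>2) \<in> borel_measurable borel" using qm[of z] by measurable
    from vol_chart(1)[OF c this] qz int show ?thesis unfolding eq by simp
  qed
  have main: "(\<integral>x. (\<eta> x * \<phi> x)\<^sup>2 \<partial>vol) \<le> \<epsilon> * (\<integral>x. (\<phi> x)\<^sup>2 + Gam \<phi> \<phi> x \<partial>vol) + (\<Sum>j\<in>J. (\<integral>x. \<phi> x * q j x \<partial>vol)\<^sup>2)"
    if \<phi>: "Cn (Suc 0) \<phi>" and K: "compact K" "\<forall>x. x \<notin> K \<longrightarrow> \<phi> x = 0" for \<phi> K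
  proof -
    let ?\<phi> = "\<lambda>y. \<phi> (chart_inv c y)"
    have \<eta>\<phi>: "Cn (Suc 0) (\<lambda>x. \<eta> x * \<phi> x)" by (rule Cn_mult[OF \<eta> \<phi>])
    have \<phi>m: "\<phi> \<in> borel_measurable borel" and \<eta>m: "\<eta> \<in> borel_measurable borel"
      using Cn_measurable \<phi> \<eta> by blast+
    define v where "v y = indicator (R c) y * (?\<eta> y * ?\<phi> y)" for y
    have hC: "Ck_on (Suc 0) (R c) (\<lambda>y. ?\<eta> y * ?\<phi> y)" using CnD[OF \<eta>\<phi> c] .
    have vC: "Ck_on (Suc 0) UNIV v"
      unfolding v_def[abs_def] by (rule Ck_on_extend(1)[OF c hC S]) (simp add: \<eta>0)
    have v0: "v y = 0" if "y \<notin> Kc" for y using notK[of y] that by (simp add: v_def indicator_def)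
    note cont = Ck_on_UNIV_compact_support_pderiv[OF vC Kcomp v0]
    have vc: "continuous_on UNIV v" using Ck_on_imp_continuous_on[OF vC] .
    have vint: "integrable lborel (\<lambda>y. (v y)\<^sup>2)"
      using v0 by (intro integrable_compact_support[OF _ Kcomp] continuous_intros vc) simp
    have pc: "continuous_on UNIV (pderiv_at i v)" for i using vC by simp
    have p0: "pderiv_at i v y = 0" if "y \<notin> Kc" for i y
      using cont(3)[OF _ that] v0 by blast
    have gint: "integrable lborel (gsq v)"
      unfolding gsq_def[abs_def] using p0 by (intro integrable_compact_support[OF _ Kcomp] continuous_intros pc) simp
    have a: "(\<integral>x. (\<eta> x * \<phi> x)\<^sup>2 \<partial>vol) \<le> d1 * (\<integral>y. (v y)\<^sup>2 \<partial>lborel)"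
    proof -
      have m: "(\<lambda>x. (\<eta> x * \<phi> x)\<^sup>2) \<in> borel_measurable borel" using \<phi>m \<eta>m by measurable
      have z: "(\<eta> x * \<phi> x)\<^sup>2 = 0" if "x \<notin> fst c" for x
      proof -
        have "x \<notin> S" using that S(2) by blast
        then show ?thesis by (simp add: \<eta>0)
      qed
      have "integrable vol (\<lambda>x. (\<eta> x * \<phi> x)\<^sup>2)"
        by (rule integrable_vol_compact[OF S(1) continuous_on_power[OF Cn_imp_continuous[OF \<eta>\<phi>]]]) (simp add: \<eta>0)
      then have int: "integrable lborel (\<lambda>y. indicator (R c) y * (dens c y * (?\<eta> y * ?\<phi> y)\<^sup>2))"
        using vol_chart(1)[OF c m z] by simp
      have "(\<integral>x. (\<eta> x * \<phi> x)\<^sup>2 \<partial>vol) = (\<integral>y. indicator (R c) y * (dens c y * (?\<eta> y * ?\<phi> y)\<^sup>2) \<partial>lborel)"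
        using vol_chart(2)[OF c m z] by simp
      also have "\<dots> \<le> (\<integral>y. d1 * (v y)\<^sup>2 \<partial>lborel)"
      proof (rule integral_mono[OF int])
        show "integrable lborel (\<lambda>y. d1 * (v y)\<^sup>2)" using vint by simp
        fix y
        show "indicator (R c) y * (dens c y * (?\<eta> y * ?\<phi> y)\<^sup>2) \<le> d1 * (v y)\<^sup>2"
        proof (cases "y \<in> Kc")
          case True
          then have "dens c y \<le> d1" "y \<in> R c" using d1(2)[OF True] KR by auto
          then show ?thesis by (simp add: v_def mult_right_mono)
        next
          case False
          then show ?thesis using notK[of y] by (simp add: v_def indicator_def)
        qed
      qed
      finally show ?thesis by simp
    qed
    have b: "(\<integral>y. gsq v y \<partial>lborel) \<le> C * (\<integral>x. (\<phi> x)\<^sup>2 + Gam \<phi> \<phi> x \<partial>vol)"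
    proof -
      define F where "F x = (\<phi> x)\<^sup>2 + Gam \<phi> \<phi> x" for x
      have Kop: "open (- K)" using K(1) by (simp add: compact_imp_closed open_Compl)
      have F0: "0 \<le> F x" for x using Gam_nonneg by (simp add: F_def)
      have Fc: "continuous_on UNIV F" unfolding F_def
        by (intro continuous_intros Cn_imp_continuous[OF \<phi>] Cn_imp_continuous[OF Cn_Gam[OF \<phi> \<phi>]])
      have Fint: "integrable vol F"
        using K(2) Gam_zero[OF Kop, of \<phi> _ \<phi>] by (intro integrable_vol_compact[OF K(1) Fc]) (simp add: F_def)
      have Sb: "S \<in> sets borel" using S(1) by (simp add: compact_imp_closed)
      have SF: "integrable vol (\<lambda>x. indicator S x * F x)"
        using integrable_mult_indicator[OF _ Fint, of S] Sb by (simp add: sets_vol)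
      have m: "(\<lambda>x. indicator S x * F x) \<in> borel_measurable borel"
        using borel_measurable_continuous_onI[OF Fc] Sb by measurable
      have z: "indicator S x * F x = 0" if "x \<notin> fst c" for x
      proof -
        have "x \<notin> S" using that S(2) by blast
        then show ?thesis by simp
      qed
      have int: "integrable lborel (\<lambda>y. indicator (R c) y * (dens c y * (indicator S (chart_inv c y) * F (chart_inv c y))))"
        using vol_chart(1)[OF c m z] SF by simp
      have "(\<integral>y. gsq v y \<partial>lborel) \<le> (\<integral>y. C * (indicator (R c) y * (dens c y * (indicator S (chart_inv c y) * F (chart_inv c y)))) \<partial>lborel)"
      proof (rule integral_mono[OF gint])
        show "integrable lborel (\<lambda>y. C * (indicator (R c) y * (dens c y * (indicator S (chart_inv c y) * F (chart_inv c y)))))"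
          using int by simp
        fix y
        show "gsq v y \<le> C * (indicator (R c) y * (dens c y * (indicator S (chart_inv c y) * F (chart_inv c y))))"
        proof (cases "y \<in> Kc")
          case True
          then have yR: "y \<in> R c" using KR by blast
          have yS: "chart_inv c y \<in> S"
          proof -
            obtain x where "x \<in> S" "y = snd c x" using True unfolding Kc_def by blast
            moreover from this have "x \<in> fst c" using S(2) by blast
            ultimately show ?thesis by (simp add: chart_inv_snd[OF c])
          qed
          define p' where "p' = dd c \<phi> y"
          define r' where "r' = dd c \<eta> y"
          have "pderiv_at i v y = dd c (\<lambda>x. \<eta> x * \<phi> x) y $ i" for i
            unfolding dd_def vec_lambda_beta
            by (rule pderiv_at_cong_open[OF open_R[OF c] yR]) (simp add: v_def)
          then have "pderiv_at i v y = ?\<eta> y * p' $ i + ?\<phi> y * r' $ i" for i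
            by (simp add: dd_mult[OF \<eta> \<phi> c yR] p'_def r'_def)
          moreover have "(s + t)\<^sup>2 \<le> 2 * s\<^sup>2 + 2 * t\<^sup>2" for s t :: real
            using zero_le_power2[of "s - t"] by (simp add: power2_eq_square algebra_simps)
          ultimately have "gsq v y \<le> (\<Sum>i\<in>UNIV. 2 * (?\<eta> y * p' $ i)\<^sup>2 + 2 * (?\<phi> y * r' $ i)\<^sup>2)"
            unfolding gsq_def by (intro sum_mono) simp
          also have "\<dots> = 2 * (?\<eta> y * ?\<eta> y) * (norm p')\<^sup>2 + 2 * (?\<phi> y)\<^sup>2 * (\<Sum>i\<in>UNIV. r' $ i * r' $ i)"
            unfolding power2_norm_eq_inner
            by (simp add: sum.distrib sum_distrib_left inner_vec_def power2_eq_square mult_ac)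
          also have "\<dots> \<le> 2 * E1 * (G1 * gp c \<phi> \<phi> y) + 2 * (?\<phi> y)\<^sup>2 * E2"
          proof (rule add_mono)
            have gpnn: "0 \<le> gp c \<phi> \<phi> y" unfolding gp_def by (rule ginv_pos(1)[OF c yR])
            have "(norm p')\<^sup>2 \<le> (\<Sum>i\<in>UNIV. \<Sum>j\<in>UNIV. \<bar>gM c y $ i $ j\<bar>) * gp c \<phi> \<phi> y"
              unfolding gp_def p'_def by (rule ginv_pos(2)[OF c yR])
            also have "\<dots> \<le> G1 * gp c \<phi> \<phi> y" using G1(2)[OF True] gpnn by (rule mult_right_mono)
            finally have "(norm p')\<^sup>2 \<le> G1 * gp c \<phi> \<phi> y" .
            moreover have "?\<eta> y * ?\<eta> y \<le> E1" using E1(2)[OF True] by simp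
            ultimately show "2 * (?\<eta> y * ?\<eta> y) * (norm p')\<^sup>2 \<le> 2 * E1 * (G1 * gp c \<phi> \<phi> y)"
              using E1(1) by (intro mult_mono mult_left_mono) simp_all
            show "2 * (?\<phi> y)\<^sup>2 * (\<Sum>i\<in>UNIV. r' $ i * r' $ i) \<le> 2 * (?\<phi> y)\<^sup>2 * E2"
              using E2(2)[OF True] by (intro mult_left_mono) (simp_all add: r'_def)
          qed
          also have "\<dots> \<le> (2 * E1 * G1 + 2 * E2) * F (chart_inv c y)"
          proof -
            have "Gam \<phi> \<phi> (chart_inv c y) = gp c \<phi> \<phi> y"
              using Gam_chart[OF \<phi> \<phi> c chart_inv_dom[OF yR]] by (simp add: snd_chart_inv[OF c yR])
            moreover have "0 \<le> E2 * Gam \<phi> \<phi> (chart_inv c y)" "0 \<le> E1 * G1 * (?\<phi> y)\<^sup>2"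
              using E1 E2 G1 Gam_nonneg by simp_all
            ultimately show ?thesis by (simp add: F_def algebra_simps)
          qed
          also have "\<dots> \<le> (2 * E1 * G1 + 2 * E2) * (d2 * dens c y * F (chart_inv c y))"
          proof -
            have "1 \<le> d2 * dens c y" using d2(2)[OF True] dens_pos[OF c yR] by (simp add: field_simps)
            then have "1 * F (chart_inv c y) \<le> d2 * dens c y * F (chart_inv c y)" using F0 by (intro mult_right_mono)
            then show ?thesis using E1 E2 G1 by (intro mult_left_mono) simp_all
          qed
          also have "\<dots> = C * (indicator (R c) y * (dens c y * (indicator S (chart_inv c y) * F (chart_inv c y))))"
            using yR yS by (simp add: C_def mult_ac)
          finally show ?thesis .
        next
          case False
          then have "gsq v y = 0" using p0 by (simp add: gsq_def)
          moreover have "0 \<le> C * (indicator (R c) y * (dens c y * (indicator S (chart_inv c y) * F (chart_inv c y))))"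
            using C0 F0 dens_pos[OF c, of y] by (simp add: indicator_def less_imp_le)
          ultimately show ?thesis by simp
        qed
      qed
      also have "\<dots> = C * (\<integral>x. indicator S x * F x \<partial>vol)"
        using vol_chart(2)[OF c m z] by simp
      also have "\<dots> \<le> C * (\<integral>x. F x \<partial>vol)"
        using F0 C0 by (intro mult_left_mono integral_mono SF Fint) (simp_all add: indicator_def)
      finally show ?thesis by (simp add: F_def)
    qed
    have c': "wt * (\<integral>y. indicator (cell \<delta> z) y * v y \<partial>lborel) = (\<integral>x. \<phi> x * q z x \<partial>vol)" for z
    proof -
      have m: "(\<lambda>x. \<phi> x * q z x) \<in> borel_measurable borel" using \<phi>m qm[of z] by measurable
      have "(\<integral>x. \<phi> x * q z x \<partial>vol) = (\<integral>y. indicator (R c) y * (dens c y * (?\<phi> y * q z (chart_inv c y))) \<partial>lborel)"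
        using vol_chart(2)[OF c m] qz by simp
      also have "\<dots> = (\<integral>y. wt * (indicator (cell \<delta> z) y * v y) \<partial>lborel)"
      proof (rule Bochner_Integration.integral_cong[OF refl])
        fix y
        show "indicator (R c) y * (dens c y * (?\<phi> y * q z (chart_inv c y))) = wt * (indicator (cell \<delta> z) y * v y)"
        proof (cases "y \<in> R c")
          case True
          then show ?thesis using dens_pos[OF c True]
            by (simp add: q_def w_def v_def chart_inv_dom snd_chart_inv[OF c] mult_ac)
        qed (simp add: v_def)
      qed
      finally show ?thesis by simp
    qed
    have "(\<integral>y. (v y)\<^sup>2 \<partial>lborel) \<le> m * \<delta>\<^sup>2 * (\<integral>y. gsq v y \<partial>lborel)
        + (\<Sum>z\<in>J. 2 / \<delta> ^ CARD('n) * (\<integral>y. indicator (cell \<delta> z) y * v y \<partial>lborel)\<^sup>2)"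
      using grid_inequality[OF Kcomp \<delta> vC v0] by (simp add: m_def J_def)
    then have "d1 * (\<integral>y. (v y)\<^sup>2 \<partial>lborel) \<le> d1 * (m * \<delta>\<^sup>2 * (\<integral>y. gsq v y \<partial>lborel)
        + (\<Sum>z\<in>J. 2 / \<delta> ^ CARD('n) * (\<integral>y. indicator (cell \<delta> z) y * v y \<partial>lborel)\<^sup>2))"
      using d1(1) by (rule mult_left_mono)
    also have "\<dots> = d1 * (m * \<delta>\<^sup>2) * (\<integral>y. gsq v y \<partial>lborel) + (\<Sum>z\<in>J. (\<integral>x. \<phi> x * q z x \<partial>vol)\<^sup>2)"
      unfolding c'[symmetric] power_mult_distrib wt2 by (simp add: distrib_left sum_distrib_left mult_ac)
    also have "d1 * (m * \<delta>\<^sup>2) * (\<integral>y. gsq v y \<partial>lborel) \<le> d1 * (m * \<delta>\<^sup>2) * (C * (\<integral>x. (\<phi> x)\<^sup>2 + Gam \<phi> \<phi> x \<partial>vol))"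
      using b d1 m0 by (intro mult_left_mono) simp_all
    also have "\<dots> \<le> \<epsilon> * (\<integral>x. (\<phi> x)\<^sup>2 + Gam \<phi> \<phi> x \<partial>vol)"
    proof -
      have "0 \<le> (\<integral>x. (\<phi> x)\<^sup>2 + Gam \<phi> \<phi> x \<partial>vol)"
        by (intro integral_nonneg_AE AE_I2 add_nonneg_nonneg Gam_nonneg) simp
      then show ?thesis using mult_right_mono[OF \<delta>2] by (simp add: mult.assoc)
    qed
    finally show ?thesis using a by simp
  qed
  show ?thesis
  proof (intro exI[of _ J] exI[of _ q] conjI ballI allI impI)
    fix \<phi> K assume "Cn (Suc 0) \<phi>" "compact K" "\<forall>x. x \<notin> K \<longrightarrow> \<phi> x = 0"
    then show "(\<integral>x. (\<eta> x * \<phi> x)\<^sup>2 \<partial>vol) \<le> \<epsilon> * (\<integral>x. (\<phi> x)\<^sup>2 + Gam \<phi> \<phi> x \<partial>vol) + (\<Sum>j\<in>J. (\<integral>x. \<phi> x * q j x \<partial>vol)\<^sup>2)"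
      by (rule main)
  qed (simp_all add: finJ qm qint)
qed

section \<open>Test functions on the domain\<close>

lemma test_funsD:
  assumes "\<phi> \<in> test_funs A \<Omega>"
  shows "Cn k \<phi>" "compact (closure {x. \<phi> x \<noteq> 0})" "closure {x. \<phi> x \<noteq> 0} \<subseteq> \<Omega>"
    "x \<notin> closure {x. \<phi> x \<noteq> 0} \<Longrightarrow> \<phi> x = 0" "x \<notin> \<Omega> \<Longrightarrow> \<phi> x = 0"
proof -
  show "Cn k \<phi>" using assms by (simp add: test_funs_def smooth_fun_iff_Cn)
  show "compact (closure {x. \<phi> x \<noteq> 0})" and sub: "closure {x. \<phi> x \<noteq> 0} \<subseteq> \<Omega>"
    using assms by (simp_all add: test_funs_def)
  show cl: "\<phi> x = 0" if "x \<notin> closure {x. \<phi> x \<noteq> 0}" for x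
    using that closure_subset[of "{x. \<phi> x \<noteq> 0}"] by blast
  then show "x \<notin> \<Omega> \<Longrightarrow> \<phi> x = 0" using sub by blast
qed

lemma test_funsI:
  assumes "\<And>k. Cn k \<phi>" "compact K" "K \<subseteq> \<Omega>" "\<And>x. x \<notin> K \<Longrightarrow> \<phi> x = 0"
  shows "\<phi> \<in> test_funs A \<Omega>"
proof -
  have "{x. \<phi> x \<noteq> 0} \<subseteq> K" using assms(4) by blast
  then have sub: "closure {x. \<phi> x \<noteq> 0} \<subseteq> K"
    using compact_imp_closed[OF assms(2)] by (rule closure_minimal)
  then have "compact (K \<inter> closure {x. \<phi> x \<noteq> 0})" using assms(2) by (intro compact_Int_closed) simp_all
  moreover have "K \<inter> closure {x. \<phi> x \<noteq> 0} = closure {x. \<phi> x \<noteq> 0}" using sub by blast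
  ultimately show ?thesis using assms(1,3) sub by (auto simp: test_funs_def smooth_fun_iff_Cn)
qed

lemma test_funs_Green:
  assumes "\<phi> \<in> test_funs A \<Omega>" "Cn (Suc (Suc 0)) u"
  shows "(\<integral>x. \<phi> x * lap u x \<partial>vol) = - (\<integral>x. Gam \<phi> u x \<partial>vol)" "integrable vol (Gam \<phi> u)"
  using Green[OF test_funsD(2)[OF assms(1)] test_funsD(1)[OF assms(1)] test_funsD(4)[OF assms(1)] assms(2)] by simp_all

lemma integrable_test_fun:
  assumes "\<phi> \<in> test_funs A \<Omega>" "continuous_on UNIV f"
  shows "integrable vol (\<lambda>x. \<phi> x * f x)"
proof (rule integrable_vol_compact[OF test_funsD(2)[OF assms(1)]])
  show "continuous_on UNIV (\<lambda>x. \<phi> x * f x)"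
    using Cn_imp_continuous[OF test_funsD(1)[OF assms(1), of 0]] assms(2) by (intro continuous_on_mult)
  show "\<phi> x * f x = 0" if "x \<notin> closure {x. \<phi> x \<noteq> 0}" for x
    using test_funsD(4)[OF assms(1) that] by (rule mult_eq_0_iff[THEN iffD2, OF disjI1])
qed

text \<open>The Laplacian is local, so the support does not grow.\<close>

lemma lap_test_fun:
  assumes "\<phi> \<in> test_funs A \<Omega>"
  shows "lap \<phi> \<in> test_funs A \<Omega>"
proof (rule test_funsI[OF _ test_funsD(2,3)[OF assms]])
  show "Cn k (lap \<phi>)" for k using assms by (intro Cn_lap test_funsD(1))
  have op: "open (- closure {x. \<phi> x \<noteq> 0})" by (simp add: open_Compl)
  show "lap \<phi> x = 0" if "x \<notin> closure {x. \<phi> x \<noteq> 0}" for x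
  proof (rule lap_zero[OF op])
    show "\<phi> y = 0" if "y \<in> - closure {x. \<phi> x \<noteq> 0}" for y
      using that by (rule test_funsD(4)[OF assms ComplD])
  qed (use that in \<open>rule ComplI[OF notE]\<close>)
qed

lemma mult_test_fun:
  assumes "\<phi> \<in> test_funs A \<Omega>" "\<And>k. Cn k u"
  shows "(\<lambda>x. u x * \<phi> x) \<in> test_funs A \<Omega>"
proof (rule test_funsI[OF _ test_funsD(2,3)[OF assms(1)]])
  show "Cn k (\<lambda>x. u x * \<phi> x)" for k by (intro Cn_mult assms(2) test_funsD(1)[OF assms(1)])
  show "u x * \<phi> x = 0" if "x \<notin> closure {x. \<phi> x \<noteq> 0}" for x
    using test_funsD(4)[OF assms(1) that] by (rule mult_eq_0_iff[THEN iffD2, OF disjI2])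
qed

lemma zero_test_fun: "(\<lambda>x. 0) \<in> test_funs A \<Omega>"
  by (rule test_funsI[of _ "{}"]) (simp_all add: Cn_const)

lemma lin_test_fun:
  assumes "\<phi> \<in> test_funs A \<Omega>" "\<psi> \<in> test_funs A \<Omega>"
  shows "(\<lambda>x. a * \<phi> x + b * \<psi> x) \<in> test_funs A \<Omega>"
proof (rule test_funsI[of _ "closure {x. \<phi> x \<noteq> 0} \<union> closure {x. \<psi> x \<noteq> 0}"])
  show "Cn k (\<lambda>x. a * \<phi> x + b * \<psi> x)" for k by (intro Cn_lin test_funsD(1)[OF assms(1)] test_funsD(1)[OF assms(2)])
  show "compact (closure {x. \<phi> x \<noteq> 0} \<union> closure {x. \<psi> x \<noteq> 0})"
    by (intro compact_Un test_funsD(2)[OF assms(1)] test_funsD(2)[OF assms(2)])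
  show "closure {x. \<phi> x \<noteq> 0} \<union> closure {x. \<psi> x \<noteq> 0} \<subseteq> \<Omega>"
    using test_funsD(3)[OF assms(1)] test_funsD(3)[OF assms(2)] by (rule Un_least)
  fix x assume "x \<notin> closure {x. \<phi> x \<noteq> 0} \<union> closure {x. \<psi> x \<noteq> 0}"
  then have "\<phi> x = 0" "\<psi> x = 0"
    by (blast intro: test_funsD(4)[OF assms(1)] test_funsD(4)[OF assms(2)])+
  then show "a * \<phi> x + b * \<psi> x = 0" by simp
qed

lemma ip_vol_on:
  assumes "\<Omega> \<in> sets borel" "\<And>x. x \<notin> \<Omega> \<Longrightarrow> u x = 0"
  shows "ip (restrict_space vol \<Omega>) u v = (\<integral>x. u x * v x \<partial>vol)"
proof -
  have "ip (restrict_space vol \<Omega>) u v = (\<integral>x. indicator \<Omega> x *\<^sub>R (u x * v x) \<partial>vol)"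
    unfolding ip_def using assms(1) by (intro integral_restrict_space) (simp add: sets_vol)
  also have "\<dots> = (\<integral>x. u x * v x \<partial>vol)"
    by (rule Bochner_Integration.integral_cong) (use assms(2) in \<open>auto simp: indicator_def\<close>)
  finally show ?thesis .
qed

lemma L2_vol_on:
  assumes "\<Omega> \<in> sets borel" "u \<in> borel_measurable borel" "integrable vol (\<lambda>x. (u x)\<^sup>2)"
  shows "u \<in> L2 (restrict_space vol \<Omega>)"
proof -
  have \<Omega>: "\<Omega> \<inter> space vol \<in> sets vol" using assms(1) by (simp add: sets_vol)
  have "integrable (restrict_space vol \<Omega>) (\<lambda>x. (u x)\<^sup>2)"
    unfolding integrable_restrict_space[OF \<Omega>] using integrable_mult_indicator[OF _ assms(3), of \<Omega>] assms(1)
    by (simp add: sets_vol)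
  moreover have "u \<in> borel_measurable (restrict_space vol \<Omega>)"
    using assms(2) by (intro measurable_restrict_space1) simp
  ultimately show ?thesis by (simp add: L2_def)
qed

lemma test_fun_L2:
  assumes "\<Omega> \<in> sets borel" "\<phi> \<in> test_funs A \<Omega>"
  shows "\<phi> \<in> L2 (restrict_space vol \<Omega>)"
proof (rule L2_vol_on[OF assms(1)])
  show "\<phi> \<in> borel_measurable borel" using Cn_measurable[OF test_funsD(1)[OF assms(2), of 0]] .
  show "integrable vol (\<lambda>x. (\<phi> x)\<^sup>2)"
    using integrable_test_fun[OF assms(2) Cn_imp_continuous[OF test_funsD(1)[OF assms(2), of 0]]]
    by (simp add: power2_eq_square)
qed

text \<open>The local inequalities are added over a finite cover by bumps. The gradient disappears
  through Green's formula: its energy is minus the inner product of \<phi> with its Laplacian, so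
  the integral of \<phi>^2 + |grad \<phi>|^2 is at most twice the squared graph norm.\<close>

theorem compactness_vol_on:
  assumes \<Omega>: "open \<Omega>" "compact (closure \<Omega>)" and \<epsilon>: "\<epsilon> > 0"
  shows "\<exists>N q. (\<forall>j<(N::nat). q j \<in> L2 (restrict_space vol \<Omega>)) \<and>
    (\<forall>\<phi>\<in>test_funs A \<Omega>. ip (restrict_space vol \<Omega>) \<phi> \<phi>
      \<le> \<epsilon> * (ip (restrict_space vol \<Omega>) \<phi> \<phi> + ip (restrict_space vol \<Omega>) (lap \<phi>) (lap \<phi>))
        + (\<Sum>j<N. (ip (restrict_space vol \<Omega>) \<phi> (q j))\<^sup>2))"
proof -
  have \<Omega>b: "\<Omega> \<in> sets borel" using \<Omega>(1) by simp
  from bump_cover[OF \<Omega>(2)] obtain I and c :: "'a \<Rightarrow> ('a, 'n) chart" and \<eta> S where I: "finite I"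
    and *: "\<forall>i. c i \<in> A \<and> Cn (Suc 0) (\<eta> i) \<and> (\<forall>x. 0 \<le> \<eta> i x) \<and> compact (S i) \<and> S i \<subseteq> fst (c i) \<and> (\<forall>x. x \<notin> S i \<longrightarrow> \<eta> i x = 0)"
    and pos: "\<forall>x\<in>closure \<Omega>. (\<Sum>i\<in>I. \<eta> i x) > 0"
    by (elim exE conjE)
  have \<eta>C: "Cn (Suc 0) (\<eta> i)" for i using * by simp
  define s where "s x = (\<Sum>i\<in>I. \<eta> i x)" for x
  have "\<exists>b>0. \<forall>x\<in>closure \<Omega>. b \<le> s x"
  proof (cases "closure \<Omega> = {}")
    case False
    have "Cn (Suc 0) s" unfolding s_def using \<eta>C by (rule Cn_sum)
    then have "continuous_on (closure \<Omega>) s" using Cn_imp_continuous continuous_on_subset by blast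
    from continuous_attains_inf[OF \<Omega>(2) False this] obtain x where "x \<in> closure \<Omega>" "\<forall>y\<in>closure \<Omega>. s x \<le> s y" by blast
    then show ?thesis using pos by (intro exI[of _ "s x"]) (simp add: s_def)
  qed (auto intro: exI[of _ 1])
  then obtain b where b: "b > 0" "\<And>x. x \<in> closure \<Omega> \<Longrightarrow> b \<le> s x" by blast
  \<comment> \<open>The bumps add up to at least \<open>b\<close> on the domain, so Cauchy-Schwarz
    over \<open>I\<close> bounds \<phi>^2 by \<kappa> times the sum of the (\<eta> i
    \<phi>)^2.\<close>
  define \<kappa> where "\<kappa> = card I / b\<^sup>2"
  have \<kappa>: "\<kappa> \<ge> 0" by (simp add: \<kappa>_def)
  \<comment> \<open>Compensates for \<kappa>, for the number of charts, and for the factor 2 between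
    the energy and the squared graph norm.\<close>
  define \<epsilon>' where "\<epsilon>' = \<epsilon> / (2 * (1 + \<kappa> * card I))"
  have den: "1 + \<kappa> * card I > 0" using \<kappa> by (simp add: add_pos_nonneg)
  have \<epsilon>': "\<epsilon>' > 0" using \<epsilon> den by (simp add: \<epsilon>'_def)
  have \<epsilon>'2: "\<kappa> * card I * \<epsilon>' * 2 \<le> \<epsilon>"
  proof -
    have "\<epsilon>' * (2 * (1 + \<kappa> * card I)) = \<epsilon>" using den by (simp add: \<epsilon>'_def)
    then have "\<kappa> * card I * \<epsilon>' * 2 = \<epsilon> - 2 * \<epsilon>'" by (simp add: algebra_simps)
    then show ?thesis using \<epsilon>' by simp
  qed
  define P where "P i (J :: (int^'n) set) q \<longleftrightarrow> finite J \<and> (\<forall>j\<in>J. q j \<in> borel_measurable borel \<and> integrable vol (\<lambda>x. (q j x)\<^sup>2)) \<and>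
    (\<forall>\<phi> K. Cn (Suc 0) \<phi> \<longrightarrow> compact K \<longrightarrow> (\<forall>x. x \<notin> K \<longrightarrow> \<phi> x = 0) \<longrightarrow>
      (\<integral>x. (\<eta> i x * \<phi> x)\<^sup>2 \<partial>vol) \<le> \<epsilon>' * (\<integral>x. (\<phi> x)\<^sup>2 + Gam \<phi> \<phi> x \<partial>vol) + (\<Sum>j\<in>J. (\<integral>x. \<phi> x * q j x \<partial>vol)\<^sup>2))" for i J q
  have "\<exists>J q. P i J q" for i
    unfolding P_def
    by (rule chart_compactness[of "c i" "\<eta> i" "S i"]) (use * \<epsilon>' in simp_all)
  then obtain J q where Jq: "\<And>i. P i (J i) (q i)" by metis
  have finJ: "finite (J i)" for i using Jq[of i] by (simp add: P_def)
  have qL: "q i j \<in> borel_measurable borel" "integrable vol (\<lambda>x. (q i j x)\<^sup>2)" if "j \<in> J i" for i j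
    using Jq[of i] that by (simp_all add: P_def)
  define X where "X = (SIGMA i:I. J i)"
  have finX: "finite X" unfolding X_def using I finJ by (intro finite_SigmaI)
  \<comment> \<open>Enumerates the pairs of a chart and a functional by natural numbers, as the
    locale \<open>clamped\<close> expects; \<kappa> is absorbed into \<open>Q\<close> through its
    square root.\<close>
  obtain e where e: "bij_betw e {0..<card X} X" using ex_bij_betw_nat_finite[OF finX] by blast
  define Q where "Q k x = sqrt \<kappa> * q (fst (e k)) (snd (e k)) x" for k x
  have QL: "Q k \<in> L2 (restrict_space vol \<Omega>)" if "k < card X" for k
  proof -
    have "e k \<in> X" using bij_betwE[OF e] that by simp
    then have "snd (e k) \<in> J (fst (e k))" by (auto simp: X_def)
    from L2_vol_on[OF \<Omega>b qL[OF this]] show ?thesis unfolding Q_def[abs_def] by (rule L2_cmult)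
  qed
  have main: "ip (restrict_space vol \<Omega>) \<phi> \<phi>
      \<le> \<epsilon> * (ip (restrict_space vol \<Omega>) \<phi> \<phi> + ip (restrict_space vol \<Omega>) (lap \<phi>) (lap \<phi>))
        + (\<Sum>k<card X. (ip (restrict_space vol \<Omega>) \<phi> (Q k))\<^sup>2)" if \<phi>: "\<phi> \<in> test_funs A \<Omega>" for \<phi>
  proof -
    note \<phi>D = test_funsD[OF \<phi>]
    have ip: "ip (restrict_space vol \<Omega>) \<phi> v = (\<integral>x. \<phi> x * v x \<partial>vol)" for v
      by (rule ip_vol_on[OF \<Omega>b \<phi>D(5)])
    have L2: "\<phi> \<in> L2 (restrict_space vol \<Omega>)" "lap \<phi> \<in> L2 (restrict_space vol \<Omega>)"
      using test_fun_L2[OF \<Omega>b] \<phi> lap_test_fun[OF \<phi>] by blast+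
    define N where "N = ip (restrict_space vol \<Omega>) \<phi> \<phi> + ip (restrict_space vol \<Omega>) (lap \<phi>) (lap \<phi>)"
    have \<phi>2: "integrable vol (\<lambda>x. (\<phi> x)\<^sup>2)"
      using integrable_test_fun[OF \<phi> Cn_imp_continuous[OF \<phi>D(1)[of 0]]] by (simp add: power2_eq_square)
    have "(\<integral>x. (\<phi> x)\<^sup>2 + Gam \<phi> \<phi> x \<partial>vol) \<le> 2 * N"
    proof -
      have "(\<integral>x. (\<phi> x)\<^sup>2 + Gam \<phi> \<phi> x \<partial>vol) = ip (restrict_space vol \<Omega>) \<phi> \<phi> - ip (restrict_space vol \<Omega>) \<phi> (lap \<phi>)"
        using \<phi>2 test_funs_Green[OF \<phi> \<phi>D(1)] by (simp add: ip power2_eq_square)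
      moreover have "0 \<le> ip (restrict_space vol \<Omega>) (\<lambda>x. 1 * \<phi> x + 1 * lap \<phi> x) (\<lambda>x. 1 * \<phi> x + 1 * lap \<phi> x)"
        by (rule ip_self_nonneg)
      ultimately show ?thesis
        using ip_lin_lin[OF L2, of 1 1] ip_self_nonneg[of "restrict_space vol \<Omega>" \<phi>] ip_self_nonneg[of "restrict_space vol \<Omega>" "lap \<phi>"]
        by (simp add: N_def)
    qed
    then have N: "\<epsilon>' * (\<integral>x. (\<phi> x)\<^sup>2 + Gam \<phi> \<phi> x \<partial>vol) \<le> \<epsilon>' * (2 * N)"
      using \<epsilon>' by (intro mult_left_mono) simp_all
    have N0: "N \<ge> 0" by (simp add: N_def ip_self_nonneg)
    have \<eta>\<phi>int: "integrable vol (\<lambda>x. (\<eta> i x * \<phi> x)\<^sup>2)" for i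
      by (rule integrable_vol_compact[OF \<phi>D(2) continuous_on_power[OF Cn_imp_continuous[OF Cn_mult[OF \<eta>C \<phi>D(1)]]]])
        (rule zero_eq_power2[THEN iffD2, OF mult_eq_0_iff[THEN iffD2, OF disjI2[OF \<phi>D(4)]]])
    have piece: "(\<integral>x. (\<eta> i x * \<phi> x)\<^sup>2 \<partial>vol) \<le> \<epsilon>' * (2 * N) + (\<Sum>j\<in>J i. (\<integral>x. \<phi> x * q i j x \<partial>vol)\<^sup>2)" for i
    proof -
      have "(\<integral>x. (\<eta> i x * \<phi> x)\<^sup>2 \<partial>vol) \<le> \<epsilon>' * (\<integral>x. (\<phi> x)\<^sup>2 + Gam \<phi> \<phi> x \<partial>vol) + (\<Sum>j\<in>J i. (\<integral>x. \<phi> x * q i j x \<partial>vol)\<^sup>2)"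
        using Jq[of i] \<phi>D(1)[of "Suc 0"] \<phi>D(2,4) unfolding P_def by blast
      then show ?thesis using N by linarith
    qed
    have "ip (restrict_space vol \<Omega>) \<phi> \<phi> = (\<integral>x. (\<phi> x)\<^sup>2 \<partial>vol)" by (simp add: ip power2_eq_square)
    also have "\<dots> \<le> (\<integral>x. \<kappa> * (\<Sum>i\<in>I. (\<eta> i x * \<phi> x)\<^sup>2) \<partial>vol)"
    proof (rule integral_mono[OF \<phi>2])
      show "integrable vol (\<lambda>x. \<kappa> * (\<Sum>i\<in>I. (\<eta> i x * \<phi> x)\<^sup>2))"
        using \<eta>\<phi>int by (intro integrable_mult_right Bochner_Integration.integrable_sum)
      fix x
      show "(\<phi> x)\<^sup>2 \<le> \<kappa> * (\<Sum>i\<in>I. (\<eta> i x * \<phi> x)\<^sup>2)"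
      proof (cases "x \<in> \<Omega>")
        case True
        then have "b \<le> s x" using b(2) closure_subset by blast
        then have "b\<^sup>2 * (\<phi> x)\<^sup>2 \<le> (s x)\<^sup>2 * (\<phi> x)\<^sup>2"
          using b(1) by (intro mult_right_mono power_mono) simp_all
        also have "\<dots> = (\<Sum>i\<in>I. \<eta> i x * \<phi> x)\<^sup>2" by (simp add: s_def power_mult_distrib flip: sum_distrib_right)
        also have "\<dots> \<le> (\<Sum>i\<in>I. (\<eta> i x * \<phi> x)\<^sup>2) * card I" by (rule sum_squared_le_sum_of_squares)
        finally show ?thesis using b(1) by (simp add: \<kappa>_def field_simps)
      next
        case False
        then show ?thesis using \<phi>D(5) by simp
      qed
    qed
    also have "\<dots> = \<kappa> * (\<Sum>i\<in>I. \<integral>x. (\<eta> i x * \<phi> x)\<^sup>2 \<partial>vol)"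
      using \<eta>\<phi>int by (simp add: Bochner_Integration.integral_sum)
    also have "\<dots> \<le> \<kappa> * (\<Sum>i\<in>I. \<epsilon>' * (2 * N) + (\<Sum>j\<in>J i. (\<integral>x. \<phi> x * q i j x \<partial>vol)\<^sup>2))"
      by (intro mult_left_mono sum_mono piece \<kappa>)
    also have "\<dots> = (\<kappa> * card I * \<epsilon>' * 2) * N + \<kappa> * (\<Sum>i\<in>I. \<Sum>j\<in>J i. (\<integral>x. \<phi> x * q i j x \<partial>vol)\<^sup>2)"
      by (simp add: sum.distrib distrib_left mult_ac)
    also have "(\<kappa> * card I * \<epsilon>' * 2) * N \<le> \<epsilon> * N" using \<epsilon>'2 N0 by (rule mult_right_mono)
    also have "\<kappa> * (\<Sum>i\<in>I. \<Sum>j\<in>J i. (\<integral>x. \<phi> x * q i j x \<partial>vol)\<^sup>2) = (\<Sum>k<card X. (ip (restrict_space vol \<Omega>) \<phi> (Q k))\<^sup>2)"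
    proof -
      have "(\<Sum>i\<in>I. \<Sum>j\<in>J i. (\<integral>x. \<phi> x * q i j x \<partial>vol)\<^sup>2) = (\<Sum>(i, j)\<in>X. (\<integral>x. \<phi> x * q i j x \<partial>vol)\<^sup>2)"
        unfolding X_def using I finJ by (intro sum.Sigma) simp_all
      also have "\<dots> = (\<Sum>k\<in>{0..<card X}. (\<lambda>(i, j). (\<integral>x. \<phi> x * q i j x \<partial>vol)\<^sup>2) (e k))"
        by (rule sum.reindex_bij_betw[OF e, symmetric])
      finally have "\<kappa> * (\<Sum>i\<in>I. \<Sum>j\<in>J i. (\<integral>x. \<phi> x * q i j x \<partial>vol)\<^sup>2)
        = (\<Sum>k<card X. \<kappa> * (\<integral>x. \<phi> x * q (fst (e k)) (snd (e k)) x \<partial>vol)\<^sup>2)"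
        by (simp add: sum_distrib_left case_prod_unfold atLeast0LessThan)
      also have "\<dots> = (\<Sum>k<card X. (ip (restrict_space vol \<Omega>) \<phi> (Q k))\<^sup>2)"
      proof (rule sum.cong[OF refl])
        fix k
        have "(\<integral>x. \<phi> x * Q k x \<partial>vol) = sqrt \<kappa> * (\<integral>x. \<phi> x * q (fst (e k)) (snd (e k)) x \<partial>vol)"
          by (simp add: Q_def mult.left_commute)
        then show "\<kappa> * (\<integral>x. \<phi> x * q (fst (e k)) (snd (e k)) x \<partial>vol)\<^sup>2 = (ip (restrict_space vol \<Omega>) \<phi> (Q k))\<^sup>2"
          using \<kappa> by (simp add: ip power_mult_distrib)
      qed
      finally show ?thesis .
    qed
    finally show ?thesis by (simp add: N_def)
  qed
  show ?thesis
    by (intro exI[of _ "card X"] exI[of _ Q] conjI allI impI ballI main QL)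
qed

section \<open>Eigenmaps\<close>

text \<open>The product rule at 1 = 1 * 1 equates the value for the constant 1 with its double;
  linearity does the rest. The Laplacian of a constant is treated alike.\<close>

lemma Gam_const: "Gam (\<lambda>x. a) w x = 0"
proof -
  have "Gam (\<lambda>x. 1 * 1) w x = 1 * Gam (\<lambda>x. 1) w x + 1 * Gam (\<lambda>x. 1) w x"
    by (rule Gam_mult_left) (rule Cn_const)+
  then have "Gam (\<lambda>x. 1) w x = 0" by simp
  moreover have "Gam (\<lambda>x. a * 1 + 0 * 1) w x = a * Gam (\<lambda>x. 1) w x + 0 * Gam (\<lambda>x. 1) w x"
    by (rule Gam_lin_left) (rule Cn_const)+
  ultimately show ?thesis by simp
qed

lemma lap_const: "lap (\<lambda>x. a) x = 0"
proof -
  have "lap (\<lambda>x. 1 * 1) x = 1 * lap (\<lambda>x. 1) x + 1 * lap (\<lambda>x. 1) x + 2 * Gam (\<lambda>x. 1) (\<lambda>x. 1) x"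
    by (rule lap_mult) (rule Cn_const)+
  then have "lap (\<lambda>x. 1) x = 0" by (simp add: Gam_const)
  moreover have "lap (\<lambda>x. a * 1 + 0 * 1) = (\<lambda>x. a * lap (\<lambda>x. 1) x + 0 * lap (\<lambda>x. 1) x)"
    by (rule lap_lin) (rule Cn_const)+
  ultimately show ?thesis by (simp add: fun_eq_iff)
qed

lemma lap_sum:
  assumes "\<And>i. i \<in> I \<Longrightarrow> Cn (Suc (Suc 0)) (u i)"
  shows "lap (\<lambda>x. \<Sum>i\<in>I. u i x) x = (\<Sum>i\<in>I. lap (u i) x)"
  using assms
proof (induction I rule: infinite_finite_induct)
  case (insert i I)
  have "lap (\<lambda>x. 1 * u i x + 1 * (\<Sum>i\<in>I. u i x)) = (\<lambda>x. 1 * lap (u i) x + 1 * lap (\<lambda>x. \<Sum>i\<in>I. u i x) x)"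
    by (intro lap_lin Cn_sum insert.prems) simp_all
  then show ?case using insert by simp
qed (simp_all add: lap_const)

end

locale riemannian_eigenmap = riemannian A gM
  for A :: "('a::{t2_space, second_countable_topology}, 'n::finite) chart set" and gM :: "('a, 'n) metric" +
  fixes X :: "'a \<Rightarrow> real^'m::finite" and lam :: real
  assumes eigenmap: "eigenmap A gM lam X" and lam_nonzero: "lam \<noteq> 0"
begin

definition Y :: "'m \<Rightarrow> 'a \<Rightarrow> real" where "Y p x = X x $ p"

lemma Cn_Y: "Cn k (Y p)"
  using eigenmap by (simp add: eigenmap_def smooth_fun_iff_Cn Y_def[abs_def])

lemma lap_Y: "lap (Y p) x = - lam * Y p x"
  using eigenmap by (simp add: eigenmap_def Y_def[abs_def])

lemma Y_sphere: "(\<Sum>p\<in>UNIV. (Y p x)\<^sup>2) = 1"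
proof -
  have "X x \<bullet> X x = 1" using eigenmap by (simp add: eigenmap_def dot_square_norm)
  then show ?thesis by (simp add: inner_vec_def Y_def power2_eq_square)
qed

text \<open>The Laplacian of the constant function with value 1, written as the sum of the squares
  of the \<open>Y p\<close>, vanishes; the product rule splits it into \<open>- 2 * lam\<close> plus
  twice the energy density.\<close>

lemma sum_Gam_Y: "(\<Sum>p\<in>UNIV. Gam (Y p) (Y p) x) = lam"
proof -
  have "lap (\<lambda>x. \<Sum>p\<in>UNIV. Y p x * Y p x) x = (\<Sum>p\<in>UNIV. 2 * (Y p x * lap (Y p) x) + 2 * Gam (Y p) (Y p) x)"
    by (subst lap_sum) (simp_all add: Cn_mult Cn_Y lap_mult)
  moreover have "(\<Sum>p\<in>UNIV. Y p x * lap (Y p) x) = - lam * (\<Sum>p\<in>UNIV. (Y p x)\<^sup>2)"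
    by (simp add: lap_Y sum_distrib_left power2_eq_square mult_ac sum_negf)
  ultimately show ?thesis
    using Y_sphere by (simp add: lap_const sum.distrib flip: sum_distrib_left power2_eq_square)
qed

text \<open>\<open>lam\<close> is a sum of squared gradient norms, evaluated at an arbitrary
  point.\<close>

lemma lam_pos: "lam > 0"
proof -
  have "0 \<le> (\<Sum>p\<in>UNIV. Gam (Y p) (Y p) undefined)" by (intro sum_nonneg Gam_nonneg)
  then show ?thesis using lam_nonzero by (simp add: sum_Gam_Y)
qed

text \<open>The gradient of the same constant: the image lies in the sphere, so the derivatives are
  tangential.\<close>

lemma sum_Y_Gam_Y: "(\<Sum>p\<in>UNIV. Y p x * Gam (Y p) w x) = 0"
proof -
  have "Gam (\<lambda>x. \<Sum>p\<in>UNIV. Y p x * Y p x) w x = (\<Sum>p\<in>UNIV. 2 * (Y p x * Gam (Y p) w x))"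
    by (subst Gam_sum_left) (simp_all add: Cn_mult Cn_Y Gam_mult_left)
  then show ?thesis using Y_sphere by (simp add: Gam_const flip: sum_distrib_left power2_eq_square)
qed

lemma commutator_Y:
  assumes "Cn (Suc (Suc 0)) u"
  shows "lap (\<lambda>x. Y p x * u x) x - Y p x * lap u x = 2 * Gam (Y p) u x - lam * (Y p x * u x)"
  using lap_mult[OF Cn_Y assms] by (simp add: lap_Y)

lemma sum_Y_commutator_Y:
  assumes "Cn (Suc (Suc 0)) u"
  shows "(\<Sum>p\<in>UNIV. Y p x * (lap (\<lambda>x. Y p x * u x) x - Y p x * lap u x)) = - lam * u x"
proof -
  have "(\<Sum>p\<in>UNIV. Y p x * (lap (\<lambda>x. Y p x * u x) x - Y p x * lap u x))
    = (\<Sum>p\<in>UNIV. 2 * (Y p x * Gam (Y p) u x) - lam * u x * (Y p x)\<^sup>2)"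
    unfolding commutator_Y[OF assms] by (simp add: algebra_simps power2_eq_square)
  also have "\<dots> = - lam * u x"
    by (simp add: sum_subtractf sum_Y_Gam_Y Y_sphere flip: sum_distrib_left)
  finally show ?thesis .
qed

text \<open>The cross terms vanish by tangency, and Cauchy-Schwarz for the gradients, with total
  energy density \<open>lam\<close>, gives the coefficient 4 lam.\<close>

lemma sum_commutator_Y_sq_le:
  assumes u: "Cn (Suc (Suc 0)) u"
  shows "(\<Sum>p\<in>UNIV. (lap (\<lambda>x. Y p x * u x) x - Y p x * lap u x)\<^sup>2) \<le> lam\<^sup>2 * (u x)\<^sup>2 + 4 * lam * Gam u u x"
proof -
  have "(\<Sum>p\<in>UNIV. (lap (\<lambda>x. Y p x * u x) x - Y p x * lap u x)\<^sup>2)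
    = (\<Sum>p\<in>UNIV. 4 * (Gam (Y p) u x)\<^sup>2 - 4 * lam * u x * (Y p x * Gam (Y p) u x) + lam\<^sup>2 * (u x)\<^sup>2 * (Y p x)\<^sup>2)"
    unfolding commutator_Y[OF u] by (simp add: power2_diff power_mult_distrib algebra_simps)
  also have "\<dots> = 4 * (\<Sum>p\<in>UNIV. (Gam (Y p) u x)\<^sup>2) + lam\<^sup>2 * (u x)\<^sup>2"
    by (simp add: sum_subtractf sum.distrib sum_Y_Gam_Y Y_sphere flip: sum_distrib_left)
  also have "(\<Sum>p\<in>UNIV. (Gam (Y p) u x)\<^sup>2) \<le> (\<Sum>p\<in>UNIV. Gam (Y p) (Y p) x * Gam u u x)"
    by (intro sum_mono Gam_Cauchy_Schwarz Cn_Y Cn_le[OF u]) simp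
  also have "\<dots> = lam * Gam u u x" by (simp add: sum_Gam_Y flip: sum_distrib_right)
  finally show ?thesis by simp
qed

text \<open>The pointwise identities are integrated. Green's formula turns the integral of
  \<open>Gam \<phi> \<phi>\<close> into minus the inner product of \<phi> with
  \<open>lap \<phi>\<close>; used for two test functions, with the symmetry of \<open>Gam\<close>,
  it gives the symmetry of the Laplacian.\<close>

theorem clamped_eigenmap_vol_on:
  assumes \<Omega>: "open \<Omega>" "compact (closure \<Omega>)"
  shows "clamped_eigenmap (restrict_space vol \<Omega>) (test_funs A \<Omega>) lap Y lam"
proof
  have \<Omega>b: "\<Omega> \<in> sets borel" using \<Omega>(1) by simp
  have ip: "ip (restrict_space vol \<Omega>) \<phi> v = (\<integral>x. \<phi> x * v x \<partial>vol)" if "\<phi> \<in> test_funs A \<Omega>" for \<phi> v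
    by (rule ip_vol_on[OF \<Omega>b test_funsD(5)[OF that]])
  show "\<phi> \<in> L2 (restrict_space vol \<Omega>)" if "\<phi> \<in> test_funs A \<Omega>" for \<phi> using \<Omega>b that by (rule test_fun_L2)
  show "(\<lambda>x. 0) \<in> test_funs A \<Omega>" by (rule zero_test_fun)
  fix \<phi> assume \<phi>: "\<phi> \<in> test_funs A \<Omega>"
  note C = test_funsD(1)[OF \<phi>]
  show lap_\<phi>: "lap \<phi> \<in> test_funs A \<Omega>" using \<phi> by (rule lap_test_fun)
  show X_T: "(\<lambda>x. Y p x * \<phi> x) \<in> test_funs A \<Omega>" for p using \<phi> Cn_Y by (rule mult_test_fun)
  show "(\<Sum>p\<in>UNIV. Y p x * (lap (\<lambda>x. Y p x * \<phi> x) x - Y p x * lap \<phi> x)) = - lam * \<phi> x" for x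
    by (rule sum_Y_commutator_Y[OF C])
  define c where "c p x = lap (\<lambda>x. Y p x * \<phi> x) x - Y p x * lap \<phi> x" for p x
  have cT: "c p \<in> test_funs A \<Omega>" for p
    using lin_test_fun[OF lap_test_fun[OF X_T] mult_test_fun[OF lap_\<phi> Cn_Y], of 1 p "-1" p] by (simp add: c_def[abs_def])
  have sq: "integrable vol (\<lambda>x. (\<psi> x)\<^sup>2)" if "\<psi> \<in> test_funs A \<Omega>" for \<psi>
    using integrable_test_fun[OF that Cn_imp_continuous[OF test_funsD(1)[OF that, of 0]]] by (simp add: power2_eq_square)
  note Gr = test_funs_Green[OF \<phi> C]
  have "(\<Sum>p\<in>UNIV. ip (restrict_space vol \<Omega>) (c p) (c p)) = (\<integral>x. (\<Sum>p\<in>UNIV. (c p x)\<^sup>2) \<partial>vol)"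
    using sq[OF cT] by (simp add: ip[OF cT] Bochner_Integration.integral_sum flip: power2_eq_square)
  also have "\<dots> \<le> (\<integral>x. lam\<^sup>2 * (\<phi> x)\<^sup>2 + 4 * lam * Gam \<phi> \<phi> x \<partial>vol)"
    using sq[OF cT] sq[OF \<phi>] Gr(2) sum_commutator_Y_sq_le[OF C]
    by (intro integral_mono Bochner_Integration.integrable_sum Bochner_Integration.integrable_add integrable_mult_right)
      (simp_all add: c_def)
  also have "\<dots> = lam\<^sup>2 * ip (restrict_space vol \<Omega>) \<phi> \<phi> - 4 * lam * ip (restrict_space vol \<Omega>) \<phi> (lap \<phi>)"
    using sq[OF \<phi>] Gr by (simp add: ip[OF \<phi>] power2_eq_square)
  finally show "(\<Sum>p\<in>UNIV. ip (restrict_space vol \<Omega>) (\<lambda>x. lap (\<lambda>x. Y p x * \<phi> x) x - Y p x * lap \<phi> x)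
        (\<lambda>x. lap (\<lambda>x. Y p x * \<phi> x) x - Y p x * lap \<phi> x))
      \<le> lam\<^sup>2 * ip (restrict_space vol \<Omega>) \<phi> \<phi> - 4 * lam * ip (restrict_space vol \<Omega>) \<phi> (lap \<phi>)"
    unfolding c_def[abs_def] .
  fix \<psi> assume \<psi>: "\<psi> \<in> test_funs A \<Omega>"
  show "(\<lambda>x. a * \<phi> x + b * \<psi> x) \<in> test_funs A \<Omega>" for a b using \<phi> \<psi> by (rule lin_test_fun)
  show "lap (\<lambda>x. a * \<phi> x + b * \<psi> x) = (\<lambda>x. a * lap \<phi> x + b * lap \<psi> x)" for a b
    by (rule lap_lin[OF C test_funsD(1)[OF \<psi>]])
  have "ip (restrict_space vol \<Omega>) (lap \<phi>) \<psi> = (\<integral>x. \<psi> x * lap \<phi> x \<partial>vol)"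
    unfolding ip_commute[of _ "lap \<phi>"] by (rule ip[OF \<psi>])
  also have "\<dots> = (\<integral>x. \<phi> x * lap \<psi> x \<partial>vol)"
    unfolding test_funs_Green(1)[OF \<psi> C] test_funs_Green(1)[OF \<phi> test_funsD(1)[OF \<psi>]] Gam_commute[of \<psi>] ..
  also have "\<dots> = ip (restrict_space vol \<Omega>) \<phi> (lap \<psi>)" by (rule ip[OF \<phi>, symmetric])
  finally show "ip (restrict_space vol \<Omega>) (lap \<phi>) \<psi> = ip (restrict_space vol \<Omega>) \<phi> (lap \<psi>)" .
next
  fix \<epsilon> :: real assume "\<epsilon> > 0"
  with \<Omega> show "\<exists>N q. (\<forall>j<N. q j \<in> L2 (restrict_space vol \<Omega>)) \<and>
      (\<forall>\<phi>\<in>test_funs A \<Omega>. ip (restrict_space vol \<Omega>) \<phi> \<phi>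
        \<le> \<epsilon> * (ip (restrict_space vol \<Omega>) \<phi> \<phi> + ip (restrict_space vol \<Omega>) (lap \<phi>) (lap \<phi>))
          + (\<Sum>j<(N::nat). (ip (restrict_space vol \<Omega>) \<phi> (q j))\<^sup>2))"
    by (rule compactness_vol_on)
next
  show "Y p \<in> borel_measurable (restrict_space vol \<Omega>)" for p
    using Cn_measurable[OF Cn_Y] by (intro measurable_restrict_space1) simp
  show "(\<Sum>p\<in>UNIV. (Y p x)\<^sup>2) = 1" for x by (rule Y_sphere)
  show "lam > 0" by (rule lam_pos)
qed

end

theorem theorem3p1:
  fixes A :: "('a::{t2_space, second_countable_topology}, 'n::finite) chart set"
    and gM :: "('a, 'n) metric"
    and lam :: real
    and X :: "'a \<Rightarrow> real^'m::finite"
    and \<Omega> :: "'a set"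
    and ev :: "nat \<Rightarrow> real"
    and k :: nat
    and f g :: "real \<Rightarrow> real"
  assumes "riemannian_manifold A gM"
    and "laplace_eigenvalue A gM lam" and "lam \<noteq> 0"
    and "eigenmap A gM lam X"
    and "bounded_domain \<Omega>"
    and "clamped_eigenvalues A gM \<Omega> ev"
    and "k \<ge> 1" and "ev (k + 1) > ev k"
    and "(f, g) \<in> Im_class (ev (k + 1))"
  shows "(\<Sum>i=1..k. f (ev i))
    \<le> sqrt (\<Sum>i=1..k. g (ev i) * (lam + 6 * sqrt (ev i)))
      * sqrt (\<Sum>i=1..k. (f (ev i))\<^sup>2 / (g (ev i) * (ev (k + 1) - ev i)) * (lam + 4 * sqrt (ev i)))"
proof -
  interpret M: riemannian_eigenmap A gM X lam
    by unfold_locales (fact assms)+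
  interpret C: clamped_eigenmap "vol_on A gM \<Omega>" "test_funs A \<Omega>" "laplacian A gM" M.Y lam
    using M.clamped_eigenmap_vol_on[of \<Omega>] assms(5) by (simp add: bounded_domain_def M.vol_def)
  \<comment> \<open>Membership in \<open>H20\<close> is the existence of a pair in the graph
    closure, so the two eigenspaces coincide by unfolding.\<close>
  have "C.eigensp \<mu> = clamped_eigenspace A gM \<Omega> \<mu>" for \<mu>
    unfolding C.eigensp_def clamped_eigenspace_def H20_def C.graph_clos_def L2lim_def ip_def by blast
  then show ?thesis
    using assms(6,8,9) by (intro C.universal_inequality) (simp_all add: clamped_eigenvalues_def)
qed

end
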